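(* Let $(M,\alpha_M)\rightarrowtail(K,\alpha_K)\twoheadrightarrow(L,\alpha_L)$ be an extension (short exact sequence) of Hom-Lie algebras, with $M$ regarded as an ideal of $K$. Let $(R,\alpha_R)\rightarrowtail(F,\alpha_F)\twoheadrightarrow(K,\alpha_K)$ be a free presentation of $(K,\alpha_K)$ and let $(S,\alpha_S)$ be the ideal of $(F,\alpha_F)$ that is the preimage of $M$, so that $(M,\alpha_M)\cong(S/R,\bar\alpha_S)$. Then there is an exact sequence of Hom-vector spaces $$(\ker(R\curlywedge F\to F),\alpha_{\curlywedge}|)\to(\ker(S\curlywedge F\to F),\alpha_{\curlywedge}|)\to(\ker(M\curlywedge K\to K),\alpha_{\curlywedge}|)\to H_2^{\alpha}(K)\to H_2^{\alpha}(L)\to\Big(\frac{M}{[M,K]},\bar\alpha_M\Big)\to H_1^{\alpha}(K)\twoheadrightarrow H_1^{\alpha}(L).$$ Moreover, if the extension $(M,\alpha_M)\rightarrowtail(K,\alpha_K)\twoheadrightarrow(L,\alpha_L)$ is split (i.e. $K\twoheadrightarrow L$ has a section that is a homomorphism of Hom-Lie algebras), then this sequence induces a short exact sequence $$(\ker(M\curlywedge K\to K),\alpha_{\curlywedge}|)\rightarrowtail H_2^{\alpha}(K)\twoheadrightarrow H_2^{\alpha}(L).$$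
   Context: Fix a field $\mathbb F$. A Hom-vector space is a pair $(V,\alpha_V)$ of an $\mathbb F$-vector space and a linear map $\alpha_V:V\to V$; morphisms are linear maps commuting with these maps. A (multiplicative) Hom-Lie algebra $(L,\alpha_L)$ is a Hom-vector space with a bilinear product $[\,,]$ such that $[x,y]=-[y,x]$, $[\alpha_L(x),[y,z]]+[\alpha_L(y),[z,x]]+[\alpha_L(z),[x,y]]=0$ and $\alpha_L([x,y])=[\alpha_L(x),\alpha_L(y)]$. Homomorphisms are algebra homomorphisms commuting with the structure maps. An ideal is an $\alpha_L$-invariant subspace $H$ with $[H,L]\subseteq H$; for ideals $H,K$, $[H,K]$ is the span of all $[h,k]$. Exterior product: let $M,N$ be ideals of a Hom-Lie algebra $(L,\alpha_L)$, with $\alpha_M,\alpha_N$ the restrictions of $\alpha_L$. The tensor product $(M\star N,\alpha_\star)$ is the Hom-Lie algebra generated by symbols $m\star n$ ($m\in M,n\in N$), bilinear in $m$ and $n$ over $\mathbb F$, subject to $[m,m']\star\alpha_N(n)=\alpha_M(m)\star[m',n]-\alpha_M(m')\star[m,n]$, $\ \alpha_M(m)\star[n,n']=[n',m]\star\alpha_N(n)-[n,m]\star\alpha_N(n')$, $\ [m\star n,m'\star n']=-[n,m]\star[m',n']$, with $\alpha_\star(m\star n)=\alpha_M(m)\star\alpha_N(n)$. Let $M\square N$ be the subspace spanned by all $x\star x$, $x\in M\cap N$ (it is a central ideal). The exterior product is $(M\curlywedge N,\alpha_\curlywedge)=(M\star N)/(M\square N)$ with the induced map, and $m\curlywedge n$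 is the image of $m\star n$. The maps $M\curlywedge K\to K$, $R\curlywedge F\to F$, $S\curlywedge F\to F$ are the commutator homomorphisms $a\curlywedge b\mapsto[a,b]$, and $\alpha_\curlywedge|$ denotes restriction of $\alpha_\curlywedge$. Homology (trivial coefficients): let $C_n^\alpha(L)=L^{\wedge n}$ (exterior power, $L^{\wedge 0}=\mathbb F$) with map $\alpha_L^{\wedge n}$, and $d_n(x_1\wedge\dots\wedge x_n)=\sum_{i<j}(-1)^{i+j}[x_i,x_j]\wedge\alpha_L(x_1)\wedge\dots\wedge\widehat{\alpha_L(x_i)}\wedge\dots\wedge\widehat{\alpha_L(x_j)}\wedge\dots\wedge\alpha_L(x_n)$. Then $H_n^\alpha(L)=\ker(d_n)/\mathrm{Im}(d_{n+1})$ with the map induced by $\alpha_L^{\wedge n}$; in particular $H_1^\alpha(L)\cong L/[L,L]$. Free presentation: a Hom-set is a set $X$ with a self-map $\alpha_X$. The free Hom-Lie algebra on $(X,\alpha_X)$ is $(A_X/I,\bar\alpha_A)$, where $A_X$ is the free non-associative $\mathbb F$-algebra on $X$, $\alpha_A$ the endomorphism induced by $\alpha_X$, and $I$ the two-sided ideal generated by all $ab+ba$ and $\alpha_A(a)(bc)+\alpha_A(b)(ca)+\alpha_A(c)(ab)$. A free presentation of $K$ is a short exact sequence of Hom-Lie algebras $R\rightarrowtail F\twoheadrightarrow K$ with $F$ free and $R$ an ideal of $F$.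
   Formalization: The field is assumed to have characteristic different from 2; in characteristic 2 the bracket is only antisymmetric, free Hom-Lie algebras have [x,x] ≠ 0, and the commutator homomorphism (x⋏x = 0 ↦ [x,x]) and d_2 are not well defined. *)

theory Defs
  imports "HOL.Hull" "HOL-Algebra.Module" "HOL-Algebra.QuotRing"
begin

section \<open>Hom-vector spaces and Hom-Lie algebras\<close>

text \<open>
  Hom-vector spaces and Hom-algebras share one record type. As with the records of
  \<^theory>\<open>HOL-Algebra.Module\<close>, the fields \<^const>\<open>mult\<close> and \<^const>\<open>one\<close> are irrelevant for a
  (Hom-)vector space. For a Hom-algebra, \<^const>\<open>mult\<close> is the (nonassociative) product, hence the
  bracket of a Hom-Lie algebra, and \<^const>\<open>one\<close> remains irrelevant.
\<close>

record ('a, 'b) hom_alg = "('a, 'b) module" +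
  twist :: "'b \<Rightarrow> 'b"  (\<open>\<alpha>\<index>\<close>)

locale hom_vector_space = R?: field R + module R V
  for R :: "('a, 'r) ring_scheme" (structure) and V :: "('a, 'b) hom_alg" (structure) +
  assumes twist_closed: "x \<in> carrier V \<Longrightarrow> \<alpha>\<^bsub>V\<^esub> x \<in> carrier V"
    and twist_add: "\<lbrakk>x \<in> carrier V; y \<in> carrier V\<rbrakk>
      \<Longrightarrow> \<alpha>\<^bsub>V\<^esub> (x \<oplus>\<^bsub>V\<^esub> y) = \<alpha>\<^bsub>V\<^esub> x \<oplus>\<^bsub>V\<^esub> \<alpha>\<^bsub>V\<^esub> y"
    and twist_smult: "\<lbrakk>r \<in> carrier R; x \<in> carrier V\<rbrakk>
      \<Longrightarrow> \<alpha>\<^bsub>V\<^esub> (r \<odot>\<^bsub>V\<^esub> x) = r \<odot>\<^bsub>V\<^esub> \<alpha>\<^bsub>V\<^esub> x"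

locale hom_lie_algebra = hom_vector_space R L
  for R :: "('a, 'r) ring_scheme" (structure) and L :: "('a, 'b) hom_alg" (structure) +
  assumes lie_closed: "\<lbrakk>x \<in> carrier L; y \<in> carrier L\<rbrakk> \<Longrightarrow> x \<otimes>\<^bsub>L\<^esub> y \<in> carrier L"
    and lie_add_left: "\<lbrakk>x \<in> carrier L; y \<in> carrier L; z \<in> carrier L\<rbrakk>
      \<Longrightarrow> (x \<oplus>\<^bsub>L\<^esub> y) \<otimes>\<^bsub>L\<^esub> z = x \<otimes>\<^bsub>L\<^esub> z \<oplus>\<^bsub>L\<^esub> y \<otimes>\<^bsub>L\<^esub> z"
    and lie_add_right: "\<lbrakk>x \<in> carrier L; y \<in> carrier L; z \<in> carrier L\<rbrakk>
      \<Longrightarrow> x \<otimes>\<^bsub>L\<^esub> (y \<oplus>\<^bsub>L\<^esub> z) = x \<otimes>\<^bsub>L\<^esub> y \<oplus>\<^bsub>L\<^esub> x \<otimes>\<^bsub>L\<^esub> z"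
    and lie_smult_left: "\<lbrakk>r \<in> carrier R; x \<in> carrier L; y \<in> carrier L\<rbrakk>
      \<Longrightarrow> (r \<odot>\<^bsub>L\<^esub> x) \<otimes>\<^bsub>L\<^esub> y = r \<odot>\<^bsub>L\<^esub> (x \<otimes>\<^bsub>L\<^esub> y)"
    and lie_smult_right: "\<lbrakk>r \<in> carrier R; x \<in> carrier L; y \<in> carrier L\<rbrakk>
      \<Longrightarrow> x \<otimes>\<^bsub>L\<^esub> (r \<odot>\<^bsub>L\<^esub> y) = r \<odot>\<^bsub>L\<^esub> (x \<otimes>\<^bsub>L\<^esub> y)"
    and lie_antisym: "\<lbrakk>x \<in> carrier L; y \<in> carrier L\<rbrakk> \<Longrightarrow> x \<otimes>\<^bsub>L\<^esub> y = \<ominus>\<^bsub>L\<^esub> (y \<otimes>\<^bsub>L\<^esub> x)"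
    and hom_jacobi: "\<lbrakk>x \<in> carrier L; y \<in> carrier L; z \<in> carrier L\<rbrakk>
      \<Longrightarrow> \<alpha>\<^bsub>L\<^esub> x \<otimes>\<^bsub>L\<^esub> (y \<otimes>\<^bsub>L\<^esub> z) \<oplus>\<^bsub>L\<^esub> \<alpha>\<^bsub>L\<^esub> y \<otimes>\<^bsub>L\<^esub> (z \<otimes>\<^bsub>L\<^esub> x)
            \<oplus>\<^bsub>L\<^esub> \<alpha>\<^bsub>L\<^esub> z \<otimes>\<^bsub>L\<^esub> (x \<otimes>\<^bsub>L\<^esub> y) = \<zero>\<^bsub>L\<^esub>"
    and twist_lie: "\<lbrakk>x \<in> carrier L; y \<in> carrier L\<rbrakk>
      \<Longrightarrow> \<alpha>\<^bsub>L\<^esub> (x \<otimes>\<^bsub>L\<^esub> y) = \<alpha>\<^bsub>L\<^esub> x \<otimes>\<^bsub>L\<^esub> \<alpha>\<^bsub>L\<^esub> y"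

definition hom_vec_hom ::
  "('a, 'r) ring_scheme \<Rightarrow> ('a, 'b) hom_alg \<Rightarrow> ('a, 'c) hom_alg \<Rightarrow> ('b \<Rightarrow> 'c) set" where
  "hom_vec_hom R V W = {f \<in> carrier V \<rightarrow> carrier W.
     (\<forall>x\<in>carrier V. \<forall>y\<in>carrier V. f (x \<oplus>\<^bsub>V\<^esub> y) = f x \<oplus>\<^bsub>W\<^esub> f y) \<and>
     (\<forall>r\<in>carrier R. \<forall>x\<in>carrier V. f (r \<odot>\<^bsub>V\<^esub> x) = r \<odot>\<^bsub>W\<^esub> f x) \<and>
     (\<forall>x\<in>carrier V. f (\<alpha>\<^bsub>V\<^esub> x) = \<alpha>\<^bsub>W\<^esub> (f x))}"

definition hom_lie_hom ::
  "('a, 'r) ring_scheme \<Rightarrow> ('a, 'b) hom_alg \<Rightarrow> ('a, 'c) hom_alg \<Rightarrow> ('b \<Rightarrow> 'c) set" where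
  "hom_lie_hom R L L' = {f \<in> hom_vec_hom R L L'.
     \<forall>x\<in>carrier L. \<forall>y\<in>carrier L. f (x \<otimes>\<^bsub>L\<^esub> y) = f x \<otimes>\<^bsub>L'\<^esub> f y}"

definition hom_lie_ideal :: "('a, 'r) ring_scheme \<Rightarrow> 'b set \<Rightarrow> ('a, 'b) hom_alg \<Rightarrow> bool" where
  "hom_lie_ideal R H L \<longleftrightarrow> submodule H R L \<and> (\<forall>h\<in>H. \<alpha>\<^bsub>L\<^esub> h \<in> H) \<and>
     (\<forall>h\<in>H. \<forall>x\<in>carrier L. h \<otimes>\<^bsub>L\<^esub> x \<in> H)"

definition lin_span :: "('a, 'r) ring_scheme \<Rightarrow> ('a, 'b) hom_alg \<Rightarrow> 'b set \<Rightarrow> 'b set" where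
  "lin_span R V B = (\<lambda>W. submodule W R V) hull B"

definition commutator_span ::
  "('a, 'r) ring_scheme \<Rightarrow> ('a, 'b) hom_alg \<Rightarrow> 'b set \<Rightarrow> 'b set \<Rightarrow> 'b set" where
  "commutator_span R L H K = lin_span R L {h \<otimes>\<^bsub>L\<^esub> k | h k. h \<in> H \<and> k \<in> K}"

text \<open>
  Short exact sequence \<open>M \<rightarrow> K \<rightarrow> L\<close>, the kernel \<open>M\<close> being given as an ideal of \<open>K\<close>.
\<close>

definition hom_lie_extension ::
  "('a, 'r) ring_scheme \<Rightarrow> 'b set \<Rightarrow> ('a, 'b) hom_alg \<Rightarrow> ('a, 'c) hom_alg \<Rightarrow> ('b \<Rightarrow> 'c) \<Rightarrow> bool"
  where
  "hom_lie_extension R M K L p \<longleftrightarrow>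
     hom_lie_algebra R K \<and> hom_lie_algebra R L \<and> hom_lie_ideal R M K \<and>
     p \<in> hom_lie_hom R K L \<and> p ` carrier K = carrier L \<and> M = a_kernel K L p"

definition split_extension ::
  "('a, 'r) ring_scheme \<Rightarrow> ('a, 'b) hom_alg \<Rightarrow> ('a, 'c) hom_alg \<Rightarrow> ('b \<Rightarrow> 'c) \<Rightarrow> bool" where
  "split_extension R K L p \<longleftrightarrow> (\<exists>s\<in>hom_lie_hom R L K. \<forall>x\<in>carrier L. p (s x) = x)"

definition exact_at ::
  "('a, 'r) ring_scheme \<Rightarrow> ('a, 'u) hom_alg \<Rightarrow> ('u \<Rightarrow> 'v) \<Rightarrow> ('a, 'v) hom_alg \<Rightarrow> ('v \<Rightarrow> 'w)
     \<Rightarrow> ('a, 'w) hom_alg \<Rightarrow> bool" where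
  "exact_at R U f V g W \<longleftrightarrow>
     hom_vector_space R U \<and> hom_vector_space R V \<and> hom_vector_space R W \<and>
     f \<in> hom_vec_hom R U V \<and> g \<in> hom_vec_hom R V W \<and> f ` carrier U = a_kernel V W g"

definition short_exact ::
  "('a, 'r) ring_scheme \<Rightarrow> ('a, 'u) hom_alg \<Rightarrow> ('u \<Rightarrow> 'v) \<Rightarrow> ('a, 'v) hom_alg \<Rightarrow> ('v \<Rightarrow> 'w)
     \<Rightarrow> ('a, 'w) hom_alg \<Rightarrow> bool" where
  "short_exact R U f V g W \<longleftrightarrow>
     exact_at R U f V g W \<and> inj_on f (carrier U) \<and> g ` carrier V = carrier W"


section \<open>Quotients\<close>

text \<open>
  The map sending a coset of the source to the coset of \<open>W\<close> in \<open>V\<close> that contains the \<open>g\<close>-image of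
  its elements.
\<close>

definition quot_map :: "('a, 'b) hom_alg \<Rightarrow> 'b set \<Rightarrow> ('c \<Rightarrow> 'b) \<Rightarrow> 'c set \<Rightarrow> 'b set" where
  "quot_map V W g C = (\<Union>x\<in>C. W +>\<^bsub>V\<^esub> g x)"

text \<open>
  The quotient by an \<open>\<alpha>\<close>-invariant subspace or, when the product matters, by an \<open>\<alpha>\<close>-invariant
  two-sided ideal.
\<close>

definition quot :: "('a, 'b) hom_alg \<Rightarrow> 'b set \<Rightarrow> ('a, 'b set) hom_alg" where
  "quot V W = \<lparr>carrier = a_rcosets\<^bsub>V\<^esub> W, mult = rcoset_mult V W, one = undefined,
     zero = W, add = set_add V, smult = (\<lambda>r. quot_map V W (\<lambda>x. r \<odot>\<^bsub>V\<^esub> x)),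
     twist = quot_map V W (twist V)\<rparr>"


section \<open>Free Hom-vector spaces and free Hom-Lie algebras\<close>

text \<open>
  \<open>push R h\<close> is the linear map of finitely supported functions that sends the basis vector at \<open>b\<close>
  to the basis vector at \<open>h b\<close>.
\<close>

definition push :: "('a, 'r) ring_scheme \<Rightarrow> ('b \<Rightarrow> 'c) \<Rightarrow> ('b \<Rightarrow> 'a) \<Rightarrow> 'c \<Rightarrow> 'a" where
  "push R h f = (\<lambda>c. \<Oplus>\<^bsub>R\<^esub>b\<in>{b. f b \<noteq> \<zero>\<^bsub>R\<^esub> \<and> h b = c}. f b)"

definition single :: "('a, 'r) ring_scheme \<Rightarrow> 'b \<Rightarrow> 'b \<Rightarrow> 'a" where
  "single R b = (\<lambda>c. if c = b then \<one>\<^bsub>R\<^esub> else \<zero>\<^bsub>R\<^esub>)"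

text \<open>The vector space with basis \<open>B\<close>, with the linear map induced by \<open>h\<close> on the basis.\<close>

definition free_vec ::
  "('a, 'r) ring_scheme \<Rightarrow> 'b set \<Rightarrow> ('b \<Rightarrow> 'b) \<Rightarrow> ('a, 'b \<Rightarrow> 'a) hom_alg" where
  "free_vec R B h = \<lparr>carrier = {f. range f \<subseteq> carrier R \<and> finite {b. f b \<noteq> \<zero>\<^bsub>R\<^esub>} \<and>
                                    {b. f b \<noteq> \<zero>\<^bsub>R\<^esub>} \<subseteq> B},
     mult = undefined, one = undefined, zero = (\<lambda>b. \<zero>\<^bsub>R\<^esub>), add = (\<lambda>f g b. f b \<oplus>\<^bsub>R\<^esub> g b),
     smult = (\<lambda>r f b. r \<otimes>\<^bsub>R\<^esub> f b), twist = push R h\<rparr>"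

text \<open>The linear extension of a map \<open>\<phi>\<close> defined on basis elements.\<close>

definition lin_ext ::
  "('a, 'r) ring_scheme \<Rightarrow> ('a, 'c) hom_alg \<Rightarrow> ('b \<Rightarrow> 'c) \<Rightarrow> ('b \<Rightarrow> 'a) \<Rightarrow> 'c" where
  "lin_ext R V \<phi> f = (\<Oplus>\<^bsub>V\<^esub>b\<in>{b. f b \<noteq> \<zero>\<^bsub>R\<^esub>}. f b \<odot>\<^bsub>V\<^esub> \<phi> b)"

text \<open>Nonassociative words, the basis of the free nonassociative algebra.\<close>

datatype 'x magma = Gen 'x | Mul "'x magma" "'x magma"

text \<open>
  A word \<open>Mul s t\<close> factors in exactly one way, so the coefficient of a product \<open>f g\<close> at it is
  \<open>f s g t\<close>, and the coefficient of a product at a generator vanishes.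
\<close>

definition free_nonassoc ::
  "('a, 'r) ring_scheme \<Rightarrow> 'x set \<Rightarrow> ('x \<Rightarrow> 'x) \<Rightarrow> ('a, 'x magma \<Rightarrow> 'a) hom_alg" where
  "free_nonassoc R X a = (free_vec R {t. set_magma t \<subseteq> X} (map_magma a))
     \<lparr>mult := (\<lambda>f g t. case t of Gen x \<Rightarrow> \<zero>\<^bsub>R\<^esub> | Mul s u \<Rightarrow> f s \<otimes>\<^bsub>R\<^esub> g u)\<rparr>"

definition ideal_generated ::
  "('a, 'r) ring_scheme \<Rightarrow> ('a, 'b) hom_alg \<Rightarrow> 'b set \<Rightarrow> 'b set" where
  "ideal_generated R A B =
     (\<lambda>J. submodule J R A \<and> (\<forall>a\<in>carrier A. \<forall>x\<in>J. a \<otimes>\<^bsub>A\<^esub> x \<in> J \<and> x \<otimes>\<^bsub>A\<^esub> a \<in> J)) hull B"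

definition hom_lie_relators :: "('a, 'b) hom_alg \<Rightarrow> 'b set" where
  "hom_lie_relators A =
     {a \<otimes>\<^bsub>A\<^esub> b \<oplus>\<^bsub>A\<^esub> b \<otimes>\<^bsub>A\<^esub> a | a b. a \<in> carrier A \<and> b \<in> carrier A} \<union>
     {\<alpha>\<^bsub>A\<^esub> a \<otimes>\<^bsub>A\<^esub> (b \<otimes>\<^bsub>A\<^esub> c) \<oplus>\<^bsub>A\<^esub> \<alpha>\<^bsub>A\<^esub> b \<otimes>\<^bsub>A\<^esub> (c \<otimes>\<^bsub>A\<^esub> a) \<oplus>\<^bsub>A\<^esub> \<alpha>\<^bsub>A\<^esub> c \<otimes>\<^bsub>A\<^esub> (a \<otimes>\<^bsub>A\<^esub> b)
        | a b c. a \<in> carrier A \<and> b \<in> carrier A \<and> c \<in> carrier A}"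

text \<open>
  The Hom-Lie algebra generated by the Hom-set \<open>(X, a)\<close> subject to an \<open>\<alpha>\<close>-invariant set \<open>Q\<close> of
  relators.
\<close>

definition presentation_ideal ::
  "('a, 'r) ring_scheme \<Rightarrow> 'x set \<Rightarrow> ('x \<Rightarrow> 'x) \<Rightarrow> ('x magma \<Rightarrow> 'a) set \<Rightarrow> ('x magma \<Rightarrow> 'a) set"
  where
  "presentation_ideal R X a Q =
     ideal_generated R (free_nonassoc R X a) (hom_lie_relators (free_nonassoc R X a) \<union> Q)"

definition presented_hom_lie ::
  "('a, 'r) ring_scheme \<Rightarrow> 'x set \<Rightarrow> ('x \<Rightarrow> 'x) \<Rightarrow> ('x magma \<Rightarrow> 'a) set
     \<Rightarrow> ('a, ('x magma \<Rightarrow> 'a) set) hom_alg" where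
  "presented_hom_lie R X a Q = quot (free_nonassoc R X a) (presentation_ideal R X a Q)"

definition free_hom_lie ::
  "('a, 'r) ring_scheme \<Rightarrow> 'x set \<Rightarrow> ('x \<Rightarrow> 'x) \<Rightarrow> ('a, ('x magma \<Rightarrow> 'a) set) hom_alg" where
  "free_hom_lie R X a = presented_hom_lie R X a {}"

definition is_free_hom_lie ::
  "('a, 'r) ring_scheme \<Rightarrow> 'x set \<Rightarrow> ('x \<Rightarrow> 'x) \<Rightarrow> ('a, 'b) hom_alg \<Rightarrow> bool" where
  "is_free_hom_lie R X a F \<longleftrightarrow> a \<in> X \<rightarrow> X \<and>
     (\<exists>f \<in> hom_lie_hom R (free_hom_lie R X a) F.
        bij_betw f (carrier (free_hom_lie R X a)) (carrier F))"


section \<open>Tensor and exterior products of ideals\<close>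

definition tensor_relators ::
  "('a, 'r) ring_scheme \<Rightarrow> ('a, 'b) hom_alg \<Rightarrow> 'b set \<Rightarrow> 'b set \<Rightarrow> (('b \<times> 'b) magma \<Rightarrow> 'a) set"
  where
  "tensor_relators R L M N =
    (let A = free_nonassoc R (M \<times> N) (map_prod (twist L) (twist L));
         e = (\<lambda>m n. single R (Gen (m, n)))
     in {e (m \<oplus>\<^bsub>L\<^esub> m') n \<ominus>\<^bsub>A\<^esub> (e m n \<oplus>\<^bsub>A\<^esub> e m' n) | m m' n. m \<in> M \<and> m' \<in> M \<and> n \<in> N} \<union>
        {e m (n \<oplus>\<^bsub>L\<^esub> n') \<ominus>\<^bsub>A\<^esub> (e m n \<oplus>\<^bsub>A\<^esub> e m n') | m n n'. m \<in> M \<and> n \<in> N \<and> n' \<in> N} \<union>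
        {e (r \<odot>\<^bsub>L\<^esub> m) n \<ominus>\<^bsub>A\<^esub> r \<odot>\<^bsub>A\<^esub> e m n | r m n. r \<in> carrier R \<and> m \<in> M \<and> n \<in> N} \<union>
        {e m (r \<odot>\<^bsub>L\<^esub> n) \<ominus>\<^bsub>A\<^esub> r \<odot>\<^bsub>A\<^esub> e m n | r m n. r \<in> carrier R \<and> m \<in> M \<and> n \<in> N} \<union>
        {e (m \<otimes>\<^bsub>L\<^esub> m') (\<alpha>\<^bsub>L\<^esub> n) \<ominus>\<^bsub>A\<^esub>
           (e (\<alpha>\<^bsub>L\<^esub> m) (m' \<otimes>\<^bsub>L\<^esub> n) \<ominus>\<^bsub>A\<^esub> e (\<alpha>\<^bsub>L\<^esub> m') (m \<otimes>\<^bsub>L\<^esub> n))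
           | m m' n. m \<in> M \<and> m' \<in> M \<and> n \<in> N} \<union>
        {e (\<alpha>\<^bsub>L\<^esub> m) (n \<otimes>\<^bsub>L\<^esub> n') \<ominus>\<^bsub>A\<^esub>
           (e (n' \<otimes>\<^bsub>L\<^esub> m) (\<alpha>\<^bsub>L\<^esub> n) \<ominus>\<^bsub>A\<^esub> e (n \<otimes>\<^bsub>L\<^esub> m) (\<alpha>\<^bsub>L\<^esub> n'))
           | m n n'. m \<in> M \<and> n \<in> N \<and> n' \<in> N} \<union>
        {e m n \<otimes>\<^bsub>A\<^esub> e m' n' \<ominus>\<^bsub>A\<^esub> (\<ominus>\<^bsub>A\<^esub> e (n \<otimes>\<^bsub>L\<^esub> m) (m' \<otimes>\<^bsub>L\<^esub> n'))
           | m n m' n'. m \<in> M \<and> n \<in> N \<and> m' \<in> M \<and> n' \<in> N})"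

definition tensor_ideal ::
  "('a, 'r) ring_scheme \<Rightarrow> ('a, 'b) hom_alg \<Rightarrow> 'b set \<Rightarrow> 'b set \<Rightarrow> (('b \<times> 'b) magma \<Rightarrow> 'a) set"
  where
  "tensor_ideal R L M N =
     presentation_ideal R (M \<times> N) (map_prod (twist L) (twist L)) (tensor_relators R L M N)"

definition tensor ::
  "('a, 'r) ring_scheme \<Rightarrow> ('a, 'b) hom_alg \<Rightarrow> 'b set \<Rightarrow> 'b set
     \<Rightarrow> ('a, (('b \<times> 'b) magma \<Rightarrow> 'a) set) hom_alg" where
  "tensor R L M N =
     presented_hom_lie R (M \<times> N) (map_prod (twist L) (twist L)) (tensor_relators R L M N)"

definition tensor_elem ::
  "('a, 'r) ring_scheme \<Rightarrow> ('a, 'b) hom_alg \<Rightarrow> 'b set \<Rightarrow> 'b set \<Rightarrow> 'b \<Rightarrow> 'b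
     \<Rightarrow> (('b \<times> 'b) magma \<Rightarrow> 'a) set" where
  "tensor_elem R L M N m n = tensor_ideal R L M N
     +>\<^bsub>free_nonassoc R (M \<times> N) (map_prod (twist L) (twist L))\<^esub> single R (Gen (m, n))"

definition tensor_square ::
  "('a, 'r) ring_scheme \<Rightarrow> ('a, 'b) hom_alg \<Rightarrow> 'b set \<Rightarrow> 'b set
     \<Rightarrow> (('b \<times> 'b) magma \<Rightarrow> 'a) set set" where
  "tensor_square R L M N =
     lin_span R (tensor R L M N) {tensor_elem R L M N x x | x. x \<in> M \<inter> N}"

definition exterior ::
  "('a, 'r) ring_scheme \<Rightarrow> ('a, 'b) hom_alg \<Rightarrow> 'b set \<Rightarrow> 'b set
     \<Rightarrow> ('a, (('b \<times> 'b) magma \<Rightarrow> 'a) set set) hom_alg" where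
  "exterior R L M N = quot (tensor R L M N) (tensor_square R L M N)"

primrec eval_commutator :: "('a, 'b) hom_alg \<Rightarrow> ('b \<times> 'b) magma \<Rightarrow> 'b" where
  "eval_commutator L (Gen x) = fst x \<otimes>\<^bsub>L\<^esub> snd x"
| "eval_commutator L (Mul s t) = eval_commutator L s \<otimes>\<^bsub>L\<^esub> eval_commutator L t"

text \<open>
  The commutator homomorphism from the exterior product to \<open>L\<close>: the multiplicative linear extension
  of \<open>(m, n) \<mapsto> [m, n]\<close> is constant on the cosets involved, so both images are singletons.
\<close>

definition commutator_map ::
  "('a, 'r) ring_scheme \<Rightarrow> ('a, 'b) hom_alg \<Rightarrow> (('b \<times> 'b) magma \<Rightarrow> 'a) set set \<Rightarrow> 'b" where
  "commutator_map R L C =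
     the_elem ((\<lambda>D. the_elem (lin_ext R L (eval_commutator L) ` D)) ` C)"

definition commutator_ker ::
  "('a, 'r) ring_scheme \<Rightarrow> ('a, 'b) hom_alg \<Rightarrow> 'b set \<Rightarrow> 'b set
     \<Rightarrow> ('a, (('b \<times> 'b) magma \<Rightarrow> 'a) set set) hom_alg" where
  "commutator_ker R L M N = (exterior R L M N)
     \<lparr>carrier := a_kernel (exterior R L M N) L (commutator_map R L)\<rparr>"

text \<open>
  The map of exterior products into that of the ideals \<open>M\<close>, \<open>N\<close> of \<open>L\<close>, induced by a homomorphism
  \<open>\<phi>\<close> into \<open>L\<close>; it sends the class of a generator \<open>(m, n)\<close> to the class of \<open>(\<phi> m, \<phi> n)\<close>.
\<close>

definition exterior_map ::
  "('a, 'r) ring_scheme \<Rightarrow> ('a, 'c) hom_alg \<Rightarrow> 'c set \<Rightarrow> 'c set \<Rightarrow> ('b \<Rightarrow> 'c)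
     \<Rightarrow> (('b \<times> 'b) magma \<Rightarrow> 'a) set set \<Rightarrow> (('c \<times> 'c) magma \<Rightarrow> 'a) set set" where
  "exterior_map R L M N \<phi> =
     quot_map (tensor R L M N) (tensor_square R L M N)
       (quot_map (free_nonassoc R (M \<times> N) (map_prod (twist L) (twist L))) (tensor_ideal R L M N)
         (push R (map_magma (map_prod \<phi> \<phi>))))"


section \<open>Homology with trivial coefficients\<close>

definition tuples ::
  "('a, 'r) ring_scheme \<Rightarrow> ('a, 'b) hom_alg \<Rightarrow> nat \<Rightarrow> ('a, 'b list \<Rightarrow> 'a) hom_alg" where
  "tuples R L n = free_vec R {xs. length xs = n \<and> set xs \<subseteq> carrier L} (map (twist L))"

text \<open>The relations defining the exterior power: multilinearity and alternation.\<close>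

definition wedge_relators ::
  "('a, 'r) ring_scheme \<Rightarrow> ('a, 'b) hom_alg \<Rightarrow> nat \<Rightarrow> ('b list \<Rightarrow> 'a) set" where
  "wedge_relators R L n =
    (let T = tuples R L n; B = {xs. length xs = n \<and> set xs \<subseteq> carrier L}
     in {single R (xs[i := x \<oplus>\<^bsub>L\<^esub> y]) \<ominus>\<^bsub>T\<^esub> (single R (xs[i := x]) \<oplus>\<^bsub>T\<^esub> single R (xs[i := y]))
           | xs i x y. xs \<in> B \<and> i < n \<and> x \<in> carrier L \<and> y \<in> carrier L} \<union>
        {single R (xs[i := r \<odot>\<^bsub>L\<^esub> x]) \<ominus>\<^bsub>T\<^esub> r \<odot>\<^bsub>T\<^esub> single R (xs[i := x])
           | xs i r x. xs \<in> B \<and> i < n \<and> r \<in> carrier R \<and> x \<in> carrier L} \<union>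
        {single R xs | xs i j. xs \<in> B \<and> i < j \<and> j < n \<and> xs ! i = xs ! j})"

definition wedge_null ::
  "('a, 'r) ring_scheme \<Rightarrow> ('a, 'b) hom_alg \<Rightarrow> nat \<Rightarrow> ('b list \<Rightarrow> 'a) set" where
  "wedge_null R L n = lin_span R (tuples R L n) (wedge_relators R L n)"

definition chains ::
  "('a, 'r) ring_scheme \<Rightarrow> ('a, 'b) hom_alg \<Rightarrow> nat \<Rightarrow> ('a, ('b list \<Rightarrow> 'a) set) hom_alg" where
  "chains R L n = quot (tuples R L n) (wedge_null R L n)"

definition wedge ::
  "('a, 'r) ring_scheme \<Rightarrow> ('a, 'b) hom_alg \<Rightarrow> 'b list \<Rightarrow> ('b list \<Rightarrow> 'a) set" where
  "wedge R L xs = wedge_null R L (length xs) +>\<^bsub>tuples R L (length xs)\<^esub> single R xs"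

text \<open>
  List positions start at \<open>0\<close> rather than \<open>1\<close>, which does not affect the parity of \<open>i + j\<close>;
  \<open>nths xs (- {i, j})\<close> omits the entries at the positions \<open>i\<close> and \<open>j\<close>. For \<open>n \<le> 1\<close> the sum is
  empty, so the boundary map is zero.
\<close>

definition tuple_boundary ::
  "('a, 'r) ring_scheme \<Rightarrow> ('a, 'b) hom_alg \<Rightarrow> nat \<Rightarrow> 'b list \<Rightarrow> 'b list \<Rightarrow> 'a" where
  "tuple_boundary R L n xs =
    (let T = tuples R L (n - 1)
     in finsum T
          (\<lambda>(i, j). ((\<ominus>\<^bsub>R\<^esub> \<one>\<^bsub>R\<^esub>) [^]\<^bsub>R\<^esub> (i + j)) \<odot>\<^bsub>T\<^esub>
             single R ((xs ! i \<otimes>\<^bsub>L\<^esub> xs ! j) # map (twist L) (nths xs (- {i, j}))))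
          {(i, j). i < j \<and> j < n})"

definition boundary ::
  "('a, 'r) ring_scheme \<Rightarrow> ('a, 'b) hom_alg \<Rightarrow> nat
     \<Rightarrow> ('b list \<Rightarrow> 'a) set \<Rightarrow> ('b list \<Rightarrow> 'a) set" where
  "boundary R L n = quot_map (tuples R L (n - 1)) (wedge_null R L (n - 1))
     (lin_ext R (tuples R L (n - 1)) (tuple_boundary R L n))"

definition cycles ::
  "('a, 'r) ring_scheme \<Rightarrow> ('a, 'b) hom_alg \<Rightarrow> nat \<Rightarrow> ('a, ('b list \<Rightarrow> 'a) set) hom_alg" where
  "cycles R L n = (chains R L n)
     \<lparr>carrier := a_kernel (chains R L n) (chains R L (n - 1)) (boundary R L n)\<rparr>"

definition boundaries ::
  "('a, 'r) ring_scheme \<Rightarrow> ('a, 'b) hom_alg \<Rightarrow> nat \<Rightarrow> ('b list \<Rightarrow> 'a) set set" where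
  "boundaries R L n = boundary R L (n + 1) ` carrier (chains R L (n + 1))"

definition homology ::
  "('a, 'r) ring_scheme \<Rightarrow> ('a, 'b) hom_alg \<Rightarrow> nat \<Rightarrow> ('a, ('b list \<Rightarrow> 'a) set set) hom_alg"
  where
  "homology R L n = quot (cycles R L n) (boundaries R L n)"

text \<open>The map into the homology of \<open>L\<close> induced by a homomorphism \<open>\<phi>\<close> into \<open>L\<close>.\<close>

definition homology_map ::
  "('a, 'r) ring_scheme \<Rightarrow> ('a, 'c) hom_alg \<Rightarrow> nat \<Rightarrow> ('b \<Rightarrow> 'c)
     \<Rightarrow> ('b list \<Rightarrow> 'a) set set \<Rightarrow> ('c list \<Rightarrow> 'a) set set" where
  "homology_map R L n \<phi> = quot_map (cycles R L n) (boundaries R L n)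
     (quot_map (tuples R L n) (wedge_null R L n) (push R (map \<phi>)))"


section \<open>Abelianisation of an ideal relative to the algebra\<close>

definition ideal_coinvariants ::
  "('a, 'r) ring_scheme \<Rightarrow> ('a, 'b) hom_alg \<Rightarrow> 'b set \<Rightarrow> ('a, 'b set) hom_alg" where
  "ideal_coinvariants R K M = quot (K\<lparr>carrier := M\<rparr>) (commutator_span R K M (carrier K))"

text \<open>The map \<open>M/[M, K] \<rightarrow> H\<^sub>1(K)\<close> induced by the inclusion of \<open>M\<close> into \<open>K\<close>.\<close>

definition coinvariants_to_homology ::
  "('a, 'r) ring_scheme \<Rightarrow> ('a, 'b) hom_alg \<Rightarrow> 'b set \<Rightarrow> ('b list \<Rightarrow> 'a) set set" where
  "coinvariants_to_homology R K =
     quot_map (cycles R K 1) (boundaries R K 1) (\<lambda>m. wedge R K [m])"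

end

theory Submission
  imports Defs
begin

text \<open>
  Call a bilinear map \<open>\<phi>\<close> on \<open>M \<times> K\<close> an exterior form if \<open>\<phi> [x, y] (\<alpha> z)\<close> satisfies the Jacobi identity
  and \<open>\<phi>\<close> is alternating on \<open>M\<close>. The vector space \<open>M \<curlywedge> K\<close> is universal for exterior forms, and so
  is the quotient \<open>Q(K)\<close> of \<open>K \<and> K\<close> by the image of \<open>d\<^sub>3\<close> in the case \<open>M = K\<close>. Hence \<open>H\<^sub>2(K)\<close> is the
  kernel of the commutator on \<open>Q(K)\<close>, and comparing universal properties by means of lifts shows that
  \<open>M \<curlywedge> K \<rightarrow> Q(K) \<rightarrow> Q(L) \<rightarrow> 0\<close> and \<open>R \<curlywedge> F \<rightarrow> S \<curlywedge> F \<rightarrow> M \<curlywedge> K \<rightarrow> 0\<close> are exact. The snake lemma for the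
  commutator maps of the first of these to \<open>M \<rightarrow> K \<rightarrow> L\<close> gives the sequence from \<open>ker (M \<curlywedge> K \<rightarrow> K)\<close>
  onwards. The commutator is injective on \<open>Q(F)\<close> because \<open>F\<close> is free; therefore \<open>S \<curlywedge> F \<rightarrow> Q(F)\<close>
  kills the kernel of the commutator, which yields exactness at \<open>ker (M \<curlywedge> K \<rightarrow> K)\<close>. In the split
  case, let \<open>\<tau>\<close> be the composite \<open>K \<rightarrow> L \<rightarrow> K\<close> and \<open>\<pi> x = x - \<tau> x\<close>; then
  \<open>x \<and> y \<mapsto> \<pi> x \<curlywedge> y - \<pi> y \<curlywedge> \<tau> x\<close> is a left inverse of \<open>M \<curlywedge> K \<rightarrow> Q(K)\<close>.
\<close>

section \<open>Linear maps and spans\<close>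

text \<open>The obstacle is that \<open>exterior\<close> is presented as a nonassociative algebra,
  so neither its size nor the linear maps out of it can be read off. Both are settled by the
  relation for products of generators: since \<open>[n, m] = - [m, n]\<close>, it says that the
  product of two generators is the generator built from their commutators. Read from left to right
  it collapses every word to one generator; read as a rule of evaluation it says how a form has to
  be extended from generators to words. The kernel of such an extension need not be an ideal, and it
  becomes one only after intersection with the kernel of the evaluation by brackets.

  Spanning sets take over the role of uniqueness: linear maps that agree on generators are equal,
  and the same device transfers compatibility with twists and commutators.

  Two has to be invertible because the bracket is only antisymmetric:
  \<open>x \<curlywedge> x\<close> and \<open>x \<and> x\<close> vanish by construction, so the
  commutator and \<open>d_2\<close> are well defined only if \<open>[x, x] = 0\<close>.\<close>

lemma (in abelian_group) a_inv_zero [simp]: "\<ominus> \<zero> = \<zero>"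
  by (rule minus_equality) auto

text \<open>Linearity is kept apart from compatibility with the twists because maps produced by
  universal properties are at first only linear; the twists are checked afterwards on a spanning
  set, by \<open>hom_vec_hom_on_span\<close>.\<close>

definition lin_map ::
  "('a, 'r) ring_scheme \<Rightarrow> ('a, 'b) hom_alg \<Rightarrow> ('a, 'c) hom_alg \<Rightarrow> ('b \<Rightarrow> 'c) set" where
  "lin_map R V W = {f \<in> carrier V \<rightarrow> carrier W.
     (\<forall>x\<in>carrier V. \<forall>y\<in>carrier V. f (x \<oplus>\<^bsub>V\<^esub> y) = f x \<oplus>\<^bsub>W\<^esub> f y) \<and>
     (\<forall>r\<in>carrier R. \<forall>x\<in>carrier V. f (r \<odot>\<^bsub>V\<^esub> x) = r \<odot>\<^bsub>W\<^esub> f x)}"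

lemma lin_mapI:
  assumes "\<And>x. x \<in> carrier V \<Longrightarrow> f x \<in> carrier W"
    and "\<And>x y. \<lbrakk>x \<in> carrier V; y \<in> carrier V\<rbrakk> \<Longrightarrow> f (x \<oplus>\<^bsub>V\<^esub> y) = f x \<oplus>\<^bsub>W\<^esub> f y"
    and "\<And>r x. \<lbrakk>r \<in> carrier R; x \<in> carrier V\<rbrakk> \<Longrightarrow> f (r \<odot>\<^bsub>V\<^esub> x) = r \<odot>\<^bsub>W\<^esub> f x"
  shows "f \<in> lin_map R V W"
  using assms by (auto simp: lin_map_def)

lemma lin_mapD:
  assumes "f \<in> lin_map R V W"
  shows lin_map_closed: "x \<in> carrier V \<Longrightarrow> f x \<in> carrier W"
    and lin_map_add: "\<lbrakk>x \<in> carrier V; y \<in> carrier V\<rbrakk> \<Longrightarrow> f (x \<oplus>\<^bsub>V\<^esub> y) = f x \<oplus>\<^bsub>W\<^esub> f y"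
    and lin_map_smult: "\<lbrakk>r \<in> carrier R; x \<in> carrier V\<rbrakk> \<Longrightarrow> f (r \<odot>\<^bsub>V\<^esub> x) = r \<odot>\<^bsub>W\<^esub> f x"
  using assms by (auto simp: lin_map_def)

lemma hom_vec_hom_iff:
  "f \<in> hom_vec_hom R V W \<longleftrightarrow>
     f \<in> lin_map R V W \<and> (\<forall>x\<in>carrier V. f (\<alpha>\<^bsub>V\<^esub> x) = \<alpha>\<^bsub>W\<^esub> (f x))"
  by (auto simp: hom_vec_hom_def lin_map_def)

lemma hom_vec_homD:
  assumes "f \<in> hom_vec_hom R V W"
  shows hom_vec_hom_lin_map: "f \<in> lin_map R V W"
    and hom_vec_hom_twist: "x \<in> carrier V \<Longrightarrow> f (\<alpha>\<^bsub>V\<^esub> x) = \<alpha>\<^bsub>W\<^esub> (f x)"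
  using assms by (auto simp: hom_vec_hom_iff)

lemma lin_map_zero:
  assumes "module R V" "module R W" "f \<in> lin_map R V W"
  shows "f \<zero>\<^bsub>V\<^esub> = \<zero>\<^bsub>W\<^esub>"
proof -
  interpret V: module R V by fact
  interpret W: module R W by fact
  have "f (\<zero>\<^bsub>R\<^esub> \<odot>\<^bsub>V\<^esub> \<zero>\<^bsub>V\<^esub>) = \<zero>\<^bsub>R\<^esub> \<odot>\<^bsub>W\<^esub> f \<zero>\<^bsub>V\<^esub>"
    by (rule lin_map_smult[OF assms(3)]) auto
  then show ?thesis
    using lin_map_closed[OF assms(3)] by simp
qed

lemma lin_map_a_inv:
  assumes "module R V" "module R W" "f \<in> lin_map R V W" "x \<in> carrier V"
  shows "f (\<ominus>\<^bsub>V\<^esub> x) = \<ominus>\<^bsub>W\<^esub> f x"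
proof -
  interpret V: module R V by fact
  interpret W: module R W by fact
  have "f (\<ominus>\<^bsub>V\<^esub> x) \<oplus>\<^bsub>W\<^esub> f x = \<zero>\<^bsub>W\<^esub>"
    using lin_map_add[OF assms(3), of "\<ominus>\<^bsub>V\<^esub> x" x] assms(4) lin_map_zero[OF assms(1-3)]
    by (simp add: V.l_neg)
  then show ?thesis
    using W.minus_equality lin_map_closed[OF assms(3)] assms(4) by force
qed

lemma lin_map_minus:
  assumes "module R V" "module R W" "f \<in> lin_map R V W" "x \<in> carrier V" "y \<in> carrier V"
  shows "f (x \<ominus>\<^bsub>V\<^esub> y) = f x \<ominus>\<^bsub>W\<^esub> f y"
proof -
  interpret V: module R V by fact
  show ?thesis
    using assms lin_map_add[OF assms(3)] lin_map_a_inv[OF assms(1-3)] by (simp add: a_minus_def)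
qed

lemma lin_map_diff_zero:
  assumes "module R V" "module R W" "f \<in> lin_map R V W" "x \<in> carrier V" "y \<in> carrier V" "f x = f y"
  shows "f (x \<ominus>\<^bsub>V\<^esub> y) = \<zero>\<^bsub>W\<^esub>"
proof -
  interpret W: module R W by fact
  show ?thesis
    unfolding lin_map_minus[OF assms(1-5)] using assms(6) lin_map_closed[OF assms(3,5)]
    by (simp add: a_minus_def W.r_neg)
qed

lemma lin_map_comp:
  assumes "f \<in> lin_map R U V" "g \<in> lin_map R V W"
  shows "(\<lambda>x. g (f x)) \<in> lin_map R U W"
  using assms by (auto simp: lin_map_def Pi_iff)

lemma hom_vec_hom_comp:
  assumes "f \<in> hom_vec_hom R U V" "g \<in> hom_vec_hom R V W"
  shows "(\<lambda>x. g (f x)) \<in> hom_vec_hom R U W"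
  using assms by (auto simp: hom_vec_hom_def Pi_iff)

lemma submoduleD:
  assumes "submodule H R V"
  shows submodule_subset: "H \<subseteq> carrier V"
    and submodule_mem: "x \<in> H \<Longrightarrow> x \<in> carrier V"
    and submodule_zero: "\<zero>\<^bsub>V\<^esub> \<in> H"
    and submodule_add: "\<lbrakk>x \<in> H; y \<in> H\<rbrakk> \<Longrightarrow> x \<oplus>\<^bsub>V\<^esub> y \<in> H"
    and submodule_smult: "\<lbrakk>r \<in> carrier R; x \<in> H\<rbrakk> \<Longrightarrow> r \<odot>\<^bsub>V\<^esub> x \<in> H"
    and submodule_a_inv: "x \<in> H \<Longrightarrow> \<ominus>\<^bsub>V\<^esub> x \<in> H"
proof -
  interpret submodule H R V by fact
  show "H \<subseteq> carrier V" "x \<in> H \<Longrightarrow> x \<in> carrier V" "\<zero>\<^bsub>V\<^esub> \<in> H"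
    "\<lbrakk>x \<in> H; y \<in> H\<rbrakk> \<Longrightarrow> x \<oplus>\<^bsub>V\<^esub> y \<in> H" "\<lbrakk>r \<in> carrier R; x \<in> H\<rbrakk> \<Longrightarrow> r \<odot>\<^bsub>V\<^esub> x \<in> H"
    using subset m_closed one_closed smult_closed by auto
  show "x \<in> H \<Longrightarrow> \<ominus>\<^bsub>V\<^esub> x \<in> H"
    using m_inv_closed by (simp add: a_inv_def)
qed

lemma submodule_minus:
  assumes "submodule H R V" "x \<in> H" "y \<in> H"
  shows "x \<ominus>\<^bsub>V\<^esub> y \<in> H"
  using assms by (simp add: a_minus_def submodule_add submodule_a_inv)

text \<open>Negation is scaling by \<open>- 1\<close>, so closure under it follows from closure
  under scalars.\<close>

lemma submodule_intro:
  assumes "module R V" "H \<subseteq> carrier V" "\<zero>\<^bsub>V\<^esub> \<in> H"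
    and add: "\<And>x y. \<lbrakk>x \<in> H; y \<in> H\<rbrakk> \<Longrightarrow> x \<oplus>\<^bsub>V\<^esub> y \<in> H"
    and smult: "\<And>r x. \<lbrakk>r \<in> carrier R; x \<in> H\<rbrakk> \<Longrightarrow> r \<odot>\<^bsub>V\<^esub> x \<in> H"
  shows "submodule H R V"
proof -
  interpret V: module R V by fact
  have "\<ominus>\<^bsub>V\<^esub> x \<in> H" if "x \<in> H" for x
  proof -
    have "x \<in> carrier V"
      using that assms(2) by auto
    then have "\<ominus>\<^bsub>V\<^esub> x = (\<ominus>\<^bsub>R\<^esub> \<one>\<^bsub>R\<^esub>) \<odot>\<^bsub>V\<^esub> x"
      by (simp add: V.smult_l_minus)
    then show ?thesis
      using smult[OF _ that, of "\<ominus>\<^bsub>R\<^esub> \<one>\<^bsub>R\<^esub>"] by simp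
  qed
  then show ?thesis
    using assms by (intro V.submoduleI) auto
qed

lemma submodule_kernel:
  assumes "module R V" "module R W" "f \<in> lin_map R V W"
  shows "submodule {x \<in> carrier V. f x = \<zero>\<^bsub>W\<^esub>} R V"
proof -
  interpret V: module R V by fact
  interpret W: module R W by fact
  show ?thesis
    using lin_mapD[OF assms(3)] lin_map_zero[OF assms]
    by (intro submodule_intro[OF assms(1)]) auto
qed

lemma submodule_vimage:
  assumes "module R V" "module R W" "f \<in> lin_map R V W" "submodule H R W"
  shows "submodule {x \<in> carrier V. f x \<in> H} R V"
proof -
  interpret V: module R V by fact
  show ?thesis
    using lin_mapD[OF assms(3)] lin_map_zero[OF assms(1-3)] submoduleD[OF assms(4)]
    by (intro submodule_intro[OF assms(1)]) auto
qed

lemma submodule_image: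
  assumes "module R V" "module R W" "f \<in> lin_map R V W" "submodule H R V"
  shows "submodule (f ` H) R W"
proof (rule submodule_intro[OF assms(2)])
  note H = submoduleD[OF assms(4)]
  show "f ` H \<subseteq> carrier W"
    using H lin_mapD[OF assms(3)] by auto
  show "\<zero>\<^bsub>W\<^esub> \<in> f ` H"
    using lin_map_zero[OF assms(1-3)] H(3) by (metis image_eqI)
  show "x \<oplus>\<^bsub>W\<^esub> y \<in> f ` H" if xy: "x \<in> f ` H" "y \<in> f ` H" for x y
  proof -
    obtain u v where "u \<in> H" "v \<in> H" "x = f u" "y = f v"
      using xy by auto
    then show ?thesis
      using H lin_map_add[OF assms(3), of u v] by (intro image_eqI[of _ _ "u \<oplus>\<^bsub>V\<^esub> v"]) auto
  qed
  show "r \<odot>\<^bsub>W\<^esub> x \<in> f ` H" if rx: "r \<in> carrier R" "x \<in> f ` H" for r x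
  proof -
    obtain u where "u \<in> H" "x = f u"
      using rx by auto
    then show ?thesis
      using H rx lin_map_smult[OF assms(3), of r u] by (intro image_eqI[of _ _ "r \<odot>\<^bsub>V\<^esub> u"]) auto
  qed
qed

lemma submodule_Int:
  assumes "module R V" "submodule H R V" "submodule H' R V"
  shows "submodule (H \<inter> H') R V"
  by (rule submodule_intro[OF assms(1)])
    (auto intro: submoduleD[OF assms(2)] submoduleD[OF assms(3)])

lemma a_kernel_eq: "a_kernel V W f = {x \<in> carrier V. f x = \<zero>\<^bsub>W\<^esub>}"
  by (simp add: a_kernel_def kernel_def)

lemma lin_span_subset: "B \<subseteq> lin_span R V B"
  unfolding lin_span_def by (rule hull_subset)

lemma lin_span_minimal: "\<lbrakk>B \<subseteq> W; submodule W R V\<rbrakk> \<Longrightarrow> lin_span R V B \<subseteq> W"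
  unfolding lin_span_def by (rule hull_minimal)

lemma submodule_lin_span:
  assumes "module R V" "B \<subseteq> carrier V"
  shows "submodule (lin_span R V B) R V"
proof -
  interpret V: module R V by fact
  have c: "submodule (carrier V) R V"
    by (rule V.carrier_is_submodule)
  show ?thesis
  proof (rule submodule_intro[OF assms(1)])
    show "lin_span R V B \<subseteq> carrier V"
      by (rule lin_span_minimal[OF assms(2) c])
  qed (auto simp: lin_span_def hull_def intro: submoduleD)
qed

text \<open>The set where two linear maps agree is a submodule, so it contains the span of the
  generators. Nearly every identity between maps below is reduced in this way to one on
  \<open>ext_elem\<close>, \<open>chain_class\<close>, \<open>wedge\<close> or basis
  vectors.\<close>

lemma lin_span_eq_on:
  assumes "module R V" "module R W" "f \<in> lin_map R V W" "g \<in> lin_map R V W" "lin_span R V B = carrier V"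
    and eq: "\<And>b. b \<in> B \<Longrightarrow> f b = g b"
    and x: "x \<in> carrier V"
  shows "f x = g x"
proof -
  interpret V: module R V by fact
  have "submodule {x \<in> carrier V. f x = g x} R V"
    using lin_mapD[OF assms(3)] lin_mapD[OF assms(4)] lin_map_zero[OF assms(1-3)]
      lin_map_zero[OF assms(1,2,4)]
    by (intro submodule_intro[OF assms(1)]) auto
  moreover have "B \<subseteq> {x \<in> carrier V. f x = g x}"
    using eq lin_span_subset[of B R V] assms(5) by auto
  ultimately have "lin_span R V B \<subseteq> {x \<in> carrier V. f x = g x}"
    by (intro lin_span_minimal)
  then show ?thesis
    using x assms(5) by auto
qed

lemma lin_span_image:
  assumes "module R V" "module R W" "f \<in> lin_map R V W" "B \<subseteq> carrier V"
  shows "lin_span R W (f ` B) = f ` lin_span R V B"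
proof
  show "lin_span R W (f ` B) \<subseteq> f ` lin_span R V B"
    by (intro lin_span_minimal image_mono lin_span_subset submodule_image[OF assms(1-3)]
        submodule_lin_span assms)
  have fB: "f ` B \<subseteq> carrier W"
    using assms(4) lin_map_closed[OF assms(3)] by auto
  have "lin_span R V B \<subseteq> {x \<in> carrier V. f x \<in> lin_span R W (f ` B)}"
    by (intro lin_span_minimal submodule_vimage[OF assms(1-3)] submodule_lin_span[OF assms(2) fB])
      (use assms(4) lin_span_subset[of "f ` B" R W] in auto)
  then show "f ` lin_span R V B \<subseteq> lin_span R W (f ` B)"
    by auto
qed

text \<open>Every element of \<open>Q\<close> is some \<open>p x\<close>, so linearity of
  \<open>h\<close> is forced by that of \<open>g\<close>. Maps on quotients are defined here by
  \<open>the_elem\<close> or by unions over cosets; once such a map is evaluated on each coset, this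
  lemma makes it linear.\<close>

lemma lin_map_factor:
  assumes V: "module R V" and p: "p \<in> lin_map R V Q" "p ` carrier V = carrier Q"
    and g: "g \<in> lin_map R V W" and h: "\<And>x. x \<in> carrier V \<Longrightarrow> h (p x) = g x"
  shows "h \<in> lin_map R Q W"
proof -
  interpret V: module R V by fact
  have ex: "\<exists>x. x \<in> carrier V \<and> y = p x" if "y \<in> carrier Q" for y
    using that p(2) by blast
  show ?thesis
  proof (rule lin_mapI)
    show "h y \<in> carrier W" if "y \<in> carrier Q" for y
      using ex[OF that] h lin_map_closed[OF g] by auto
    show "h (y \<oplus>\<^bsub>Q\<^esub> z) = h y \<oplus>\<^bsub>W\<^esub> h z" if yz: "y \<in> carrier Q" "z \<in> carrier Q" for y z
    proof -
      obtain u v where uv: "u \<in> carrier V" "v \<in> carrier V" "y = p u" "z = p v"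
        using ex yz by meson
      then show ?thesis
        using h[of "u \<oplus>\<^bsub>V\<^esub> v"] h lin_map_add[OF g] lin_map_add[OF p(1)] by simp
    qed
    show "h (r \<odot>\<^bsub>Q\<^esub> y) = r \<odot>\<^bsub>W\<^esub> h y" if ry: "r \<in> carrier R" "y \<in> carrier Q" for r y
    proof -
      obtain u where uv: "u \<in> carrier V" "y = p u"
        using ex ry by meson
      then show ?thesis
        using h[of "r \<odot>\<^bsub>V\<^esub> u"] h lin_map_smult[OF g] lin_map_smult[OF p(1)] ry by simp
    qed
  qed
qed

lemma hom_vector_space_module: "hom_vector_space R V \<Longrightarrow> module R V"
  by (simp add: hom_vector_space_def)

lemma twist_lin_map: "hom_vector_space R V \<Longrightarrow> twist V \<in> lin_map R V V"
  by (auto intro!: lin_mapI simp: hom_vector_space.twist_closed hom_vector_space.twist_add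
      hom_vector_space.twist_smult)

lemma hom_vector_space_intro:
  "\<lbrakk>field R; module R V; twist V \<in> lin_map R V V\<rbrakk> \<Longrightarrow> hom_vector_space R V"
  unfolding hom_vector_space_def hom_vector_space_axioms_def by (auto dest: lin_mapD)

lemma hom_vec_hom_factor:
  assumes V: "hom_vector_space R V" and p: "p \<in> hom_vec_hom R V Q" "p ` carrier V = carrier Q"
    and g: "g \<in> hom_vec_hom R V W" and h: "\<And>x. x \<in> carrier V \<Longrightarrow> h (p x) = g x"
  shows "h \<in> hom_vec_hom R Q W"
  unfolding hom_vec_hom_iff
proof (intro conjI ballI)
  note twV = hom_vector_space.twist_closed[OF V]
  show "h \<in> lin_map R Q W"
    by (rule lin_map_factor[OF hom_vector_space_module[OF V] hom_vec_hom_lin_map[OF p(1)] p(2)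
        hom_vec_hom_lin_map[OF g] h])
  fix y assume "y \<in> carrier Q"
  then obtain x where x: "x \<in> carrier V" "y = p x"
    unfolding p(2)[symmetric] by (rule imageE)
  have "h (\<alpha>\<^bsub>Q\<^esub> y) = h (p (\<alpha>\<^bsub>V\<^esub> x))"
    using hom_vec_hom_twist[OF p(1) x(1)] x(2) by simp
  also have "\<dots> = g (\<alpha>\<^bsub>V\<^esub> x)"
    by (rule h[OF twV[OF x(1)]])
  also have "\<dots> = \<alpha>\<^bsub>W\<^esub> (h y)"
    using hom_vec_hom_twist[OF g x(1)] h[OF x(1)] x(2) by simp
  finally show "h (\<alpha>\<^bsub>Q\<^esub> y) = \<alpha>\<^bsub>W\<^esub> (h y)" .
qed

text \<open>\<open>f\<close> after the twist and the twist after \<open>f\<close> are both linear,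
  so it suffices to compare them on generators.\<close>

lemma hom_vec_hom_on_span:
  assumes "hom_vector_space R V" "hom_vector_space R W" "f \<in> lin_map R V W"
    "lin_span R V B = carrier V"
    and eq: "\<And>b. b \<in> B \<Longrightarrow> f (\<alpha>\<^bsub>V\<^esub> b) = \<alpha>\<^bsub>W\<^esub> (f b)"
  shows "f \<in> hom_vec_hom R V W"
proof -
  have "f (\<alpha>\<^bsub>V\<^esub> x) = \<alpha>\<^bsub>W\<^esub> (f x)" if "x \<in> carrier V" for x
    by (rule lin_span_eq_on[OF _ _ lin_map_comp[OF twist_lin_map assms(3)]
          lin_map_comp[OF assms(3) twist_lin_map] assms(4) eq that])
      (use assms hom_vector_space_module in auto)
  then show ?thesis
    using assms(3) by (simp add: hom_vec_hom_iff)
qed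

lemma hom_vector_space_restrict:
  assumes V: "hom_vector_space R V" and H: "submodule H R V" and tw: "\<And>x. x \<in> H \<Longrightarrow> \<alpha>\<^bsub>V\<^esub> x \<in> H"
  shows "hom_vector_space R (V\<lparr>carrier := H\<rparr>)"
proof -
  interpret V: hom_vector_space R V by fact
  show ?thesis
    using tw submodule_mem[OF H] V.twist_add V.twist_smult
    by (intro hom_vector_space_intro V.field_axioms lin_mapI
        submodule.submodule_is_module[OF H V.module_axioms]) auto
qed

lemma hom_vector_space_kernel:
  assumes "hom_vector_space R V" "hom_vector_space R W" "f \<in> hom_vec_hom R V W"
  shows "hom_vector_space R (V\<lparr>carrier := a_kernel V W f\<rparr>)"
  unfolding a_kernel_eq
proof (rule hom_vector_space_restrict[OF assms(1)])
  show "submodule {x \<in> carrier V. f x = \<zero>\<^bsub>W\<^esub>} R V"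
    using assms by (intro submodule_kernel hom_vector_space_module hom_vec_hom_lin_map)
  show "\<alpha>\<^bsub>V\<^esub> x \<in> {x \<in> carrier V. f x = \<zero>\<^bsub>W\<^esub>}" if "x \<in> {x \<in> carrier V. f x = \<zero>\<^bsub>W\<^esub>}" for x
    using that hom_vec_hom_twist[OF assms(3)] lin_map_zero[OF _ _ twist_lin_map[OF assms(2)]]
      hom_vector_space_module[OF assms(2)] hom_vector_space.twist_closed[OF assms(1)] by auto
qed

section \<open>Quotients\<close>

lemma coset_iff: "y \<in> W +>\<^bsub>V\<^esub> x \<longleftrightarrow> (\<exists>w\<in>W. y = w \<oplus>\<^bsub>V\<^esub> x)"
  by (auto simp: a_r_coset_def')

context
  fixes R :: "('a, 'r) ring_scheme" and V :: "('a, 'b) hom_alg" and W :: "'b set"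
  assumes V: "module R V" and W: "submodule W R V"
begin

interpretation V: module R V by (rule V)

lemma coset_self: "x \<in> carrier V \<Longrightarrow> x \<in> W +>\<^bsub>V\<^esub> x"
  using submodule_zero[OF W] by (auto simp: coset_iff intro!: bexI[of _ "\<zero>\<^bsub>V\<^esub>"])

lemma coset_eq_iff:
  assumes "x \<in> carrier V" "y \<in> carrier V"
  shows "W +>\<^bsub>V\<^esub> x = W +>\<^bsub>V\<^esub> y \<longleftrightarrow> x \<ominus>\<^bsub>V\<^esub> y \<in> W"
proof
  assume "W +>\<^bsub>V\<^esub> x = W +>\<^bsub>V\<^esub> y"
  then have "x \<in> W +>\<^bsub>V\<^esub> y"
    using coset_self[OF assms(1)] by simp
  then obtain w where "w \<in> W" "x = w \<oplus>\<^bsub>V\<^esub> y"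
    by (auto simp: coset_iff)
  then show "x \<ominus>\<^bsub>V\<^esub> y \<in> W"
    using assms submodule_mem[OF W] by (simp add: a_minus_def V.a_assoc V.r_neg)
next
  have sub: "W +>\<^bsub>V\<^esub> x \<subseteq> W +>\<^bsub>V\<^esub> y" if xy: "x \<ominus>\<^bsub>V\<^esub> y \<in> W" "x \<in> carrier V" "y \<in> carrier V" for x y
  proof
    fix z assume "z \<in> W +>\<^bsub>V\<^esub> x"
    then obtain w where w: "w \<in> W" "z = w \<oplus>\<^bsub>V\<^esub> x"
      by (auto simp: coset_iff)
    then have "z = (w \<oplus>\<^bsub>V\<^esub> (x \<ominus>\<^bsub>V\<^esub> y)) \<oplus>\<^bsub>V\<^esub> y"
      using xy submodule_mem[OF W] by (simp add: a_minus_def V.a_assoc V.l_neg)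
    then show "z \<in> W +>\<^bsub>V\<^esub> y"
      using w xy submodule_add[OF W] by (auto simp: coset_iff)
  qed
  assume d: "x \<ominus>\<^bsub>V\<^esub> y \<in> W"
  then have "\<ominus>\<^bsub>V\<^esub> (x \<ominus>\<^bsub>V\<^esub> y) \<in> W"
    by (rule submodule_a_inv[OF W])
  then have "y \<ominus>\<^bsub>V\<^esub> x \<in> W"
    using assms by (simp add: a_minus_def V.minus_add V.a_comm)
  then show "W +>\<^bsub>V\<^esub> x = W +>\<^bsub>V\<^esub> y"
    using sub d assms by blast
qed

lemma coset_eqI:
  "\<lbrakk>x \<in> carrier V; y \<in> carrier V; x \<ominus>\<^bsub>V\<^esub> y \<in> W\<rbrakk> \<Longrightarrow> W +>\<^bsub>V\<^esub> x = W +>\<^bsub>V\<^esub> y"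
  by (simp add: coset_eq_iff)

lemma coset_zero_iff:
  assumes "x \<in> carrier V"
  shows "W +>\<^bsub>V\<^esub> x = W \<longleftrightarrow> x \<in> W"
  using coset_eq_iff[OF assms V.zero_closed] assms submodule_subset[OF W]
  by (simp add: a_minus_def)

text \<open>A map that kills \<open>W\<close> is constant on each coset, so its image of a coset is
  a singleton. Definitions such as \<open>commutator_map\<close> are evaluated by this.\<close>

lemma the_elem_coset:
  assumes "module R U" "g \<in> lin_map R V U" "\<And>w. w \<in> W \<Longrightarrow> g w = \<zero>\<^bsub>U\<^esub>" "x \<in> carrier V"
  shows "the_elem (g ` (W +>\<^bsub>V\<^esub> x)) = g x"
proof -
  interpret U: module R U by fact
  have "g y = g x" if "y \<in> W +>\<^bsub>V\<^esub> x" for y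
    using that assms lin_mapD[OF assms(2)] submodule_mem[OF W] by (auto simp: coset_iff)
  then have "g ` (W +>\<^bsub>V\<^esub> x) = {g x}"
    using coset_self[OF assms(4)] by blast
  then show ?thesis
    by simp
qed

text \<open>\<open>quot_map\<close> is a union of cosets of \<open>H\<close> indexed by the elements
  of the source coset. As \<open>g\<close> carries \<open>W\<close> into \<open>H\<close>, these
  cosets all coincide, and the union over the nonempty index set is that single coset.\<close>

lemma quot_map_coset:
  fixes U :: "('a, 'c) hom_alg"
  assumes U: "module R U" and H: "submodule H R U"
    and g: "g \<in> lin_map R V U" "\<And>w. w \<in> W \<Longrightarrow> g w \<in> H" and x: "x \<in> carrier V"
  shows "quot_map U H g (W +>\<^bsub>V\<^esub> x) = H +>\<^bsub>U\<^esub> g x"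
proof -
  interpret U: module R U by fact
  have "H +>\<^bsub>U\<^esub> g y = H +>\<^bsub>U\<^esub> g x" if y: "y \<in> W +>\<^bsub>V\<^esub> x" for y
  proof -
    obtain w where w: "w \<in> W" "y = w \<oplus>\<^bsub>V\<^esub> x"
      using y unfolding coset_iff by blast
    then have "w \<in> carrier V"
      using submodule_mem[OF W] by simp
    then have "g y = g w \<oplus>\<^bsub>U\<^esub> g x" "g w \<in> carrier U" "g x \<in> carrier U"
      using lin_mapD[OF g(1)] x w by auto
    then have "H +>\<^bsub>U\<^esub> g y = (H +>\<^bsub>U\<^esub> g w) +>\<^bsub>U\<^esub> g x"
      using U.a_coset_add_assoc submodule_subset[OF H] by simp
    moreover have "H +>\<^bsub>U\<^esub> g w = H"
      using U.a_coset_join2 g(2)[OF w(1)] \<open>g w \<in> carrier U\<close> submodule.axioms(1)[OF H] by simp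
    ultimately show ?thesis
      by simp
  qed
  then show ?thesis
    using coset_self[OF x] unfolding quot_map_def by blast
qed

lemma quot_carrier: "carrier (quot V W) = (\<lambda>x. W +>\<^bsub>V\<^esub> x) ` carrier V"
  by (auto simp: quot_def A_RCOSETS_def')

lemma quot_zero: "\<zero>\<^bsub>quot V W\<^esub> = W"
  by (simp add: quot_def)

lemma quot_add:
  assumes "x \<in> carrier V" "y \<in> carrier V"
  shows "(W +>\<^bsub>V\<^esub> x) \<oplus>\<^bsub>quot V W\<^esub> (W +>\<^bsub>V\<^esub> y) = W +>\<^bsub>V\<^esub> (x \<oplus>\<^bsub>V\<^esub> y)"
proof -
  interpret abelian_subgroup W V
    using V.abelian_group_axioms submodule.axioms(1)[OF W]
    by (intro abelian_subgroupI3 additive_subgroupI)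
  show ?thesis
    using a_rcos_sum[OF assms] by (simp add: quot_def)
qed

lemma quot_smult:
  assumes "r \<in> carrier R" "x \<in> carrier V"
  shows "r \<odot>\<^bsub>quot V W\<^esub> (W +>\<^bsub>V\<^esub> x) = W +>\<^bsub>V\<^esub> (r \<odot>\<^bsub>V\<^esub> x)"
proof -
  have "(\<lambda>x. r \<odot>\<^bsub>V\<^esub> x) \<in> lin_map R V V"
    using assms(1)
    by (auto intro!: lin_mapI simp: V.smult_r_distr V.smult_assoc1[symmetric] V.R.m_comm)
  then show ?thesis
    using quot_map_coset[OF V W, of "\<lambda>x. r \<odot>\<^bsub>V\<^esub> x" x] assms submodule_smult[OF W]
    by (simp add: quot_def)
qed

lemma quot_module: "module R (quot V W)"
proof -
  have ex: "\<exists>x. x \<in> carrier V \<and> C = W +>\<^bsub>V\<^esub> x" if "C \<in> carrier (quot V W)" for C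
    using that by (auto simp: quot_carrier)
  have coset: "W +>\<^bsub>V\<^esub> x \<in> carrier (quot V W)" if "x \<in> carrier V" for x
    using that by (auto simp: quot_carrier)
  \<comment> \<open>\<open>quot\<close> names its zero as \<open>W\<close> itself; it is rewritten
    as the coset of zero so that the axioms can be checked on representatives.\<close>
  have zero: "\<zero>\<^bsub>quot V W\<^esub> = W +>\<^bsub>V\<^esub> \<zero>\<^bsub>V\<^esub>"
    using coset_zero_iff[OF V.zero_closed] submodule_zero[OF W] by (simp add: quot_zero)
  show ?thesis
  proof (rule moduleI[OF V.R.is_cring abelian_groupI])
    fix C D E
    assume "C \<in> carrier (quot V W)" "D \<in> carrier (quot V W)" "E \<in> carrier (quot V W)"
    then obtain x y z where *: "x \<in> carrier V" "C = W +>\<^bsub>V\<^esub> x" "y \<in> carrier V" "D = W +>\<^bsub>V\<^esub> y"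
      "z \<in> carrier V" "E = W +>\<^bsub>V\<^esub> z"
      using ex by meson
    show "C \<oplus>\<^bsub>quot V W\<^esub> D \<oplus>\<^bsub>quot V W\<^esub> E = C \<oplus>\<^bsub>quot V W\<^esub> (D \<oplus>\<^bsub>quot V W\<^esub> E)"
      using * by (simp add: quot_add V.a_assoc)
  next
    fix C D r
    assume "C \<in> carrier (quot V W)" "D \<in> carrier (quot V W)"
    then obtain x y where *: "x \<in> carrier V" "C = W +>\<^bsub>V\<^esub> x" "y \<in> carrier V" "D = W +>\<^bsub>V\<^esub> y"
      using ex by meson
    show "C \<oplus>\<^bsub>quot V W\<^esub> D \<in> carrier (quot V W)"
      using * coset by (simp add: quot_add)
    show "C \<oplus>\<^bsub>quot V W\<^esub> D = D \<oplus>\<^bsub>quot V W\<^esub> C"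
      using * by (simp add: quot_add V.a_comm)
    assume "r \<in> carrier R"
    then show "r \<odot>\<^bsub>quot V W\<^esub> (C \<oplus>\<^bsub>quot V W\<^esub> D) = r \<odot>\<^bsub>quot V W\<^esub> C \<oplus>\<^bsub>quot V W\<^esub> r \<odot>\<^bsub>quot V W\<^esub> D"
      using * by (simp add: quot_add quot_smult V.smult_r_distr)
  next
    show "\<zero>\<^bsub>quot V W\<^esub> \<in> carrier (quot V W)"
      using coset[OF V.zero_closed] zero by simp
  next
    fix C assume "C \<in> carrier (quot V W)"
    then obtain x where *: "x \<in> carrier V" "C = W +>\<^bsub>V\<^esub> x"
      using ex by meson
    show "\<zero>\<^bsub>quot V W\<^esub> \<oplus>\<^bsub>quot V W\<^esub> C = C"
      unfolding zero using * by (simp add: quot_add)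
    show "\<one>\<^bsub>R\<^esub> \<odot>\<^bsub>quot V W\<^esub> C = C"
      using * by (simp add: quot_smult)
    have "(W +>\<^bsub>V\<^esub> (\<ominus>\<^bsub>V\<^esub> x)) \<oplus>\<^bsub>quot V W\<^esub> C = \<zero>\<^bsub>quot V W\<^esub>"
      unfolding zero using * by (simp add: quot_add V.l_neg)
    then show "\<exists>D\<in>carrier (quot V W). D \<oplus>\<^bsub>quot V W\<^esub> C = \<zero>\<^bsub>quot V W\<^esub>"
      using coset[of "\<ominus>\<^bsub>V\<^esub> x"] * by blast
    fix r s assume rs: "r \<in> carrier R" "s \<in> carrier R"
    show "(r \<oplus>\<^bsub>R\<^esub> s) \<odot>\<^bsub>quot V W\<^esub> C = r \<odot>\<^bsub>quot V W\<^esub> C \<oplus>\<^bsub>quot V W\<^esub> s \<odot>\<^bsub>quot V W\<^esub> C"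
      "(r \<otimes>\<^bsub>R\<^esub> s) \<odot>\<^bsub>quot V W\<^esub> C = r \<odot>\<^bsub>quot V W\<^esub> (s \<odot>\<^bsub>quot V W\<^esub> C)"
      using rs * by (simp_all add: quot_add quot_smult V.smult_l_distr V.smult_assoc1)
  next
    fix r C assume "r \<in> carrier R" "C \<in> carrier (quot V W)"
    then show "r \<odot>\<^bsub>quot V W\<^esub> C \<in> carrier (quot V W)"
      using ex[of C] coset by (auto simp: quot_smult)
  qed
qed

lemma proj_lin_map: "(\<lambda>x. W +>\<^bsub>V\<^esub> x) \<in> lin_map R V (quot V W)"
  by (rule lin_mapI) (auto simp: quot_carrier quot_add quot_smult)

end

lemma hom_vector_space_quot:
  assumes V: "hom_vector_space R V" and W: "submodule W R V"
    and tw: "\<And>w. w \<in> W \<Longrightarrow> \<alpha>\<^bsub>V\<^esub> w \<in> W"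
  shows "hom_vector_space R (quot V W)"
    and "(\<lambda>x. W +>\<^bsub>V\<^esub> x) \<in> hom_vec_hom R V (quot V W)"
proof -
  interpret V: hom_vector_space R V by fact
  have m: "module R V"
    by (rule V.module_axioms)
  have *: "\<alpha>\<^bsub>quot V W\<^esub> (W +>\<^bsub>V\<^esub> x) = W +>\<^bsub>V\<^esub> \<alpha>\<^bsub>V\<^esub> x" if "x \<in> carrier V" for x
    using quot_map_coset[OF m W m W twist_lin_map[OF V] tw that] by (simp add: quot_def)
  show "(\<lambda>x. W +>\<^bsub>V\<^esub> x) \<in> hom_vec_hom R V (quot V W)"
    using proj_lin_map[OF m W] * by (simp add: hom_vec_hom_iff)
  have "twist (quot V W) \<in> lin_map R (quot V W) (quot V W)"
    using lin_map_factor[OF m proj_lin_map[OF m W] _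
        lin_map_comp[OF twist_lin_map[OF V] proj_lin_map[OF m W]] *] quot_carrier[OF m W] by auto
  then show "hom_vector_space R (quot V W)"
    by (intro hom_vector_space_intro V.field_axioms quot_module[OF m W])
qed

section \<open>Free vector spaces\<close>

lemma free_vec_carrier_iff:
  "f \<in> carrier (free_vec R B h) \<longleftrightarrow>
     (\<forall>b. f b \<in> carrier R) \<and> finite {b. f b \<noteq> \<zero>\<^bsub>R\<^esub>} \<and> {b. f b \<noteq> \<zero>\<^bsub>R\<^esub>} \<subseteq> B"
  by (auto simp: free_vec_def)

lemma free_vec_simps:
  "(f \<oplus>\<^bsub>free_vec R B h\<^esub> g) b = f b \<oplus>\<^bsub>R\<^esub> g b"
  "(r \<odot>\<^bsub>free_vec R B h\<^esub> f) b = r \<otimes>\<^bsub>R\<^esub> f b"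
  "\<zero>\<^bsub>free_vec R B h\<^esub> b = \<zero>\<^bsub>R\<^esub>"
  "\<alpha>\<^bsub>free_vec R B h\<^esub> = push R h"
  by (auto simp: free_vec_def)

context
  fixes R :: "('a, 'r) ring_scheme" (structure)
  assumes R: "field R"
begin

interpretation R: field R by (rule R)

lemma free_vec_module: "module R (free_vec R B h)"
proof -
  let ?V = "free_vec R B h"
  show ?thesis
  proof (rule moduleI[OF R.is_cring abelian_groupI])
    fix f g assume fg: "f \<in> carrier ?V" "g \<in> carrier ?V"
    have "{b. f b \<oplus> g b \<noteq> \<zero>} \<subseteq> {b. f b \<noteq> \<zero>} \<union> {b. g b \<noteq> \<zero>}"
      by auto
    then have "finite {b. f b \<oplus> g b \<noteq> \<zero>}" "{b. f b \<oplus> g b \<noteq> \<zero>} \<subseteq> B"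
      using fg unfolding free_vec_carrier_iff by (auto intro: finite_subset)
    then show "f \<oplus>\<^bsub>?V\<^esub> g \<in> carrier ?V"
      using fg by (simp add: free_vec_carrier_iff free_vec_simps)
    show "f \<oplus>\<^bsub>?V\<^esub> g = g \<oplus>\<^bsub>?V\<^esub> f"
      using fg by (auto simp: free_vec_carrier_iff free_vec_simps R.a_comm)
    fix r assume r: "r \<in> carrier R"
    show "r \<odot>\<^bsub>?V\<^esub> (f \<oplus>\<^bsub>?V\<^esub> g) = r \<odot>\<^bsub>?V\<^esub> f \<oplus>\<^bsub>?V\<^esub> r \<odot>\<^bsub>?V\<^esub> g"
      using fg r by (auto simp: free_vec_carrier_iff free_vec_simps R.r_distr)
  next
    fix f g k assume "f \<in> carrier ?V" "g \<in> carrier ?V" "k \<in> carrier ?V"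
    then show "f \<oplus>\<^bsub>?V\<^esub> g \<oplus>\<^bsub>?V\<^esub> k = f \<oplus>\<^bsub>?V\<^esub> (g \<oplus>\<^bsub>?V\<^esub> k)"
      by (auto simp: free_vec_carrier_iff free_vec_simps R.a_assoc)
  next
    fix f assume f: "f \<in> carrier ?V"
    have smult: "r \<odot>\<^bsub>?V\<^esub> f \<in> carrier ?V" if r: "r \<in> carrier R" for r
    proof -
      have "{b. r \<otimes> f b \<noteq> \<zero>} \<subseteq> {b. f b \<noteq> \<zero>}"
        using r by auto
      then have "finite {b. r \<otimes> f b \<noteq> \<zero>}" "{b. r \<otimes> f b \<noteq> \<zero>} \<subseteq> B"
        using f unfolding free_vec_carrier_iff by (auto intro: finite_subset)
      then show ?thesis
        using f r by (simp add: free_vec_carrier_iff free_vec_simps)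
    qed
    show "\<zero>\<^bsub>?V\<^esub> \<oplus>\<^bsub>?V\<^esub> f = f" "\<one> \<odot>\<^bsub>?V\<^esub> f = f"
      using f by (auto simp: free_vec_carrier_iff free_vec_simps)
    have "(\<ominus> \<one>) \<odot>\<^bsub>?V\<^esub> f \<oplus>\<^bsub>?V\<^esub> f = \<zero>\<^bsub>?V\<^esub>"
      using f by (auto simp: free_vec_carrier_iff free_vec_simps R.l_minus R.l_neg)
    then show "\<exists>g\<in>carrier ?V. g \<oplus>\<^bsub>?V\<^esub> f = \<zero>\<^bsub>?V\<^esub>"
      using smult by blast
    fix r s assume rs: "r \<in> carrier R" "s \<in> carrier R"
    show "(r \<oplus> s) \<odot>\<^bsub>?V\<^esub> f = r \<odot>\<^bsub>?V\<^esub> f \<oplus>\<^bsub>?V\<^esub> s \<odot>\<^bsub>?V\<^esub> f" "(r \<otimes> s) \<odot>\<^bsub>?V\<^esub> f = r \<odot>\<^bsub>?V\<^esub> (s \<odot>\<^bsub>?V\<^esub> f)"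
      using f rs by (auto simp: free_vec_carrier_iff free_vec_simps R.l_distr R.m_assoc)
    show "r \<odot>\<^bsub>?V\<^esub> f \<in> carrier ?V"
      using smult rs by simp
  next
    show "\<zero>\<^bsub>?V\<^esub> \<in> carrier ?V"
      by (auto simp: free_vec_carrier_iff free_vec_simps)
  qed
qed

lemma single_closed: "b \<in> B \<Longrightarrow> single R b \<in> carrier (free_vec R B h)"
  by (auto simp: free_vec_carrier_iff single_def)

lemma lin_span_single: "lin_span R (free_vec R B h) (single R ` B) = carrier (free_vec R B h)"
proof
  let ?V = "free_vec R B h"
  interpret V: module R ?V by (rule free_vec_module)
  have sub: "submodule (lin_span R ?V (single R ` B)) R ?V"
    by (intro submodule_lin_span free_vec_module) (auto intro: single_closed)
  note S = submoduleD[OF sub]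
  show "lin_span R ?V (single R ` B) \<subseteq> carrier ?V"
    by (rule S)
  \<comment> \<open>The induction runs over a finite set \<open>T\<close> containing the support
    rather than over the support itself, since cancelling the coefficient at \<open>t\<close> then
    fits the induction hypothesis directly.\<close>
  have "f \<in> lin_span R ?V (single R ` B)"
    if "finite T" "f \<in> carrier ?V" "{b. f b \<noteq> \<zero>} \<subseteq> T" for f T
    using that
  proof (induction T arbitrary: f rule: finite_induct)
    case empty
    then have "f = \<zero>\<^bsub>?V\<^esub>"
      by (auto simp: free_vec_def)
    then show ?case
      using S(3) by simp
  next
    case (insert t T)
    show ?case
    proof (cases "f t = \<zero>")
      case True
      then show ?thesis
        using insert by (intro insert.IH) auto
    next
      case False
      let ?g = "\<lambda>b. if b = t then \<zero> else f b"
      have t: "t \<in> B" "f t \<in> carrier R"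
        using insert.prems(1) False by (auto simp: free_vec_carrier_iff)
      have gs: "{b. ?g b \<noteq> \<zero>} \<subseteq> {b. f b \<noteq> \<zero>}"
        by auto
      then have "finite {b. ?g b \<noteq> \<zero>}"
        using insert.prems(1) unfolding free_vec_carrier_iff by (blast intro: finite_subset)
      then have g: "?g \<in> carrier ?V"
        using gs insert.prems(1) unfolding free_vec_carrier_iff by auto
      have g_in: "?g \<in> lin_span R ?V (single R ` B)"
        using insert.prems(2) by (intro insert.IH g) auto
      have t_in: "f t \<odot>\<^bsub>?V\<^esub> single R t \<in> lin_span R ?V (single R ` B)"
        using t lin_span_subset[of "single R ` B" R ?V] by (intro S) auto
      have eq: "f = ?g \<oplus>\<^bsub>?V\<^esub> f t \<odot>\<^bsub>?V\<^esub> single R t"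
        using insert.prems(1) by (auto simp: free_vec_simps free_vec_carrier_iff single_def)
      show ?thesis
        by (subst eq) (rule S(4)[OF g_in t_in])
    qed
  qed
  then show "carrier ?V \<subseteq> lin_span R ?V (single R ` B)"
    by (auto simp: free_vec_carrier_iff)
qed

lemma lin_eq_on_single:
  assumes "module R W" "f \<in> lin_map R (free_vec R B h) W" "g \<in> lin_map R (free_vec R B h) W"
    and "\<And>b. b \<in> B \<Longrightarrow> f (single R b) = g (single R b)" and "x \<in> carrier (free_vec R B h)"
  shows "f x = g x"
  by (rule lin_span_eq_on[OF free_vec_module assms(1-3) lin_span_single])
    (use assms(4,5) in auto)

context
  fixes V :: "('a, 'c) hom_alg" and \<phi> :: "'b \<Rightarrow> 'c" and B :: "'b set"
  assumes V: "module R V" and \<phi>: "\<phi> \<in> B \<rightarrow> carrier V"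
begin

interpretation V: module R V by (rule V)

text \<open>\<open>lin_ext\<close> sums over the exact support, which changes under addition and
  scaling; summing over a common finite superset brings two such sums to the same index set.\<close>

lemma lin_ext_superset:
  assumes f: "f \<in> carrier (free_vec R B h)" and S: "finite S" "{b. f b \<noteq> \<zero>} \<subseteq> S" "S \<subseteq> B"
  shows "lin_ext R V \<phi> f = (\<Oplus>\<^bsub>V\<^esub>b\<in>S. f b \<odot>\<^bsub>V\<^esub> \<phi> b)"
proof -
  have "\<phi> b \<in> carrier V" if "b \<in> S" for b
    using that S(3) \<phi> by auto
  then show ?thesis
    unfolding lin_ext_def
    using f S(1,2) by (intro V.add.finprod_mono_neutral_cong_left) (auto simp: free_vec_carrier_iff)
qed

lemma lin_ext_lin_map: "lin_ext R V \<phi> \<in> lin_map R (free_vec R B h) V"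
proof (rule lin_mapI)
  let ?F = "free_vec R B h"
  interpret F: module R ?F by (rule free_vec_module)
  fix f assume f: "f \<in> carrier ?F"
  let ?S = "{b. f b \<noteq> \<zero>}"
  have fc: "f b \<in> carrier R" "finite ?S" "?S \<subseteq> B" for b
    using f by (auto simp: free_vec_carrier_iff)
  have term_closed: "f b \<odot>\<^bsub>V\<^esub> \<phi> b \<in> carrier V" if "b \<in> B" for b
    using fc \<phi> that by auto
  then show "lin_ext R V \<phi> f \<in> carrier V"
    unfolding lin_ext_def using fc by (intro V.add.finprod_closed) auto
  show "lin_ext R V \<phi> (r \<odot>\<^bsub>?F\<^esub> f) = r \<odot>\<^bsub>V\<^esub> lin_ext R V \<phi> f" if r: "r \<in> carrier R" for r
  proof -
    have "lin_ext R V \<phi> (r \<odot>\<^bsub>?F\<^esub> f) = (\<Oplus>\<^bsub>V\<^esub>b\<in>?S. (r \<odot>\<^bsub>?F\<^esub> f) b \<odot>\<^bsub>V\<^esub> \<phi> b)"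
      using f r fc by (intro lin_ext_superset[where h = h]) (auto simp: free_vec_simps)
    also have "\<dots> = (\<Oplus>\<^bsub>V\<^esub>b\<in>?S. r \<odot>\<^bsub>V\<^esub> (f b \<odot>\<^bsub>V\<^esub> \<phi> b))"
      using r fc \<phi> term_closed
      by (intro V.add.finprod_cong') (auto simp: free_vec_simps subset_iff Pi_iff V.smult_assoc1)
    also have "\<dots> = r \<odot>\<^bsub>V\<^esub> lin_ext R V \<phi> f"
      unfolding lin_ext_def using fc r term_closed
      by (intro V.finsum_smult_ldistr[symmetric]) auto
    finally show ?thesis .
  qed
  fix g assume g: "g \<in> carrier ?F"
  let ?T = "{b. g b \<noteq> \<zero>}"
  have gc: "g b \<in> carrier R" "finite ?T" "?T \<subseteq> B" for b
    using g by (auto simp: free_vec_carrier_iff)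
  have term_closed': "g b \<odot>\<^bsub>V\<^esub> \<phi> b \<in> carrier V" if "b \<in> B" for b
    using gc \<phi> that by auto
  have "lin_ext R V \<phi> (f \<oplus>\<^bsub>?F\<^esub> g) = (\<Oplus>\<^bsub>V\<^esub>b\<in>?S \<union> ?T. (f \<oplus>\<^bsub>?F\<^esub> g) b \<odot>\<^bsub>V\<^esub> \<phi> b)"
    using f g fc gc by (intro lin_ext_superset[where h = h]) (auto simp: free_vec_simps)
  also have "\<dots> = (\<Oplus>\<^bsub>V\<^esub>b\<in>?S \<union> ?T. f b \<odot>\<^bsub>V\<^esub> \<phi> b \<oplus>\<^bsub>V\<^esub> g b \<odot>\<^bsub>V\<^esub> \<phi> b)"
  proof (intro V.add.finprod_cong')
    show "(f \<oplus>\<^bsub>?F\<^esub> g) b \<odot>\<^bsub>V\<^esub> \<phi> b = f b \<odot>\<^bsub>V\<^esub> \<phi> b \<oplus>\<^bsub>V\<^esub> g b \<odot>\<^bsub>V\<^esub> \<phi> b" if "b \<in> ?S \<union> ?T" for b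
    proof -
      have "\<phi> b \<in> carrier V"
        using that \<phi> fc(3) gc(3) by auto
      then show ?thesis
        using fc(1)[of b] gc(1)[of b] by (simp add: free_vec_simps V.smult_l_distr)
    qed
    show "(\<lambda>b. f b \<odot>\<^bsub>V\<^esub> \<phi> b \<oplus>\<^bsub>V\<^esub> g b \<odot>\<^bsub>V\<^esub> \<phi> b) \<in> ?S \<union> ?T \<rightarrow> carrier V"
      using term_closed term_closed' fc(3) gc(3) by blast
  qed simp
  also have "\<dots> = (\<Oplus>\<^bsub>V\<^esub>b\<in>?S \<union> ?T. f b \<odot>\<^bsub>V\<^esub> \<phi> b) \<oplus>\<^bsub>V\<^esub> (\<Oplus>\<^bsub>V\<^esub>b\<in>?S \<union> ?T. g b \<odot>\<^bsub>V\<^esub> \<phi> b)"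
    using term_closed term_closed' fc(3) gc(3) by (intro V.add.finprod_multf) blast+
  also have "(\<Oplus>\<^bsub>V\<^esub>b\<in>?S \<union> ?T. f b \<odot>\<^bsub>V\<^esub> \<phi> b) = lin_ext R V \<phi> f"
    using f fc gc by (intro lin_ext_superset[where h = h, symmetric]) auto
  also have "(\<Oplus>\<^bsub>V\<^esub>b\<in>?S \<union> ?T. g b \<odot>\<^bsub>V\<^esub> \<phi> b) = lin_ext R V \<phi> g"
    using g fc gc by (intro lin_ext_superset[where h = h, symmetric]) auto
  finally show "lin_ext R V \<phi> (f \<oplus>\<^bsub>?F\<^esub> g) = lin_ext R V \<phi> f \<oplus>\<^bsub>V\<^esub> lin_ext R V \<phi> g" .
qed

lemma lin_ext_single:
  assumes "b \<in> B"
  shows "lin_ext R V \<phi> (single R b) = \<phi> b"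
proof -
  have "lin_ext R V \<phi> (single R b) = (\<Oplus>\<^bsub>V\<^esub>c\<in>{b}. single R b c \<odot>\<^bsub>V\<^esub> \<phi> c)"
    using assms by (intro lin_ext_superset[where h = id] single_closed) (auto simp: single_def)
  also have "\<dots> = \<phi> b"
  proof -
    have "(\<lambda>c. single R b c \<odot>\<^bsub>V\<^esub> \<phi> c) \<in> {} \<rightarrow> carrier V"
      by auto
    moreover have "\<phi> b \<in> carrier V"
      using assms \<phi> by auto
    moreover from this have "single R b b \<odot>\<^bsub>V\<^esub> \<phi> b = \<phi> b"
      by (simp add: single_def)
    ultimately show ?thesis
      by (simp add: V.add.finprod_insert)
  qed
  finally show ?thesis .
qed

end

lemma finsum_free_vec_apply:
  assumes "finite S" "g \<in> S \<rightarrow> carrier (free_vec R B h)"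
  shows "finsum (free_vec R B h) g S c = (\<Oplus>s\<in>S. g s c)"
  using assms
proof (induction S rule: finite_induct)
  case empty
  interpret F: module R "free_vec R B h" by (rule free_vec_module)
  show ?case
    by (simp add: free_vec_simps)
next
  case (insert s S)
  interpret F: module R "free_vec R B h" by (rule free_vec_module)
  have "(\<lambda>s. g s c) \<in> S \<rightarrow> carrier R" "g s c \<in> carrier R" "g \<in> S \<rightarrow> carrier (free_vec R B h)"
    using insert.prems by (auto simp: free_vec_carrier_iff Pi_iff)
  then show ?case
    using insert by (simp add: free_vec_simps)
qed

text \<open>At \<open>c\<close> the extension collects exactly the coefficients over the fibre of
  \<open>h\<close> above \<open>c\<close>, which is the sum that defines \<open>push\<close>.
  Linearity of \<open>push\<close> and its values on basis vectors are inherited from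
  \<open>lin_ext\<close>.\<close>

lemma push_eq_lin_ext:
  assumes h: "h \<in> B \<rightarrow> B'" and f: "f \<in> carrier (free_vec R B k)"
  shows "push R h f = lin_ext R (free_vec R B' k') (\<lambda>b. single R (h b)) f"
proof
  fix c
  let ?S = "{b. f b \<noteq> \<zero>}"
  have fc: "f b \<in> carrier R" "finite ?S" "?S \<subseteq> B" for b
    using f by (auto simp: free_vec_carrier_iff)
  interpret F: module R "free_vec R B' k'" by (rule free_vec_module)
  have "lin_ext R (free_vec R B' k') (\<lambda>b. single R (h b)) f c
      = (\<Oplus>b\<in>?S. (f b \<odot>\<^bsub>free_vec R B' k'\<^esub> single R (h b)) c)"
    unfolding lin_ext_def
  proof (intro finsum_free_vec_apply fc(2) funcsetI F.smult_closed fc(1) single_closed)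
    show "h b \<in> B'" if "b \<in> ?S" for b
      using that fc(3) h by auto
  qed
  also have "\<dots> = (\<Oplus>b\<in>{b. f b \<noteq> \<zero> \<and> h b = c}. f b)"
    using fc by (intro R.add.finprod_mono_neutral_cong_right) (auto simp: free_vec_simps single_def)
  finally show "push R h f c = lin_ext R (free_vec R B' k') (\<lambda>b. single R (h b)) f c"
    by (simp add: push_def)
qed

lemma push_lin_map:
  assumes "h \<in> B \<rightarrow> B'"
  shows "push R h \<in> lin_map R (free_vec R B k) (free_vec R B' k')"
proof -
  interpret F: module R "free_vec R B k" by (rule free_vec_module)
  have s: "(\<lambda>b. single R (h b)) \<in> B \<rightarrow> carrier (free_vec R B' k')"
    using assms by (auto intro: single_closed)
  note l = lin_ext_lin_map[OF free_vec_module s, where h = k]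
  show ?thesis
    using lin_mapD[OF l] push_eq_lin_ext[OF assms, where k = k and k' = k']
    by (intro lin_mapI) auto
qed

lemma push_single:
  assumes "h \<in> B \<rightarrow> B'" "b \<in> B"
  shows "push R h (single R b) = single R (h b)"
proof -
  have s: "(\<lambda>b. single R (h b)) \<in> B \<rightarrow> carrier (free_vec R B' id)"
    using assms by (auto intro: single_closed)
  show ?thesis
    using push_eq_lin_ext[OF assms(1) single_closed[OF assms(2), where h = id], where k' = id]
      lin_ext_single[OF free_vec_module s assms(2)] by simp
qed

lemma hom_vector_space_free_vec:
  assumes "h \<in> B \<rightarrow> B"
  shows "hom_vector_space R (free_vec R B h)"
  using push_lin_map[OF assms]
  by (intro hom_vector_space_intro R free_vec_module) (simp add: free_vec_simps)

section \<open>Free nonassociative algebras\<close>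

lemma free_nonassoc_carrier:
  "carrier (free_nonassoc R X a) = carrier (free_vec R {t. set_magma t \<subseteq> X} (map_magma a))"
  by (simp add: free_nonassoc_def)

lemma free_nonassoc_mult:
  "(f \<otimes>\<^bsub>free_nonassoc R X a\<^esub> g) t = (case t of Gen x \<Rightarrow> \<zero> | Mul s u \<Rightarrow> f s \<otimes> g u)"
  by (simp add: free_nonassoc_def)

lemma lin_map_free_nonassoc:
  "f \<in> lin_map R (free_nonassoc R X a) W \<longleftrightarrow>
     f \<in> lin_map R (free_vec R {t. set_magma t \<subseteq> X} (map_magma a)) W"
  by (simp add: free_nonassoc_def lin_map_def)

lemma lin_map_free_nonassoc':
  "f \<in> lin_map R W (free_nonassoc R X a) \<longleftrightarrow>
     f \<in> lin_map R W (free_vec R {t. set_magma t \<subseteq> X} (map_magma a))"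
  by (simp add: free_nonassoc_def lin_map_def)

lemma free_nonassoc_twist: "\<alpha>\<^bsub>free_nonassoc R X a\<^esub> = push R (map_magma a)"
  by (simp add: free_nonassoc_def free_vec_def)

text \<open>\<open>free_nonassoc\<close> is \<open>free_vec\<close> with only the product replaced,
  and the module axioms do not look at that field, so the vector space structure carries
  over.\<close>

lemma module_mult_update [simp]: "module R (V\<lparr>mult := m\<rparr>) \<longleftrightarrow> module R V"
proof -
  have "add_monoid (V\<lparr>mult := m\<rparr>) = add_monoid V"
    by simp
  then show ?thesis
    by (simp add: module_def module_axioms_def abelian_group_def abelian_group_axioms_def
        abelian_monoid_def)
qed

lemma free_nonassoc_module: "module R (free_nonassoc R X a)"
  using free_vec_module by (simp add: free_nonassoc_def)

lemma map_magma_funcset: "a \<in> X \<rightarrow> Y \<Longrightarrow> map_magma a \<in> {t. set_magma t \<subseteq> X} \<rightarrow> {t. set_magma t \<subseteq> Y}"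
  by (auto simp: magma.set_map Pi_iff subset_iff)

lemma hom_vector_space_free_nonassoc:
  assumes "a \<in> X \<rightarrow> X"
  shows "hom_vector_space R (free_nonassoc R X a)"
  using push_lin_map[OF map_magma_funcset[OF assms]]
  by (intro hom_vector_space_intro R free_nonassoc_module)
    (simp add: free_nonassoc_twist lin_map_free_nonassoc lin_map_free_nonassoc')

lemma single_word_closed: "set_magma t \<subseteq> X \<Longrightarrow> single R t \<in> carrier (free_nonassoc R X a)"
  by (auto simp: free_nonassoc_carrier intro: single_closed)

lemma lin_span_words:
  "lin_span R (free_nonassoc R X a) (single R ` {t. set_magma t \<subseteq> X})
     = carrier (free_nonassoc R X a)"
proof -
  have "submodule H R (free_nonassoc R X a) \<longleftrightarrow>
      submodule H R (free_vec R {t. set_magma t \<subseteq> X} (map_magma a))" for H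
    by (simp add: free_nonassoc_def submodule_def submodule_axioms_def)
  then show ?thesis
    using lin_span_single[of "{t. set_magma t \<subseteq> X}" "map_magma a"]
    by (simp add: lin_span_def free_nonassoc_carrier)
qed

lemma single_mult:
  "single R s \<otimes>\<^bsub>free_nonassoc R X a\<^esub> single R t = single R (Mul s t)"
  by (auto simp: free_nonassoc_mult single_def split: magma.split)

lemma free_nonassoc_mult_closed:
  assumes f: "f \<in> carrier (free_nonassoc R X a)" and g: "g \<in> carrier (free_nonassoc R X a)"
  shows "f \<otimes>\<^bsub>free_nonassoc R X a\<^esub> g \<in> carrier (free_nonassoc R X a)"
proof -
  let ?fg = "f \<otimes>\<^bsub>free_nonassoc R X a\<^esub> g"
  let ?S = "{b. f b \<noteq> \<zero>}" and ?T = "{b. g b \<noteq> \<zero>}"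
  have c: "f b \<in> carrier R" "g b \<in> carrier R" "finite ?S" "finite ?T"
    "?S \<subseteq> {t. set_magma t \<subseteq> X}" "?T \<subseteq> {t. set_magma t \<subseteq> X}" for b
    using f g by (auto simp: free_nonassoc_carrier free_vec_carrier_iff)
  \<comment> \<open>A composite word splits uniquely into its two factors, so the support of a
    product is covered by the pairs from the two finite supports.\<close>
  have sub: "{t. ?fg t \<noteq> \<zero>} \<subseteq> (\<lambda>(s, t). Mul s t) ` (?S \<times> ?T)"
  proof
    fix t assume t: "t \<in> {t. ?fg t \<noteq> \<zero>}"
    then obtain s u where "t = Mul s u" "f s \<otimes> g u \<noteq> \<zero>"
      by (cases t) (auto simp: free_nonassoc_mult)
    then show "t \<in> (\<lambda>(s, t). Mul s t) ` (?S \<times> ?T)"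
      using c(1)[of s] c(2)[of u] by (intro image_eqI[of _ _ "(s, u)"]) auto
  qed
  have "finite ((\<lambda>(s, t). Mul s t) ` (?S \<times> ?T))"
    using c(3,4) by simp
  then have "finite {t. ?fg t \<noteq> \<zero>}"
    using sub by (rule finite_subset[rotated])
  moreover have "{t. ?fg t \<noteq> \<zero>} \<subseteq> {t. set_magma t \<subseteq> X}"
    using sub c(5,6) by fastforce
  moreover have "?fg t \<in> carrier R" for t
    using c(1,2) by (cases t) (auto simp: free_nonassoc_mult)
  ultimately show ?thesis
    by (simp add: free_nonassoc_carrier free_vec_carrier_iff)
qed

lemma free_nonassoc_mult_lin_map:
  assumes f: "f \<in> carrier (free_nonassoc R X a)"
  shows "(\<lambda>g. f \<otimes>\<^bsub>free_nonassoc R X a\<^esub> g) \<in> lin_map R (free_nonassoc R X a) (free_nonassoc R X a)"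
    and "(\<lambda>g. g \<otimes>\<^bsub>free_nonassoc R X a\<^esub> f) \<in> lin_map R (free_nonassoc R X a) (free_nonassoc R X a)"
proof -
  let ?A = "free_nonassoc R X a"
  have c: "g t \<in> carrier R" if "g \<in> carrier ?A" for g t
    using that by (auto simp: free_nonassoc_carrier free_vec_carrier_iff)
  have s: "(g \<oplus>\<^bsub>?A\<^esub> k) t = g t \<oplus> k t" "(r \<odot>\<^bsub>?A\<^esub> g) t = r \<otimes> g t" for g k r t
    by (simp_all add: free_nonassoc_def free_vec_def)
  show "(\<lambda>g. f \<otimes>\<^bsub>?A\<^esub> g) \<in> lin_map R ?A ?A"
    by (intro lin_mapI free_nonassoc_mult_closed f ext)
      (auto simp: s free_nonassoc_mult c f R.r_distr R.m_lcomm split: magma.split)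
  show "(\<lambda>g. g \<otimes>\<^bsub>?A\<^esub> f) \<in> lin_map R ?A ?A"
    by (intro lin_mapI free_nonassoc_mult_closed f ext)
      (auto simp: s free_nonassoc_mult c f R.l_distr R.m_assoc split: magma.split)
qed

text \<open>Both sides are linear in each factor, so it is enough to compare them on words: the
  proof fixes a word on the left and varies \<open>g\<close>, and then varies \<open>f\<close>.
  Three maps are allowed because a form extended to words takes on a product the value of the form
  at the evaluations of the factors; with equal maps the lemma gives multiplicativity.\<close>

lemma free_nonassoc_mult_transfer:
  assumes V1: "module R V1" and V2: "module R V2" and W: "module R W"
    and P: "P \<in> lin_map R (free_nonassoc R X a) V1" and Q: "Q \<in> lin_map R (free_nonassoc R X a) V2"
    and T: "T \<in> lin_map R (free_nonassoc R X a) W"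
    and \<beta>: "\<And>x. x \<in> carrier V1 \<Longrightarrow> (\<lambda>y. \<beta> x y) \<in> lin_map R V2 W"
      "\<And>y. y \<in> carrier V2 \<Longrightarrow> (\<lambda>x. \<beta> x y) \<in> lin_map R V1 W"
    and eq: "\<And>s t. \<lbrakk>set_magma s \<subseteq> X; set_magma t \<subseteq> X\<rbrakk>
      \<Longrightarrow> T (single R (Mul s t)) = \<beta> (P (single R s)) (Q (single R t))"
    and f: "f \<in> carrier (free_nonassoc R X a)" and g: "g \<in> carrier (free_nonassoc R X a)"
  shows "T (f \<otimes>\<^bsub>free_nonassoc R X a\<^esub> g) = \<beta> (P f) (Q g)"
proof -
  let ?A = "free_nonassoc R X a"
  note A = free_nonassoc_module[of X a]
  have "T (single R s \<otimes>\<^bsub>?A\<^esub> g) = \<beta> (P (single R s)) (Q g)" if s: "set_magma s \<subseteq> X" for s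
    by (rule lin_span_eq_on[OF A W lin_map_comp[OF free_nonassoc_mult_lin_map(1)[OF
            single_word_closed[OF s]] T] lin_map_comp[OF Q \<beta>(1)[OF lin_map_closed[OF P
            single_word_closed[OF s]]]] lin_span_words _ g])
      (auto simp: single_mult eq s)
  note * = this
  show ?thesis
    by (rule lin_span_eq_on[OF A W lin_map_comp[OF free_nonassoc_mult_lin_map(2)[OF g] T]
          lin_map_comp[OF P \<beta>(2)[OF lin_map_closed[OF Q g]]] lin_span_words _ f])
      (auto simp: *)
qed

lemma push_magma_lin_map:
  assumes "h \<in> X \<rightarrow> Y"
  shows "push R (map_magma h) \<in> lin_map R (free_nonassoc R X a) (free_nonassoc R Y b)"
  using push_lin_map[OF map_magma_funcset[OF assms]]
  by (simp add: lin_map_free_nonassoc lin_map_free_nonassoc')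

lemma push_magma_single:
  assumes "h \<in> X \<rightarrow> Y" "set_magma t \<subseteq> X"
  shows "push R (map_magma h) (single R t) = single R (map_magma h t)"
  using push_single[OF map_magma_funcset[OF assms(1)]] assms(2) by simp

lemma push_magma_mult:
  assumes h: "h \<in> X \<rightarrow> Y"
    and f: "f \<in> carrier (free_nonassoc R X a)" and g: "g \<in> carrier (free_nonassoc R X a)"
  shows "push R (map_magma h) (f \<otimes>\<^bsub>free_nonassoc R X a\<^esub> g)
    = push R (map_magma h) f \<otimes>\<^bsub>free_nonassoc R Y b\<^esub> push R (map_magma h) g"
  using free_nonassoc_mult_transfer[OF free_nonassoc_module free_nonassoc_module
      free_nonassoc_module push_magma_lin_map[OF h] push_magma_lin_map[OF h]
      push_magma_lin_map[OF h] free_nonassoc_mult_lin_map(1) free_nonassoc_mult_lin_map(2) _ f g]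
  by (auto simp: push_magma_single[OF h] single_mult)

end

section \<open>Hom-Lie algebras\<close>

lemma lin_map_restrict:
  assumes "module R V" "module R W" "f \<in> lin_map R V W" "lin_span R V B = carrier V"
    "submodule H R W" and "\<And>b. b \<in> B \<Longrightarrow> f b \<in> H"
  shows "f \<in> lin_map R V (W\<lparr>carrier := H\<rparr>)"
proof -
  have "lin_span R V B \<subseteq> {x \<in> carrier V. f x \<in> H}"
    using assms(4,6) lin_span_subset[of B R V]
    by (intro lin_span_minimal submodule_vimage[OF assms(1-3,5)]) auto
  then show ?thesis
    using lin_mapD[OF assms(3)] assms(4) by (intro lin_mapI) auto
qed

lemma lin_map_restrict_domain:
  "\<lbrakk>f \<in> lin_map R V W; H \<subseteq> carrier V\<rbrakk> \<Longrightarrow> f \<in> lin_map R (V\<lparr>carrier := H\<rparr>) W"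
  by (auto simp: lin_map_def subset_iff)

lemma restrict_module:
  assumes "module R V" "submodule H R V"
  shows "module R (V\<lparr>carrier := H\<rparr>)"
  by (rule submodule.submodule_is_module[OF assms(2,1)])

context hom_lie_algebra
begin

lemma lie_lin_map:
  assumes "x \<in> carrier L"
  shows "(\<lambda>y. x \<otimes>\<^bsub>L\<^esub> y) \<in> lin_map R L L" "(\<lambda>y. y \<otimes>\<^bsub>L\<^esub> x) \<in> lin_map R L L"
  using assms by (auto intro!: lin_mapI lie_closed
      simp: lie_add_left lie_add_right lie_smult_left lie_smult_right)

lemma lie_zero [simp]:
  assumes "x \<in> carrier L"
  shows "x \<otimes>\<^bsub>L\<^esub> \<zero>\<^bsub>L\<^esub> = \<zero>\<^bsub>L\<^esub>" "\<zero>\<^bsub>L\<^esub> \<otimes>\<^bsub>L\<^esub> x = \<zero>\<^bsub>L\<^esub>"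
  using lie_lin_map[OF assms] lin_map_zero[OF module_axioms module_axioms] by auto

lemma lie_a_inv:
  assumes "x \<in> carrier L" "y \<in> carrier L"
  shows "x \<otimes>\<^bsub>L\<^esub> (\<ominus>\<^bsub>L\<^esub> y) = \<ominus>\<^bsub>L\<^esub> (x \<otimes>\<^bsub>L\<^esub> y)" "(\<ominus>\<^bsub>L\<^esub> y) \<otimes>\<^bsub>L\<^esub> x = \<ominus>\<^bsub>L\<^esub> (y \<otimes>\<^bsub>L\<^esub> x)"
  using lie_lin_map[OF assms(1)] lin_map_a_inv[OF module_axioms module_axioms _ assms(2)] by auto

text \<open>Antisymmetry only gives \<open>2 [x, x] = 0\<close>, which is divided by two. This is
  the point at which the characteristic enters.\<close>

lemma lie_self:
  assumes two: "\<one>\<^bsub>R\<^esub> \<oplus>\<^bsub>R\<^esub> \<one>\<^bsub>R\<^esub> \<noteq> \<zero>\<^bsub>R\<^esub>" and x: "x \<in> carrier L"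
  shows "x \<otimes>\<^bsub>L\<^esub> x = \<zero>\<^bsub>L\<^esub>"
proof -
  let ?t = "\<one>\<^bsub>R\<^esub> \<oplus>\<^bsub>R\<^esub> \<one>\<^bsub>R\<^esub>" and ?y = "x \<otimes>\<^bsub>L\<^esub> x"
  have y: "?y \<in> carrier L"
    using lie_closed x by simp
  have t: "?t \<in> Units R"
    using two field_Units by simp
  have "?y \<oplus>\<^bsub>L\<^esub> ?y = \<zero>\<^bsub>L\<^esub>"
    using lie_antisym[OF x x] y r_neg by metis
  then have "?t \<odot>\<^bsub>L\<^esub> ?y = \<zero>\<^bsub>L\<^esub>"
    using y by (simp add: smult_l_distr)
  then have "inv\<^bsub>R\<^esub> ?t \<odot>\<^bsub>L\<^esub> (?t \<odot>\<^bsub>L\<^esub> ?y) = \<zero>\<^bsub>L\<^esub>"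
    using R.Units_inv_closed[OF t] by simp
  then have "(inv\<^bsub>R\<^esub> ?t \<otimes>\<^bsub>R\<^esub> ?t) \<odot>\<^bsub>L\<^esub> ?y = \<zero>\<^bsub>L\<^esub>"
    using y R.Units_inv_closed[OF t] R.Units_closed[OF t] smult_assoc1 by simp
  then show ?thesis
    unfolding R.Units_l_inv[OF t] smult_one[OF y] .
qed

end

lemma hom_lie_algebra_vec: "hom_lie_algebra R K \<Longrightarrow> hom_vector_space R K"
  by (simp add: hom_lie_algebra_def)

lemma hom_lie_algebra_module: "hom_lie_algebra R K \<Longrightarrow> module R K"
  by (intro hom_vector_space_module hom_lie_algebra_vec)

lemma hom_lie_homD:
  assumes "f \<in> hom_lie_hom R K K'"
  shows hom_lie_hom_vec: "f \<in> hom_vec_hom R K K'"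
    and hom_lie_hom_lin: "f \<in> lin_map R K K'"
    and hom_lie_hom_closed: "x \<in> carrier K \<Longrightarrow> f x \<in> carrier K'"
    and hom_lie_hom_twist: "x \<in> carrier K \<Longrightarrow> f (\<alpha>\<^bsub>K\<^esub> x) = \<alpha>\<^bsub>K'\<^esub> (f x)"
    and hom_lie_hom_lie: "\<lbrakk>x \<in> carrier K; y \<in> carrier K\<rbrakk> \<Longrightarrow> f (x \<otimes>\<^bsub>K\<^esub> y) = f x \<otimes>\<^bsub>K'\<^esub> f y"
    and hom_lie_hom_add: "\<lbrakk>x \<in> carrier K; y \<in> carrier K\<rbrakk> \<Longrightarrow> f (x \<oplus>\<^bsub>K\<^esub> y) = f x \<oplus>\<^bsub>K'\<^esub> f y"
    and hom_lie_hom_smult: "\<lbrakk>r \<in> carrier R; x \<in> carrier K\<rbrakk> \<Longrightarrow> f (r \<odot>\<^bsub>K\<^esub> x) = r \<odot>\<^bsub>K'\<^esub> f x"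
  using assms by (auto simp: hom_lie_hom_def hom_vec_hom_iff dest: lin_mapD)

lemma twist_hom_lie_hom:
  assumes "hom_lie_algebra R K"
  shows "twist K \<in> hom_lie_hom R K K"
  using twist_lin_map[OF hom_lie_algebra_vec[OF assms]] hom_lie_algebra.twist_lie[OF assms]
  by (auto simp: hom_lie_hom_def hom_vec_hom_iff)

lemma hom_lie_idealD:
  assumes "hom_lie_ideal R M K"
  shows hom_lie_ideal_submodule: "submodule M R K"
    and hom_lie_ideal_subset: "x \<in> M \<Longrightarrow> x \<in> carrier K"
    and hom_lie_ideal_twist: "x \<in> M \<Longrightarrow> \<alpha>\<^bsub>K\<^esub> x \<in> M"
    and hom_lie_ideal_lie: "\<lbrakk>x \<in> M; y \<in> carrier K\<rbrakk> \<Longrightarrow> x \<otimes>\<^bsub>K\<^esub> y \<in> M"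
  using assms submodule_subset[of M R K] by (auto simp: hom_lie_ideal_def)

lemma hom_lie_ideal_lie':
  assumes "hom_lie_algebra R K" "hom_lie_ideal R M K" "x \<in> carrier K" "y \<in> M"
  shows "x \<otimes>\<^bsub>K\<^esub> y \<in> M"
proof -
  interpret hom_lie_algebra R K by fact
  have "x \<otimes>\<^bsub>K\<^esub> y = \<ominus>\<^bsub>K\<^esub> (y \<otimes>\<^bsub>K\<^esub> x)"
    by (intro lie_antisym assms hom_lie_ideal_subset[OF assms(2)])
  then show ?thesis
    using submodule_a_inv[OF hom_lie_ideal_submodule[OF assms(2)]
        hom_lie_ideal_lie[OF assms(2) assms(4,3)]] by simp
qed

lemma hom_lie_ideal_carrier: "hom_lie_algebra R K \<Longrightarrow> hom_lie_ideal R (carrier K) K"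
  using module.carrier_is_submodule[OF hom_lie_algebra_module]
  by (auto simp: hom_lie_ideal_def hom_lie_algebra.lie_closed
      hom_vector_space.twist_closed[OF hom_lie_algebra_vec])

section \<open>Exterior forms\<close>

text \<open>These clauses are the linear relations among the symbols \<open>m \<star> n\<close>
  together with \<open>x \<star> x = 0\<close>. The relation for products of generators does not
  appear: it constrains no bilinear map but fixes how a form extends to longer words
  (\<open>word_form\<close>). The left argument stays in \<open>M\<close>, so linearity there refers
  to the restricted record.\<close>

definition exterior_form ::
  "('a, 'r) ring_scheme \<Rightarrow> ('a, 'b) hom_alg \<Rightarrow> 'b set \<Rightarrow> ('a, 'c) hom_alg \<Rightarrow> ('b \<Rightarrow> 'b \<Rightarrow> 'c) \<Rightarrow> bool"
  where
  "exterior_form R K M W \<phi> \<longleftrightarrow>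
     (\<forall>m\<in>M. (\<lambda>n. \<phi> m n) \<in> lin_map R K W) \<and>
     (\<forall>n\<in>carrier K. (\<lambda>m. \<phi> m n) \<in> lin_map R (K\<lparr>carrier := M\<rparr>) W) \<and>
     (\<forall>m\<in>M. \<phi> m m = \<zero>\<^bsub>W\<^esub>) \<and>
     (\<forall>m\<in>M. \<forall>m'\<in>M. \<forall>n\<in>carrier K. \<phi> (m \<otimes>\<^bsub>K\<^esub> m') (\<alpha>\<^bsub>K\<^esub> n)
        = \<phi> (\<alpha>\<^bsub>K\<^esub> m) (m' \<otimes>\<^bsub>K\<^esub> n) \<ominus>\<^bsub>W\<^esub> \<phi> (\<alpha>\<^bsub>K\<^esub> m') (m \<otimes>\<^bsub>K\<^esub> n)) \<and>
     (\<forall>m\<in>M. \<forall>n\<in>carrier K. \<forall>n'\<in>carrier K. \<phi> (\<alpha>\<^bsub>K\<^esub> m) (n \<otimes>\<^bsub>K\<^esub> n')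
        = \<phi> (n' \<otimes>\<^bsub>K\<^esub> m) (\<alpha>\<^bsub>K\<^esub> n) \<ominus>\<^bsub>W\<^esub> \<phi> (n \<otimes>\<^bsub>K\<^esub> m) (\<alpha>\<^bsub>K\<^esub> n'))"

lemma exterior_formD:
  assumes "exterior_form R K M W \<phi>"
  shows exterior_form_lin_right: "m \<in> M \<Longrightarrow> (\<lambda>n. \<phi> m n) \<in> lin_map R K W"
    and exterior_form_lin_left: "n \<in> carrier K \<Longrightarrow> (\<lambda>m. \<phi> m n) \<in> lin_map R (K\<lparr>carrier := M\<rparr>) W"
    and exterior_form_self: "m \<in> M \<Longrightarrow> \<phi> m m = \<zero>\<^bsub>W\<^esub>"
    and exterior_form_lie_left: "\<lbrakk>m \<in> M; m' \<in> M; n \<in> carrier K\<rbrakk> \<Longrightarrow> \<phi> (m \<otimes>\<^bsub>K\<^esub> m') (\<alpha>\<^bsub>K\<^esub> n)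
        = \<phi> (\<alpha>\<^bsub>K\<^esub> m) (m' \<otimes>\<^bsub>K\<^esub> n) \<ominus>\<^bsub>W\<^esub> \<phi> (\<alpha>\<^bsub>K\<^esub> m') (m \<otimes>\<^bsub>K\<^esub> n)"
    and exterior_form_lie_right: "\<lbrakk>m \<in> M; n \<in> carrier K; n' \<in> carrier K\<rbrakk> \<Longrightarrow>
        \<phi> (\<alpha>\<^bsub>K\<^esub> m) (n \<otimes>\<^bsub>K\<^esub> n')
        = \<phi> (n' \<otimes>\<^bsub>K\<^esub> m) (\<alpha>\<^bsub>K\<^esub> n) \<ominus>\<^bsub>W\<^esub> \<phi> (n \<otimes>\<^bsub>K\<^esub> m) (\<alpha>\<^bsub>K\<^esub> n')"
    and exterior_form_closed: "\<lbrakk>m \<in> M; n \<in> carrier K\<rbrakk> \<Longrightarrow> \<phi> m n \<in> carrier W"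
    and exterior_form_add_right: "\<lbrakk>m \<in> M; n \<in> carrier K; n' \<in> carrier K\<rbrakk> \<Longrightarrow>
        \<phi> m (n \<oplus>\<^bsub>K\<^esub> n') = \<phi> m n \<oplus>\<^bsub>W\<^esub> \<phi> m n'"
    and exterior_form_add_left: "\<lbrakk>m \<in> M; m' \<in> M; n \<in> carrier K\<rbrakk> \<Longrightarrow>
        \<phi> (m \<oplus>\<^bsub>K\<^esub> m') n = \<phi> m n \<oplus>\<^bsub>W\<^esub> \<phi> m' n"
    and exterior_form_smult_right: "\<lbrakk>r \<in> carrier R; m \<in> M; n \<in> carrier K\<rbrakk> \<Longrightarrow>
        \<phi> m (r \<odot>\<^bsub>K\<^esub> n) = r \<odot>\<^bsub>W\<^esub> \<phi> m n"
    and exterior_form_smult_left: "\<lbrakk>r \<in> carrier R; m \<in> M; n \<in> carrier K\<rbrakk> \<Longrightarrow>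
        \<phi> (r \<odot>\<^bsub>K\<^esub> m) n = r \<odot>\<^bsub>W\<^esub> \<phi> m n"
  using assms by (auto simp: exterior_form_def lin_map_def Pi_iff)

section \<open>Consequences of the axioms of an exterior form\<close>

context
  fixes R :: "('a, 'r) ring_scheme" and K :: "('a, 'b) hom_alg" (structure) and M :: "'b set"
    and W :: "('a, 'c) hom_alg" and \<phi> :: "'b \<Rightarrow> 'b \<Rightarrow> 'c"
  assumes K: "hom_lie_algebra R K" and M: "hom_lie_ideal R M K"
    and W: "module R W" and \<phi>: "exterior_form R K M W \<phi>"
begin

interpretation K: hom_lie_algebra R K by (rule K)
interpretation W: module R W by (rule W)

text \<open>Polarisation of the vanishing of \<open>\<phi> (x + y) (x + y)\<close>; both arguments
  have to lie in \<open>M\<close>, since the diagonal condition is available only there.\<close>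

lemma exterior_form_antisym:
  assumes "x \<in> M" "y \<in> M"
  shows "\<phi> x y = \<ominus>\<^bsub>W\<^esub> \<phi> y x"
proof -
  have c: "x \<in> carrier K" "y \<in> carrier K"
    using assms hom_lie_ideal_subset[OF M] by auto
  note cl = exterior_form_closed[OF \<phi>]
  have xy: "x \<oplus> y \<in> M"
    using submodule_add[OF hom_lie_ideal_submodule[OF M]] assms by simp
  have "\<zero>\<^bsub>W\<^esub> = \<phi> (x \<oplus> y) (x \<oplus> y)"
    using exterior_form_self[OF \<phi> xy] by simp
  also have "\<dots> = \<phi> x (x \<oplus> y) \<oplus>\<^bsub>W\<^esub> \<phi> y (x \<oplus> y)"
    using assms c by (intro exterior_form_add_left[OF \<phi>]) auto
  also have "\<dots> = \<phi> x y \<oplus>\<^bsub>W\<^esub> \<phi> y x"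
    using assms c exterior_form_self[OF \<phi>] cl by (simp add: exterior_form_add_right[OF \<phi>])
  finally have "\<phi> x y \<oplus>\<^bsub>W\<^esub> \<phi> y x = \<zero>\<^bsub>W\<^esub>"
    by simp
  then show ?thesis
    using W.minus_equality[of "\<phi> x y" "\<phi> y x"] cl assms c by simp
qed

lemma exterior_form_a_inv:
  assumes "m \<in> M" "n \<in> carrier K"
  shows "\<phi> m (\<ominus> n) = \<ominus>\<^bsub>W\<^esub> \<phi> m n" "\<phi> (\<ominus> m) n = \<ominus>\<^bsub>W\<^esub> \<phi> m n"
proof -
  show "\<phi> m (\<ominus> n) = \<ominus>\<^bsub>W\<^esub> \<phi> m n"
    by (rule lin_map_a_inv[OF K.module_axioms W exterior_form_lin_right[OF \<phi> assms(1)] assms(2)])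
  have m: "m \<in> carrier K" "\<ominus> m \<in> M"
    using assms hom_lie_ideal_subset[OF M] submodule_a_inv[OF hom_lie_ideal_submodule[OF M]] by auto
  have z: "\<phi> \<zero> n = \<zero>\<^bsub>W\<^esub>"
    using lin_map_zero[OF restrict_module[OF K.module_axioms hom_lie_ideal_submodule[OF M]] W
        exterior_form_lin_left[OF \<phi> assms(2)]] by simp
  have "\<phi> (\<ominus> m) n \<oplus>\<^bsub>W\<^esub> \<phi> m n = \<phi> (\<ominus> m \<oplus> m) n"
    by (rule exterior_form_add_left[OF \<phi> m(2) assms, symmetric])
  also have "\<dots> = \<zero>\<^bsub>W\<^esub>"
    using z m by (simp add: K.l_neg)
  finally show "\<phi> (\<ominus> m) n = \<ominus>\<^bsub>W\<^esub> \<phi> m n"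
    using W.minus_equality[of "\<phi> (\<ominus> m) n" "\<phi> m n"] exterior_form_closed[OF \<phi>] m assms by simp
qed

lemma exterior_form_zero:
  "m \<in> M \<Longrightarrow> \<phi> m \<zero> = \<zero>\<^bsub>W\<^esub>" "n \<in> carrier K \<Longrightarrow> \<phi> \<zero> n = \<zero>\<^bsub>W\<^esub>"
  using lin_map_zero[OF K.module_axioms W exterior_form_lin_right[OF \<phi>]]
    lin_map_zero[OF restrict_module[OF K.module_axioms hom_lie_ideal_submodule[OF M]] W
        exterior_form_lin_left[OF \<phi>]] by auto

text \<open>Antisymmetry of \<open>\<phi>\<close> in the third term and of the bracket in the second
  reduce the sum to \<open>exterior_form_lie_left\<close>. It is used to show that the Hom-Jacobi
  relators of words vanish under a form, the entries being evaluations of words and hence elements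
  of \<open>M\<close>.\<close>

lemma exterior_form_jacobi:
  assumes "x \<in> M" "y \<in> M" "z \<in> M"
  shows "\<phi> (\<alpha> x) (y \<otimes> z) \<oplus>\<^bsub>W\<^esub> \<phi> (\<alpha> y) (z \<otimes> x) \<oplus>\<^bsub>W\<^esub> \<phi> (\<alpha> z) (x \<otimes> y) = \<zero>\<^bsub>W\<^esub>"
proof -
  have c: "x \<in> carrier K" "y \<in> carrier K" "z \<in> carrier K"
    using assms hom_lie_ideal_subset[OF M] by auto
  note t = hom_lie_ideal_twist[OF M] hom_lie_ideal_lie[OF M]
  note cl = exterior_form_closed[OF \<phi>]
  have xz: "x \<otimes> z \<in> carrier K" "y \<otimes> z \<in> carrier K"
    using c K.lie_closed by auto
  have 1: "\<phi> (\<alpha> z) (x \<otimes> y) = \<ominus>\<^bsub>W\<^esub> \<phi> (x \<otimes> y) (\<alpha> z)"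
    using assms c t by (intro exterior_form_antisym) auto
  have 2: "\<phi> (\<alpha> y) (z \<otimes> x) = \<ominus>\<^bsub>W\<^esub> \<phi> (\<alpha> y) (x \<otimes> z)"
    using K.lie_antisym[of z x] exterior_form_a_inv(1)[OF t(1) xz(1), of y] assms c by simp
  have "\<phi> (\<alpha> x) (y \<otimes> z) \<in> carrier W" "\<phi> (\<alpha> y) (x \<otimes> z) \<in> carrier W"
    using cl t assms xz by auto
  then show ?thesis
    unfolding 1 2 exterior_form_lie_left[OF \<phi> assms(1,2) c(3)]
    by (simp add: a_minus_def W.minus_add W.a_ac W.r_neg W.r_neg1 W.r_neg2)
qed

end

text \<open>The form that induces the commutator homomorphism. Its two mixed clauses are the
  Hom-Jacobi identity rearranged by antisymmetry, and the diagonal clause is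
  \<open>lie_self\<close>.\<close>

lemma exterior_form_lie:
  assumes K: "hom_lie_algebra R K" and two: "\<one>\<^bsub>R\<^esub> \<oplus>\<^bsub>R\<^esub> \<one>\<^bsub>R\<^esub> \<noteq> \<zero>\<^bsub>R\<^esub>"
    and M: "hom_lie_ideal R M K"
  shows "exterior_form R K M K (\<lambda>m n. m \<otimes>\<^bsub>K\<^esub> n)"
proof -
  interpret K: hom_lie_algebra R K by (rule K)
  have Mc: "m \<in> carrier K" if "m \<in> M" for m
    using that hom_lie_ideal_subset[OF M] by auto
  note cl = K.lie_closed K.twist_closed K.a_inv_closed
  have jac: "(m \<otimes>\<^bsub>K\<^esub> m') \<otimes>\<^bsub>K\<^esub> \<alpha>\<^bsub>K\<^esub> n
      = \<alpha>\<^bsub>K\<^esub> m \<otimes>\<^bsub>K\<^esub> (m' \<otimes>\<^bsub>K\<^esub> n) \<ominus>\<^bsub>K\<^esub> \<alpha>\<^bsub>K\<^esub> m' \<otimes>\<^bsub>K\<^esub> (m \<otimes>\<^bsub>K\<^esub> n)"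
    if c: "m \<in> carrier K" "m' \<in> carrier K" "n \<in> carrier K" for m m' n
  proof -
    let ?a = "\<alpha>\<^bsub>K\<^esub> m \<otimes>\<^bsub>K\<^esub> (m' \<otimes>\<^bsub>K\<^esub> n)" and ?b = "\<alpha>\<^bsub>K\<^esub> m' \<otimes>\<^bsub>K\<^esub> (m \<otimes>\<^bsub>K\<^esub> n)"
      and ?c = "(m \<otimes>\<^bsub>K\<^esub> m') \<otimes>\<^bsub>K\<^esub> \<alpha>\<^bsub>K\<^esub> n"
    have abc: "?a \<in> carrier K" "?b \<in> carrier K" "?c \<in> carrier K"
      using c cl by auto
    have b: "\<alpha>\<^bsub>K\<^esub> m' \<otimes>\<^bsub>K\<^esub> (n \<otimes>\<^bsub>K\<^esub> m) = \<ominus>\<^bsub>K\<^esub> ?b"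
      using c cl K.lie_antisym[of n m] K.lie_a_inv(1)[of "\<alpha>\<^bsub>K\<^esub> m'" "m \<otimes>\<^bsub>K\<^esub> n"] by simp
    have c': "\<alpha>\<^bsub>K\<^esub> n \<otimes>\<^bsub>K\<^esub> (m \<otimes>\<^bsub>K\<^esub> m') = \<ominus>\<^bsub>K\<^esub> ?c"
      using c cl by (intro K.lie_antisym) auto
    have "?a \<oplus>\<^bsub>K\<^esub> \<ominus>\<^bsub>K\<^esub> ?b \<oplus>\<^bsub>K\<^esub> \<ominus>\<^bsub>K\<^esub> ?c = \<zero>\<^bsub>K\<^esub>"
      using K.hom_jacobi[OF c] unfolding b c' .
    then have "?a \<oplus>\<^bsub>K\<^esub> \<ominus>\<^bsub>K\<^esub> ?b = ?c"
      using K.minus_equality[of "?a \<oplus>\<^bsub>K\<^esub> \<ominus>\<^bsub>K\<^esub> ?b" "\<ominus>\<^bsub>K\<^esub> ?c"] abc by simp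
    then show ?thesis
      by (simp add: a_minus_def)
  qed
  show ?thesis
    unfolding exterior_form_def
  proof (intro conjI ballI)
    fix m assume m: "m \<in> M"
    show "(\<lambda>n. m \<otimes>\<^bsub>K\<^esub> n) \<in> lin_map R K K"
      by (rule K.lie_lin_map[OF Mc[OF m]])
    show "m \<otimes>\<^bsub>K\<^esub> m = \<zero>\<^bsub>K\<^esub>"
      by (rule K.lie_self[OF two Mc[OF m]])
  next
    fix n assume n: "n \<in> carrier K"
    show "(\<lambda>m. m \<otimes>\<^bsub>K\<^esub> n) \<in> lin_map R (K\<lparr>carrier := M\<rparr>) K"
      by (rule lin_map_restrict_domain[OF K.lie_lin_map(2)[OF n]]) (auto intro: Mc)
  next
    fix m m' n assume "m \<in> M" "m' \<in> M" "n \<in> carrier K"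
    then show "(m \<otimes>\<^bsub>K\<^esub> m') \<otimes>\<^bsub>K\<^esub> \<alpha>\<^bsub>K\<^esub> n
      = \<alpha>\<^bsub>K\<^esub> m \<otimes>\<^bsub>K\<^esub> (m' \<otimes>\<^bsub>K\<^esub> n) \<ominus>\<^bsub>K\<^esub> \<alpha>\<^bsub>K\<^esub> m' \<otimes>\<^bsub>K\<^esub> (m \<otimes>\<^bsub>K\<^esub> n)"
      using Mc by (intro jac) auto
  next
    fix m n n' assume m: "m \<in> M" and n: "n \<in> carrier K" "n' \<in> carrier K"
    note m' = Mc[OF m]
    \<comment> \<open>The second mixed clause is \<open>jac\<close> for \<open>n\<close>,
      \<open>n'\<close>, \<open>m\<close> after every outer bracket has been flipped.\<close>
    have "\<alpha>\<^bsub>K\<^esub> m \<otimes>\<^bsub>K\<^esub> (n \<otimes>\<^bsub>K\<^esub> n') = \<ominus>\<^bsub>K\<^esub> ((n \<otimes>\<^bsub>K\<^esub> n') \<otimes>\<^bsub>K\<^esub> \<alpha>\<^bsub>K\<^esub> m)"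
      using m' n cl by (intro K.lie_antisym) auto
    also have "\<dots> = \<ominus>\<^bsub>K\<^esub> (\<alpha>\<^bsub>K\<^esub> n \<otimes>\<^bsub>K\<^esub> (n' \<otimes>\<^bsub>K\<^esub> m) \<ominus>\<^bsub>K\<^esub> \<alpha>\<^bsub>K\<^esub> n' \<otimes>\<^bsub>K\<^esub> (n \<otimes>\<^bsub>K\<^esub> m))"
      using jac[OF n m'] by simp
    also have "\<dots> = \<ominus>\<^bsub>K\<^esub> (\<alpha>\<^bsub>K\<^esub> n \<otimes>\<^bsub>K\<^esub> (n' \<otimes>\<^bsub>K\<^esub> m)) \<ominus>\<^bsub>K\<^esub> \<ominus>\<^bsub>K\<^esub> (\<alpha>\<^bsub>K\<^esub> n' \<otimes>\<^bsub>K\<^esub> (n \<otimes>\<^bsub>K\<^esub> m))"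
      using m' n cl by (simp add: a_minus_def K.minus_add)
    also have "\<dots> = (n' \<otimes>\<^bsub>K\<^esub> m) \<otimes>\<^bsub>K\<^esub> \<alpha>\<^bsub>K\<^esub> n \<ominus>\<^bsub>K\<^esub> (n \<otimes>\<^bsub>K\<^esub> m) \<otimes>\<^bsub>K\<^esub> \<alpha>\<^bsub>K\<^esub> n'"
      using m' n cl K.lie_antisym[of "n' \<otimes>\<^bsub>K\<^esub> m" "\<alpha>\<^bsub>K\<^esub> n"] K.lie_antisym[of "n \<otimes>\<^bsub>K\<^esub> m" "\<alpha>\<^bsub>K\<^esub> n'"]
      by simp
    finally show "\<alpha>\<^bsub>K\<^esub> m \<otimes>\<^bsub>K\<^esub> (n \<otimes>\<^bsub>K\<^esub> n')
      = (n' \<otimes>\<^bsub>K\<^esub> m) \<otimes>\<^bsub>K\<^esub> \<alpha>\<^bsub>K\<^esub> n \<ominus>\<^bsub>K\<^esub> (n \<otimes>\<^bsub>K\<^esub> m) \<otimes>\<^bsub>K\<^esub> \<alpha>\<^bsub>K\<^esub> n'" .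
  qed
qed

lemma exterior_form_comp:
  assumes W: "module R W" and W': "module R W'"
    and \<phi>: "exterior_form R K M W \<phi>" and f: "f \<in> lin_map R W W'"
    and K: "hom_lie_algebra R K" and M: "hom_lie_ideal R M K"
  shows "exterior_form R K M W' (\<lambda>m n. f (\<phi> m n))"
  unfolding exterior_form_def
proof (intro conjI ballI)
  interpret K: hom_lie_algebra R K by (rule K)
  note cl = hom_lie_ideal_subset[OF M] hom_lie_ideal_twist[OF M] hom_lie_ideal_lie[OF M]
    hom_lie_ideal_lie'[OF K M] K.lie_closed K.twist_closed exterior_form_closed[OF \<phi>]
  fix m assume m: "m \<in> M"
  show "(\<lambda>n. f (\<phi> m n)) \<in> lin_map R K W'"
    by (rule lin_map_comp[OF exterior_form_lin_right[OF \<phi> m] f])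
  show "f (\<phi> m m) = \<zero>\<^bsub>W'\<^esub>"
    unfolding exterior_form_self[OF \<phi> m] by (rule lin_map_zero[OF W W' f])
  fix n assume n: "n \<in> carrier K"
  { fix m' assume m': "m' \<in> M"
    show "f (\<phi> (m \<otimes>\<^bsub>K\<^esub> m') (\<alpha>\<^bsub>K\<^esub> n))
        = f (\<phi> (\<alpha>\<^bsub>K\<^esub> m) (m' \<otimes>\<^bsub>K\<^esub> n)) \<ominus>\<^bsub>W'\<^esub> f (\<phi> (\<alpha>\<^bsub>K\<^esub> m') (m \<otimes>\<^bsub>K\<^esub> n))"
      unfolding exterior_form_lie_left[OF \<phi> m m' n]
      using m m' n cl by (intro lin_map_minus[OF W W' f]) auto }
  fix n' assume n': "n' \<in> carrier K"
  show "f (\<phi> (\<alpha>\<^bsub>K\<^esub> m) (n \<otimes>\<^bsub>K\<^esub> n'))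
      = f (\<phi> (n' \<otimes>\<^bsub>K\<^esub> m) (\<alpha>\<^bsub>K\<^esub> n)) \<ominus>\<^bsub>W'\<^esub> f (\<phi> (n \<otimes>\<^bsub>K\<^esub> m) (\<alpha>\<^bsub>K\<^esub> n'))"
    unfolding exterior_form_lie_right[OF \<phi> m n n']
    using m n n' cl by (intro lin_map_minus[OF W W' f]) auto
next
  fix n assume n: "n \<in> carrier K"
  show "(\<lambda>m. f (\<phi> m n)) \<in> lin_map R (K\<lparr>carrier := M\<rparr>) W'"
    by (rule lin_map_comp[OF exterior_form_lin_left[OF \<phi> n] f])
qed

lemma exterior_form_pullback:
  assumes K: "hom_lie_algebra R K" and M: "hom_lie_ideal R M K"
    and \<phi>: "exterior_form R K' M' W \<phi>" and f: "f \<in> hom_lie_hom R K K'"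
    and fM: "\<And>m. m \<in> M \<Longrightarrow> f m \<in> M'"
  shows "exterior_form R K M W (\<lambda>m n. \<phi> (f m) (f n))"
  unfolding exterior_form_def
proof (intro conjI ballI)
  interpret K: hom_lie_algebra R K by (rule K)
  note Mc = hom_lie_ideal_subset[OF M]
  note fs = hom_lie_hom_lie[OF f] hom_lie_hom_twist[OF f]
  fix m assume m: "m \<in> M"
  show "(\<lambda>n. \<phi> (f m) (f n)) \<in> lin_map R K W"
    by (rule lin_map_comp[OF hom_lie_hom_lin[OF f] exterior_form_lin_right[OF \<phi> fM[OF m]]])
  show "\<phi> (f m) (f m) = \<zero>\<^bsub>W\<^esub>"
    by (rule exterior_form_self[OF \<phi> fM[OF m]])
  fix n assume n: "n \<in> carrier K"
  { fix m' assume m': "m' \<in> M"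
    show "\<phi> (f (m \<otimes>\<^bsub>K\<^esub> m')) (f (\<alpha>\<^bsub>K\<^esub> n)) = \<phi> (f (\<alpha>\<^bsub>K\<^esub> m)) (f (m' \<otimes>\<^bsub>K\<^esub> n)) \<ominus>\<^bsub>W\<^esub>
        \<phi> (f (\<alpha>\<^bsub>K\<^esub> m')) (f (m \<otimes>\<^bsub>K\<^esub> n))"
      unfolding fs(1)[OF Mc[OF m] Mc[OF m']] fs(1)[OF Mc[OF m] n] fs(1)[OF Mc[OF m'] n]
        fs(2)[OF n] fs(2)[OF Mc[OF m]] fs(2)[OF Mc[OF m']]
      by (rule exterior_form_lie_left[OF \<phi> fM[OF m] fM[OF m'] hom_lie_hom_closed[OF f n]]) }
  fix n' assume n': "n' \<in> carrier K"
  show "\<phi> (f (\<alpha>\<^bsub>K\<^esub> m)) (f (n \<otimes>\<^bsub>K\<^esub> n')) = \<phi> (f (n' \<otimes>\<^bsub>K\<^esub> m)) (f (\<alpha>\<^bsub>K\<^esub> n)) \<ominus>\<^bsub>W\<^esub>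
      \<phi> (f (n \<otimes>\<^bsub>K\<^esub> m)) (f (\<alpha>\<^bsub>K\<^esub> n'))"
    unfolding fs(1)[OF n n'] fs(1)[OF n Mc[OF m]] fs(1)[OF n' Mc[OF m]]
      fs(2)[OF n] fs(2)[OF Mc[OF m]] fs(2)[OF n']
    by (rule exterior_form_lie_right[OF \<phi> fM[OF m] hom_lie_hom_closed[OF f n]
          hom_lie_hom_closed[OF f n']])
next
  have fM': "f \<in> lin_map R (K\<lparr>carrier := M\<rparr>) (K'\<lparr>carrier := M'\<rparr>)"
    using hom_lie_homD[OF f] fM hom_lie_ideal_subset[OF M] by (auto intro!: lin_mapI)
  fix n assume n: "n \<in> carrier K"
  show "(\<lambda>m. \<phi> (f m) (f n)) \<in> lin_map R (K\<lparr>carrier := M\<rparr>) W"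
    by (rule lin_map_comp[OF fM' exterior_form_lin_left[OF \<phi> hom_lie_hom_closed[OF f n]]])
qed

section \<open>The exterior product of an ideal with the algebra\<close>

lemma ideal_generated_minimal:
  assumes "B \<subseteq> J" "submodule J R A"
    and "\<And>a x. \<lbrakk>a \<in> carrier A; x \<in> J\<rbrakk> \<Longrightarrow> a \<otimes>\<^bsub>A\<^esub> x \<in> J"
    and "\<And>a x. \<lbrakk>a \<in> carrier A; x \<in> J\<rbrakk> \<Longrightarrow> x \<otimes>\<^bsub>A\<^esub> a \<in> J"
  shows "ideal_generated R A B \<subseteq> J"
  unfolding ideal_generated_def using assms by (intro hull_minimal) auto

lemma ideal_generated_superset: "B \<subseteq> ideal_generated R A B"
  unfolding ideal_generated_def by (rule hull_subset)

lemma ideal_generated_ideal: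
  assumes A: "module R A" and B: "B \<subseteq> carrier A"
    and cl: "\<And>x y. \<lbrakk>x \<in> carrier A; y \<in> carrier A\<rbrakk> \<Longrightarrow> x \<otimes>\<^bsub>A\<^esub> y \<in> carrier A"
  shows "submodule (ideal_generated R A B) R A"
    and "\<lbrakk>a \<in> carrier A; x \<in> ideal_generated R A B\<rbrakk> \<Longrightarrow> a \<otimes>\<^bsub>A\<^esub> x \<in> ideal_generated R A B"
    and "\<lbrakk>a \<in> carrier A; x \<in> ideal_generated R A B\<rbrakk> \<Longrightarrow> x \<otimes>\<^bsub>A\<^esub> a \<in> ideal_generated R A B"
proof -
  interpret A: module R A by fact
  show "submodule (ideal_generated R A B) R A"
  proof (rule submodule_intro[OF A])
    show "ideal_generated R A B \<subseteq> carrier A"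
      by (rule ideal_generated_minimal[OF B A.carrier_is_submodule cl cl])
  qed (auto simp: ideal_generated_def hull_def intro: submoduleD)
qed (auto simp: ideal_generated_def hull_def)

text \<open>In the tensor product \<open>(m \<star> n) (m' \<star> n') = - [n, m] \<star> [m', n'] =
  [m, n] \<star> [m', n']\<close>, so a linear map that takes the value \<open>\<phi> m n\<close> at
  \<open>m \<star> n\<close> must take on a composite word the value of \<open>\<phi>\<close> at the
  commutators of its two factors. For \<open>\<phi>\<close> the bracket this is
  \<open>eval_commutator\<close>.\<close>

primrec word_form ::
  "('a, 'b) hom_alg \<Rightarrow> ('b \<Rightarrow> 'b \<Rightarrow> 'c) \<Rightarrow> ('b \<times> 'b) magma \<Rightarrow> 'c" where
  "word_form K \<phi> (Gen x) = \<phi> (fst x) (snd x)"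
| "word_form K \<phi> (Mul s t) = \<phi> (eval_commutator K s) (eval_commutator K t)"

section \<open>Words over pairs, their evaluation by brackets, and the tensor ideal\<close>

context
  fixes R :: "('a, 'r) ring_scheme" and K :: "('a, 'b) hom_alg" (structure) and M :: "'b set"
  assumes K: "hom_lie_algebra R K" and two: "\<one>\<^bsub>R\<^esub> \<oplus>\<^bsub>R\<^esub> \<one>\<^bsub>R\<^esub> \<noteq> \<zero>\<^bsub>R\<^esub>"
    and M: "hom_lie_ideal R M K"
begin

interpretation K: hom_lie_algebra R K by (rule K)

private abbreviation (input) tensor_words :: "('a, ('b \<times> 'b) magma \<Rightarrow> 'a) hom_alg" where
  "tensor_words \<equiv> free_nonassoc R (M \<times> carrier K) (map_prod (twist K) (twist K))"

private abbreviation (input) gen :: "'b \<Rightarrow> 'b \<Rightarrow> ('b \<times> 'b) magma \<Rightarrow> 'a" where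
  "gen m n \<equiv> single R (Gen (m, n))"

private abbreviation (input) ev :: "(('b \<times> 'b) magma \<Rightarrow> 'a) \<Rightarrow> 'b" where
  "ev \<equiv> lin_ext R K (eval_commutator K)"

private abbreviation (input) TI :: "(('b \<times> 'b) magma \<Rightarrow> 'a) set" where
  "TI \<equiv> tensor_ideal R K M (carrier K)"

lemma twist_pair_funcset: "map_prod (twist K) (twist K) \<in> M \<times> carrier K \<rightarrow> M \<times> carrier K"
  using hom_lie_ideal_twist[OF M] K.twist_closed by auto

lemma tensor_words_vec: "hom_vector_space R tensor_words"
  by (rule hom_vector_space_free_nonassoc[OF K.field_axioms twist_pair_funcset])

interpretation A: module R tensor_words
  by (rule hom_vector_space_module[OF tensor_words_vec])

lemmas tw_module = A.module_axioms
lemmas tw_mult_closed = free_nonassoc_mult_closed[OF K.field_axioms,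
    where X = "M \<times> carrier K" and a = "map_prod (twist K) (twist K)"]

lemma gen_closed [intro, simp]: "\<lbrakk>m \<in> M; n \<in> carrier K\<rbrakk> \<Longrightarrow> gen m n \<in> carrier tensor_words"
  by (intro single_word_closed[OF K.field_axioms]) auto

text \<open>The ideal property gives a value in \<open>M\<close>, not only in \<open>K\<close>; this
  is what admits evaluated words as left arguments of a form.\<close>

lemma eval_commutator_closed: "set_magma t \<subseteq> M \<times> carrier K \<Longrightarrow> eval_commutator K t \<in> M"
proof (induction t)
  case (Gen x)
  then show ?case
    using hom_lie_ideal_lie[OF M] by auto
next
  case (Mul s t)
  then show ?case
    using hom_lie_ideal_lie[OF M] hom_lie_ideal_subset[OF M] by auto
qed

lemma eval_commutator_funcset:
  "eval_commutator K \<in> {t. set_magma t \<subseteq> M \<times> carrier K} \<rightarrow> carrier K"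
  using eval_commutator_closed hom_lie_ideal_subset[OF M] by auto

lemma ev_single: "set_magma t \<subseteq> M \<times> carrier K \<Longrightarrow> ev (single R t) = eval_commutator K t"
  by (rule lin_ext_single[OF K.field_axioms K.module_axioms eval_commutator_funcset]) auto

lemma ev_lin_map: "ev \<in> lin_map R tensor_words K"
  using lin_ext_lin_map[OF K.field_axioms K.module_axioms eval_commutator_funcset]
  by (simp add: lin_map_free_nonassoc[OF K.field_axioms])

lemma ev_lin_map': "ev \<in> lin_map R tensor_words (K\<lparr>carrier := M\<rparr>)"
  by (rule lin_map_restrict[OF tw_module K.module_axioms ev_lin_map lin_span_words[OF K.field_axioms]
        hom_lie_ideal_submodule[OF M]])
    (auto simp: ev_single eval_commutator_closed)

lemma ev_closed: "f \<in> carrier tensor_words \<Longrightarrow> ev f \<in> M"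
  using lin_map_closed[OF ev_lin_map'] by simp

lemma ev_mult:
  assumes "f \<in> carrier tensor_words" "g \<in> carrier tensor_words"
  shows "ev (f \<otimes>\<^bsub>tensor_words\<^esub> g) = ev f \<otimes> ev g"
  by (rule free_nonassoc_mult_transfer[OF K.field_axioms K.module_axioms K.module_axioms
        K.module_axioms ev_lin_map ev_lin_map ev_lin_map _ _ _ assms])
    (auto intro: K.lie_lin_map simp: ev_single)

lemma ev_twist:
  assumes "f \<in> carrier tensor_words"
  shows "ev (\<alpha>\<^bsub>tensor_words\<^esub> f) = \<alpha> (ev f)"
proof (rule lin_span_eq_on[OF tw_module K.module_axioms
      lin_map_comp[OF twist_lin_map[OF tensor_words_vec] ev_lin_map]
      lin_map_comp[OF ev_lin_map twist_lin_map[OF K.hom_vector_space_axioms]]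
      lin_span_words[OF K.field_axioms] _ assms])
  fix f assume "f \<in> single R ` {t. set_magma t \<subseteq> M \<times> carrier K}"
  then obtain t where t: "set_magma t \<subseteq> M \<times> carrier K" "f = single R t"
    by auto
  have "set_magma (map_magma (map_prod (twist K) (twist K)) t) \<subseteq> M \<times> carrier K"
    using map_magma_funcset[OF K.field_axioms twist_pair_funcset] t by auto
  moreover have "eval_commutator K (map_magma (map_prod (twist K) (twist K)) t)
      = \<alpha> (eval_commutator K t)"
    using t(1)
  proof (induction t)
    case (Mul s t)
    then show ?case
      using eval_commutator_closed hom_lie_ideal_subset[OF M] by (auto simp: K.twist_lie)
  qed (use hom_lie_ideal_subset[OF M] K.twist_lie in auto)
  ultimately show "ev (\<alpha>\<^bsub>tensor_words\<^esub> f) = \<alpha> (ev f)"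
    using t by (simp add: free_nonassoc_twist[OF K.field_axioms] ev_single
        push_magma_single[OF K.field_axioms twist_pair_funcset])
qed

text \<open>The cases follow the order of the union in \<open>tensor_relators\<close>: additivity in
  either argument, homogeneity in either argument, the two mixed relations, and the product of
  generators. \<open>tensor_relatorsI\<close> lists the introduction rules in the same order, and
  later proofs refer to these positions.\<close>

lemma tensor_relators_cases:
  assumes "x \<in> tensor_relators R K M (carrier K)"
  obtains m m' n where "m \<in> M" "m' \<in> M" "n \<in> carrier K"
      "x = gen (m \<oplus> m') n \<ominus>\<^bsub>tensor_words\<^esub> (gen m n \<oplus>\<^bsub>tensor_words\<^esub> gen m' n)"
  | m n n' where "m \<in> M" "n \<in> carrier K" "n' \<in> carrier K"
      "x = gen m (n \<oplus> n') \<ominus>\<^bsub>tensor_words\<^esub> (gen m n \<oplus>\<^bsub>tensor_words\<^esub> gen m n')"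
  | r m n where "r \<in> carrier R" "m \<in> M" "n \<in> carrier K"
      "x = gen (r \<odot> m) n \<ominus>\<^bsub>tensor_words\<^esub> r \<odot>\<^bsub>tensor_words\<^esub> gen m n"
  | r m n where "r \<in> carrier R" "m \<in> M" "n \<in> carrier K"
      "x = gen m (r \<odot> n) \<ominus>\<^bsub>tensor_words\<^esub> r \<odot>\<^bsub>tensor_words\<^esub> gen m n"
  | m m' n where "m \<in> M" "m' \<in> M" "n \<in> carrier K"
      "x = gen (m \<otimes> m') (\<alpha> n) \<ominus>\<^bsub>tensor_words\<^esub>
         (gen (\<alpha> m) (m' \<otimes> n) \<ominus>\<^bsub>tensor_words\<^esub> gen (\<alpha> m') (m \<otimes> n))"
  | m n n' where "m \<in> M" "n \<in> carrier K" "n' \<in> carrier K"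
      "x = gen (\<alpha> m) (n \<otimes> n') \<ominus>\<^bsub>tensor_words\<^esub>
         (gen (n' \<otimes> m) (\<alpha> n) \<ominus>\<^bsub>tensor_words\<^esub> gen (n \<otimes> m) (\<alpha> n'))"
  | m n m' n' where "m \<in> M" "n \<in> carrier K" "m' \<in> M" "n' \<in> carrier K"
      "x = gen m n \<otimes>\<^bsub>tensor_words\<^esub> gen m' n'
         \<ominus>\<^bsub>tensor_words\<^esub> (\<ominus>\<^bsub>tensor_words\<^esub> gen (n \<otimes> m) (m' \<otimes> n'))"
  using assms unfolding tensor_relators_def Let_def Un_iff mem_Collect_eq
  apply (elim disjE exE conjE)
  subgoal by (rule that(1))
  subgoal by (rule that(2))
  subgoal by (rule that(3))
  subgoal by (rule that(4))
  subgoal by (rule that(5))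
  subgoal by (rule that(6))
  subgoal by (rule that(7))
  done

lemma tensor_relatorsI:
  "\<lbrakk>m \<in> M; m' \<in> M; n \<in> carrier K\<rbrakk> \<Longrightarrow>
    gen (m \<oplus> m') n \<ominus>\<^bsub>tensor_words\<^esub> (gen m n \<oplus>\<^bsub>tensor_words\<^esub> gen m' n) \<in> tensor_relators R K M (carrier K)"
  "\<lbrakk>m \<in> M; n \<in> carrier K; n' \<in> carrier K\<rbrakk> \<Longrightarrow>
    gen m (n \<oplus> n') \<ominus>\<^bsub>tensor_words\<^esub> (gen m n \<oplus>\<^bsub>tensor_words\<^esub> gen m n') \<in> tensor_relators R K M (carrier K)"
  "\<lbrakk>r \<in> carrier R; m \<in> M; n \<in> carrier K\<rbrakk> \<Longrightarrow>
    gen (r \<odot> m) n \<ominus>\<^bsub>tensor_words\<^esub> r \<odot>\<^bsub>tensor_words\<^esub> gen m n \<in> tensor_relators R K M (carrier K)"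
  "\<lbrakk>r \<in> carrier R; m \<in> M; n \<in> carrier K\<rbrakk> \<Longrightarrow>
    gen m (r \<odot> n) \<ominus>\<^bsub>tensor_words\<^esub> r \<odot>\<^bsub>tensor_words\<^esub> gen m n \<in> tensor_relators R K M (carrier K)"
  "\<lbrakk>m \<in> M; m' \<in> M; n \<in> carrier K\<rbrakk> \<Longrightarrow>
    gen (m \<otimes> m') (\<alpha> n) \<ominus>\<^bsub>tensor_words\<^esub>
      (gen (\<alpha> m) (m' \<otimes> n) \<ominus>\<^bsub>tensor_words\<^esub> gen (\<alpha> m') (m \<otimes> n)) \<in> tensor_relators R K M (carrier K)"
  "\<lbrakk>m \<in> M; n \<in> carrier K; n' \<in> carrier K\<rbrakk> \<Longrightarrow>
    gen (\<alpha> m) (n \<otimes> n') \<ominus>\<^bsub>tensor_words\<^esub>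
      (gen (n' \<otimes> m) (\<alpha> n) \<ominus>\<^bsub>tensor_words\<^esub> gen (n \<otimes> m) (\<alpha> n')) \<in> tensor_relators R K M (carrier K)"
  "\<lbrakk>m \<in> M; n \<in> carrier K; m' \<in> M; n' \<in> carrier K\<rbrakk> \<Longrightarrow>
    gen m n \<otimes>\<^bsub>tensor_words\<^esub> gen m' n'
      \<ominus>\<^bsub>tensor_words\<^esub> (\<ominus>\<^bsub>tensor_words\<^esub> gen (n \<otimes> m) (m' \<otimes> n')) \<in> tensor_relators R K M (carrier K)"
  unfolding tensor_relators_def Let_def
  subgoal by (rule UnI1, rule UnI1, rule UnI1, rule UnI1, rule UnI1, rule UnI1, rule CollectI, intro exI conjI, rule refl, assumption+)
  subgoal by (rule UnI1, rule UnI1, rule UnI1, rule UnI1, rule UnI1, rule UnI2, rule CollectI, intro exI conjI, rule refl, assumption+)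
  subgoal by (rule UnI1, rule UnI1, rule UnI1, rule UnI1, rule UnI2, rule CollectI, intro exI conjI, rule refl, assumption+)
  subgoal by (rule UnI1, rule UnI1, rule UnI1, rule UnI2, rule CollectI, intro exI conjI, rule refl, assumption+)
  subgoal by (rule UnI1, rule UnI1, rule UnI2, rule CollectI, intro exI conjI, rule refl, assumption+)
  subgoal by (rule UnI1, rule UnI2, rule CollectI, intro exI conjI, rule refl, assumption+)
  subgoal by (rule UnI2, rule CollectI, intro exI conjI, rule refl, assumption+)
  done

lemma ideal_closed:
  "m \<in> M \<Longrightarrow> m \<in> carrier K"
  "\<lbrakk>m \<in> M; m' \<in> M\<rbrakk> \<Longrightarrow> m \<oplus> m' \<in> M"
  "\<lbrakk>r \<in> carrier R; m \<in> M\<rbrakk> \<Longrightarrow> r \<odot> m \<in> M"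
  "m \<in> M \<Longrightarrow> \<ominus> m \<in> M"
  "\<zero> \<in> M"
  "m \<in> M \<Longrightarrow> \<alpha> m \<in> M"
  "\<lbrakk>m \<in> M; n \<in> carrier K\<rbrakk> \<Longrightarrow> m \<otimes> n \<in> M"
  "\<lbrakk>m \<in> M; n \<in> carrier K\<rbrakk> \<Longrightarrow> n \<otimes> m \<in> M"
  "n \<in> carrier K \<Longrightarrow> \<alpha> n \<in> carrier K"
  "\<lbrakk>n \<in> carrier K; n' \<in> carrier K\<rbrakk> \<Longrightarrow> n \<otimes> n' \<in> carrier K"
  using hom_lie_idealD[OF M] hom_lie_ideal_lie'[OF K M] K.twist_closed K.lie_closed
    submoduleD[OF hom_lie_ideal_submodule[OF M]] by auto

lemma tensor_relators_closed:
  assumes "x \<in> hom_lie_relators tensor_words \<union> tensor_relators R K M (carrier K)"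
  shows "x \<in> carrier tensor_words"
  using assms
proof
  note tw = hom_vector_space.twist_closed[OF tensor_words_vec]
  show "x \<in> carrier tensor_words" if "x \<in> hom_lie_relators tensor_words"
    using that unfolding hom_lie_relators_def by (auto intro!: tw_mult_closed tw)
  show "x \<in> carrier tensor_words" if "x \<in> tensor_relators R K M (carrier K)"
    using that
    by (cases rule: tensor_relators_cases)
      (simp_all add: tw_mult_closed ideal_closed)
qed

lemma tensor_ideal_ideal:
  shows "submodule TI R tensor_words"
    and "\<lbrakk>a \<in> carrier tensor_words; x \<in> TI\<rbrakk> \<Longrightarrow> a \<otimes>\<^bsub>tensor_words\<^esub> x \<in> TI"
    and "\<lbrakk>a \<in> carrier tensor_words; x \<in> TI\<rbrakk> \<Longrightarrow> x \<otimes>\<^bsub>tensor_words\<^esub> a \<in> TI"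
    and "x \<in> hom_lie_relators tensor_words \<Longrightarrow> x \<in> TI"
    and "x \<in> tensor_relators R K M (carrier K) \<Longrightarrow> x \<in> TI"
proof -
  let ?B = "hom_lie_relators tensor_words \<union> tensor_relators R K M (carrier K)"
  have TI: "TI = ideal_generated R tensor_words ?B"
    by (simp add: tensor_ideal_def presentation_ideal_def)
  have B: "?B \<subseteq> carrier tensor_words"
    by (rule subsetI) (rule tensor_relators_closed)
  note I = ideal_generated_ideal[OF tw_module B]
  show "submodule TI R tensor_words"
    unfolding TI by (rule I(1)) (rule tw_mult_closed)
  show "a \<otimes>\<^bsub>tensor_words\<^esub> x \<in> TI" if "a \<in> carrier tensor_words" "x \<in> TI"
    using that unfolding TI by (intro I(2) tw_mult_closed)
  show "x \<otimes>\<^bsub>tensor_words\<^esub> a \<in> TI" if "a \<in> carrier tensor_words" "x \<in> TI"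
    using that unfolding TI by (intro I(3) tw_mult_closed)
  show "x \<in> TI" if "x \<in> hom_lie_relators tensor_words"
    unfolding TI by (rule subsetD[OF ideal_generated_superset UnI1[OF that]])
  show "x \<in> TI" if "x \<in> tensor_relators R K M (carrier K)"
    unfolding TI by (rule subsetD[OF ideal_generated_superset UnI2[OF that]])
qed

text \<open>\<open>T\<close> is kept abstract because the argument is used twice: for the extension
  of \<open>\<phi>\<close> to words, and for the evaluation map itself, which is the extension of
  the bracket. The Hom-Lie relators vanish by antisymmetry and the Jacobi identity of the form at
  evaluated words; each linear tensor relator is one clause of the form.\<close>

lemma relators_vanish:
  assumes W: "module R W" and \<phi>: "exterior_form R K M W \<phi>" and T: "T \<in> lin_map R tensor_words W"
    and T_gen: "\<And>m n. \<lbrakk>m \<in> M; n \<in> carrier K\<rbrakk> \<Longrightarrow> T (gen m n) = \<phi> m n"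
    and T_mult: "\<And>f g. \<lbrakk>f \<in> carrier tensor_words; g \<in> carrier tensor_words\<rbrakk> \<Longrightarrow>
      T (f \<otimes>\<^bsub>tensor_words\<^esub> g) = \<phi> (ev f) (ev g)"
    and x: "x \<in> hom_lie_relators tensor_words \<union> tensor_relators R K M (carrier K)"
  shows "T x = \<zero>\<^bsub>W\<^esub>"
  using x
proof
  interpret W: module R W by fact
  note tw = hom_vector_space.twist_closed[OF tensor_words_vec]
  note Tadd = lin_map_add[OF T] and Tsmult = lin_map_smult[OF T]
    and Tminus = lin_map_minus[OF tw_module W T] and Tinv = lin_map_a_inv[OF tw_module W T]
  note \<phi>_closed = exterior_form_closed[OF \<phi>]
  assume x: "x \<in> hom_lie_relators tensor_words"
  show "T x = \<zero>\<^bsub>W\<^esub>"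
    using x unfolding hom_lie_relators_def Un_iff mem_Collect_eq
  proof (elim disjE exE conjE)
    fix a b assume x: "x = a \<otimes>\<^bsub>tensor_words\<^esub> b \<oplus>\<^bsub>tensor_words\<^esub> b \<otimes>\<^bsub>tensor_words\<^esub> a"
      and ab: "a \<in> carrier tensor_words" "b \<in> carrier tensor_words"
    have e: "ev a \<in> M" "ev b \<in> M"
      using ab by (auto intro: ev_closed)
    have "T x = \<phi> (ev a) (ev b) \<oplus>\<^bsub>W\<^esub> \<phi> (ev b) (ev a)"
      unfolding x using ab tw_mult_closed by (simp add: Tadd T_mult)
    also have "\<phi> (ev b) (ev a) = \<ominus>\<^bsub>W\<^esub> \<phi> (ev a) (ev b)"
      by (rule exterior_form_antisym[OF K M W \<phi> e(2,1)])
    finally show "T x = \<zero>\<^bsub>W\<^esub>"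
      using \<phi>_closed e ideal_closed(1) by (simp add: W.r_neg)
  next
    fix a b c assume x: "x = \<alpha>\<^bsub>tensor_words\<^esub> a \<otimes>\<^bsub>tensor_words\<^esub> (b \<otimes>\<^bsub>tensor_words\<^esub> c)
        \<oplus>\<^bsub>tensor_words\<^esub> \<alpha>\<^bsub>tensor_words\<^esub> b \<otimes>\<^bsub>tensor_words\<^esub> (c \<otimes>\<^bsub>tensor_words\<^esub> a)
        \<oplus>\<^bsub>tensor_words\<^esub> \<alpha>\<^bsub>tensor_words\<^esub> c \<otimes>\<^bsub>tensor_words\<^esub> (a \<otimes>\<^bsub>tensor_words\<^esub> b)"
      and abc: "a \<in> carrier tensor_words" "b \<in> carrier tensor_words" "c \<in> carrier tensor_words"
    have "ev a \<in> M" "ev b \<in> M" "ev c \<in> M"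
      using abc by (auto intro: ev_closed)
    then have "\<phi> (\<alpha> (ev a)) (ev b \<otimes> ev c) \<oplus>\<^bsub>W\<^esub> \<phi> (\<alpha> (ev b)) (ev c \<otimes> ev a)
        \<oplus>\<^bsub>W\<^esub> \<phi> (\<alpha> (ev c)) (ev a \<otimes> ev b) = \<zero>\<^bsub>W\<^esub>"
      by (rule exterior_form_jacobi[OF K M W \<phi>])
    then show "T x = \<zero>\<^bsub>W\<^esub>"
      unfolding x using abc tw_mult_closed tw by (simp add: Tadd T_mult ev_mult ev_twist)
  qed
next
  interpret W: module R W by fact
  note Tadd = lin_map_add[OF T] and Tsmult = lin_map_smult[OF T]
    and Tminus = lin_map_minus[OF tw_module W T] and Tinv = lin_map_a_inv[OF tw_module W T]
  note \<phi>_closed = exterior_form_closed[OF \<phi>]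
  have zero: "u \<ominus>\<^bsub>W\<^esub> v = \<zero>\<^bsub>W\<^esub>" if "u = v" "v \<in> carrier W" for u v
    using that by (simp add: a_minus_def W.r_neg)
  note c = ideal_closed
  assume "x \<in> tensor_relators R K M (carrier K)"
  then show "T x = \<zero>\<^bsub>W\<^esub>"
  proof (cases rule: tensor_relators_cases)
    case (1 m m' n)
    then show ?thesis
      using c by (simp add: Tminus Tadd T_gen \<phi>_closed exterior_form_add_left[OF \<phi>] zero)
  next
    case (2 m n n')
    then show ?thesis
      using c by (simp add: Tminus Tadd T_gen \<phi>_closed exterior_form_add_right[OF \<phi>] zero)
  next
    case (3 r m n)
    then show ?thesis
      using c by (simp add: Tminus Tsmult T_gen \<phi>_closed exterior_form_smult_left[OF \<phi>] zero)
  next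
    case (4 r m n)
    then show ?thesis
      using c by (simp add: Tminus Tsmult T_gen \<phi>_closed exterior_form_smult_right[OF \<phi>] zero)
  next
    case (5 m m' n)
    have "T x = T (gen (m \<otimes> m') (\<alpha> n)) \<ominus>\<^bsub>W\<^esub> (T (gen (\<alpha> m) (m' \<otimes> n)) \<ominus>\<^bsub>W\<^esub> T (gen (\<alpha> m') (m \<otimes> n)))"
      using 5 c by (simp add: Tminus)
    also have "\<dots> = \<phi> (m \<otimes> m') (\<alpha> n) \<ominus>\<^bsub>W\<^esub> (\<phi> (\<alpha> m) (m' \<otimes> n) \<ominus>\<^bsub>W\<^esub> \<phi> (\<alpha> m') (m \<otimes> n))"
      using 5 c by (simp add: T_gen)
    also have "\<dots> = \<zero>\<^bsub>W\<^esub>"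
      using 5 c by (intro zero exterior_form_lie_left[OF \<phi>] W.minus_closed \<phi>_closed) auto
    finally show ?thesis .
  next
    case (6 m n n')
    have "T x = T (gen (\<alpha> m) (n \<otimes> n')) \<ominus>\<^bsub>W\<^esub> (T (gen (n' \<otimes> m) (\<alpha> n)) \<ominus>\<^bsub>W\<^esub> T (gen (n \<otimes> m) (\<alpha> n')))"
      using 6 c by (simp add: Tminus)
    also have "\<dots> = \<phi> (\<alpha> m) (n \<otimes> n') \<ominus>\<^bsub>W\<^esub> (\<phi> (n' \<otimes> m) (\<alpha> n) \<ominus>\<^bsub>W\<^esub> \<phi> (n \<otimes> m) (\<alpha> n'))"
      using 6 c by (simp add: T_gen)
    also have "\<dots> = \<zero>\<^bsub>W\<^esub>"
      using 6 c by (intro zero exterior_form_lie_right[OF \<phi>] W.minus_closed \<phi>_closed) auto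
    finally show ?thesis .
  next
    case (7 m n m' n')
    \<comment> \<open>The product relator vanishes because the minus sign in it turns
      \<open>[n, m]\<close> into \<open>[m, n]\<close>, the evaluation of the first
      generator.\<close>
    have e: "ev (gen m n) = m \<otimes> n" "ev (gen m' n') = m' \<otimes> n'"
      using 7 by (auto simp: ev_single)
    have "T x = T (gen m n \<otimes>\<^bsub>tensor_words\<^esub> gen m' n') \<ominus>\<^bsub>W\<^esub> (\<ominus>\<^bsub>W\<^esub> T (gen (n \<otimes> m) (m' \<otimes> n')))"
      using 7 c tw_mult_closed by (simp add: Tminus Tinv)
    also have "\<dots> = \<phi> (m \<otimes> n) (m' \<otimes> n') \<ominus>\<^bsub>W\<^esub> (\<ominus>\<^bsub>W\<^esub> \<phi> (n \<otimes> m) (m' \<otimes> n'))"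
      using 7 c by (simp add: T_gen T_mult e)
    also have "\<ominus>\<^bsub>W\<^esub> \<phi> (n \<otimes> m) (m' \<otimes> n') = \<phi> (\<ominus> (n \<otimes> m)) (m' \<otimes> n')"
      using 7 c by (intro exterior_form_a_inv(2)[OF K M W \<phi>, symmetric]) auto
    also have "\<ominus> (n \<otimes> m) = m \<otimes> n"
      using 7 c by (intro K.lie_antisym[symmetric]) auto
    also have "\<phi> (m \<otimes> n) (m' \<otimes> n') \<ominus>\<^bsub>W\<^esub> \<phi> (m \<otimes> n) (m' \<otimes> n') = \<zero>\<^bsub>W\<^esub>"
      using 7 c by (intro zero refl \<phi>_closed) auto
    finally show ?thesis .
  qed
qed

text \<open>A case distinction suffices, as both functions recurse through
  \<open>eval_commutator\<close> only. The equation lets the vanishing of extended forms on the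
  tensor ideal be applied to the commutator map.\<close>

lemma eval_commutator_eq_word_form: "eval_commutator K = word_form K (\<lambda>m n. m \<otimes> n)"
proof
  show "eval_commutator K t = word_form K (\<lambda>m n. m \<otimes> n) t" for t
    by (cases t) auto
qed

context
  fixes W :: "('a, 'c) hom_alg" and \<phi> :: "'b \<Rightarrow> 'b \<Rightarrow> 'c"
  assumes W: "module R W" and \<phi>: "exterior_form R K M W \<phi>"
begin

interpretation W: module R W by (rule W)

lemma word_form_funcset:
  "word_form K \<phi> \<in> {t. set_magma t \<subseteq> M \<times> carrier K} \<rightarrow> carrier W"
proof
  fix t assume "t \<in> {t. set_magma t \<subseteq> M \<times> carrier K}"
  then show "word_form K \<phi> t \<in> carrier W"
    using exterior_form_closed[OF \<phi>] eval_commutator_closed ideal_closed(1) by (cases t) auto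
qed

lemma word_form_ext_single:
  "set_magma t \<subseteq> M \<times> carrier K \<Longrightarrow> lin_ext R W (word_form K \<phi>) (single R t) = word_form K \<phi> t"
  by (rule lin_ext_single[OF K.field_axioms W word_form_funcset]) auto

lemma word_form_ext_lin_map: "lin_ext R W (word_form K \<phi>) \<in> lin_map R tensor_words W"
  using lin_ext_lin_map[OF K.field_axioms W word_form_funcset]
  by (simp add: lin_map_free_nonassoc[OF K.field_axioms])

lemma word_form_ext_mult:
  assumes "f \<in> carrier tensor_words" "g \<in> carrier tensor_words"
  shows "lin_ext R W (word_form K \<phi>) (f \<otimes>\<^bsub>tensor_words\<^esub> g) = \<phi> (ev f) (ev g)"
  by (rule free_nonassoc_mult_transfer[OF K.field_axioms
        restrict_module[OF K.module_axioms hom_lie_ideal_submodule[OF M]] K.module_axioms W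
        ev_lin_map' ev_lin_map word_form_ext_lin_map _ _ _ assms])
    (auto intro: exterior_form_lin_left[OF \<phi>] exterior_form_lin_right[OF \<phi>]
      simp: ev_single word_form_ext_single)

text \<open>
  Killing also the commutator makes the kernel an ideal: a product is sent to a value of \<open>\<phi>\<close> at the
  commutators of its factors.
\<close>

lemma word_form_ext_tensor_ideal:
  assumes "x \<in> TI"
  shows "lin_ext R W (word_form K \<phi>) x = \<zero>\<^bsub>W\<^esub>"
proof -
  let ?T = "lin_ext R W (word_form K \<phi>)"
  let ?J = "{x \<in> carrier tensor_words. ?T x = \<zero>\<^bsub>W\<^esub>} \<inter> {x \<in> carrier tensor_words. ev x = \<zero>}"
  have J1: "submodule {x \<in> carrier tensor_words. ?T x = \<zero>\<^bsub>W\<^esub>} R tensor_words"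
    by (rule submodule_kernel[OF tw_module W word_form_ext_lin_map])
  have J2: "submodule {x \<in> carrier tensor_words. ev x = \<zero>} R tensor_words"
    by (rule submodule_kernel[OF tw_module K.module_axioms ev_lin_map])
  have "TI \<subseteq> ?J"
    unfolding tensor_ideal_def presentation_ideal_def
  proof (rule ideal_generated_minimal)
    show "hom_lie_relators tensor_words \<union> tensor_relators R K M (carrier K) \<subseteq> ?J"
    proof
      fix x assume x: "x \<in> hom_lie_relators tensor_words \<union> tensor_relators R K M (carrier K)"
      have "?T x = \<zero>\<^bsub>W\<^esub>"
        by (rule relators_vanish[OF W \<phi> word_form_ext_lin_map _ word_form_ext_mult x])
          (auto simp: word_form_ext_single)
      \<comment> \<open>Evaluation is the extension of the bracket, so the same lemma applies with
        the form \<open>exterior_form_lie\<close>.\<close>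
      moreover have "ev x = \<zero>"
        by (rule relators_vanish[OF K.module_axioms exterior_form_lie[OF K two M] ev_lin_map _
              ev_mult x])
          (auto simp: ev_single)
      ultimately show "x \<in> ?J"
        using tensor_relators_closed[OF x] by simp
    qed
    show "submodule ?J R tensor_words"
      by (rule submodule_Int[OF tw_module J1 J2])
    fix a x assume a: "a \<in> carrier tensor_words" and x: "x \<in> ?J"
    then have e: "ev a \<in> M" "ev a \<in> carrier K"
      using ev_closed ideal_closed(1) by auto
    show "a \<otimes>\<^bsub>tensor_words\<^esub> x \<in> ?J"
      using a x e tw_mult_closed exterior_form_zero[OF K M W \<phi>]
      by (simp add: word_form_ext_mult ev_mult)
    show "x \<otimes>\<^bsub>tensor_words\<^esub> a \<in> ?J"
      using a x e tw_mult_closed exterior_form_zero[OF K M W \<phi>]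
      by (simp add: word_form_ext_mult ev_mult)
  qed
  then show ?thesis
    using assms by auto
qed

end

end

section \<open>Functoriality of the tensor ideal\<close>

lemma hom_lie_relators_map:
  assumes A: "hom_vector_space R A" and P: "P \<in> lin_map R A A'"
    and P_mult: "\<And>x y. \<lbrakk>x \<in> carrier A; y \<in> carrier A\<rbrakk> \<Longrightarrow> P (x \<otimes>\<^bsub>A\<^esub> y) = P x \<otimes>\<^bsub>A'\<^esub> P y"
    and P_twist: "\<And>x. x \<in> carrier A \<Longrightarrow> P (\<alpha>\<^bsub>A\<^esub> x) = \<alpha>\<^bsub>A'\<^esub> (P x)"
    and mc: "\<And>x y. \<lbrakk>x \<in> carrier A; y \<in> carrier A\<rbrakk> \<Longrightarrow> x \<otimes>\<^bsub>A\<^esub> y \<in> carrier A"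
    and x: "x \<in> hom_lie_relators A"
  shows "P x \<in> hom_lie_relators A'"
proof -
  interpret A: hom_vector_space R A by (rule A)
  note P_closed = lin_map_closed[OF P] and P_add = lin_map_add[OF P]
  show ?thesis
    using x unfolding hom_lie_relators_def Un_iff mem_Collect_eq
  proof (elim disjE exE conjE)
    fix a b assume "x = a \<otimes>\<^bsub>A\<^esub> b \<oplus>\<^bsub>A\<^esub> b \<otimes>\<^bsub>A\<^esub> a" "a \<in> carrier A" "b \<in> carrier A"
    then show "(\<exists>a b. P x = a \<otimes>\<^bsub>A'\<^esub> b \<oplus>\<^bsub>A'\<^esub> b \<otimes>\<^bsub>A'\<^esub> a \<and> a \<in> carrier A' \<and> b \<in> carrier A') \<or>
      (\<exists>a b c. P x = \<alpha>\<^bsub>A'\<^esub> a \<otimes>\<^bsub>A'\<^esub> (b \<otimes>\<^bsub>A'\<^esub> c) \<oplus>\<^bsub>A'\<^esub> \<alpha>\<^bsub>A'\<^esub> b \<otimes>\<^bsub>A'\<^esub> (c \<otimes>\<^bsub>A'\<^esub> a)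
        \<oplus>\<^bsub>A'\<^esub> \<alpha>\<^bsub>A'\<^esub> c \<otimes>\<^bsub>A'\<^esub> (a \<otimes>\<^bsub>A'\<^esub> b) \<and> a \<in> carrier A' \<and> b \<in> carrier A' \<and> c \<in> carrier A')"
      by (intro disjI1 exI[of _ "P a"] exI[of _ "P b"]) (simp add: P_add P_mult mc P_closed)
  next
    fix a b c assume "x = \<alpha>\<^bsub>A\<^esub> a \<otimes>\<^bsub>A\<^esub> (b \<otimes>\<^bsub>A\<^esub> c) \<oplus>\<^bsub>A\<^esub> \<alpha>\<^bsub>A\<^esub> b \<otimes>\<^bsub>A\<^esub> (c \<otimes>\<^bsub>A\<^esub> a)
        \<oplus>\<^bsub>A\<^esub> \<alpha>\<^bsub>A\<^esub> c \<otimes>\<^bsub>A\<^esub> (a \<otimes>\<^bsub>A\<^esub> b)" "a \<in> carrier A" "b \<in> carrier A" "c \<in> carrier A"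
    then show "(\<exists>a b. P x = a \<otimes>\<^bsub>A'\<^esub> b \<oplus>\<^bsub>A'\<^esub> b \<otimes>\<^bsub>A'\<^esub> a \<and> a \<in> carrier A' \<and> b \<in> carrier A') \<or>
      (\<exists>a b c. P x = \<alpha>\<^bsub>A'\<^esub> a \<otimes>\<^bsub>A'\<^esub> (b \<otimes>\<^bsub>A'\<^esub> c) \<oplus>\<^bsub>A'\<^esub> \<alpha>\<^bsub>A'\<^esub> b \<otimes>\<^bsub>A'\<^esub> (c \<otimes>\<^bsub>A'\<^esub> a)
        \<oplus>\<^bsub>A'\<^esub> \<alpha>\<^bsub>A'\<^esub> c \<otimes>\<^bsub>A'\<^esub> (a \<otimes>\<^bsub>A'\<^esub> b) \<and> a \<in> carrier A' \<and> b \<in> carrier A' \<and> c \<in> carrier A')"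
      by (intro disjI2 exI[of _ "P a"] exI[of _ "P b"] exI[of _ "P c"])
        (simp add: P_add P_mult mc P_closed P_twist A.twist_closed)
  qed
qed

text \<open>Each relator goes to a relator of the same shape, and the preimage of the target ideal
  under a multiplicative map is a two-sided ideal, so it contains the source ideal. With
  \<open>f\<close> the twist of \<open>K\<close> this yields the invariance of the ideal under the
  twist.\<close>

lemma push_tensor_ideal:
  assumes K: "hom_lie_algebra R K" and K': "hom_lie_algebra R K'"
    and two: "\<one>\<^bsub>R\<^esub> \<oplus>\<^bsub>R\<^esub> \<one>\<^bsub>R\<^esub> \<noteq> \<zero>\<^bsub>R\<^esub>"
    and M: "hom_lie_ideal R M K" and M': "hom_lie_ideal R M' K'"
    and f: "f \<in> hom_lie_hom R K K'" and fM: "\<And>m. m \<in> M \<Longrightarrow> f m \<in> M'"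
    and x: "x \<in> tensor_ideal R K M (carrier K)"
  shows "push R (map_magma (map_prod f f)) x \<in> tensor_ideal R K' M' (carrier K')"
proof -
  interpret K: hom_lie_algebra R K by (rule K)
  interpret K': hom_lie_algebra R K' by (rule K')
  let ?A = "free_nonassoc R (M \<times> carrier K) (map_prod (twist K) (twist K))"
  let ?A' = "free_nonassoc R (M' \<times> carrier K') (map_prod (twist K') (twist K'))"
  let ?P = "push R (map_magma (map_prod f f))"
  let ?g = "\<lambda>m n. single R (Gen (m, n))"
  let ?I' = "tensor_ideal R K' M' (carrier K')"
  have A: "module R ?A"
    by (rule tw_module[OF K two M])
  have A': "module R ?A'"
    by (rule tw_module[OF K' two M'])
  interpret A: module R ?A by (rule A)
  note I' = tensor_ideal_ideal[OF K' two M']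
  note fs = hom_lie_homD[OF f]
  have ff: "map_prod f f \<in> M \<times> carrier K \<rightarrow> M' \<times> carrier K'"
    using fM fs(3) by auto
  have P: "?P \<in> lin_map R ?A ?A'"
    by (rule push_magma_lin_map[OF K.field_axioms ff])
  note P_mult = push_magma_mult[OF K.field_axioms ff,
      where a = "map_prod (twist K) (twist K)" and b = "map_prod (twist K') (twist K')"]
  have P_twist: "?P (\<alpha>\<^bsub>?A\<^esub> a) = \<alpha>\<^bsub>?A'\<^esub> (?P a)" if a: "a \<in> carrier ?A" for a
  proof (rule lin_span_eq_on[OF A A' lin_map_comp[OF twist_lin_map[OF tensor_words_vec[OF K two M]] P]
        lin_map_comp[OF P twist_lin_map[OF tensor_words_vec[OF K' two M']]]
        lin_span_words[OF K.field_axioms] _ a])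
    fix b assume "b \<in> single R ` {t. set_magma t \<subseteq> M \<times> carrier K}"
    then obtain t where t: "set_magma t \<subseteq> M \<times> carrier K" "b = single R t"
      by auto
    note c = map_magma_funcset[OF K.field_axioms twist_pair_funcset[OF K two M]]
      map_magma_funcset[OF K.field_axioms ff]
    note s = push_magma_single[OF K.field_axioms ff]
      push_magma_single[OF K.field_axioms twist_pair_funcset[OF K two M]]
      push_magma_single[OF K.field_axioms twist_pair_funcset[OF K' two M']]
    \<comment> \<open>A homomorphism commutes with the twists letter by letter, hence on words;
      linearity extends this to the whole free algebra.\<close>
    have "map_magma (map_prod f f) (map_magma (map_prod (twist K) (twist K)) t)
        = map_magma (map_prod (twist K') (twist K')) (map_magma (map_prod f f) t)"
      using t(1) fs(4) hom_lie_ideal_subset[OF M]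
      by (auto simp: magma.map_comp intro!: magma.map_cong)
    moreover have "set_magma (map_magma (map_prod (twist K) (twist K)) t) \<subseteq> M \<times> carrier K"
      "set_magma (map_magma (map_prod f f) t) \<subseteq> M' \<times> carrier K'"
      using c t(1) by auto
    ultimately show "?P (\<alpha>\<^bsub>?A\<^esub> b) = \<alpha>\<^bsub>?A'\<^esub> (?P b)"
      using t by (simp add: free_nonassoc_twist[OF K.field_axioms] s)
  qed
  note tw = hom_vector_space.twist_closed[OF tensor_words_vec[OF K two M]]
  note mc = tw_mult_closed[OF K two M]
  have P_gen: "?P (?g m n) = ?g (f m) (f n)" if "m \<in> M" "n \<in> carrier K" for m n
    using push_magma_single[OF K.field_axioms ff, of "Gen (m, n)"] that by simp
  note P_closed = lin_map_closed[OF P] and P_add = lin_map_add[OF P] and P_smult = lin_map_smult[OF P]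
    and P_minus = lin_map_minus[OF A A' P] and P_inv = lin_map_a_inv[OF A A' P]
  note gc = gen_closed[OF K two M]
  note c = ideal_closed[OF K two M]
  have rel: "?P x \<in> ?I'" if "x \<in> hom_lie_relators ?A \<union> tensor_relators R K M (carrier K)" for x
    using that
  proof
    assume x: "x \<in> hom_lie_relators ?A"
    have "?P x \<in> hom_lie_relators ?A'"
      by (rule hom_lie_relators_map[OF tensor_words_vec[OF K two M] P P_mult P_twist mc x])
    then show ?thesis
      by (rule I'(4))
  next
    assume "x \<in> tensor_relators R K M (carrier K)"
    then have "?P x \<in> tensor_relators R K' M' (carrier K')"
    proof (cases rule: tensor_relators_cases[OF K two M, consumes 1])
      case (1 m m' n)
      then show ?thesis
        using tensor_relatorsI(1)[OF K' two M' fM fM fs(3), of m m' n] c gc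
        by (simp add: P_minus P_add P_gen fs(6))
    next
      case (2 m n n')
      then show ?thesis
        using tensor_relatorsI(2)[OF K' two M' fM fs(3) fs(3), of m n n'] c gc
        by (simp add: P_minus P_add P_gen fs(6))
    next
      case (3 r m n)
      then show ?thesis
        using tensor_relatorsI(3)[OF K' two M' _ fM fs(3), of r m n] c gc
        by (simp add: P_minus P_smult P_gen fs(7))
    next
      case (4 r m n)
      then show ?thesis
        using tensor_relatorsI(4)[OF K' two M' _ fM fs(3), of r m n] c gc
        by (simp add: P_minus P_smult P_gen fs(7))
    next
      case (5 m m' n)
      then show ?thesis
        using tensor_relatorsI(5)[OF K' two M' fM fM fs(3), of m m' n] c gc
        by (simp add: P_minus P_gen fs(4,5))
    next
      case (6 m n n')
      then show ?thesis
        using tensor_relatorsI(6)[OF K' two M' fM fs(3) fs(3), of m n n'] c gc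
        by (simp add: P_minus P_gen fs(4,5))
    next
      case (7 m n m' n')
      then show ?thesis
        using tensor_relatorsI(7)[OF K' two M' fM fs(3) fM fs(3), of m n m' n'] c gc mc
        by (simp add: P_minus P_inv P_mult P_gen fs(4,5))
    qed
    then show ?thesis
      by (rule I'(5))
  qed
  have "tensor_ideal R K M (carrier K) \<subseteq> {x \<in> carrier ?A. ?P x \<in> ?I'}"
    unfolding tensor_ideal_def[of R K] presentation_ideal_def[of R "M \<times> carrier K"]
  proof (rule ideal_generated_minimal)
    show "hom_lie_relators ?A \<union> tensor_relators R K M (carrier K) \<subseteq> {x \<in> carrier ?A. ?P x \<in> ?I'}"
      using rel tensor_relators_closed[OF K two M] by blast
    show "submodule {x \<in> carrier ?A. ?P x \<in> ?I'} R ?A"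
      by (rule submodule_vimage[OF A A' P I'(1)])
    fix a x assume "a \<in> carrier ?A" "x \<in> {x \<in> carrier ?A. ?P x \<in> ?I'}"
    then show "a \<otimes>\<^bsub>?A\<^esub> x \<in> {x \<in> carrier ?A. ?P x \<in> ?I'}" "x \<otimes>\<^bsub>?A\<^esub> a \<in> {x \<in> carrier ?A. ?P x \<in> ?I'}"
      using I'(2)[OF P_closed[of a], of "?P x"] I'(3)[OF P_closed[of a], of "?P x"]
      by (auto simp: P_mult mc)
  qed
  then show ?thesis
    using x by blast
qed

text \<open>The exterior product is a quotient of a quotient of the word algebra. Its elements are
  handled as images of words under this one surjective map, so that the two layers of cosets need
  not be opened separately.\<close>

definition ext_proj :: "('a, 'r) ring_scheme \<Rightarrow> ('a, 'b) hom_alg \<Rightarrow> 'b set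
    \<Rightarrow> (('b \<times> 'b) magma \<Rightarrow> 'a) \<Rightarrow> (('b \<times> 'b) magma \<Rightarrow> 'a) set set" where
  "ext_proj R K M x = tensor_square R K M (carrier K) +>\<^bsub>tensor R K M (carrier K)\<^esub>
     (tensor_ideal R K M (carrier K)
        +>\<^bsub>free_nonassoc R (M \<times> carrier K) (map_prod (twist K) (twist K))\<^esub> x)"

definition ext_elem :: "('a, 'r) ring_scheme \<Rightarrow> ('a, 'b) hom_alg \<Rightarrow> 'b set \<Rightarrow> 'b \<Rightarrow> 'b
    \<Rightarrow> (('b \<times> 'b) magma \<Rightarrow> 'a) set set" where
  "ext_elem R K M m n = ext_proj R K M (single R (Gen (m, n)))"

section \<open>The exterior product as a vector space\<close>

context
  fixes R :: "('a, 'r) ring_scheme" and K :: "('a, 'b) hom_alg" (structure) and M :: "'b set"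
  assumes K: "hom_lie_algebra R K" and two: "\<one>\<^bsub>R\<^esub> \<oplus>\<^bsub>R\<^esub> \<one>\<^bsub>R\<^esub> \<noteq> \<zero>\<^bsub>R\<^esub>"
    and M: "hom_lie_ideal R M K"
begin

interpretation K: hom_lie_algebra R K by (rule K)

private abbreviation (input) A where "A \<equiv> free_nonassoc R (M \<times> carrier K) (map_prod (twist K) (twist K))"
private abbreviation (input) T where "T \<equiv> tensor R K M (carrier K)"
private abbreviation (input) E where "E \<equiv> exterior R K M (carrier K)"
private abbreviation (input) I where "I \<equiv> tensor_ideal R K M (carrier K)"
private abbreviation (input) Sq where "Sq \<equiv> tensor_square R K M (carrier K)"
private abbreviation (input) g where "g \<equiv> \<lambda>m n. single R (Gen (m, n))"

private lemmas A_module = tw_module[OF K two M]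

interpretation A: module R A by (rule A_module)

private lemmas I_ideal = tensor_ideal_ideal[OF K two M]
private lemmas M_closed = ideal_closed[OF K two M]
private lemmas g_closed = gen_closed[OF K two M]

lemma tensor_eq_quot: "T = quot A I"
  by (simp add: tensor_def presented_hom_lie_def tensor_ideal_def)

lemma tensor_ideal_twist:
  assumes "x \<in> I"
  shows "\<alpha>\<^bsub>A\<^esub> x \<in> I"
  using push_tensor_ideal[OF K K two M M twist_hom_lie_hom[OF K] hom_lie_ideal_twist[OF M] assms]
  by (simp add: free_nonassoc_twist[OF K.field_axioms])

lemma tensor_vec: "hom_vector_space R T"
  and tensor_proj: "(\<lambda>x. I +>\<^bsub>A\<^esub> x) \<in> hom_vec_hom R A T"
  unfolding tensor_eq_quot
  by (rule hom_vector_space_quot(1)[OF tensor_words_vec[OF K two M] I_ideal(1)], erule tensor_ideal_twist)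
    (rule hom_vector_space_quot(2)[OF tensor_words_vec[OF K two M] I_ideal(1)], erule tensor_ideal_twist)

lemma tensor_proj_surj: "(\<lambda>x. I +>\<^bsub>A\<^esub> x) ` carrier A = carrier T"
  unfolding tensor_eq_quot by (rule quot_carrier[OF A_module I_ideal(1), symmetric])

interpretation T: module R T by (rule hom_vector_space_module[OF tensor_vec])

text \<open>With the whole algebra as second factor, \<open>M \<inter> N\<close> is
  \<open>M\<close>.\<close>

lemma tensor_square_eq: "Sq = lin_span R T ((\<lambda>x. I +>\<^bsub>A\<^esub> g x x) ` M)"
  using hom_lie_ideal_subset[OF M]
  by (auto simp: tensor_square_def tensor_elem_def intro!: arg_cong[where f = "lin_span R T"])

lemma tensor_square_gens: "(\<lambda>x. I +>\<^bsub>A\<^esub> g x x) ` M \<subseteq> carrier T"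
  using lin_map_closed[OF hom_vec_hom_lin_map[OF tensor_proj]] g_closed hom_lie_ideal_subset[OF M]
  by auto

lemma tensor_square_submodule: "submodule Sq R T"
  unfolding tensor_square_eq by (rule submodule_lin_span[OF T.module_axioms tensor_square_gens])

lemma tensor_square_twist:
  assumes "x \<in> Sq"
  shows "\<alpha>\<^bsub>T\<^esub> x \<in> Sq"
proof -
  have "lin_span R T ((\<lambda>x. I +>\<^bsub>A\<^esub> g x x) ` M) \<subseteq> {x \<in> carrier T. \<alpha>\<^bsub>T\<^esub> x \<in> Sq}"
  proof (rule lin_span_minimal)
    show "submodule {x \<in> carrier T. \<alpha>\<^bsub>T\<^esub> x \<in> Sq} R T"
      by (rule submodule_vimage[OF T.module_axioms T.module_axioms twist_lin_map[OF tensor_vec]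
            tensor_square_submodule])
    have "\<alpha>\<^bsub>T\<^esub> (I +>\<^bsub>A\<^esub> g x x) \<in> Sq" if x: "x \<in> M" for x
    proof -
      have xc: "x \<in> carrier K"
        using x M_closed(1) by simp
      have "\<alpha>\<^bsub>T\<^esub> (I +>\<^bsub>A\<^esub> g x x) = I +>\<^bsub>A\<^esub> \<alpha>\<^bsub>A\<^esub> (g x x)"
        using hom_vec_hom_twist[OF tensor_proj] g_closed[OF x xc] by simp
      also have "\<alpha>\<^bsub>A\<^esub> (g x x) = g (\<alpha> x) (\<alpha> x)"
        using push_magma_single[OF K.field_axioms twist_pair_funcset[OF K two M], of "Gen (x, x)"]
          x xc by (simp add: free_nonassoc_twist[OF K.field_axioms])
      finally show ?thesis
        using lin_span_subset[of "(\<lambda>x. I +>\<^bsub>A\<^esub> g x x) ` M" R T] M_closed(6)[OF x]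
        unfolding tensor_square_eq by auto
    qed
    then show "(\<lambda>x. I +>\<^bsub>A\<^esub> g x x) ` M \<subseteq> {x \<in> carrier T. \<alpha>\<^bsub>T\<^esub> x \<in> Sq}"
      using tensor_square_gens by auto
  qed
  then show ?thesis
    using assms unfolding tensor_square_eq by auto
qed

lemma exterior_vec: "hom_vector_space R E"
  and exterior_proj: "(\<lambda>D. Sq +>\<^bsub>T\<^esub> D) \<in> hom_vec_hom R T E"
  unfolding exterior_def
  by (rule hom_vector_space_quot(1)[OF tensor_vec tensor_square_submodule], erule tensor_square_twist)
    (rule hom_vector_space_quot(2)[OF tensor_vec tensor_square_submodule], erule tensor_square_twist)

interpretation E: module R E by (rule hom_vector_space_module[OF exterior_vec])

lemmas exterior_module = E.module_axioms

lemma ext_proj_hom: "ext_proj R K M \<in> hom_vec_hom R A E"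
  using hom_vec_hom_comp[OF tensor_proj exterior_proj]
  by (simp add: ext_proj_def[abs_def])

lemma ext_proj_surj: "ext_proj R K M ` carrier A = carrier E"
proof -
  have "ext_proj R K M ` carrier A = (\<lambda>D. Sq +>\<^bsub>T\<^esub> D) ` (\<lambda>x. I +>\<^bsub>A\<^esub> x) ` carrier A"
    by (simp add: image_image ext_proj_def)
  also have "\<dots> = carrier E"
    unfolding tensor_proj_surj exterior_def
    by (rule quot_carrier[OF T.module_axioms tensor_square_submodule, symmetric])
  finally show ?thesis .
qed

lemma ext_proj_eqI:
  assumes "x \<in> carrier A" "y \<in> carrier A" "x \<ominus>\<^bsub>A\<^esub> y \<in> I"
  shows "ext_proj R K M x = ext_proj R K M y"
  using coset_eqI[OF A_module I_ideal(1) assms] by (simp add: ext_proj_def)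

lemmas ext_proj_lin = hom_vec_hom_lin_map[OF ext_proj_hom]

lemma ext_elem_closed: "\<lbrakk>m \<in> M; n \<in> carrier K\<rbrakk> \<Longrightarrow> ext_elem R K M m n \<in> carrier E"
  unfolding ext_elem_def by (rule lin_map_closed[OF ext_proj_lin g_closed])

lemma ext_elem_twist:
  assumes "m \<in> M" "n \<in> carrier K"
  shows "\<alpha>\<^bsub>E\<^esub> (ext_elem R K M m n) = ext_elem R K M (\<alpha> m) (\<alpha> n)"
proof -
  have "\<alpha>\<^bsub>A\<^esub> (g m n) = g (\<alpha> m) (\<alpha> n)"
    using push_magma_single[OF K.field_axioms twist_pair_funcset[OF K two M], of "Gen (m, n)"]
      assms by (simp add: free_nonassoc_twist[OF K.field_axioms])
  then show ?thesis
    using hom_vec_hom_twist[OF ext_proj_hom g_closed[OF assms]] by (simp add: ext_elem_def)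
qed

text \<open>For each clause about sums, scalars or brackets, the difference of the two sides comes
  from a relator in the tensor ideal; the diagonal clause is what the quotient by the square
  provides.\<close>

lemma ext_elem_form: "exterior_form R K M E (ext_elem R K M)"
proof -
  note rel = tensor_relatorsI[OF K two M, THEN I_ideal(5)]
  note add = lin_map_add[OF ext_proj_lin] and smult = lin_map_smult[OF ext_proj_lin]
    and minus = lin_map_minus[OF A_module E.module_axioms ext_proj_lin]
  note c = M_closed g_closed
  show ?thesis
    unfolding exterior_form_def
  proof (intro conjI ballI lin_mapI)
    fix m n assume mn: "m \<in> M" "n \<in> carrier K"
    then show "ext_elem R K M m n \<in> carrier E"
      by (rule ext_elem_closed)
    { fix n' assume n': "n' \<in> carrier K"
      have "ext_elem R K M m (n \<oplus> n') = ext_proj R K M (g m n \<oplus>\<^bsub>A\<^esub> g m n')"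
        unfolding ext_elem_def using mn n' c by (intro ext_proj_eqI rel) auto
      then show "ext_elem R K M m (n \<oplus> n') = ext_elem R K M m n \<oplus>\<^bsub>E\<^esub> ext_elem R K M m n'"
        using mn n' c by (simp add: ext_elem_def add)
      have "ext_elem R K M (\<alpha> m) (n \<otimes> n')
          = ext_proj R K M (g (n' \<otimes> m) (\<alpha> n) \<ominus>\<^bsub>A\<^esub> g (n \<otimes> m) (\<alpha> n'))"
        unfolding ext_elem_def using mn n' c by (intro ext_proj_eqI rel) auto
      then show "ext_elem R K M (\<alpha> m) (n \<otimes> n')
          = ext_elem R K M (n' \<otimes> m) (\<alpha> n) \<ominus>\<^bsub>E\<^esub> ext_elem R K M (n \<otimes> m) (\<alpha> n')"
        using mn n' c by (simp add: ext_elem_def minus) }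
    { fix r assume r: "r \<in> carrier R"
      have "ext_elem R K M m (r \<odot> n) = ext_proj R K M (r \<odot>\<^bsub>A\<^esub> g m n)"
        unfolding ext_elem_def using mn r c by (intro ext_proj_eqI rel) auto
      then show "ext_elem R K M m (r \<odot> n) = r \<odot>\<^bsub>E\<^esub> ext_elem R K M m n"
        using mn r c by (simp add: ext_elem_def smult) }
    { fix m' assume m': "m' \<in> M"
      have "ext_elem R K M (m \<otimes> m') (\<alpha> n)
          = ext_proj R K M (g (\<alpha> m) (m' \<otimes> n) \<ominus>\<^bsub>A\<^esub> g (\<alpha> m') (m \<otimes> n))"
        unfolding ext_elem_def using mn m' c by (intro ext_proj_eqI rel) auto
      then show "ext_elem R K M (m \<otimes> m') (\<alpha> n)
          = ext_elem R K M (\<alpha> m) (m' \<otimes> n) \<ominus>\<^bsub>E\<^esub> ext_elem R K M (\<alpha> m') (m \<otimes> n)"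
        using mn m' c by (simp add: ext_elem_def minus) }
  next
    fix m assume m: "m \<in> M"
    then have gmm: "g m m \<in> carrier A"
      using c by auto
    have "I +>\<^bsub>A\<^esub> g m m \<in> Sq"
      unfolding tensor_square_eq
      using lin_span_subset[of "(\<lambda>x. I +>\<^bsub>A\<^esub> g x x) ` M" R T] m by auto
    moreover have "I +>\<^bsub>A\<^esub> g m m \<in> carrier T"
      by (rule lin_map_closed[OF hom_vec_hom_lin_map[OF tensor_proj] gmm])
    ultimately show "ext_elem R K M m m = \<zero>\<^bsub>E\<^esub>"
      using coset_zero_iff[OF T.module_axioms tensor_square_submodule]
      by (simp add: ext_elem_def ext_proj_def exterior_def
          quot_zero[OF T.module_axioms tensor_square_submodule])
  next
    fix n m assume n: "n \<in> carrier K" and "m \<in> carrier (K\<lparr>carrier := M\<rparr>)"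
    then have m: "m \<in> M" by simp
    show "ext_elem R K M m n \<in> carrier E"
      using m n by (rule ext_elem_closed)
    { fix m' assume "m' \<in> carrier (K\<lparr>carrier := M\<rparr>)"
      then have m': "m' \<in> M" by simp
      have "ext_elem R K M (m \<oplus> m') n = ext_proj R K M (g m n \<oplus>\<^bsub>A\<^esub> g m' n)"
        unfolding ext_elem_def using m n m' c by (intro ext_proj_eqI rel) auto
      then show "ext_elem R K M (m \<oplus>\<^bsub>K\<lparr>carrier := M\<rparr>\<^esub> m') n
          = ext_elem R K M m n \<oplus>\<^bsub>E\<^esub> ext_elem R K M m' n"
        using m n m' c by (simp add: ext_elem_def add) }
    { fix r assume r: "r \<in> carrier R"
      have "ext_elem R K M (r \<odot> m) n = ext_proj R K M (r \<odot>\<^bsub>A\<^esub> g m n)"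
        unfolding ext_elem_def using m n r c by (intro ext_proj_eqI rel) auto
      then show "ext_elem R K M (r \<odot>\<^bsub>K\<lparr>carrier := M\<rparr>\<^esub> m) n = r \<odot>\<^bsub>E\<^esub> ext_elem R K M m n"
        using m n r c by (simp add: ext_elem_def smult) }
  qed
qed

text \<open>From \<open>x y - x' y' = (x - x') y + x' (y - y')\<close> and the two-sided ideal
  property.\<close>

lemma tensor_ideal_mult_cong:
  assumes "x \<in> carrier A" "x' \<in> carrier A" "y \<in> carrier A" "y' \<in> carrier A"
    and "x \<ominus>\<^bsub>A\<^esub> x' \<in> I" "y \<ominus>\<^bsub>A\<^esub> y' \<in> I"
  shows "x \<otimes>\<^bsub>A\<^esub> y \<ominus>\<^bsub>A\<^esub> x' \<otimes>\<^bsub>A\<^esub> y' \<in> I"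
proof -
  note mc = tw_mult_closed[OF K two M]
  note l = free_nonassoc_mult_lin_map[OF K.field_axioms]
  have 1: "(x \<ominus>\<^bsub>A\<^esub> x') \<otimes>\<^bsub>A\<^esub> y = x \<otimes>\<^bsub>A\<^esub> y \<ominus>\<^bsub>A\<^esub> x' \<otimes>\<^bsub>A\<^esub> y"
    by (rule lin_map_minus[OF A_module A_module l(2)[OF assms(3)] assms(1,2)])
  have 2: "x' \<otimes>\<^bsub>A\<^esub> (y \<ominus>\<^bsub>A\<^esub> y') = x' \<otimes>\<^bsub>A\<^esub> y \<ominus>\<^bsub>A\<^esub> x' \<otimes>\<^bsub>A\<^esub> y'"
    by (rule lin_map_minus[OF A_module A_module l(1)[OF assms(2)] assms(3,4)])
  have "(x \<ominus>\<^bsub>A\<^esub> x') \<otimes>\<^bsub>A\<^esub> y \<oplus>\<^bsub>A\<^esub> x' \<otimes>\<^bsub>A\<^esub> (y \<ominus>\<^bsub>A\<^esub> y') \<in> I"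
    by (rule submodule_add[OF I_ideal(1) I_ideal(3)[OF assms(3,5)] I_ideal(2)[OF assms(2,6)]])
  also have "(x \<ominus>\<^bsub>A\<^esub> x') \<otimes>\<^bsub>A\<^esub> y \<oplus>\<^bsub>A\<^esub> x' \<otimes>\<^bsub>A\<^esub> (y \<ominus>\<^bsub>A\<^esub> y') = x \<otimes>\<^bsub>A\<^esub> y \<ominus>\<^bsub>A\<^esub> x' \<otimes>\<^bsub>A\<^esub> y'"
    unfolding 1 2 using mc[OF assms(1,3)] mc[OF assms(2,3)] mc[OF assms(2,4)]
    by (simp add: a_minus_def A.a_assoc A.r_neg1)
  finally show ?thesis .
qed

lemma tensor_ideal_diff_trans:
  assumes "x \<in> carrier A" "y \<in> carrier A" "z \<in> carrier A" "x \<ominus>\<^bsub>A\<^esub> y \<in> I" "y \<ominus>\<^bsub>A\<^esub> z \<in> I"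
  shows "x \<ominus>\<^bsub>A\<^esub> z \<in> I"
  using coset_eq_iff[OF A_module I_ideal(1)] assms by metis

text \<open>
  By the relation for products of generators, every word is congruent to a single generator.
\<close>

lemma word_cong_gen:
  "set_magma t \<subseteq> M \<times> carrier K \<Longrightarrow> \<exists>m\<in>M. \<exists>n\<in>carrier K. single R t \<ominus>\<^bsub>A\<^esub> g m n \<in> I"
proof (induction t)
  case (Gen x)
  then obtain m n where "x = (m, n)" "m \<in> M" "n \<in> carrier K"
    by (cases x) auto
  moreover from this have "g m n \<ominus>\<^bsub>A\<^esub> g m n = \<zero>\<^bsub>A\<^esub>"
    using g_closed by (simp add: a_minus_def A.r_neg)
  ultimately have "single R (Gen x) \<ominus>\<^bsub>A\<^esub> g m n \<in> I"
    using submodule_zero[OF I_ideal(1)] by simp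
  then show ?case
    using \<open>m \<in> M\<close> \<open>n \<in> carrier K\<close> by blast
next
  case (Mul s t)
  obtain m n m' n' where mn: "m \<in> M" "n \<in> carrier K" "single R s \<ominus>\<^bsub>A\<^esub> g m n \<in> I"
    "m' \<in> M" "n' \<in> carrier K" "single R t \<ominus>\<^bsub>A\<^esub> g m' n' \<in> I"
    using Mul by auto
  have w: "single R s \<in> carrier A" "single R t \<in> carrier A" "single R (Mul s t) \<in> carrier A"
    using Mul.prems by (auto intro!: single_word_closed[OF K.field_axioms])
  let ?a = "n \<otimes> m" and ?b = "m' \<otimes> n'"
  have ab: "?a \<in> M" "?b \<in> carrier K" "?b \<in> M"
    using mn M_closed by auto
  have 1: "single R (Mul s t) \<ominus>\<^bsub>A\<^esub> g m n \<otimes>\<^bsub>A\<^esub> g m' n' \<in> I"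
    using tensor_ideal_mult_cong[OF w(1) g_closed[OF mn(1,2)] w(2) g_closed[OF mn(4,5)] mn(3,6)]
    by (simp add: single_mult[OF K.field_axioms])
  have 2: "g m n \<otimes>\<^bsub>A\<^esub> g m' n' \<ominus>\<^bsub>A\<^esub> (\<ominus>\<^bsub>A\<^esub> g ?a ?b) \<in> I"
    by (rule I_ideal(5)[OF tensor_relatorsI(7)[OF K two M mn(1,2,4,5)]])
  \<comment> \<open>The product relation leaves a minus sign outside the generator; homogeneity with
    the scalar \<open>- 1\<close> moves it into the left entry, so that a generator is obtained
    again.\<close>
  have "g ((\<ominus>\<^bsub>R\<^esub> \<one>\<^bsub>R\<^esub>) \<odot> ?a) ?b \<ominus>\<^bsub>A\<^esub> (\<ominus>\<^bsub>R\<^esub> \<one>\<^bsub>R\<^esub>) \<odot>\<^bsub>A\<^esub> g ?a ?b \<in> I"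
    using ab by (intro I_ideal(5) tensor_relatorsI(3)[OF K two M]) auto
  then have "g (\<ominus> ?a) ?b \<ominus>\<^bsub>A\<^esub> (\<ominus>\<^bsub>A\<^esub> g ?a ?b) \<in> I"
    using ab g_closed M_closed(1) by (simp add: A.smult_l_minus K.smult_l_minus)
  then have 3: "(\<ominus>\<^bsub>A\<^esub> g ?a ?b) \<ominus>\<^bsub>A\<^esub> g (\<ominus> ?a) ?b \<in> I"
    using coset_eq_iff[OF A_module I_ideal(1), of "\<ominus>\<^bsub>A\<^esub> g ?a ?b" "g (\<ominus> ?a) ?b"]
      coset_eq_iff[OF A_module I_ideal(1), of "g (\<ominus> ?a) ?b" "\<ominus>\<^bsub>A\<^esub> g ?a ?b"]
      ab M_closed(4) g_closed by auto
  have "single R (Mul s t) \<ominus>\<^bsub>A\<^esub> g (\<ominus> ?a) ?b \<in> I"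
    using tensor_ideal_diff_trans[OF w(3) _ _ 1 tensor_ideal_diff_trans[OF _ _ _ 2 3]]
      ab mn M_closed(4) g_closed tw_mult_closed[OF K two M] by simp
  then show ?case
    using ab M_closed(4) by blast
qed

text \<open>The algebra is spanned by the classes of words, and each word is congruent to one
  generator, so the generators span it as a vector space and not merely as an algebra. Hence linear
  maps out of the exterior product are determined by their values on them.\<close>

lemma lin_span_ext_elem:
  "lin_span R E {ext_elem R K M m n | m n. m \<in> M \<and> n \<in> carrier K} = carrier E"
proof
  let ?B = "{ext_elem R K M m n | m n. m \<in> M \<and> n \<in> carrier K}"
  have B: "?B \<subseteq> carrier E"
    using ext_elem_closed by auto
  note s = submodule_lin_span[OF E.module_axioms B]
  show "lin_span R E ?B \<subseteq> carrier E"
    by (rule submodule_subset[OF s])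
  have "carrier E = lin_span R E (ext_proj R K M ` single R ` {t. set_magma t \<subseteq> M \<times> carrier K})"
    using lin_span_image[OF A_module E.module_axioms ext_proj_lin, of
        "single R ` {t. set_magma t \<subseteq> M \<times> carrier K}"] ext_proj_surj
    by (auto simp: lin_span_words[OF K.field_axioms] intro: single_word_closed[OF K.field_axioms])
  also have "\<dots> \<subseteq> lin_span R E ?B"
  proof (rule lin_span_minimal[OF _ s])
    show "ext_proj R K M ` single R ` {t. set_magma t \<subseteq> M \<times> carrier K} \<subseteq> lin_span R E ?B"
    proof (intro image_subsetI, elim imageE)
      fix x t assume "x = single R t" "t \<in> {t. set_magma t \<subseteq> M \<times> carrier K}"
      then have t: "set_magma t \<subseteq> M \<times> carrier K" "x = single R t"
        by auto
      obtain m n where mn: "m \<in> M" "n \<in> carrier K" "single R t \<ominus>\<^bsub>A\<^esub> g m n \<in> I"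
        using word_cong_gen[OF t(1)] by auto
      have "ext_proj R K M x = ext_elem R K M m n"
        unfolding t(2) ext_elem_def
        by (rule ext_proj_eqI[OF single_word_closed[OF K.field_axioms t(1)] g_closed[OF mn(1,2)] mn(3)])
      then show "ext_proj R K M x \<in> lin_span R E ?B"
        using lin_span_subset[of ?B R E] mn by auto
    qed
  qed
  finally show "carrier E \<subseteq> lin_span R E ?B" .
qed

text \<open>The map is descended twice, through the tensor ideal and then through the square;
  vanishing on the square is checked on the diagonal generators, since the once descended map is
  linear. The nested \<open>the_elem\<close> has the shape of \<open>commutator_map\<close>.\<close>

lemma exterior_descend:
  assumes W: "module R W" and h: "h \<in> lin_map R A W"
    and "\<And>x. x \<in> I \<Longrightarrow> h x = \<zero>\<^bsub>W\<^esub>" and hM: "\<And>m. m \<in> M \<Longrightarrow> h (g m m) = \<zero>\<^bsub>W\<^esub>"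
    and x: "x \<in> carrier A"
  shows "the_elem ((\<lambda>D. the_elem (h ` D)) ` ext_proj R K M x) = h x"
proof -
  let ?k = "\<lambda>D. the_elem (h ` D)"
  have k: "?k (I +>\<^bsub>A\<^esub> x) = h x" if "x \<in> carrier A" for x
    by (rule the_elem_coset[OF A_module I_ideal(1) W h assms(3) that])
  have k_lin: "?k \<in> lin_map R T W"
    by (rule lin_map_factor[OF A_module hom_vec_hom_lin_map[OF tensor_proj] tensor_proj_surj h k])
  have "Sq \<subseteq> {D \<in> carrier T. ?k D = \<zero>\<^bsub>W\<^esub>}"
    unfolding tensor_square_eq
  proof (rule lin_span_minimal)
    show "submodule {D \<in> carrier T. ?k D = \<zero>\<^bsub>W\<^esub>} R T"
      by (rule submodule_kernel[OF T.module_axioms W k_lin])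
    show "(\<lambda>x. I +>\<^bsub>A\<^esub> g x x) ` M \<subseteq> {D \<in> carrier T. ?k D = \<zero>\<^bsub>W\<^esub>}"
    proof
      fix D assume "D \<in> (\<lambda>x. I +>\<^bsub>A\<^esub> g x x) ` M"
      then obtain m where m: "m \<in> M" "D = I +>\<^bsub>A\<^esub> g m m"
        by auto
      then show "D \<in> {D \<in> carrier T. ?k D = \<zero>\<^bsub>W\<^esub>}"
        using k[OF g_closed[OF m(1) M_closed(1)[OF m(1)]]] hM[OF m(1)] tensor_square_gens by auto
    qed
  qed
  then have "the_elem (?k ` (Sq +>\<^bsub>T\<^esub> (I +>\<^bsub>A\<^esub> x))) = ?k (I +>\<^bsub>A\<^esub> x)"
    using lin_map_closed[OF hom_vec_hom_lin_map[OF tensor_proj] x]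
    by (intro the_elem_coset[OF T.module_axioms tensor_square_submodule W k_lin]) auto
  then show ?thesis
    using k[OF x] by (simp add: ext_proj_def)
qed

text \<open>The form is extended to words by \<open>word_form\<close>, and the extension descends
  because it kills the tensor ideal and the diagonal. Uniqueness is supplied by
  \<open>lin_span_ext_elem\<close>.\<close>

lemma exterior_universal:
  assumes W: "module R W" and \<phi>: "exterior_form R K M W \<phi>"
  shows "\<exists>h. h \<in> lin_map R E W \<and> (\<forall>m\<in>M. \<forall>n\<in>carrier K. h (ext_elem R K M m n) = \<phi> m n)"
proof -
  let ?T = "lin_ext R W (word_form K \<phi>)"
  let ?h = "\<lambda>C. the_elem ((\<lambda>D. the_elem (?T ` D)) ` C)"
  note T = word_form_ext_lin_map[OF K two M W \<phi>]
  have T_gen: "?T (g m n) = \<phi> m n" if "m \<in> M" "n \<in> carrier K" for m n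
    using word_form_ext_single[OF K two M W \<phi>, of "Gen (m, n)"] that by simp
  have h: "?h (ext_proj R K M x) = ?T x" if x: "x \<in> carrier A" for x
  proof (rule exterior_descend[OF W T _ _ x])
    show "?T y = \<zero>\<^bsub>W\<^esub>" if "y \<in> I" for y
      by (rule word_form_ext_tensor_ideal[OF K two M W \<phi> that])
    show "?T (g m m) = \<zero>\<^bsub>W\<^esub>" if "m \<in> M" for m
      using T_gen[OF that M_closed(1)[OF that]] exterior_form_self[OF \<phi> that] by simp
  qed
  have "?h \<in> lin_map R E W"
    by (rule lin_map_factor[OF A_module ext_proj_lin ext_proj_surj T h])
  moreover have "?h (ext_elem R K M m n) = \<phi> m n" if "m \<in> M" "n \<in> carrier K" for m n
    using h[OF g_closed[OF that]] T_gen[OF that] by (simp add: ext_elem_def)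
  ultimately show ?thesis
    by blast
qed

lemma commutator_map_hom: "commutator_map R K \<in> hom_vec_hom R E K"
  and commutator_map_elem:
    "\<lbrakk>m \<in> M; n \<in> carrier K\<rbrakk> \<Longrightarrow> commutator_map R K (ext_elem R K M m n) = m \<otimes> n"
proof -
  let ?T = "lin_ext R K (eval_commutator K)"
  note form = exterior_form_lie[OF K two M]
  note eq = eval_commutator_eq_word_form[OF K two M]
  note T = ev_lin_map[OF K two M]
  have T_gen: "?T (g m n) = m \<otimes> n" if "m \<in> M" "n \<in> carrier K" for m n
    using ev_single[OF K two M, of "Gen (m, n)"] that by simp
  have h: "commutator_map R K (ext_proj R K M x) = ?T x" if x: "x \<in> carrier A" for x
    unfolding commutator_map_def
  proof (rule exterior_descend[OF K.module_axioms T _ _ x])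
    show "?T y = \<zero>" if "y \<in> I" for y
      unfolding eq by (rule word_form_ext_tensor_ideal[OF K two M K.module_axioms form that])
    show "?T (g m m) = \<zero>" if "m \<in> M" for m
      using T_gen[OF that M_closed(1)[OF that]] exterior_form_self[OF form that] by simp
  qed
  show elem: "commutator_map R K (ext_elem R K M m n) = m \<otimes> n" if "m \<in> M" "n \<in> carrier K" for m n
    using h[OF g_closed[OF that]] T_gen[OF that] by (simp add: ext_elem_def)
  have T': "?T \<in> hom_vec_hom R A K"
    using T ev_twist[OF K two M] by (simp add: hom_vec_hom_iff)
  show "commutator_map R K \<in> hom_vec_hom R E K"
    by (rule hom_vec_hom_factor[OF tensor_words_vec[OF K two M] ext_proj_hom ext_proj_surj T' h])
qed

end

text \<open>\<open>push\<close> along \<open>f\<close> respects both layers of the quotient: the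
  tensor ideal by \<open>push_tensor_ideal\<close>, and the square because the generator at
  \<open>(m, m)\<close> goes to the one at \<open>(f m, f m)\<close>.\<close>

lemma
  assumes K: "hom_lie_algebra R K" and K': "hom_lie_algebra R K'"
    and two: "\<one>\<^bsub>R\<^esub> \<oplus>\<^bsub>R\<^esub> \<one>\<^bsub>R\<^esub> \<noteq> \<zero>\<^bsub>R\<^esub>"
    and M: "hom_lie_ideal R M K" and M': "hom_lie_ideal R M' K'"
    and f: "f \<in> hom_lie_hom R K K'" and fM: "\<And>m. m \<in> M \<Longrightarrow> f m \<in> M'"
  shows exterior_map_lin: "exterior_map R K' M' (carrier K') f
      \<in> lin_map R (exterior R K M (carrier K)) (exterior R K' M' (carrier K'))"
    and exterior_map_elem: "\<lbrakk>m \<in> M; n \<in> carrier K\<rbrakk> \<Longrightarrow>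
      exterior_map R K' M' (carrier K') f (ext_elem R K M m n) = ext_elem R K' M' (f m) (f n)"
proof -
  interpret K: hom_lie_algebra R K by (rule K)
  let ?A = "free_nonassoc R (M \<times> carrier K) (map_prod (twist K) (twist K))"
  let ?A' = "free_nonassoc R (M' \<times> carrier K') (map_prod (twist K') (twist K'))"
  let ?I = "tensor_ideal R K M (carrier K)"
  let ?I' = "tensor_ideal R K' M' (carrier K')"
  let ?T = "tensor R K M (carrier K)"
  let ?T' = "tensor R K' M' (carrier K')"
  let ?S = "tensor_square R K M (carrier K)"
  let ?S' = "tensor_square R K' M' (carrier K')"
  let ?P = "push R (map_magma (map_prod f f))"
  let ?g = "\<lambda>m n. single R (Gen (m, n))"
  let ?k = "quot_map ?A' ?I' ?P"
  note A = tw_module[OF K two M] and A' = tw_module[OF K' two M']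
  note T = hom_vector_space_module[OF tensor_vec[OF K two M]]
    and T' = hom_vector_space_module[OF tensor_vec[OF K' two M']]
  note c = ideal_closed(1)[OF K two M]
  have ff: "map_prod f f \<in> M \<times> carrier K \<rightarrow> M' \<times> carrier K'"
    using fM hom_lie_hom_closed[OF f] by auto
  have P: "?P \<in> lin_map R ?A ?A'"
    by (rule push_magma_lin_map[OF K.field_axioms ff])
  have P_gen: "?P (?g m n) = ?g (f m) (f n)" if "m \<in> M" "n \<in> carrier K" for m n
    using push_magma_single[OF K.field_axioms ff, of "Gen (m, n)"] that by simp
  have k: "?k (?I +>\<^bsub>?A\<^esub> x) = ?I' +>\<^bsub>?A'\<^esub> ?P x" if "x \<in> carrier ?A" for x
    by (rule quot_map_coset[OF A tensor_ideal_ideal(1)[OF K two M] A'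
          tensor_ideal_ideal(1)[OF K' two M'] P push_tensor_ideal[OF K K' two M M' f fM] that])
  have k_lin: "?k \<in> lin_map R ?T ?T'"
    by (rule lin_map_factor[OF A hom_vec_hom_lin_map[OF tensor_proj[OF K two M]]
          tensor_proj_surj[OF K two M]
          lin_map_comp[OF P hom_vec_hom_lin_map[OF tensor_proj[OF K' two M']]] k])
  have "?S \<subseteq> {D \<in> carrier ?T. ?k D \<in> ?S'}"
    unfolding tensor_square_eq[OF K two M]
  proof (rule lin_span_minimal)
    show "submodule {D \<in> carrier ?T. ?k D \<in> ?S'} R ?T"
      by (rule submodule_vimage[OF T T' k_lin tensor_square_submodule[OF K' two M']])
    show "(\<lambda>x. ?I +>\<^bsub>?A\<^esub> ?g x x) ` M \<subseteq> {D \<in> carrier ?T. ?k D \<in> ?S'}"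
    proof
      fix D assume "D \<in> (\<lambda>x. ?I +>\<^bsub>?A\<^esub> ?g x x) ` M"
      then obtain m where m: "m \<in> M" "D = ?I +>\<^bsub>?A\<^esub> ?g m m"
        by auto
      have "?k D = ?I' +>\<^bsub>?A'\<^esub> ?g (f m) (f m)"
        unfolding m(2) using k[OF gen_closed[OF K two M m(1) c[OF m(1)]]] P_gen[OF m(1) c[OF m(1)]]
        by simp
      also have "\<dots> \<in> ?S'"
        unfolding tensor_square_eq[OF K' two M'] using fM[OF m(1)]
        by (intro subsetD[OF lin_span_subset]) auto
      finally show "D \<in> {D \<in> carrier ?T. ?k D \<in> ?S'}"
        using m tensor_square_gens[OF K two M] by auto
    qed
  qed
  then have em: "exterior_map R K' M' (carrier K') f (ext_proj R K M x) = ext_proj R K' M' (?P x)"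
    if x: "x \<in> carrier ?A" for x
    unfolding exterior_map_def ext_proj_def k[OF x, symmetric]
    using lin_map_closed[OF hom_vec_hom_lin_map[OF tensor_proj[OF K two M]] x]
    by (intro quot_map_coset[OF T tensor_square_submodule[OF K two M] T'
          tensor_square_submodule[OF K' two M'] k_lin]) auto
  show "exterior_map R K' M' (carrier K') f
      \<in> lin_map R (exterior R K M (carrier K)) (exterior R K' M' (carrier K'))"
    by (rule lin_map_factor[OF A ext_proj_lin[OF K two M] ext_proj_surj[OF K two M]
          lin_map_comp[OF P ext_proj_lin[OF K' two M']] em])
  show "exterior_map R K' M' (carrier K') f (ext_elem R K M m n) = ext_elem R K' M' (f m) (f n)"
    if "m \<in> M" "n \<in> carrier K"
    using em[OF gen_closed[OF K two M that]] P_gen[OF that] by (simp add: ext_elem_def)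
qed

section \<open>Exterior powers\<close>

text \<open>Alternating multilinear maps in the vocabulary of \<open>wedge_relators\<close>: apart
  from closure, each clause makes one family of relators vanish. List updates treat all positions
  and all degrees at once.\<close>

definition wedge_form ::
  "('a, 'r) ring_scheme \<Rightarrow> ('a, 'b) hom_alg \<Rightarrow> nat \<Rightarrow> ('a, 'c) hom_alg \<Rightarrow> ('b list \<Rightarrow> 'c) \<Rightarrow> bool"
  where
  "wedge_form R K n W \<phi> \<longleftrightarrow>
    (let B = {xs. length xs = n \<and> set xs \<subseteq> carrier K} in
     (\<forall>xs\<in>B. \<phi> xs \<in> carrier W) \<and>
     (\<forall>xs\<in>B. \<forall>i<n. \<forall>x\<in>carrier K. \<forall>y\<in>carrier K.
        \<phi> (xs[i := x \<oplus>\<^bsub>K\<^esub> y]) = \<phi> (xs[i := x]) \<oplus>\<^bsub>W\<^esub> \<phi> (xs[i := y])) \<and>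
     (\<forall>xs\<in>B. \<forall>i<n. \<forall>r\<in>carrier R. \<forall>x\<in>carrier K.
        \<phi> (xs[i := r \<odot>\<^bsub>K\<^esub> x]) = r \<odot>\<^bsub>W\<^esub> \<phi> (xs[i := x])) \<and>
     (\<forall>xs\<in>B. \<forall>i j. i < j \<and> j < n \<and> xs ! i = xs ! j \<longrightarrow> \<phi> xs = \<zero>\<^bsub>W\<^esub>))"

lemma wedge_formD:
  assumes "wedge_form R K n W \<phi>" and "length xs = n" "set xs \<subseteq> carrier K"
  shows wedge_form_closed: "\<phi> xs \<in> carrier W"
    and wedge_form_add: "\<lbrakk>i < n; x \<in> carrier K; y \<in> carrier K\<rbrakk> \<Longrightarrow>
      \<phi> (xs[i := x \<oplus>\<^bsub>K\<^esub> y]) = \<phi> (xs[i := x]) \<oplus>\<^bsub>W\<^esub> \<phi> (xs[i := y])"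
    and wedge_form_smult: "\<lbrakk>i < n; r \<in> carrier R; x \<in> carrier K\<rbrakk> \<Longrightarrow>
      \<phi> (xs[i := r \<odot>\<^bsub>K\<^esub> x]) = r \<odot>\<^bsub>W\<^esub> \<phi> (xs[i := x])"
    and wedge_form_alt: "\<lbrakk>i < j; j < n; xs ! i = xs ! j\<rbrakk> \<Longrightarrow> \<phi> xs = \<zero>\<^bsub>W\<^esub>"
  using assms by (auto simp: wedge_form_def Let_def)

lemma wedge_form_pullback:
  assumes \<phi>: "wedge_form R K' n W \<phi>" and f: "f \<in> lin_map R K K'"
  shows "wedge_form R K n W (\<lambda>xs. \<phi> (map f xs))"
proof -
  have s: "set (map f xs) \<subseteq> carrier K'" if "set xs \<subseteq> carrier K" for xs
    using that lin_map_closed[OF f] by auto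
  show ?thesis
    unfolding wedge_form_def Let_def
    using wedge_form_closed[OF \<phi> _ s] wedge_form_add[OF \<phi> _ s] wedge_form_smult[OF \<phi> _ s]
      wedge_form_alt[OF \<phi> _ s]
      lin_map_add[OF f] lin_map_smult[OF f] lin_map_closed[OF f]
    by (auto simp: map_update)
qed

context
  fixes R :: "('a, 'r) ring_scheme" and K :: "('a, 'b) hom_alg" (structure)
  assumes K: "hom_vector_space R K"
begin

interpretation K: hom_vector_space R K by (rule K)

lemma twist_tuples_funcset:
  "map (twist K) \<in> {xs. length xs = n \<and> set xs \<subseteq> carrier K} \<rightarrow> {xs. length xs = n \<and> set xs \<subseteq> carrier K}"
  using K.twist_closed by (auto simp: subset_iff)

lemma tuples_vec: "hom_vector_space R (tuples R K n)"
  unfolding tuples_def by (rule hom_vector_space_free_vec[OF K.field_axioms twist_tuples_funcset])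

lemmas tuples_module = hom_vector_space_module[OF tuples_vec]

lemma single_tuple_closed:
  "\<lbrakk>length xs = n; set xs \<subseteq> carrier K\<rbrakk> \<Longrightarrow> single R xs \<in> carrier (tuples R K n)"
  unfolding tuples_def by (rule single_closed[OF K.field_axioms]) auto

lemma wedge_relators_cases:
  assumes "u \<in> wedge_relators R K n"
  obtains xs i x y where "length xs = n" "set xs \<subseteq> carrier K" "i < n" "x \<in> carrier K" "y \<in> carrier K"
      "u = single R (xs[i := x \<oplus> y]) \<ominus>\<^bsub>tuples R K n\<^esub>
        (single R (xs[i := x]) \<oplus>\<^bsub>tuples R K n\<^esub> single R (xs[i := y]))"
  | xs i r x where "length xs = n" "set xs \<subseteq> carrier K" "i < n" "r \<in> carrier R" "x \<in> carrier K"
      "u = single R (xs[i := r \<odot> x]) \<ominus>\<^bsub>tuples R K n\<^esub> r \<odot>\<^bsub>tuples R K n\<^esub> single R (xs[i := x])"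
  | xs i j where "length xs = n" "set xs \<subseteq> carrier K" "i < j" "j < n" "xs ! i = xs ! j"
      "u = single R xs"
  using assms unfolding wedge_relators_def Let_def Un_iff mem_Collect_eq
  apply (elim disjE exE conjE)
  subgoal by (rule that(1))
  subgoal by (rule that(2))
  subgoal by (rule that(3))
  done

lemma wedge_relatorsI:
  "\<lbrakk>length xs = n; set xs \<subseteq> carrier K; i < n; x \<in> carrier K; y \<in> carrier K\<rbrakk> \<Longrightarrow>
    single R (xs[i := x \<oplus> y]) \<ominus>\<^bsub>tuples R K n\<^esub>
      (single R (xs[i := x]) \<oplus>\<^bsub>tuples R K n\<^esub> single R (xs[i := y])) \<in> wedge_relators R K n"
  "\<lbrakk>length xs = n; set xs \<subseteq> carrier K; i < n; r \<in> carrier R; x \<in> carrier K\<rbrakk> \<Longrightarrow>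
    single R (xs[i := r \<odot> x]) \<ominus>\<^bsub>tuples R K n\<^esub> r \<odot>\<^bsub>tuples R K n\<^esub> single R (xs[i := x])
      \<in> wedge_relators R K n"
  "\<lbrakk>length xs = n; set xs \<subseteq> carrier K; i < j; j < n; xs ! i = xs ! j\<rbrakk> \<Longrightarrow>
    single R xs \<in> wedge_relators R K n"
  unfolding wedge_relators_def Let_def mem_Collect_eq Un_iff
  subgoal by (rule disjI1, rule disjI1, intro exI conjI, rule refl, assumption+)
  subgoal by (rule disjI1, rule disjI2, intro exI conjI, rule refl, assumption+)
  subgoal by (rule disjI2, intro exI conjI, rule refl, assumption+)
  done

lemma set_update_closed:
  "\<lbrakk>set xs \<subseteq> carrier K; x \<in> carrier K\<rbrakk> \<Longrightarrow> set (xs[i := x]) \<subseteq> carrier K"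
  using set_update_subset_insert[of xs i x] by auto

lemma wedge_form_cong:
  assumes \<phi>: "wedge_form R K n W \<phi>"
    and eq: "\<And>xs. \<lbrakk>length xs = n; set xs \<subseteq> carrier K\<rbrakk> \<Longrightarrow> \<psi> xs = \<phi> xs"
  shows "wedge_form R K n W \<psi>"
  unfolding wedge_form_def Let_def
proof (intro conjI ballI allI impI)
  fix xs assume "xs \<in> {xs. length xs = n \<and> set xs \<subseteq> carrier K}"
  then have xs: "length xs = n" "set xs \<subseteq> carrier K"
    by auto
  have u: "\<psi> (xs[i := x]) = \<phi> (xs[i := x])" if "x \<in> carrier K" for i x
    using eq[of "xs[i := x]"] set_update_closed[OF xs(2) that] xs(1) by simp
  show "\<psi> xs \<in> carrier W"
    using wedge_form_closed[OF \<phi> xs] eq[OF xs] by simp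
  { fix i x assume ix: "i < n" "x \<in> carrier K"
    { fix y assume "y \<in> carrier K"
      then show "\<psi> (xs[i := x \<oplus> y]) = \<psi> (xs[i := x]) \<oplus>\<^bsub>W\<^esub> \<psi> (xs[i := y])"
        using wedge_form_add[OF \<phi> xs ix(1)] ix(2) by (simp add: u) }
    { fix r assume "r \<in> carrier R"
      then show "\<psi> (xs[i := r \<odot> x]) = r \<odot>\<^bsub>W\<^esub> \<psi> (xs[i := x])"
        using wedge_form_smult[OF \<phi> xs ix(1)] ix(2) by (simp add: u) } }
  { fix i j assume "i < j \<and> j < n \<and> xs ! i = xs ! j"
    then show "\<psi> xs = \<zero>\<^bsub>W\<^esub>"
      using wedge_form_alt[OF \<phi> xs] eq[OF xs] by auto }
qed

lemma wedge_relators_closed: "wedge_relators R K n \<subseteq> carrier (tuples R K n)"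
proof
  interpret T: module R "tuples R K n" by (rule tuples_module)
  fix u assume "u \<in> wedge_relators R K n"
  then show "u \<in> carrier (tuples R K n)"
    by (cases rule: wedge_relators_cases) (simp_all add: single_tuple_closed set_update_closed)
qed

lemma wedge_null_submodule: "submodule (wedge_null R K n) R (tuples R K n)"
  unfolding wedge_null_def by (rule submodule_lin_span[OF tuples_module wedge_relators_closed])

context
  fixes W :: "('a, 'c) hom_alg" and n :: nat and \<phi> :: "'b list \<Rightarrow> 'c"
  assumes W: "module R W" and \<phi>: "wedge_form R K n W \<phi>"
begin

lemma wedge_form_funcset: "\<phi> \<in> {xs. length xs = n \<and> set xs \<subseteq> carrier K} \<rightarrow> carrier W"
  using wedge_form_closed[OF \<phi>] by auto

lemma wedge_form_lin_ext: "lin_ext R W \<phi> \<in> lin_map R (tuples R K n) W"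
  unfolding tuples_def by (rule lin_ext_lin_map[OF K.field_axioms W wedge_form_funcset])

lemma wedge_form_lin_ext_single:
  "\<lbrakk>length xs = n; set xs \<subseteq> carrier K\<rbrakk> \<Longrightarrow> lin_ext R W \<phi> (single R xs) = \<phi> xs"
  by (rule lin_ext_single[OF K.field_axioms W wedge_form_funcset]) auto

lemma wedge_form_wedge_null:
  assumes "u \<in> wedge_null R K n"
  shows "lin_ext R W \<phi> u = \<zero>\<^bsub>W\<^esub>"
proof -
  interpret T: module R "tuples R K n" by (rule tuples_module)
  interpret W: module R W by (rule W)
  note l = wedge_form_lin_ext
  have zero: "u \<ominus>\<^bsub>W\<^esub> v = \<zero>\<^bsub>W\<^esub>" if "u = v" "v \<in> carrier W" for u v
    using that by (simp add: a_minus_def W.r_neg)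
  note s = single_tuple_closed set_update_closed wedge_form_lin_ext_single
  have "wedge_null R K n \<subseteq> {u \<in> carrier (tuples R K n). lin_ext R W \<phi> u = \<zero>\<^bsub>W\<^esub>}"
    unfolding wedge_null_def
  proof (rule lin_span_minimal)
    show "submodule {u \<in> carrier (tuples R K n). lin_ext R W \<phi> u = \<zero>\<^bsub>W\<^esub>} R (tuples R K n)"
      by (rule submodule_kernel[OF tuples_module W l])
    show "wedge_relators R K n \<subseteq> {u \<in> carrier (tuples R K n). lin_ext R W \<phi> u = \<zero>\<^bsub>W\<^esub>}"
    proof
      fix u assume u: "u \<in> wedge_relators R K n"
      then have "lin_ext R W \<phi> u = \<zero>\<^bsub>W\<^esub>"
      proof (cases rule: wedge_relators_cases)
        case (1 xs i x y)
        then show ?thesis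
          using wedge_form_add[OF \<phi> 1(1,2,3,4,5)] wedge_form_closed[OF \<phi>]
          by (simp add: s lin_map_minus[OF tuples_module W l] lin_map_add[OF l] zero)
      next
        case (2 xs i r x)
        then show ?thesis
          using wedge_form_smult[OF \<phi> 2(1,2,3,4,5)] wedge_form_closed[OF \<phi>]
          by (simp add: s lin_map_minus[OF tuples_module W l] lin_map_smult[OF l] zero)
      next
        case (3 xs i j)
        then show ?thesis
          using wedge_form_alt[OF \<phi>] by (simp add: s)
      qed
      then show "u \<in> {u \<in> carrier (tuples R K n). lin_ext R W \<phi> u = \<zero>\<^bsub>W\<^esub>}"
        using u wedge_relators_closed by auto
    qed
  qed
  then show ?thesis
    using assms by auto
qed

end

lemma chains_module: "module R (chains R K n)"
  unfolding chains_def by (rule quot_module[OF tuples_module wedge_null_submodule])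

lemma chains_proj_lin: "(\<lambda>u. wedge_null R K n +>\<^bsub>tuples R K n\<^esub> u) \<in> lin_map R (tuples R K n) (chains R K n)"
  unfolding chains_def by (rule proj_lin_map[OF tuples_module wedge_null_submodule])

lemma chains_proj_surj:
  "(\<lambda>u. wedge_null R K n +>\<^bsub>tuples R K n\<^esub> u) ` carrier (tuples R K n) = carrier (chains R K n)"
  unfolding chains_def by (rule quot_carrier[OF tuples_module wedge_null_submodule, symmetric])

lemma wedge_eq: "length xs = n \<Longrightarrow> wedge R K xs = wedge_null R K n +>\<^bsub>tuples R K n\<^esub> single R xs"
  by (simp add: wedge_def)

lemma wedge_wedge_form: "wedge_form R K n (chains R K n) (wedge R K)"
proof -
  interpret T: module R "tuples R K n" by (rule tuples_module)
  have sub: "wedge_relators R K n \<subseteq> wedge_null R K n"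
    unfolding wedge_null_def by (rule lin_span_subset)
  note rel = wedge_relatorsI[THEN subsetD[OF sub]]
  note add = lin_map_add[OF chains_proj_lin[of n]] and smult = lin_map_smult[OF chains_proj_lin[of n]]
  note c = single_tuple_closed set_update_closed
  note eq = coset_eqI[OF tuples_module wedge_null_submodule]
  show ?thesis
    unfolding wedge_form_def Let_def
  proof (intro conjI ballI allI impI)
    fix xs assume "xs \<in> {xs. length xs = n \<and> set xs \<subseteq> carrier K}"
    then have xs: "length xs = n" "set xs \<subseteq> carrier K"
      by auto
    show "wedge R K xs \<in> carrier (chains R K n)"
      using lin_map_closed[OF chains_proj_lin single_tuple_closed[OF xs]] xs by (simp add: wedge_eq)
    { fix i assume i: "i < n"
      fix x assume x: "x \<in> carrier K"
      { fix y assume y: "y \<in> carrier K"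
        have "wedge R K (xs[i := x \<oplus> y]) = wedge_null R K n +>\<^bsub>tuples R K n\<^esub>
            (single R (xs[i := x]) \<oplus>\<^bsub>tuples R K n\<^esub> single R (xs[i := y]))"
          unfolding wedge_eq[of "xs[i := x \<oplus> y]" n, unfolded length_list_update, OF xs(1)]
          using xs i x y by (intro eq rel) (simp_all add: c)
        then show "wedge R K (xs[i := x \<oplus> y])
            = wedge R K (xs[i := x]) \<oplus>\<^bsub>chains R K n\<^esub> wedge R K (xs[i := y])"
          using xs i x y by (simp add: wedge_eq[of _ n] add c) }
      { fix r assume r: "r \<in> carrier R"
        have "wedge R K (xs[i := r \<odot> x]) = wedge_null R K n +>\<^bsub>tuples R K n\<^esub>
            (r \<odot>\<^bsub>tuples R K n\<^esub> single R (xs[i := x]))"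
          unfolding wedge_eq[of "xs[i := r \<odot> x]" n, unfolded length_list_update, OF xs(1)]
          using xs i x r by (intro eq rel) (simp_all add: c)
        then show "wedge R K (xs[i := r \<odot> x]) = r \<odot>\<^bsub>chains R K n\<^esub> wedge R K (xs[i := x])"
          using xs i x r by (simp add: wedge_eq[of _ n] smult c) } }
    { fix i j assume "i < j \<and> j < n \<and> xs ! i = xs ! j"
      then have "single R xs \<in> wedge_null R K n"
        using xs rel(3) by blast
      then show "wedge R K xs = \<zero>\<^bsub>chains R K n\<^esub>"
        using coset_zero_iff[OF tuples_module wedge_null_submodule single_tuple_closed[OF xs]] xs
        by (simp add: wedge_eq chains_def quot_zero[OF tuples_module wedge_null_submodule]) }
  qed
qed

lemma wedge_closed:
  "\<lbrakk>length xs = n; set xs \<subseteq> carrier K\<rbrakk> \<Longrightarrow> wedge R K xs \<in> carrier (chains R K n)"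
  by (rule wedge_form_closed[OF wedge_wedge_form])

lemma lin_span_wedge:
  "lin_span R (chains R K n) (wedge R K ` {xs. length xs = n \<and> set xs \<subseteq> carrier K})
     = carrier (chains R K n)"
proof -
  let ?B = "{xs. length xs = n \<and> set xs \<subseteq> carrier K}"
  have "lin_span R (tuples R K n) (single R ` ?B) = carrier (tuples R K n)"
    unfolding tuples_def by (rule lin_span_single[OF K.field_axioms])
  moreover have "wedge R K ` ?B
      = (\<lambda>u. wedge_null R K n +>\<^bsub>tuples R K n\<^esub> u) ` single R ` ?B"
    unfolding image_image by (rule image_cong) (auto simp: wedge_eq)
  moreover have "single R ` ?B \<subseteq> carrier (tuples R K n)"
    using single_tuple_closed by auto
  ultimately show ?thesis
    using lin_span_image[OF tuples_module chains_module chains_proj_lin, of "single R ` ?B" n]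
      chains_proj_surj[of n] by simp
qed

lemma chains_universal:
  assumes W: "module R W" and \<phi>: "wedge_form R K n W \<phi>"
  shows "\<exists>h. h \<in> lin_map R (chains R K n) W \<and>
    (\<forall>xs. length xs = n \<and> set xs \<subseteq> carrier K \<longrightarrow> h (wedge R K xs) = \<phi> xs)"
proof -
  let ?h = "\<lambda>C. the_elem (lin_ext R W \<phi> ` C)"
  note l = wedge_form_lin_ext[OF W \<phi>]
  have h: "?h (wedge_null R K n +>\<^bsub>tuples R K n\<^esub> u) = lin_ext R W \<phi> u"
    if "u \<in> carrier (tuples R K n)" for u
    by (rule the_elem_coset[OF tuples_module wedge_null_submodule W l
          wedge_form_wedge_null[OF W \<phi>] that])
  have "?h \<in> lin_map R (chains R K n) W"
    by (rule lin_map_factor[OF tuples_module chains_proj_lin chains_proj_surj l h])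
  moreover have "?h (wedge R K xs) = \<phi> xs" if "length xs = n" "set xs \<subseteq> carrier K" for xs
    using h[OF single_tuple_closed[OF that]] wedge_form_lin_ext_single[OF W \<phi> that] that
    by (simp add: wedge_eq)
  ultimately show ?thesis
    by blast
qed

end

text \<open>
  A linear map of tuples descends to chains as soon as its composition with the projection is an
  alternating form on tuples.
\<close>

lemma quot_map_wedge_null:
  fixes K' :: "('a, 'c) hom_alg"
  assumes K: "hom_vector_space R K" and K': "hom_vector_space R K'"
    and g: "g \<in> lin_map R (tuples R K n) (tuples R K' n')"
    and \<phi>: "wedge_form R K n (chains R K' n')
      (\<lambda>xs. wedge_null R K' n' +>\<^bsub>tuples R K' n'\<^esub> g (single R xs))"
  shows "quot_map (tuples R K' n') (wedge_null R K' n') g \<in> lin_map R (chains R K n) (chains R K' n')"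
    and "\<lbrakk>length xs = n; set xs \<subseteq> carrier K\<rbrakk> \<Longrightarrow>
      quot_map (tuples R K' n') (wedge_null R K' n') g (wedge R K xs)
        = wedge_null R K' n' +>\<^bsub>tuples R K' n'\<^esub> g (single R xs)"
proof -
  let ?q = "\<lambda>u. wedge_null R K' n' +>\<^bsub>tuples R K' n'\<^esub> u"
  let ?\<phi> = "\<lambda>xs. ?q (g (single R xs))"
  note T = tuples_module[OF K] and T' = tuples_module[OF K'] and C' = chains_module[OF K']
  note N = wedge_null_submodule[OF K] and N' = wedge_null_submodule[OF K']
  have fld: "field R"
    using K by (simp add: hom_vector_space_def)
  \<comment> \<open>The coset of \<open>g u\<close> is linear in \<open>u\<close> and agrees with
    the extension of the alternating form on single tuples, so the two coincide. As that extension
    kills \<open>wedge_null\<close>, the map \<open>g\<close> carries null elements to null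
    elements.\<close>
  have eq: "lin_ext R (chains R K' n') ?\<phi> u = ?q (g u)" if u: "u \<in> carrier (tuples R K n)" for u
    unfolding tuples_def[of R K]
  proof (rule lin_eq_on_single[OF fld C'[of n'], of _ "{xs. length xs = n \<and> set xs \<subseteq> carrier K}" "map (twist K)"])
    show "lin_ext R (chains R K' n') ?\<phi> \<in> lin_map R (free_vec R
        {xs. length xs = n \<and> set xs \<subseteq> carrier K} (map (twist K))) (chains R K' n')"
      using wedge_form_lin_ext[OF K C' \<phi>] by (simp add: tuples_def)
    show "(\<lambda>u. ?q (g u)) \<in> lin_map R (free_vec R
        {xs. length xs = n \<and> set xs \<subseteq> carrier K} (map (twist K))) (chains R K' n')"
      using lin_map_comp[OF g chains_proj_lin[OF K']] by (simp add: tuples_def)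
    show "lin_ext R (chains R K' n') ?\<phi> (single R xs) = ?q (g (single R xs))"
      if "xs \<in> {xs. length xs = n \<and> set xs \<subseteq> carrier K}" for xs
      using that wedge_form_lin_ext_single[OF K C' \<phi>] by simp
    show "u \<in> carrier (free_vec R {xs. length xs = n \<and> set xs \<subseteq> carrier K} (map (twist K)))"
      using u by (simp add: tuples_def)
  qed
  have null: "g u \<in> wedge_null R K' n'" if u: "u \<in> wedge_null R K n" for u
  proof -
    have uc: "u \<in> carrier (tuples R K n)"
      by (rule submodule_mem[OF N u])
    have "?q (g u) = \<zero>\<^bsub>chains R K' n'\<^esub>"
      using wedge_form_wedge_null[OF K C' \<phi> u] eq[OF uc] by simp
    then show ?thesis
      using coset_zero_iff[OF T' N' lin_map_closed[OF g uc]]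
      by (simp add: chains_def quot_zero[OF T' N'])
  qed
  have q: "quot_map (tuples R K' n') (wedge_null R K' n') g (wedge_null R K n +>\<^bsub>tuples R K n\<^esub> u)
      = ?q (g u)" if "u \<in> carrier (tuples R K n)" for u
    by (rule quot_map_coset[OF T N T' N' g null that])
  show "quot_map (tuples R K' n') (wedge_null R K' n') g \<in> lin_map R (chains R K n) (chains R K' n')"
    by (rule lin_map_factor[OF T chains_proj_lin[OF K] chains_proj_surj[OF K]
          lin_map_comp[OF g chains_proj_lin[OF K']] q])
  show "quot_map (tuples R K' n') (wedge_null R K' n') g (wedge R K xs) = ?q (g (single R xs))"
    if "length xs = n" "set xs \<subseteq> carrier K"
    using q[OF single_tuple_closed[OF K that]] that by (simp add: wedge_eq[OF K])
qed

text \<open>The chain-level layer of \<open>homology_map\<close>. For the twist of \<open>K\<close>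
  it is the twist of the chains (\<open>chains_twist\<close>), so naturality of the boundary also
  shows that boundaries are stable under the twist.\<close>

definition chain_map ::
  "('a, 'r) ring_scheme \<Rightarrow> ('a, 'c) hom_alg \<Rightarrow> nat \<Rightarrow> ('b \<Rightarrow> 'c)
     \<Rightarrow> ('b list \<Rightarrow> 'a) set \<Rightarrow> ('c list \<Rightarrow> 'a) set" where
  "chain_map R K' n f = quot_map (tuples R K' n) (wedge_null R K' n) (push R (map f))"

lemma
  assumes K: "hom_vector_space R K" and K': "hom_vector_space R K'" and f: "f \<in> lin_map R K K'"
  shows chain_map_lin: "chain_map R K' n f \<in> lin_map R (chains R K n) (chains R K' n)"
    and chain_map_wedge: "\<lbrakk>length xs = n; set xs \<subseteq> carrier K\<rbrakk> \<Longrightarrow>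
      chain_map R K' n f (wedge R K xs) = wedge R K' (map f xs)"
proof -
  have fld: "field R"
    using K by (simp add: hom_vector_space_def)
  let ?B = "{xs. length xs = n \<and> set xs \<subseteq> carrier K}"
  have ff: "map f \<in> ?B \<rightarrow> {xs. length xs = n \<and> set xs \<subseteq> carrier K'}"
    using lin_map_closed[OF f] by (auto simp: subset_iff)
  have g: "push R (map f) \<in> lin_map R (tuples R K n) (tuples R K' n)"
    unfolding tuples_def by (rule push_lin_map[OF fld ff])
  have s: "wedge_null R K' n +>\<^bsub>tuples R K' n\<^esub> push R (map f) (single R xs) = wedge R K' (map f xs)"
    if "length xs = n" "set xs \<subseteq> carrier K" for xs
    using push_single[OF fld ff, of xs] that by (simp add: wedge_eq[OF K'])
  have "wedge_form R K n (chains R K' n)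
      (\<lambda>xs. wedge_null R K' n +>\<^bsub>tuples R K' n\<^esub> push R (map f) (single R xs))"
    by (rule wedge_form_cong[OF K wedge_form_pullback[OF wedge_wedge_form[OF K'] f] s])
  note q = quot_map_wedge_null[OF K K' g this]
  show "chain_map R K' n f \<in> lin_map R (chains R K n) (chains R K' n)"
    unfolding chain_map_def by (rule q(1))
  show "chain_map R K' n f (wedge R K xs) = wedge R K' (map f xs)"
    if "length xs = n" "set xs \<subseteq> carrier K"
    unfolding chain_map_def using q(2)[OF that] s[OF that] by simp
qed

lemma
  assumes K: "hom_vector_space R K"
  shows chains_vec: "hom_vector_space R (chains R K n)"
    and chains_twist: "\<alpha>\<^bsub>chains R K n\<^esub> = chain_map R K n (twist K)"
proof -
  show eq: "\<alpha>\<^bsub>chains R K n\<^esub> = chain_map R K n (twist K)"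
    by (simp add: chains_def quot_def chain_map_def tuples_def free_vec_simps)
  show "hom_vector_space R (chains R K n)"
    using chain_map_lin[OF K K twist_lin_map[OF K], of n] K
    by (intro hom_vector_space_intro chains_module[OF K]) (auto simp: eq hom_vector_space_def)
qed

section \<open>Homology in degrees one and two\<close>

context
  fixes R :: "('a, 'r) ring_scheme" and K :: "('a, 'b) hom_alg" (structure)
  assumes K: "hom_lie_algebra R K" and two: "\<one>\<^bsub>R\<^esub> \<oplus>\<^bsub>R\<^esub> \<one>\<^bsub>R\<^esub> \<noteq> \<zero>\<^bsub>R\<^esub>"
begin

interpretation K: hom_lie_algebra R K by (rule K)

private lemmas Kv = K.hom_vector_space_axioms

private abbreviation (input) w where "w \<equiv> wedge R K"
private abbreviation (input) C where "C \<equiv> chains R K"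
private abbreviation (input) b where "b \<equiv> boundary R K"

interpretation C1: module R "C 1" by (rule chains_module[OF Kv])
interpretation C2: module R "C 2" by (rule chains_module[OF Kv])
interpretation C3: module R "C 3" by (rule chains_module[OF Kv])

lemma length_1: "length xs = 1 \<Longrightarrow> \<exists>x. xs = [x]"
  by (cases xs) auto

lemma length_2: "length xs = 2 \<Longrightarrow> \<exists>x y. xs = [x, y]"
  by (auto simp: length_Suc_conv numeral_eq_Suc)

lemma length_3: "length xs = 3 \<Longrightarrow> \<exists>x y z. xs = [x, y, z]"
  by (auto simp: length_Suc_conv numeral_eq_Suc)

lemma tuple_boundary_1: "tuple_boundary R K 1 [x] = \<zero>\<^bsub>tuples R K 0\<^esub>"
proof -
  interpret T: module R "tuples R K 0" by (rule tuples_module[OF Kv])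
  have e: "{(i, j). i < j \<and> j < (1::nat)} = {}"
    by auto
  show ?thesis
    unfolding tuple_boundary_def Let_def e by simp
qed

text \<open>The single pair of positions \<open>(0, 1)\<close> has odd sum; the resulting sign is
  the origin of the negations in \<open>boundary_2\<close> and \<open>boundary_2_eq\<close>.\<close>

lemma tuple_boundary_2:
  assumes "x \<in> carrier K" "y \<in> carrier K"
  shows "tuple_boundary R K 2 [x, y] = \<ominus>\<^bsub>tuples R K 1\<^esub> single R [x \<otimes> y]"
proof -
  interpret T: module R "tuples R K 1" by (rule tuples_module[OF Kv])
  have e: "{(i, j). i < j \<and> j < (2::nat)} = {(0, 1)}"
    by auto
  have e': "2 - 1 = (1::nat)"
    by simp
  have "(\<ominus>\<^bsub>R\<^esub> \<one>\<^bsub>R\<^esub>) [^]\<^bsub>R\<^esub> (1::nat) = \<ominus>\<^bsub>R\<^esub> \<one>\<^bsub>R\<^esub>"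
    by simp
  moreover have "nths [x, y] (- {0, 1}) = []"
    by (simp add: nths_Cons)
  moreover have "single R [x \<otimes> y] \<in> carrier (tuples R K 1)"
    using assms K.lie_closed by (intro single_tuple_closed[OF Kv]) auto
  ultimately show ?thesis
    unfolding tuple_boundary_def Let_def e e' by (simp add: T.smult_l_minus del: One_nat_def)
qed

lemma tuple_boundary_3:
  assumes "x \<in> carrier K" "y \<in> carrier K" "z \<in> carrier K"
  shows "tuple_boundary R K 3 [x, y, z] = \<ominus>\<^bsub>tuples R K 2\<^esub> single R [x \<otimes> y, \<alpha> z] \<oplus>\<^bsub>tuples R K 2\<^esub>
    (single R [x \<otimes> z, \<alpha> y] \<oplus>\<^bsub>tuples R K 2\<^esub> \<ominus>\<^bsub>tuples R K 2\<^esub> single R [y \<otimes> z, \<alpha> x])"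
proof -
  interpret T: module R "tuples R K 2" by (rule tuples_module[OF Kv])
  have "{(i, j). i < j \<and> j < (3::nat)} = {(0, 1), (0, 2), (1, 2)}"
    by auto
  moreover have "single R [x \<otimes> y, \<alpha> z] \<in> carrier (tuples R K 2)"
    "single R [x \<otimes> z, \<alpha> y] \<in> carrier (tuples R K 2)"
    "single R [y \<otimes> z, \<alpha> x] \<in> carrier (tuples R K 2)"
    using assms K.lie_closed K.twist_closed by (auto intro!: single_tuple_closed[OF Kv])
  moreover have "nths [x, y, z] (- {0, 1}) = [z]" "nths [x, y, z] (- {0, 2}) = [y]"
    "nths [x, y, z] (- {1, 2}) = [x]"
    by (simp_all add: nths_Cons)
  moreover have "(\<ominus>\<^bsub>R\<^esub> \<one>\<^bsub>R\<^esub>) [^]\<^bsub>R\<^esub> (1::nat) = \<ominus>\<^bsub>R\<^esub> \<one>\<^bsub>R\<^esub>" "(\<ominus>\<^bsub>R\<^esub> \<one>\<^bsub>R\<^esub>) [^]\<^bsub>R\<^esub> (2::nat) = \<one>\<^bsub>R\<^esub>"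
    "(\<ominus>\<^bsub>R\<^esub> \<one>\<^bsub>R\<^esub>) [^]\<^bsub>R\<^esub> (3::nat) = \<ominus>\<^bsub>R\<^esub> \<one>\<^bsub>R\<^esub>"
    by (simp_all add: numeral_eq_Suc K.R.l_minus)
  ultimately show ?thesis
    by (simp add: tuple_boundary_def Let_def T.smult_l_minus)
qed

text \<open>A boundary is well defined on the exterior power once the classes of its values on
  tuples form an alternating multilinear map. In degrees one, two and three this is checked from the
  explicit formulas for \<open>tuple_boundary\<close>.\<close>

lemma boundary_from_form:
  assumes tb: "tuple_boundary R K n \<in> {xs. length xs = n \<and> set xs \<subseteq> carrier K} \<rightarrow>
      carrier (tuples R K (n - 1))"
    and \<phi>: "wedge_form R K n (C (n - 1)) \<phi>"
    and eq: "\<And>xs. \<lbrakk>length xs = n; set xs \<subseteq> carrier K\<rbrakk> \<Longrightarrow>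
      wedge_null R K (n - 1) +>\<^bsub>tuples R K (n - 1)\<^esub> tuple_boundary R K n xs = \<phi> xs"
  shows "b n \<in> lin_map R (C n) (C (n - 1))"
    and "\<lbrakk>length xs = n; set xs \<subseteq> carrier K\<rbrakk> \<Longrightarrow> b n (w xs) = \<phi> xs"
proof -
  let ?g = "lin_ext R (tuples R K (n - 1)) (tuple_boundary R K n)"
  have g: "?g \<in> lin_map R (tuples R K n) (tuples R K (n - 1))"
    using lin_ext_lin_map[OF K.field_axioms tuples_module[OF Kv] tb] by (simp add: tuples_def)
  have gs: "?g (single R xs) = tuple_boundary R K n xs" if "length xs = n" "set xs \<subseteq> carrier K" for xs
    by (rule lin_ext_single[OF K.field_axioms tuples_module[OF Kv] tb]) (use that in auto)
  have "wedge_form R K n (C (n - 1))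
      (\<lambda>xs. wedge_null R K (n - 1) +>\<^bsub>tuples R K (n - 1)\<^esub> ?g (single R xs))"
    by (rule wedge_form_cong[OF Kv \<phi>]) (simp only: gs eq)
  note q = quot_map_wedge_null[OF Kv Kv g this]
  show "b n \<in> lin_map R (C n) (C (n - 1))"
    unfolding boundary_def by (rule q(1))
  show "b n (w xs) = \<phi> xs" if "length xs = n" "set xs \<subseteq> carrier K"
    unfolding boundary_def q(2)[OF that] gs[OF that] by (rule eq[OF that])
qed

lemma boundary_1:
  assumes "c \<in> carrier (C 1)"
  shows "b 1 c = \<zero>\<^bsub>C 0\<^esub>"
proof -
  interpret T: module R "tuples R K 0" by (rule tuples_module[OF Kv])
  interpret C0: module R "C 0" by (rule chains_module[OF Kv])
  have z: "(\<lambda>c. \<zero>\<^bsub>C 0\<^esub>) \<in> lin_map R (C 1) (C 0)"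
    by (auto intro!: lin_mapI)
  have "wedge_form R K 1 (C (1 - 1)) (\<lambda>xs. \<zero>\<^bsub>C 0\<^esub>)"
    unfolding wedge_form_def Let_def by auto
  moreover have "tuple_boundary R K 1 xs = \<zero>\<^bsub>tuples R K 0\<^esub>" if "length xs = 1" for xs
    using length_1[OF that] tuple_boundary_1 by auto
  moreover have "wedge_null R K 0 +>\<^bsub>tuples R K 0\<^esub> \<zero>\<^bsub>tuples R K 0\<^esub> = \<zero>\<^bsub>C 0\<^esub>"
    using lin_map_zero[OF T.module_axioms C0.module_axioms chains_proj_lin[OF Kv]] .
  ultimately have b: "b 1 \<in> lin_map R (C 1) (C 0)"
    "\<And>xs. \<lbrakk>length xs = 1; set xs \<subseteq> carrier K\<rbrakk> \<Longrightarrow> b 1 (w xs) = \<zero>\<^bsub>C 0\<^esub>"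
    using boundary_from_form[of 1 "\<lambda>xs. \<zero>\<^bsub>C 0\<^esub>"] by auto
  show ?thesis
    by (rule lin_span_eq_on[OF C1.module_axioms C0.module_axioms b(1) z lin_span_wedge[OF Kv] _ assms])
      (use b(2) in auto)
qed

lemma wedge_1_lin: "(\<lambda>x. w [x]) \<in> lin_map R K (C 1)"
proof (rule lin_mapI)
  show "w [x] \<in> carrier (C 1)" if "x \<in> carrier K" for x
    by (rule wedge_closed[OF Kv]) (use that in auto)
\<comment> \<open>The list with the single entry zero is a placeholder whose entry is overwritten by
  the list updates.\<close>
qed (use wedge_form_add[OF wedge_wedge_form[OF Kv], of "[\<zero>]" 1 0]
    wedge_form_smult[OF wedge_wedge_form[OF Kv], of "[\<zero>]" 1 0] in \<open>simp_all del: One_nat_def\<close>)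

text \<open>\<open>hd\<close> is linear on tuples of length one, and the map it induces on chains is
  a left inverse of \<open>x \<mapsto> wedge R K [x]\<close>.\<close>

lemma wedge_1_inj:
  assumes "x \<in> carrier K" "w [x] = \<zero>\<^bsub>C 1\<^esub>"
  shows "x = \<zero>"
proof -
  have "wedge_form R K 1 K hd"
    unfolding wedge_form_def Let_def by (auto simp: length_Suc_conv)
  then obtain h where h: "h \<in> lin_map R (C 1) K" "\<And>x. x \<in> carrier K \<Longrightarrow> h (w [x]) = x"
    using chains_universal[OF Kv K.module_axioms] by force
  have "x = h (w [x])"
    using h(2) assms(1) by simp
  also have "\<dots> = \<zero>"
    using lin_map_zero[OF C1.module_axioms K.module_axioms h(1)] assms(2) by simp
  finally show ?thesis .
qed

lemma wedge_1_surj: "(\<lambda>x. w [x]) ` carrier K = carrier (C 1)"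
proof
  show "(\<lambda>x. w [x]) ` carrier K \<subseteq> carrier (C 1)"
    using lin_map_closed[OF wedge_1_lin] by auto
  have "lin_span R (C 1) (w ` {xs. length xs = 1 \<and> set xs \<subseteq> carrier K}) \<subseteq> (\<lambda>x. w [x]) ` carrier K"
    by (rule lin_span_minimal[OF _ submodule_image[OF K.module_axioms C1.module_axioms wedge_1_lin
            K.carrier_is_submodule]]) (auto simp: length_Suc_conv)
  then show "carrier (C 1) \<subseteq> (\<lambda>x. w [x]) ` carrier K"
    by (simp add: lin_span_wedge[OF Kv])
qed

lemma wedge_2_closed: "\<lbrakk>x \<in> carrier K; y \<in> carrier K\<rbrakk> \<Longrightarrow> w [x, y] \<in> carrier (C 2)"
  by (rule wedge_closed[OF Kv]) auto

lemma wedge_2: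
  assumes "x \<in> carrier K"
  shows wedge_2_lin_right: "(\<lambda>y. w [x, y]) \<in> lin_map R K (C 2)"
    and wedge_2_lin_left: "(\<lambda>y. w [y, x]) \<in> lin_map R K (C 2)"
    and wedge_2_self: "w [x, x] = \<zero>\<^bsub>C 2\<^esub>"
  using assms wedge_form_add[OF wedge_wedge_form[OF Kv], of "[x, \<zero>]" 2 1]
    wedge_form_add[OF wedge_wedge_form[OF Kv], of "[\<zero>, x]" 2 0]
    wedge_form_smult[OF wedge_wedge_form[OF Kv], of "[x, \<zero>]" 2 1]
    wedge_form_smult[OF wedge_wedge_form[OF Kv], of "[\<zero>, x]" 2 0]
    wedge_form_alt[OF wedge_wedge_form[OF Kv], of "[x, x]" 2 0 1] wedge_2_closed
  by (auto intro!: lin_mapI)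

lemma bilinear_wedge_form:
  assumes "module R W" and r: "\<And>x. x \<in> carrier K \<Longrightarrow> (\<lambda>y. \<phi> x y) \<in> lin_map R K W"
    and l: "\<And>y. y \<in> carrier K \<Longrightarrow> (\<lambda>x. \<phi> x y) \<in> lin_map R K W"
    and "\<And>x. x \<in> carrier K \<Longrightarrow> \<phi> x x = \<zero>\<^bsub>W\<^esub>"
  shows "wedge_form R K 2 W (\<lambda>xs. \<phi> (xs ! 0) (xs ! 1))"
  unfolding wedge_form_def Let_def
proof (intro conjI ballI allI impI; clarify?)
  have i: "i = 0 \<or> i = 1" if "i < 2" for i :: nat
    using that by auto
  fix xs assume len: "length xs = 2" "set xs \<subseteq> carrier K"
  obtain x y where xs: "xs = [x, y]" "x \<in> carrier K" "y \<in> carrier K"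
    using length_2[OF len(1)] len(2) by auto
  show "\<phi> (xs ! 0) (xs ! 1) \<in> carrier W"
    using xs lin_map_closed[OF r] by simp
  { fix i u assume iu: "i < (2::nat)" "u \<in> carrier K"
    { fix v assume "v \<in> carrier K"
      then show "\<phi> (xs[i := u \<oplus> v] ! 0) (xs[i := u \<oplus> v] ! 1)
          = \<phi> (xs[i := u] ! 0) (xs[i := u] ! 1) \<oplus>\<^bsub>W\<^esub> \<phi> (xs[i := v] ! 0) (xs[i := v] ! 1)"
        using xs iu i[OF iu(1)] lin_map_add[OF r] lin_map_add[OF l] by auto }
    { fix s assume "s \<in> carrier R"
      then show "\<phi> (xs[i := s \<odot> u] ! 0) (xs[i := s \<odot> u] ! 1)
          = s \<odot>\<^bsub>W\<^esub> \<phi> (xs[i := u] ! 0) (xs[i := u] ! 1)"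
        using xs iu i[OF iu(1)] lin_map_smult[OF r] lin_map_smult[OF l] by auto } }
  { fix i j assume ij: "i < j" "j < (2::nat)" "xs ! i = xs ! j"
    then have e: "i = 0" "j = 1"
      by auto
    have "x = y"
      using ij(3) unfolding e xs(1) by simp
    then show "\<phi> (xs ! 0) (xs ! 1) = \<zero>\<^bsub>W\<^esub>"
      using xs assms(4) by simp }
qed

text \<open>The value \<open>- [x, y]\<close> is alternating because \<open>[x, x] = 0\<close>,
  which uses that two is invertible.\<close>

lemma boundary_2:
  shows boundary_2_lin: "b 2 \<in> lin_map R (C 2) (C 1)"
    and boundary_2_wedge:
      "\<lbrakk>x \<in> carrier K; y \<in> carrier K\<rbrakk> \<Longrightarrow> b 2 (w [x, y]) = \<ominus>\<^bsub>C 1\<^esub> w [x \<otimes> y]"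
proof -
  interpret T: module R "tuples R K 1" by (rule tuples_module[OF Kv])
  let ?\<phi> = "\<lambda>xs. \<ominus>\<^bsub>C 1\<^esub> w [xs ! 0 \<otimes> xs ! 1]"
  have neg: "(\<lambda>x. \<ominus>\<^bsub>C 1\<^esub> w [x]) \<in> lin_map R K (C 1)"
    by (rule lin_mapI)
      (simp_all add: lin_mapD[OF wedge_1_lin] C1.minus_add C1.smult_r_minus del: One_nat_def)
  have form: "wedge_form R K 2 (C 1) ?\<phi>"
    by (intro bilinear_wedge_form C1.module_axioms lin_map_comp[OF K.lie_lin_map(1) neg]
        lin_map_comp[OF K.lie_lin_map(2) neg])
      (simp_all add: K.lie_self[OF two] lin_map_zero[OF K.module_axioms C1.module_axioms neg]
        del: One_nat_def)
  have e: "2 - 1 = (1::nat)"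
    by simp
  have cl: "single R [x \<otimes> y] \<in> carrier (tuples R K 1)" if "x \<in> carrier K" "y \<in> carrier K" for x y
    using that K.lie_closed by (intro single_tuple_closed[OF Kv]) auto
  have tb: "tuple_boundary R K 2 \<in> {xs. length xs = 2 \<and> set xs \<subseteq> carrier K} \<rightarrow> carrier (tuples R K 1)"
    using cl by (auto dest!: length_2 simp: tuple_boundary_2 simp del: One_nat_def)
  have eq: "wedge_null R K 1 +>\<^bsub>tuples R K 1\<^esub> tuple_boundary R K 2 xs = ?\<phi> xs"
    if xs: "length xs = 2" "set xs \<subseteq> carrier K" for xs
  proof -
    obtain x y where xy: "xs = [x, y]" "x \<in> carrier K" "y \<in> carrier K"
      using length_2[OF xs(1)] xs(2) by auto
    show ?thesis
      using xy cl[of x y]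
        lin_map_a_inv[OF T.module_axioms C1.module_axioms chains_proj_lin[OF Kv], of "single R [x \<otimes> y]"]
      by (simp add: tuple_boundary_2 wedge_eq[OF Kv, of _ 1] del: One_nat_def)
  qed
  note B = boundary_from_form[of 2, unfolded e, OF tb form eq]
  show "b 2 \<in> lin_map R (C 2) (C 1)"
    by (rule B(1))
  show "b 2 (w [x, y]) = \<ominus>\<^bsub>C 1\<^esub> w [x \<otimes> y]" if "x \<in> carrier K" "y \<in> carrier K"
    using B(2)[of "[x, y]"] that by simp
qed

text \<open>When two entries agree, one of the three brackets vanishes and the remaining terms
  cancel. For equal neighbours they cancel as they stand; for the outer two entries a bracket has to
  be flipped first.\<close>

lemma boundary_3:
  shows boundary_3_lin: "b 3 \<in> lin_map R (C 3) (C 2)"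
    and boundary_3_wedge:
      "\<lbrakk>x \<in> carrier K; y \<in> carrier K; z \<in> carrier K\<rbrakk> \<Longrightarrow> b 3 (w [x, y, z]) =
        \<ominus>\<^bsub>C 2\<^esub> w [x \<otimes> y, \<alpha> z] \<oplus>\<^bsub>C 2\<^esub> (w [x \<otimes> z, \<alpha> y] \<oplus>\<^bsub>C 2\<^esub> \<ominus>\<^bsub>C 2\<^esub> w [y \<otimes> z, \<alpha> x])"
proof -
  interpret T: module R "tuples R K 2" by (rule tuples_module[OF Kv])
  let ?f = "\<lambda>x y z. \<ominus>\<^bsub>C 2\<^esub> w [x \<otimes> y, \<alpha> z] \<oplus>\<^bsub>C 2\<^esub> (w [x \<otimes> z, \<alpha> y] \<oplus>\<^bsub>C 2\<^esub> \<ominus>\<^bsub>C 2\<^esub> w [y \<otimes> z, \<alpha> x])"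
  let ?\<phi> = "\<lambda>xs. ?f (xs ! 0) (xs ! 1) (xs ! 2)"
  note cl = K.lie_closed K.twist_closed wedge_2_closed
  note add = lin_map_add[OF wedge_2_lin_right] lin_map_add[OF wedge_2_lin_left]
  note smult = lin_map_smult[OF wedge_2_lin_right] lin_map_smult[OF wedge_2_lin_left]
  note s = add smult K.lie_add_left K.lie_add_right K.lie_smult_left K.lie_smult_right
    K.twist_add K.twist_smult C2.minus_add C2.smult_r_minus C2.smult_r_distr
  have l_zero: "w [\<zero>, y] = \<zero>\<^bsub>C 2\<^esub>" if "y \<in> carrier K" for y
    using lin_map_zero[OF K.module_axioms C2.module_axioms wedge_2_lin_left[OF that]] .
  have l_neg: "w [\<ominus> x, y] = \<ominus>\<^bsub>C 2\<^esub> w [x, y]" if "x \<in> carrier K" "y \<in> carrier K" for x y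
    using lin_map_a_inv[OF K.module_axioms C2.module_axioms wedge_2_lin_left[OF that(2)] that(1)] .
  have form: "wedge_form R K 3 (C 2) ?\<phi>"
    unfolding wedge_form_def Let_def
  proof (intro conjI ballI allI impI; clarify?)
    have i: "i = 0 \<or> i = 1 \<or> i = 2" if "i < 3" for i :: nat
      using that by auto
    fix xs assume l: "length xs = 3" "set xs \<subseteq> carrier K"
    obtain x y z where xs: "xs = [x, y, z]" "x \<in> carrier K" "y \<in> carrier K" "z \<in> carrier K"
      using length_3[OF l(1)] l(2) by auto
    show "?\<phi> xs \<in> carrier (C 2)"
      using xs cl by simp
    { fix i u assume iu: "i < (3::nat)" "u \<in> carrier K"
      { fix v assume "v \<in> carrier K"
        then show "?\<phi> (xs[i := u \<oplus> v]) = ?\<phi> (xs[i := u]) \<oplus>\<^bsub>C 2\<^esub> ?\<phi> (xs[i := v])"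
          using i[OF iu(1)] iu(2) xs by (elim disjE) (simp_all add: cl s C2.a_ac) }
      { fix r assume "r \<in> carrier R"
        then show "?\<phi> (xs[i := r \<odot> u]) = r \<odot>\<^bsub>C 2\<^esub> ?\<phi> (xs[i := u])"
          using i[OF iu(1)] iu(2) xs by (elim disjE) (simp_all add: cl s) } }
    { fix i j assume ij: "i < j" "j < (3::nat)" "xs ! i = xs ! j"
      then consider "i = 0" "j = 1" | "i = 0" "j = 2" | "i = 1" "j = 2"
        using i by fastforce
      then show "?\<phi> xs = \<zero>\<^bsub>C 2\<^esub>"
      proof cases
        case 1
        then have "x = y" using ij xs by simp
        then show ?thesis
          using xs by (simp add: cl K.lie_self[OF two] l_zero C2.r_neg)
      next
        case 2
        then have "x = z" using ij xs by simp
        moreover have "w [y \<otimes> x, \<alpha> x] = \<ominus>\<^bsub>C 2\<^esub> w [x \<otimes> y, \<alpha> x]"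
          using K.lie_antisym[of y x] l_neg[of "x \<otimes> y" "\<alpha> x"] xs cl by simp
        ultimately show ?thesis
          using xs by (simp add: cl K.lie_self[OF two] l_zero C2.l_neg)
      next
        case 3
        then have "y = z" using ij xs by simp
        then show ?thesis
          using xs by (simp add: cl K.lie_self[OF two] l_zero C2.l_neg)
      qed }
  qed
  have e: "3 - 1 = (2::nat)"
    by simp
  have w2: "w [u, v] = wedge_null R K 2 +>\<^bsub>tuples R K 2\<^esub> single R [u, v]" for u v
    by (rule wedge_eq[OF Kv]) simp
  have sc: "single R [x \<otimes> y, \<alpha> z] \<in> carrier (tuples R K 2)"
    if "x \<in> carrier K" "y \<in> carrier K" "z \<in> carrier K" for x y z
    using that cl by (intro single_tuple_closed[OF Kv]) auto
  have tb: "tuple_boundary R K 3 \<in> {xs. length xs = 3 \<and> set xs \<subseteq> carrier K} \<rightarrow> carrier (tuples R K 2)"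
    by (auto dest!: length_3 simp: tuple_boundary_3 sc)
  have eq: "wedge_null R K 2 +>\<^bsub>tuples R K 2\<^esub> tuple_boundary R K 3 xs = ?\<phi> xs"
    if xs: "length xs = 3" "set xs \<subseteq> carrier K" for xs
  proof -
    obtain x y z where xy: "xs = [x, y, z]" "x \<in> carrier K" "y \<in> carrier K" "z \<in> carrier K"
      using length_3[OF xs(1)] xs(2) by auto
    show ?thesis
      using xy sc lin_map_a_inv[OF T.module_axioms C2.module_axioms chains_proj_lin[OF Kv]]
        lin_map_add[OF chains_proj_lin[OF Kv], of _ 2]
      by (simp add: tuple_boundary_3 w2)
  qed
  note B = boundary_from_form[of 3, unfolded e, OF tb form eq]
  show "b 3 \<in> lin_map R (C 3) (C 2)"
    by (rule B(1))
  show "b 3 (w [x, y, z]) = ?f x y z" if "x \<in> carrier K" "y \<in> carrier K" "z \<in> carrier K"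
    using B(2)[of "[x, y, z]"] that by simp
qed

end

lemma chain_map_boundary:
  assumes K: "hom_lie_algebra R K" and K': "hom_lie_algebra R K'"
    and two: "\<one>\<^bsub>R\<^esub> \<oplus>\<^bsub>R\<^esub> \<one>\<^bsub>R\<^esub> \<noteq> \<zero>\<^bsub>R\<^esub>" and f: "f \<in> hom_lie_hom R K K'"
  shows chain_map_boundary_2: "c \<in> carrier (chains R K 2) \<Longrightarrow>
      chain_map R K' 1 f (boundary R K 2 c) = boundary R K' 2 (chain_map R K' 2 f c)"
    and chain_map_boundary_3: "c \<in> carrier (chains R K 3) \<Longrightarrow>
      chain_map R K' 2 f (boundary R K 3 c) = boundary R K' 3 (chain_map R K' 3 f c)"
proof -
  note Kv = hom_lie_algebra_vec[OF K] and Kv' = hom_lie_algebra_vec[OF K']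
  note cm = chains_module[OF Kv] and cm' = chains_module[OF Kv']
  note fs = hom_lie_homD[OF f]
  note m = chain_map_lin[OF Kv Kv' fs(2)] and mw = chain_map_wedge[OF Kv Kv' fs(2)]
  note cl = hom_lie_algebra.lie_closed[OF K] hom_vector_space.twist_closed[OF Kv]
  note wc = wedge_closed[OF Kv]
  show "chain_map R K' 1 f (boundary R K 2 c) = boundary R K' 2 (chain_map R K' 2 f c)"
    if c: "c \<in> carrier (chains R K 2)"
  proof (rule lin_span_eq_on[OF cm cm' lin_map_comp[OF boundary_2_lin[OF K two] m]
        lin_map_comp[OF m boundary_2_lin[OF K' two]] lin_span_wedge[OF Kv] _ c])
    fix u assume "u \<in> wedge R K ` {xs. length xs = 2 \<and> set xs \<subseteq> carrier K}"
    then obtain x y where u: "u = wedge R K [x, y]" "x \<in> carrier K" "y \<in> carrier K"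
      by (auto dest!: length_2[OF K two])
    have "wedge R K [x \<otimes>\<^bsub>K\<^esub> y] \<in> carrier (chains R K 1)"
      using u cl by (intro wc) auto
    then show "chain_map R K' 1 f (boundary R K 2 u) = boundary R K' 2 (chain_map R K' 2 f u)"
      using u cl fs(3) mw[of _ 1]
      by (simp add: boundary_2_wedge[OF K two] boundary_2_wedge[OF K' two] mw[of _ 2] fs(5)
          lin_map_a_inv[OF cm cm' m] del: One_nat_def)
  qed
  show "chain_map R K' 2 f (boundary R K 3 c) = boundary R K' 3 (chain_map R K' 3 f c)"
    if c: "c \<in> carrier (chains R K 3)"
  proof (rule lin_span_eq_on[OF cm cm' lin_map_comp[OF boundary_3_lin[OF K two] m]
        lin_map_comp[OF m boundary_3_lin[OF K' two]] lin_span_wedge[OF Kv] _ c])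
    interpret C2: module R "chains R K 2" by (rule cm)
    fix u assume "u \<in> wedge R K ` {xs. length xs = 3 \<and> set xs \<subseteq> carrier K}"
    then obtain x y z where u: "u = wedge R K [x, y, z]" "x \<in> carrier K" "y \<in> carrier K" "z \<in> carrier K"
      by (auto dest!: length_3[OF K two])
    have "wedge R K [x \<otimes>\<^bsub>K\<^esub> y, \<alpha>\<^bsub>K\<^esub> z] \<in> carrier (chains R K 2)"
      "wedge R K [x \<otimes>\<^bsub>K\<^esub> z, \<alpha>\<^bsub>K\<^esub> y] \<in> carrier (chains R K 2)"
      "wedge R K [y \<otimes>\<^bsub>K\<^esub> z, \<alpha>\<^bsub>K\<^esub> x] \<in> carrier (chains R K 2)"
      using u cl by (auto intro!: wc)
    then show "chain_map R K' 2 f (boundary R K 3 u) = boundary R K' 3 (chain_map R K' 3 f u)"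
      using u cl fs(3)
      by (simp add: boundary_3_wedge[OF K two] boundary_3_wedge[OF K' two] mw fs(4,5)
          lin_map_a_inv[OF cm cm' m] lin_map_add[OF m])
  qed
qed

text \<open>When \<open>M\<close> is all of \<open>K\<close>, antisymmetry turns both mixed clauses
  into the same cyclic identity. That symmetric identity is what \<open>d_3\<close> provides, and
  the form of the split case is verified in the same shape.\<close>

lemma exterior_form_carrierI:
  assumes K: "hom_lie_algebra R K" and W: "module R W"
    and r: "\<And>x. x \<in> carrier K \<Longrightarrow> (\<lambda>y. \<phi> x y) \<in> lin_map R K W"
    and l: "\<And>y. y \<in> carrier K \<Longrightarrow> (\<lambda>x. \<phi> x y) \<in> lin_map R K W"
    and self: "\<And>x. x \<in> carrier K \<Longrightarrow> \<phi> x x = \<zero>\<^bsub>W\<^esub>"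
    and cyc: "\<And>x y z. \<lbrakk>x \<in> carrier K; y \<in> carrier K; z \<in> carrier K\<rbrakk> \<Longrightarrow>
      \<phi> (x \<otimes>\<^bsub>K\<^esub> y) (\<alpha>\<^bsub>K\<^esub> z) \<oplus>\<^bsub>W\<^esub> \<phi> (y \<otimes>\<^bsub>K\<^esub> z) (\<alpha>\<^bsub>K\<^esub> x) \<oplus>\<^bsub>W\<^esub> \<phi> (z \<otimes>\<^bsub>K\<^esub> x) (\<alpha>\<^bsub>K\<^esub> y) = \<zero>\<^bsub>W\<^esub>"
  shows "exterior_form R K (carrier K) W \<phi>"
proof -
  interpret K: hom_lie_algebra R K by (rule K)
  interpret W: module R W by (rule W)
  note cl = K.lie_closed K.twist_closed
  have c: "\<phi> x y \<in> carrier W" if "x \<in> carrier K" "y \<in> carrier K" for x y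
    by (rule lin_map_closed[OF r[OF that(1)] that(2)])
  have anti: "\<phi> x y = \<ominus>\<^bsub>W\<^esub> \<phi> y x" if "x \<in> carrier K" "y \<in> carrier K" for x y
  proof -
    have "\<zero>\<^bsub>W\<^esub> = \<phi> (x \<oplus>\<^bsub>K\<^esub> y) (x \<oplus>\<^bsub>K\<^esub> y)"
      using self that by simp
    also have "\<dots> = \<phi> x (x \<oplus>\<^bsub>K\<^esub> y) \<oplus>\<^bsub>W\<^esub> \<phi> y (x \<oplus>\<^bsub>K\<^esub> y)"
      using that by (intro lin_map_add[OF l]) auto
    also have "\<dots> = \<phi> x y \<oplus>\<^bsub>W\<^esub> \<phi> y x"
      using that c by (simp add: lin_map_add[OF r] self)
    finally show ?thesis
      using W.minus_equality[of "\<phi> x y" "\<phi> y x"] c that by simp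
  qed
  have solve: "u = \<ominus>\<^bsub>W\<^esub> v \<ominus>\<^bsub>W\<^esub> t" if "u \<oplus>\<^bsub>W\<^esub> v \<oplus>\<^bsub>W\<^esub> t = \<zero>\<^bsub>W\<^esub>"
    "u \<in> carrier W" "v \<in> carrier W" "t \<in> carrier W" for u v t
  proof -
    have "u \<oplus>\<^bsub>W\<^esub> (v \<oplus>\<^bsub>W\<^esub> t) = \<zero>\<^bsub>W\<^esub>"
      using that by (simp add: W.a_assoc)
    then have "u = \<ominus>\<^bsub>W\<^esub> (v \<oplus>\<^bsub>W\<^esub> t)"
      using W.minus_equality[of u "v \<oplus>\<^bsub>W\<^esub> t"] that by simp
    then show ?thesis
      using that by (simp add: W.minus_add a_minus_def)
  qed
  show ?thesis
    unfolding exterior_form_def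
  proof (intro conjI ballI)
    fix x assume x: "x \<in> carrier K"
    show "(\<lambda>y. \<phi> x y) \<in> lin_map R K W" "\<phi> x x = \<zero>\<^bsub>W\<^esub>"
      using r self x by auto
    show "(\<lambda>m. \<phi> m x) \<in> lin_map R (K\<lparr>carrier := carrier K\<rparr>) W"
      by (rule lin_map_restrict_domain[OF l[OF x]]) simp
    fix y assume y: "y \<in> carrier K"
    { fix z assume z: "z \<in> carrier K"
      have "\<phi> (x \<otimes>\<^bsub>K\<^esub> y) (\<alpha>\<^bsub>K\<^esub> z) = \<ominus>\<^bsub>W\<^esub> \<phi> (y \<otimes>\<^bsub>K\<^esub> z) (\<alpha>\<^bsub>K\<^esub> x) \<ominus>\<^bsub>W\<^esub> \<phi> (z \<otimes>\<^bsub>K\<^esub> x) (\<alpha>\<^bsub>K\<^esub> y)"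
        using x y z cl by (intro solve cyc c) auto
      also have "\<ominus>\<^bsub>W\<^esub> \<phi> (y \<otimes>\<^bsub>K\<^esub> z) (\<alpha>\<^bsub>K\<^esub> x) = \<phi> (\<alpha>\<^bsub>K\<^esub> x) (y \<otimes>\<^bsub>K\<^esub> z)"
        using x y z cl by (intro anti[symmetric]) auto
      also have "\<phi> (z \<otimes>\<^bsub>K\<^esub> x) (\<alpha>\<^bsub>K\<^esub> y) = \<ominus>\<^bsub>W\<^esub> \<phi> (\<alpha>\<^bsub>K\<^esub> y) (z \<otimes>\<^bsub>K\<^esub> x)"
        using x y z cl by (intro anti) auto
      also have "\<dots> = \<phi> (\<alpha>\<^bsub>K\<^esub> y) (\<ominus>\<^bsub>K\<^esub> (z \<otimes>\<^bsub>K\<^esub> x))"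
        using x y z cl by (intro lin_map_a_inv[OF K.module_axioms W r, symmetric]) auto
      also have "\<ominus>\<^bsub>K\<^esub> (z \<otimes>\<^bsub>K\<^esub> x) = x \<otimes>\<^bsub>K\<^esub> z"
        using x z by (intro K.lie_antisym[symmetric])
      finally show "\<phi> (x \<otimes>\<^bsub>K\<^esub> y) (\<alpha>\<^bsub>K\<^esub> z)
          = \<phi> (\<alpha>\<^bsub>K\<^esub> x) (y \<otimes>\<^bsub>K\<^esub> z) \<ominus>\<^bsub>W\<^esub> \<phi> (\<alpha>\<^bsub>K\<^esub> y) (x \<otimes>\<^bsub>K\<^esub> z)" . }
    { fix z assume z: "z \<in> carrier K"
      have "\<phi> (\<alpha>\<^bsub>K\<^esub> x) (y \<otimes>\<^bsub>K\<^esub> z) = \<ominus>\<^bsub>W\<^esub> \<phi> (y \<otimes>\<^bsub>K\<^esub> z) (\<alpha>\<^bsub>K\<^esub> x)"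
        using x y z cl by (intro anti) auto
      also have "\<phi> (y \<otimes>\<^bsub>K\<^esub> z) (\<alpha>\<^bsub>K\<^esub> x) = \<ominus>\<^bsub>W\<^esub> \<phi> (z \<otimes>\<^bsub>K\<^esub> x) (\<alpha>\<^bsub>K\<^esub> y) \<ominus>\<^bsub>W\<^esub> \<phi> (x \<otimes>\<^bsub>K\<^esub> y) (\<alpha>\<^bsub>K\<^esub> z)"
        using x y z cl by (intro solve cyc c) auto
      also have "x \<otimes>\<^bsub>K\<^esub> y = \<ominus>\<^bsub>K\<^esub> (y \<otimes>\<^bsub>K\<^esub> x)"
        using x y by (intro K.lie_antisym)
      also have "\<phi> (\<ominus>\<^bsub>K\<^esub> (y \<otimes>\<^bsub>K\<^esub> x)) (\<alpha>\<^bsub>K\<^esub> z) = \<ominus>\<^bsub>W\<^esub> \<phi> (y \<otimes>\<^bsub>K\<^esub> x) (\<alpha>\<^bsub>K\<^esub> z)"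
        using x y z cl by (intro lin_map_a_inv[OF K.module_axioms W l]) auto
      also have "\<ominus>\<^bsub>W\<^esub> (\<ominus>\<^bsub>W\<^esub> \<phi> (z \<otimes>\<^bsub>K\<^esub> x) (\<alpha>\<^bsub>K\<^esub> y) \<ominus>\<^bsub>W\<^esub> \<ominus>\<^bsub>W\<^esub> \<phi> (y \<otimes>\<^bsub>K\<^esub> x) (\<alpha>\<^bsub>K\<^esub> z))
          = \<phi> (z \<otimes>\<^bsub>K\<^esub> x) (\<alpha>\<^bsub>K\<^esub> y) \<ominus>\<^bsub>W\<^esub> \<phi> (y \<otimes>\<^bsub>K\<^esub> x) (\<alpha>\<^bsub>K\<^esub> z)"
        using x y z cl c by (simp add: a_minus_def W.minus_add)
      finally show "\<phi> (\<alpha>\<^bsub>K\<^esub> x) (y \<otimes>\<^bsub>K\<^esub> z)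
          = \<phi> (z \<otimes>\<^bsub>K\<^esub> x) (\<alpha>\<^bsub>K\<^esub> y) \<ominus>\<^bsub>W\<^esub> \<phi> (y \<otimes>\<^bsub>K\<^esub> x) (\<alpha>\<^bsub>K\<^esub> z)" . }
  qed
qed

text \<open>
  The quotient of the chains of degree two by the boundaries plays the role of the exterior square
  of \<open>K\<close>; its second homology is the kernel of the commutator on it.
\<close>

definition chain_quot ::
  "('a, 'r) ring_scheme \<Rightarrow> ('a, 'b) hom_alg \<Rightarrow> ('a, ('b list \<Rightarrow> 'a) set set) hom_alg" where
  "chain_quot R K = quot (chains R K 2) (boundaries R K 2)"

definition chain_class ::
  "('a, 'r) ring_scheme \<Rightarrow> ('a, 'b) hom_alg \<Rightarrow> 'b \<Rightarrow> 'b \<Rightarrow> ('b list \<Rightarrow> 'a) set set" where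
  "chain_class R K x y = boundaries R K 2 +>\<^bsub>chains R K 2\<^esub> wedge R K [x, y]"

text \<open>Chosen from the universal property of \<open>chain_quot\<close>; the prescribed values
  on the spanning classes determine it there. Unlike \<open>boundary\<close> it takes values in
  \<open>K\<close> itself, so that it can be compared with \<open>commutator_map\<close>.\<close>

definition chain_commutator ::
  "('a, 'r) ring_scheme \<Rightarrow> ('a, 'b) hom_alg \<Rightarrow> ('b list \<Rightarrow> 'a) set set \<Rightarrow> 'b" where
  "chain_commutator R K = (SOME h. h \<in> lin_map R (chain_quot R K) K \<and>
     (\<forall>x\<in>carrier K. \<forall>y\<in>carrier K. h (chain_class R K x y) = x \<otimes>\<^bsub>K\<^esub> y))"

context
  fixes R :: "('a, 'r) ring_scheme" and K :: "('a, 'b) hom_alg" (structure)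
  assumes K: "hom_lie_algebra R K" and two: "\<one>\<^bsub>R\<^esub> \<oplus>\<^bsub>R\<^esub> \<one>\<^bsub>R\<^esub> \<noteq> \<zero>\<^bsub>R\<^esub>"
begin

interpretation K: hom_lie_algebra R K by (rule K)

private lemmas K_vec = K.hom_vector_space_axioms

private abbreviation (input) wd where "wd \<equiv> wedge R K"
private abbreviation (input) Ch where "Ch \<equiv> chains R K"
private abbreviation (input) bd where "bd \<equiv> boundary R K"
private abbreviation (input) Bd where "Bd \<equiv> boundaries R K"
private abbreviation (input) Q where "Q \<equiv> chain_quot R K"

interpretation C1: module R "Ch 1" by (rule chains_module[OF K_vec])
interpretation C2: module R "Ch 2" by (rule chains_module[OF K_vec])
interpretation C3: module R "Ch 3" by (rule chains_module[OF K_vec])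

lemma boundaries_1: "Bd 1 = bd 2 ` carrier (Ch 2)"
proof -
  have e: "1 + 1 = (2::nat)" by simp
  show ?thesis
    unfolding boundaries_def e ..
qed

lemma boundaries_2: "Bd 2 = bd 3 ` carrier (Ch 3)"
  by (simp add: boundaries_def)

lemma boundaries_1_submodule: "submodule (Bd 1) R (Ch 1)"
  unfolding boundaries_1
  by (rule submodule_image[OF C2.module_axioms C1.module_axioms boundary_2_lin[OF K two]
        C2.carrier_is_submodule])

lemma boundaries_2_submodule: "submodule (Bd 2) R (Ch 2)"
  unfolding boundaries_2
  by (rule submodule_image[OF C3.module_axioms C2.module_axioms boundary_3_lin[OF K two]
        C3.carrier_is_submodule])

lemma boundaries_1_twist: "c \<in> Bd 1 \<Longrightarrow> \<alpha>\<^bsub>Ch 1\<^esub> c \<in> Bd 1"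
  unfolding boundaries_1 chains_twist[OF K_vec]
  using chain_map_boundary_2[OF K K two twist_hom_lie_hom[OF K]]
    lin_map_closed[OF chain_map_lin[OF K_vec K_vec twist_lin_map[OF K_vec]]] by auto

lemma boundaries_2_twist: "c \<in> Bd 2 \<Longrightarrow> \<alpha>\<^bsub>Ch 2\<^esub> c \<in> Bd 2"
  unfolding boundaries_2 chains_twist[OF K_vec]
  using chain_map_boundary_3[OF K K two twist_hom_lie_hom[OF K]]
    lin_map_closed[OF chain_map_lin[OF K_vec K_vec twist_lin_map[OF K_vec]]] by auto

lemma chain_quot_vec: "hom_vector_space R Q"
  and chain_quot_proj: "(\<lambda>c. Bd 2 +>\<^bsub>Ch 2\<^esub> c) \<in> hom_vec_hom R (Ch 2) Q"
  unfolding chain_quot_def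
  by (rule hom_vector_space_quot(1)[OF chains_vec[OF K_vec] boundaries_2_submodule], erule boundaries_2_twist)
    (rule hom_vector_space_quot(2)[OF chains_vec[OF K_vec] boundaries_2_submodule], erule boundaries_2_twist)

lemmas chain_quot_carrier = quot_carrier[OF C2.module_axioms boundaries_2_submodule,
    folded chain_quot_def]

interpretation Q: module R Q by (rule hom_vector_space_module[OF chain_quot_vec])

lemmas chain_quot_module = Q.module_axioms

lemma chain_class_closed: "\<lbrakk>x \<in> carrier K; y \<in> carrier K\<rbrakk> \<Longrightarrow> chain_class R K x y \<in> carrier Q"
  unfolding chain_class_def
  by (rule lin_map_closed[OF hom_vec_hom_lin_map[OF chain_quot_proj] wedge_2_closed[OF K two]])

lemma chain_class_twist:
  assumes "x \<in> carrier K" "y \<in> carrier K"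
  shows "\<alpha>\<^bsub>Q\<^esub> (chain_class R K x y) = chain_class R K (\<alpha> x) (\<alpha> y)"
  using hom_vec_hom_twist[OF chain_quot_proj wedge_2_closed[OF K two assms]] assms
    chain_map_wedge[OF K_vec K_vec twist_lin_map[OF K_vec], of "[x, y]" 2]
  by (simp add: chain_class_def chains_twist[OF K_vec])

text \<open>Up to the flip of \<open>[x, z]\<close>, the cyclic sum is the class of
  \<open>- d_3 (x \<and> y \<and> z)\<close>; bilinearity and alternation come from the exterior
  power.\<close>

lemma chain_class_form: "exterior_form R K (carrier K) Q (chain_class R K)"
proof (rule exterior_form_carrierI[OF K Q.module_axioms])
  note p = hom_vec_hom_lin_map[OF chain_quot_proj]
  fix x assume x: "x \<in> carrier K"
  show "(\<lambda>y. chain_class R K x y) \<in> lin_map R K Q" "(\<lambda>y. chain_class R K y x) \<in> lin_map R K Q"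
    unfolding chain_class_def
    by (rule lin_map_comp[OF wedge_2_lin_right[OF K two x] p])
      (rule lin_map_comp[OF wedge_2_lin_left[OF K two x] p])
  show "chain_class R K x x = \<zero>\<^bsub>Q\<^esub>"
    unfolding chain_class_def wedge_2_self[OF K two x]
    by (rule lin_map_zero[OF C2.module_axioms Q.module_axioms p])
  fix y z assume yz: "y \<in> carrier K" "z \<in> carrier K"
  note cl = K.lie_closed K.twist_closed x yz
  let ?u = "wd [x \<otimes> y, \<alpha> z]" and ?v = "wd [x \<otimes> z, \<alpha> y]" and ?t = "wd [y \<otimes> z, \<alpha> x]"
  have uvt: "?u \<in> carrier (Ch 2)" "?v \<in> carrier (Ch 2)" "?t \<in> carrier (Ch 2)"
    using cl by (auto intro!: wedge_2_closed[OF K two])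
  have "wd [z \<otimes> x, \<alpha> y] = wd [\<ominus> (x \<otimes> z), \<alpha> y]"
    using K.lie_antisym[OF yz(2) x] by simp
  also have "\<dots> = \<ominus>\<^bsub>Ch 2\<^esub> ?v"
    using cl by (intro lin_map_a_inv[OF K.module_axioms C2.module_axioms wedge_2_lin_left[OF K two]]) auto
  finally have v: "wd [z \<otimes> x, \<alpha> y] = \<ominus>\<^bsub>Ch 2\<^esub> ?v" .
  have "bd 3 (wd [x, y, z]) \<in> Bd 2"
    unfolding boundaries_2 using cl by (intro imageI wedge_closed[OF K_vec]) auto
  then have "\<ominus>\<^bsub>Ch 2\<^esub> (bd 3 (wd [x, y, z])) \<in> Bd 2"
    by (rule submodule_a_inv[OF boundaries_2_submodule])
  also have "\<ominus>\<^bsub>Ch 2\<^esub> (bd 3 (wd [x, y, z])) = ?u \<oplus>\<^bsub>Ch 2\<^esub> ?t \<oplus>\<^bsub>Ch 2\<^esub> \<ominus>\<^bsub>Ch 2\<^esub> ?v"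
    using uvt cl by (simp add: boundary_3_wedge[OF K two] C2.minus_add C2.a_ac)
  finally have "Bd 2 +>\<^bsub>Ch 2\<^esub> (?u \<oplus>\<^bsub>Ch 2\<^esub> ?t \<oplus>\<^bsub>Ch 2\<^esub> \<ominus>\<^bsub>Ch 2\<^esub> ?v) = \<zero>\<^bsub>Q\<^esub>"
    using coset_zero_iff[OF C2.module_axioms boundaries_2_submodule] uvt
    by (simp add: chain_quot_def quot_zero[OF C2.module_axioms boundaries_2_submodule])
  then show "chain_class R K (x \<otimes> y) (\<alpha> z) \<oplus>\<^bsub>Q\<^esub> chain_class R K (y \<otimes> z) (\<alpha> x)
      \<oplus>\<^bsub>Q\<^esub> chain_class R K (z \<otimes> x) (\<alpha> y) = \<zero>\<^bsub>Q\<^esub>"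
    using uvt by (simp add: chain_class_def v lin_map_add[OF p])
qed

lemma wedge_2_gens:
  "wd ` {xs. length xs = 2 \<and> set xs \<subseteq> carrier K} = {wd [x, y] | x y. x \<in> carrier K \<and> y \<in> carrier K}"
proof
  show "wd ` {xs. length xs = 2 \<and> set xs \<subseteq> carrier K}
      \<subseteq> {wd [x, y] | x y. x \<in> carrier K \<and> y \<in> carrier K}"
    by (auto dest!: length_2[OF K two]) blast
  show "{wd [x, y] | x y. x \<in> carrier K \<and> y \<in> carrier K}
      \<subseteq> wd ` {xs. length xs = 2 \<and> set xs \<subseteq> carrier K}"
    by (auto intro!: imageI)
qed

lemma lin_span_chain_class:
  "lin_span R Q {chain_class R K x y | x y. x \<in> carrier K \<and> y \<in> carrier K} = carrier Q"
proof -
  have "{chain_class R K x y | x y. x \<in> carrier K \<and> y \<in> carrier K}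
      = (\<lambda>c. Bd 2 +>\<^bsub>Ch 2\<^esub> c) ` {wd [x, y] | x y. x \<in> carrier K \<and> y \<in> carrier K}"
    by (auto simp: chain_class_def)
  moreover have "{wd [x, y] | x y. x \<in> carrier K \<and> y \<in> carrier K} \<subseteq> carrier (Ch 2)"
    using wedge_2_closed[OF K two] by auto
  ultimately show ?thesis
    using lin_span_image[OF C2.module_axioms Q.module_axioms hom_vec_hom_lin_map[OF chain_quot_proj]]
      lin_span_wedge[OF K_vec, of 2] chain_quot_carrier by (simp add: wedge_2_gens)
qed

text \<open>A form is bilinear and alternating, hence factors through \<open>K \<and> K\<close>; its
  mixed clause combined with antisymmetry makes the three terms of \<open>d_3\<close> cancel. This
  is the property that \<open>exterior_universal\<close> states for \<open>M = K\<close>.\<close>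

lemma chain_quot_universal:
  assumes W: "module R W" and \<phi>: "exterior_form R K (carrier K) W \<phi>"
  shows "\<exists>h. h \<in> lin_map R Q W \<and>
    (\<forall>x\<in>carrier K. \<forall>y\<in>carrier K. h (chain_class R K x y) = \<phi> x y)"
proof -
  interpret W: module R W by (rule W)
  have l: "(\<lambda>x. \<phi> x y) \<in> lin_map R K W" if "y \<in> carrier K" for y
    using exterior_form_lin_left[OF \<phi> that] by (simp add: lin_map_def)
  have "wedge_form R K 2 W (\<lambda>xs. \<phi> (xs ! 0) (xs ! 1))"
    by (rule bilinear_wedge_form[OF K two W exterior_form_lin_right[OF \<phi>] l exterior_form_self[OF \<phi>]])
  then obtain h where h: "h \<in> lin_map R (Ch 2) W"
    "\<And>xs. length xs = 2 \<and> set xs \<subseteq> carrier K \<Longrightarrow> h (wd xs) = \<phi> (xs ! 0) (xs ! 1)"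
    using chains_universal[OF K_vec W] by blast
  have h2: "h (wd [x, y]) = \<phi> x y" if "x \<in> carrier K" "y \<in> carrier K" for x y
    using h(2)[of "[x, y]"] that by simp
  have z: "(\<lambda>c. \<zero>\<^bsub>W\<^esub>) \<in> lin_map R (Ch 3) W"
    by (auto intro!: lin_mapI)
  have hb: "h (bd 3 c) = \<zero>\<^bsub>W\<^esub>" if c: "c \<in> carrier (Ch 3)" for c
  proof (rule lin_span_eq_on[OF C3.module_axioms W lin_map_comp[OF boundary_3_lin[OF K two] h(1)] z
        lin_span_wedge[OF K_vec] _ c])
    fix u assume "u \<in> wd ` {xs. length xs = 3 \<and> set xs \<subseteq> carrier K}"
    then obtain x y z where u: "u = wd [x, y, z]" "x \<in> carrier K" "y \<in> carrier K" "z \<in> carrier K"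
      by (auto dest!: length_3[OF K two])
    note cl = K.lie_closed K.twist_closed u(2-)
    note M = hom_lie_ideal_carrier[OF K]
    have wc: "wd [x \<otimes> y, \<alpha> z] \<in> carrier (Ch 2)" "wd [x \<otimes> z, \<alpha> y] \<in> carrier (Ch 2)"
      "wd [y \<otimes> z, \<alpha> x] \<in> carrier (Ch 2)"
      using cl by (auto intro!: wedge_2_closed[OF K two])
    have pc: "\<phi> (x \<otimes> y) (\<alpha> z) \<in> carrier W" "\<phi> (x \<otimes> z) (\<alpha> y) \<in> carrier W" "\<phi> (y \<otimes> z) (\<alpha> x) \<in> carrier W"
      using cl by (auto intro!: exterior_form_closed[OF \<phi>])
    have "h (bd 3 u) = \<ominus>\<^bsub>W\<^esub> \<phi> (x \<otimes> y) (\<alpha> z) \<oplus>\<^bsub>W\<^esub> (\<phi> (x \<otimes> z) (\<alpha> y) \<oplus>\<^bsub>W\<^esub> \<ominus>\<^bsub>W\<^esub> \<phi> (y \<otimes> z) (\<alpha> x))"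
      using cl wc by (simp add: u(1) boundary_3_wedge[OF K two] lin_map_add[OF h(1)]
          lin_map_a_inv[OF C2.module_axioms W h(1)] h2)
    also have "\<phi> (x \<otimes> y) (\<alpha> z) = \<phi> (\<alpha> x) (y \<otimes> z) \<ominus>\<^bsub>W\<^esub> \<phi> (\<alpha> y) (x \<otimes> z)"
      by (rule exterior_form_lie_left[OF \<phi> u(2-)])
    also have "\<phi> (\<alpha> x) (y \<otimes> z) = \<ominus>\<^bsub>W\<^esub> \<phi> (y \<otimes> z) (\<alpha> x)"
      using cl by (intro exterior_form_antisym[OF K M W \<phi>]) auto
    also have "\<phi> (\<alpha> y) (x \<otimes> z) = \<ominus>\<^bsub>W\<^esub> \<phi> (x \<otimes> z) (\<alpha> y)"
      using cl by (intro exterior_form_antisym[OF K M W \<phi>]) auto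
    also have "\<ominus>\<^bsub>W\<^esub> (\<ominus>\<^bsub>W\<^esub> \<phi> (y \<otimes> z) (\<alpha> x) \<ominus>\<^bsub>W\<^esub> \<ominus>\<^bsub>W\<^esub> \<phi> (x \<otimes> z) (\<alpha> y)) \<oplus>\<^bsub>W\<^esub>
        (\<phi> (x \<otimes> z) (\<alpha> y) \<oplus>\<^bsub>W\<^esub> \<ominus>\<^bsub>W\<^esub> \<phi> (y \<otimes> z) (\<alpha> x)) = \<zero>\<^bsub>W\<^esub>"
      using pc by (simp add: a_minus_def W.minus_add W.a_assoc W.r_neg W.r_neg1 W.r_neg2)
    finally show "h (bd 3 u) = \<zero>\<^bsub>W\<^esub>" .
  qed
  let ?h = "\<lambda>D. the_elem (h ` D)"
  have k: "?h (Bd 2 +>\<^bsub>Ch 2\<^esub> c) = h c" if "c \<in> carrier (Ch 2)" for c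
    using hb by (intro the_elem_coset[OF C2.module_axioms boundaries_2_submodule W h(1) _ that])
      (auto simp: boundaries_2)
  have "?h \<in> lin_map R Q W"
    by (rule lin_map_factor[OF C2.module_axioms hom_vec_hom_lin_map[OF chain_quot_proj]
          chain_quot_carrier[symmetric] h(1) k])
  moreover have "?h (chain_class R K x y) = \<phi> x y" if "x \<in> carrier K" "y \<in> carrier K" for x y
    unfolding chain_class_def using k[OF wedge_2_closed[OF K two that]] h2[OF that] by simp
  ultimately show ?thesis
    by blast
qed

lemma chain_commutator_lin: "chain_commutator R K \<in> lin_map R Q K"
  and chain_commutator_class:
    "\<lbrakk>x \<in> carrier K; y \<in> carrier K\<rbrakk> \<Longrightarrow> chain_commutator R K (chain_class R K x y) = x \<otimes> y"
proof -
  have "chain_commutator R K \<in> lin_map R Q K \<and>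
      (\<forall>x\<in>carrier K. \<forall>y\<in>carrier K. chain_commutator R K (chain_class R K x y) = x \<otimes> y)"
    unfolding chain_commutator_def
    by (rule someI_ex[OF chain_quot_universal[OF K.module_axioms
            exterior_form_lie[OF K two hom_lie_ideal_carrier[OF K]]]])
  then show "chain_commutator R K \<in> lin_map R Q K"
    "\<lbrakk>x \<in> carrier K; y \<in> carrier K\<rbrakk> \<Longrightarrow> chain_commutator R K (chain_class R K x y) = x \<otimes> y"
    by auto
qed

lemma chain_commutator_hom: "chain_commutator R K \<in> hom_vec_hom R Q K"
  by (rule hom_vec_hom_on_span[OF chain_quot_vec K_vec chain_commutator_lin lin_span_chain_class])
    (auto simp: chain_class_twist chain_commutator_class K.twist_closed K.twist_lie)

text \<open>Both sides are linear and agree on the elements \<open>x \<and> y\<close>. Thus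
  \<open>d_2\<close> factors through the quotient by the image of \<open>d_3\<close>; in particular
  boundaries are cycles, and the kernel of \<open>d_2\<close> can be read off from the
  commutator.\<close>

lemma boundary_2_eq:
  assumes c: "c \<in> carrier (Ch 2)"
  shows "bd 2 c = \<ominus>\<^bsub>Ch 1\<^esub> wd [chain_commutator R K (Bd 2 +>\<^bsub>Ch 2\<^esub> c)]"
proof -
  have neg: "(\<lambda>x. \<ominus>\<^bsub>Ch 1\<^esub> wd [x]) \<in> lin_map R K (Ch 1)"
    by (rule lin_mapI)
      (simp_all add: lin_mapD[OF wedge_1_lin[OF K two]] C1.minus_add C1.smult_r_minus del: One_nat_def)
  show ?thesis
  proof (rule lin_span_eq_on[OF C2.module_axioms C1.module_axioms boundary_2_lin[OF K two]
        lin_map_comp[OF lin_map_comp[OF hom_vec_hom_lin_map[OF chain_quot_proj] chain_commutator_lin] neg]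
        lin_span_wedge[OF K_vec] _ c])
    fix u assume "u \<in> wd ` {xs. length xs = 2 \<and> set xs \<subseteq> carrier K}"
    then obtain x y where u: "u = wd [x, y]" "x \<in> carrier K" "y \<in> carrier K"
      unfolding wedge_2_gens by auto
    show "bd 2 u = \<ominus>\<^bsub>Ch 1\<^esub> wd [chain_commutator R K (Bd 2 +>\<^bsub>Ch 2\<^esub> u)]"
      unfolding u(1) boundary_2_wedge[OF K two u(2,3)]
      using chain_commutator_class[OF u(2,3)] by (simp add: chain_class_def)
  qed
qed

text \<open>An equality of records rather than an isomorphism: cosets and the operations of
  \<open>quot\<close> do not depend on the carrier, so the cosets of the boundaries inside the
  cycles are literally some of the cosets in \<open>chain_quot\<close>. Which ones is decided by
  \<open>boundary_2_eq\<close> and the injectivity of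
  \<open>x \<mapsto> wedge R K [x]\<close>.\<close>

lemma homology_2_eq:
  "homology R K 2 = Q\<lparr>carrier := a_kernel Q K (chain_commutator R K)\<rparr>"
proof -
  note w1 = wedge_1_lin[OF K two]
  have "bd 2 c = \<zero>\<^bsub>Ch 1\<^esub> \<longleftrightarrow> chain_commutator R K (Bd 2 +>\<^bsub>Ch 2\<^esub> c) = \<zero>" if c: "c \<in> carrier (Ch 2)" for c
  proof -
    let ?x = "chain_commutator R K (Bd 2 +>\<^bsub>Ch 2\<^esub> c)"
    have x: "?x \<in> carrier K"
      by (rule lin_map_closed[OF chain_commutator_lin
            lin_map_closed[OF hom_vec_hom_lin_map[OF chain_quot_proj] c]])
    then have wx: "wd [?x] \<in> carrier (Ch 1)"
      by (rule lin_map_closed[OF w1])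
    have "bd 2 c = \<zero>\<^bsub>Ch 1\<^esub> \<longleftrightarrow> wd [?x] = \<zero>\<^bsub>Ch 1\<^esub>"
      unfolding boundary_2_eq[OF c] using wx C1.minus_minus[OF wx] C1.a_inv_zero by metis
    also have "\<dots> \<longleftrightarrow> ?x = \<zero>"
      using wedge_1_inj[OF K two x] lin_map_zero[OF K.module_axioms C1.module_axioms w1] by metis
    finally show ?thesis .
  qed
  then have "a_rcosets\<^bsub>cycles R K 2\<^esub> Bd 2 = a_kernel Q K (chain_commutator R K)"
    by (auto simp: A_RCOSETS_def' a_kernel_eq cycles_def chain_quot_carrier a_r_coset_def')
  then show ?thesis
    by (simp add: homology_def chain_quot_def quot_def cycles_def quot_map_def[abs_def]
        a_r_coset_def'[abs_def] set_add_def'[abs_def] rcoset_mult_def[abs_def])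
qed

end

definition homology_1_class ::
  "('a, 'r) ring_scheme \<Rightarrow> ('a, 'b) hom_alg \<Rightarrow> 'b \<Rightarrow> ('b list \<Rightarrow> 'a) set set" where
  "homology_1_class R K x = boundaries R K 1 +>\<^bsub>chains R K 1\<^esub> wedge R K [x]"

text \<open>Cosets involve only the addition, which \<open>cycles\<close> shares with
  \<open>chains\<close>.\<close>

lemma quot_map_cycles: "quot_map (cycles R K n) = quot_map (chains R K n)"
  by (simp add: quot_map_def[abs_def] cycles_def a_r_coset_def'[abs_def])

lemma hom_vec_hom_restrict:
  assumes "f \<in> hom_vec_hom R V W" "H \<subseteq> carrier V" "\<And>x. x \<in> H \<Longrightarrow> f x \<in> H'"
  shows "f \<in> hom_vec_hom R (V\<lparr>carrier := H\<rparr>) (W\<lparr>carrier := H'\<rparr>)"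
  using assms by (auto simp: hom_vec_hom_def subset_iff)

section \<open>First homology as a quotient of the algebra\<close>

context
  fixes R :: "('a, 'r) ring_scheme" and K :: "('a, 'b) hom_alg" (structure)
  assumes K: "hom_lie_algebra R K" and two: "\<one>\<^bsub>R\<^esub> \<oplus>\<^bsub>R\<^esub> \<one>\<^bsub>R\<^esub> \<noteq> \<zero>\<^bsub>R\<^esub>"
begin

interpretation K: hom_lie_algebra R K by (rule K)


interpretation C1: module R "chains R K 1" by (rule chains_module[OF hom_lie_algebra_vec[OF K]])
interpretation C2: module R "chains R K 2" by (rule chains_module[OF hom_lie_algebra_vec[OF K]])

lemma homology_1_eq: "homology R K 1 = quot (chains R K 1) (boundaries R K 1)"
proof -
  have "a_kernel (chains R K 1) (chains R K (1 - 1)) (boundary R K 1) = carrier (chains R K 1)"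
    using boundary_1[OF K two] by (auto simp: a_kernel_eq)
  then have "cycles R K 1 = chains R K 1"
    unfolding cycles_def by simp
  then show ?thesis
    by (simp add: homology_def)
qed

lemma homology_1_vec: "hom_vector_space R (homology R K 1)"
  and homology_1_proj: "(\<lambda>c. boundaries R K 1 +>\<^bsub>chains R K 1\<^esub> c) \<in> hom_vec_hom R (chains R K 1) (homology R K 1)"
  unfolding homology_1_eq
  by (rule hom_vector_space_quot(1)[OF chains_vec[OF hom_lie_algebra_vec[OF K]] boundaries_1_submodule[OF K two]],
      erule boundaries_1_twist[OF K two])
    (rule hom_vector_space_quot(2)[OF chains_vec[OF hom_lie_algebra_vec[OF K]] boundaries_1_submodule[OF K two]],
      erule boundaries_1_twist[OF K two])

lemma homology_1_class_hom: "homology_1_class R K \<in> hom_vec_hom R K (homology R K 1)"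
proof -
  have "wedge R K [\<alpha> x] = \<alpha>\<^bsub>chains R K 1\<^esub> (wedge R K [x])" if "x \<in> carrier K" for x
    using chain_map_wedge[OF hom_lie_algebra_vec[OF K] hom_lie_algebra_vec[OF K] twist_lin_map[OF hom_lie_algebra_vec[OF K]], of "[x]" 1] that
    by (simp add: chains_twist[OF hom_lie_algebra_vec[OF K]])
  then have "(\<lambda>x. wedge R K [x]) \<in> hom_vec_hom R K (chains R K 1)"
    using wedge_1_lin[OF K two] by (simp add: hom_vec_hom_iff)
  from hom_vec_hom_comp[OF this homology_1_proj] show ?thesis
    by (simp add: homology_1_class_def[abs_def])
qed

lemma homology_1_class_surj: "homology_1_class R K ` carrier K = carrier (homology R K 1)"
proof -
  have "homology_1_class R K ` carrier K = (\<lambda>c. boundaries R K 1 +>\<^bsub>chains R K 1\<^esub> c) ` (\<lambda>x. wedge R K [x]) ` carrier K"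
    by (simp add: image_image homology_1_class_def[abs_def])
  also have "\<dots> = carrier (homology R K 1)"
    unfolding wedge_1_surj[OF K two] homology_1_eq
    by (rule quot_carrier[OF C1.module_axioms boundaries_1_submodule[OF K two], symmetric])
  finally show ?thesis .
qed

text \<open>A boundary in degree one is minus a commutator, and the image of a linear map is closed
  under negation, so the sign does not matter. Describing \<open>[K, K]\<close> as the image of
  \<open>chain_commutator\<close> is what the snake argument needs.\<close>

lemma homology_1_class_zero_iff:
  assumes x: "x \<in> carrier K"
  shows "homology_1_class R K x = \<zero>\<^bsub>homology R K 1\<^esub> \<longleftrightarrow>
    x \<in> chain_commutator R K ` carrier (chain_quot R K)"
proof -
  note w1 = wedge_1_lin[OF K two]
  note wx = lin_map_closed[OF w1 x]
  note pQ = hom_vec_hom_lin_map[OF chain_quot_proj[OF K two]]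
  have "homology_1_class R K x = \<zero>\<^bsub>homology R K 1\<^esub> \<longleftrightarrow> wedge R K [x] \<in> boundaries R K 1"
    unfolding homology_1_class_def homology_1_eq
      quot_zero[OF C1.module_axioms boundaries_1_submodule[OF K two]]
    by (rule coset_zero_iff[OF C1.module_axioms boundaries_1_submodule[OF K two] wx])
  also have "\<dots> \<longleftrightarrow> x \<in> chain_commutator R K ` carrier (chain_quot R K)"
  proof
    assume "wedge R K [x] \<in> boundaries R K 1"
    then obtain c where c: "c \<in> carrier (chains R K 2)" "wedge R K [x] = boundary R K 2 c"
      unfolding boundaries_1[OF K two] by auto
    let ?D = "boundaries R K 2 +>\<^bsub>chains R K 2\<^esub> c"
    have D: "?D \<in> carrier (chain_quot R K)"
      by (rule lin_map_closed[OF pQ c(1)])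
    note l = chain_commutator_lin[OF K two]
    let ?y = "chain_commutator R K ?D"
    have y: "?y \<in> carrier K"
      by (rule lin_map_closed[OF l D])
    have "wedge R K [x \<oplus> ?y] = wedge R K [x] \<oplus>\<^bsub>chains R K 1\<^esub> wedge R K [?y]"
      by (rule lin_map_add[OF w1 x y])
    also have "\<dots> = \<zero>\<^bsub>chains R K 1\<^esub>"
      unfolding c(2) boundary_2_eq[OF K two c(1)]
      by (rule C1.l_neg[OF lin_map_closed[OF w1 y]])
    finally have "x \<oplus> ?y = \<zero>"
      using x y by (intro wedge_1_inj[OF K two]) auto
    then have "x = \<ominus> ?y"
      using K.minus_equality[of x ?y] x y by simp
    also have "\<dots> = chain_commutator R K (\<ominus>\<^bsub>chain_quot R K\<^esub> ?D)"
      by (rule lin_map_a_inv[OF chain_quot_module[OF K two] K.module_axioms l D, symmetric])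
    finally show "x \<in> chain_commutator R K ` carrier (chain_quot R K)"
      using submodule_a_inv[OF module.carrier_is_submodule[OF chain_quot_module[OF K two]] D]
      by (rule image_eqI)
  next
    assume "x \<in> chain_commutator R K ` carrier (chain_quot R K)"
    then obtain c where c: "c \<in> carrier (chains R K 2)" "x = chain_commutator R K (boundaries R K 2 +>\<^bsub>chains R K 2\<^esub> c)"
      unfolding chain_quot_carrier[OF K two] by auto
    have "boundary R K 2 c = \<ominus>\<^bsub>chains R K 1\<^esub> wedge R K [x]"
      unfolding c(2) by (rule boundary_2_eq[OF K two c(1)])
    moreover have "boundary R K 2 c \<in> boundaries R K 1"
      unfolding boundaries_1[OF K two] using c by auto
    ultimately show "wedge R K [x] \<in> boundaries R K 1"
      using submodule_a_inv[OF boundaries_1_submodule[OF K two], of "boundary R K 2 c"] wx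
      by (simp del: One_nat_def)
  qed
  finally show ?thesis .
qed

end

section \<open>Maps induced in homology\<close>

context
  fixes R :: "('a, 'r) ring_scheme" and K :: "('a, 'b) hom_alg" and K' :: "('a, 'c) hom_alg"
    and f :: "'b \<Rightarrow> 'c"
  assumes K: "hom_lie_algebra R K" and K': "hom_lie_algebra R K'"
    and two: "\<one>\<^bsub>R\<^esub> \<oplus>\<^bsub>R\<^esub> \<one>\<^bsub>R\<^esub> \<noteq> \<zero>\<^bsub>R\<^esub>" and f: "f \<in> hom_lie_hom R K K'"
begin

lemma homology_map_eq: "homology_map R K' n f = quot_map (chains R K' n) (boundaries R K' n) (chain_map R K' n f)"
  by (simp add: homology_map_def quot_map_cycles chain_map_def)

private lemmas fv = hom_lie_hom_lin[OF f]
private lemmas cm = chain_map_lin[OF hom_lie_algebra_vec[OF K] hom_lie_algebra_vec[OF K'] fv]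

lemma homology_map_1_class:
  assumes x: "x \<in> carrier K"
  shows "homology_map R K' 1 f (homology_1_class R K x) = homology_1_class R K' (f x)"
proof -
  have "chain_map R K' 1 f c \<in> boundaries R K' 1" if "c \<in> boundaries R K 1" for c
    using that chain_map_boundary_2[OF K K' two f] lin_map_closed[OF cm, of _ 2]
    unfolding boundaries_1[OF K two] boundaries_1[OF K' two] by auto
  from quot_map_coset[OF chains_module[OF hom_lie_algebra_vec[OF K]] boundaries_1_submodule[OF K two]
      chains_module[OF hom_lie_algebra_vec[OF K']] boundaries_1_submodule[OF K' two] cm this
      lin_map_closed[OF wedge_1_lin[OF K two] x]]
  show ?thesis
    using chain_map_wedge[OF hom_lie_algebra_vec[OF K] hom_lie_algebra_vec[OF K'] fv, of "[x]" 1] x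
    by (simp add: homology_map_eq homology_1_class_def)
qed

lemma homology_map_1_hom: "homology_map R K' 1 f \<in> hom_vec_hom R (homology R K 1) (homology R K' 1)"
  by (rule hom_vec_hom_factor[OF hom_lie_algebra_vec[OF K] homology_1_class_hom[OF K two]
        homology_1_class_surj[OF K two]
        hom_vec_hom_comp[OF hom_lie_hom_vec[OF f] homology_1_class_hom[OF K' two]]
        homology_map_1_class])

text \<open>The formula for \<open>homology_map\<close> makes sense on all of
  \<open>chain_quot\<close>, of which second homology is a subspace. The snake argument lifts
  elements along this larger map, which inherits surjectivity from \<open>f\<close>.\<close>

lemma homology_map_2_lin: "homology_map R K' 2 f \<in> lin_map R (chain_quot R K) (chain_quot R K')"
  and homology_map_2_class: "\<lbrakk>x \<in> carrier K; y \<in> carrier K\<rbrakk> \<Longrightarrow>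
    homology_map R K' 2 f (chain_class R K x y) = chain_class R K' (f x) (f y)"
proof -
  have B: "chain_map R K' 2 f c \<in> boundaries R K' 2" if "c \<in> boundaries R K 2" for c
    using that chain_map_boundary_3[OF K K' two f] lin_map_closed[OF cm, of _ 3]
    unfolding boundaries_2[OF K two] boundaries_2[OF K' two] by auto
  have q: "homology_map R K' 2 f (boundaries R K 2 +>\<^bsub>chains R K 2\<^esub> c)
      = boundaries R K' 2 +>\<^bsub>chains R K' 2\<^esub> chain_map R K' 2 f c" if "c \<in> carrier (chains R K 2)" for c
    unfolding homology_map_eq
    by (rule quot_map_coset[OF chains_module[OF hom_lie_algebra_vec[OF K]] boundaries_2_submodule[OF K two]
      chains_module[OF hom_lie_algebra_vec[OF K']] boundaries_2_submodule[OF K' two] cm B that])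
  show "homology_map R K' 2 f \<in> lin_map R (chain_quot R K) (chain_quot R K')"
    by (rule lin_map_factor[OF chains_module[OF hom_lie_algebra_vec[OF K]]
          hom_vec_hom_lin_map[OF chain_quot_proj[OF K two]] chain_quot_carrier[OF K two, symmetric]
          lin_map_comp[OF cm hom_vec_hom_lin_map[OF chain_quot_proj[OF K' two]]] q])
  show "homology_map R K' 2 f (chain_class R K x y) = chain_class R K' (f x) (f y)"
    if "x \<in> carrier K" "y \<in> carrier K"
    using q[OF wedge_2_closed[OF K two that]] that
      chain_map_wedge[OF hom_lie_algebra_vec[OF K] hom_lie_algebra_vec[OF K'] fv, of "[x, y]" 2]
    by (simp add: chain_class_def)
qed

lemma homology_map_2_hom: "homology_map R K' 2 f \<in> hom_vec_hom R (chain_quot R K) (chain_quot R K')"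
  by (rule hom_vec_hom_on_span[OF chain_quot_vec[OF K two] chain_quot_vec[OF K' two]
        homology_map_2_lin lin_span_chain_class[OF K two]])
    (auto simp: chain_class_twist[OF K two] chain_class_twist[OF K' two] homology_map_2_class
      hom_lie_hom_closed[OF f] hom_lie_hom_twist[OF f]
      hom_vector_space.twist_closed[OF hom_lie_algebra_vec[OF K]])

lemma homology_map_2_commutator:
  assumes x: "x \<in> carrier (chain_quot R K)"
  shows "chain_commutator R K' (homology_map R K' 2 f x) = f (chain_commutator R K x)"
  by (rule lin_span_eq_on[OF chain_quot_module[OF K two] hom_lie_algebra_module[OF K']
        lin_map_comp[OF homology_map_2_lin chain_commutator_lin[OF K' two]]
        lin_map_comp[OF chain_commutator_lin[OF K two] fv] lin_span_chain_class[OF K two] _ x])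
    (auto simp: homology_map_2_class chain_commutator_class[OF K two]
      chain_commutator_class[OF K' two] hom_lie_hom_lie[OF f] hom_lie_hom_closed[OF f])

end

section \<open>Coinvariants\<close>

context
  fixes R :: "('a, 'r) ring_scheme" and K :: "('a, 'b) hom_alg" (structure) and M :: "'b set"
  assumes K: "hom_lie_algebra R K" and two: "\<one>\<^bsub>R\<^esub> \<oplus>\<^bsub>R\<^esub> \<one>\<^bsub>R\<^esub> \<noteq> \<zero>\<^bsub>R\<^esub>"
    and M: "hom_lie_ideal R M K"
begin

interpretation K: hom_lie_algebra R K by (rule K)

private abbreviation (input) KM where "KM \<equiv> K\<lparr>carrier := M\<rparr>"
private abbreviation (input) Ext where "Ext \<equiv> exterior R K M (carrier K)"
private abbreviation (input) MK where "MK \<equiv> commutator_span R K M (carrier K)"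

text \<open>The generators \<open>m \<curlywedge> n\<close> span the exterior product and go to
  \<open>[m, n]\<close>. Thus \<open>M / [M, K]\<close> is the cokernel of the commutator map into
  \<open>M\<close>, the term in which the connecting map takes its values.\<close>

lemma commutator_span_eq: "MK = commutator_map R K ` carrier Ext"
proof -
  let ?B = "{ext_elem R K M m n | m n. m \<in> M \<and> n \<in> carrier K}"
  have "commutator_map R K ` ?B = {m \<otimes> n | m n. m \<in> M \<and> n \<in> carrier K}"
    using commutator_map_elem[OF K two M] by (auto simp: image_iff) metis+
  moreover have "?B \<subseteq> carrier Ext"
    using ext_elem_closed[OF K two M] by auto
  ultimately show ?thesis
    using lin_span_image[OF exterior_module[OF K two M] K.module_axioms
        hom_vec_hom_lin_map[OF commutator_map_hom[OF K two M]], of ?B]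
      lin_span_ext_elem[OF K two M] by (simp add: commutator_span_def)
qed

lemma restrict_vec: "hom_vector_space R KM"
  by (rule hom_vector_space_restrict[OF hom_lie_algebra_vec[OF K] hom_lie_ideal_submodule[OF M]
        hom_lie_ideal_twist[OF M]])

lemma commutator_map_ideal:
  assumes "x \<in> carrier Ext"
  shows "commutator_map R K x \<in> M"
proof -
  have "MK \<subseteq> M"
    unfolding commutator_span_def using hom_lie_ideal_lie[OF M]
    by (intro lin_span_minimal hom_lie_ideal_submodule[OF M]) auto
  then show ?thesis
    using assms unfolding commutator_span_eq by auto
qed

lemma commutator_map_restrict: "commutator_map R K \<in> hom_vec_hom R Ext KM"
  using hom_vec_hom_restrict[OF commutator_map_hom[OF K two M] order.refl commutator_map_ideal]
  by simp

lemma commutator_span_submodule: "submodule MK R KM"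
  unfolding commutator_span_eq
  by (rule submodule_image[OF exterior_module[OF K two M] hom_vector_space_module[OF restrict_vec]
        hom_vec_hom_lin_map[OF commutator_map_restrict]
        module.carrier_is_submodule[OF exterior_module[OF K two M]]])

lemma commutator_span_twist:
  assumes "x \<in> MK"
  shows "\<alpha>\<^bsub>KM\<^esub> x \<in> MK"
proof -
  obtain u where u: "u \<in> carrier Ext" "x = commutator_map R K u"
    using assms unfolding commutator_span_eq by auto
  then have "\<alpha>\<^bsub>KM\<^esub> x = commutator_map R K (\<alpha>\<^bsub>Ext\<^esub> u)"
    using hom_vec_hom_twist[OF commutator_map_hom[OF K two M]] by simp
  then show ?thesis
    unfolding commutator_span_eq using hom_vector_space.twist_closed[OF exterior_vec[OF K two M]] u
    by auto
qed

lemma coinvariants_vec: "hom_vector_space R (ideal_coinvariants R K M)"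
  and coinvariants_proj: "(\<lambda>m. MK +>\<^bsub>KM\<^esub> m) \<in> hom_vec_hom R KM (ideal_coinvariants R K M)"
  unfolding ideal_coinvariants_def
  by (rule hom_vector_space_quot(1)[OF restrict_vec commutator_span_submodule],
      erule commutator_span_twist)
    (rule hom_vector_space_quot(2)[OF restrict_vec commutator_span_submodule],
      erule commutator_span_twist)

lemma coinvariants_surj: "(\<lambda>m. MK +>\<^bsub>KM\<^esub> m) ` M = carrier (ideal_coinvariants R K M)"
  using quot_carrier[OF hom_vector_space_module[OF restrict_vec] commutator_span_submodule]
  by (simp add: ideal_coinvariants_def)

lemma coinvariants_zero_iff:
  assumes "m \<in> M"
  shows "MK +>\<^bsub>KM\<^esub> m = \<zero>\<^bsub>ideal_coinvariants R K M\<^esub> \<longleftrightarrow> m \<in> commutator_map R K ` carrier Ext"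
proof -
  note KM = hom_vector_space_module[OF restrict_vec]
  have m: "m \<in> carrier KM"
    using assms by simp
  show ?thesis
    unfolding ideal_coinvariants_def quot_zero[OF KM commutator_span_submodule]
      coset_zero_iff[OF KM commutator_span_submodule m] by (simp only: commutator_span_eq)
qed

text \<open>The class form on \<open>K\<close>, pulled back along the identity, is a form on
  \<open>M\<close>, and the universal property of \<open>M \<curlywedge> K\<close> applies to
  it.\<close>

lemma exterior_to_chain_quot:
  "\<exists>h. h \<in> hom_vec_hom R Ext (chain_quot R K) \<and>
     (\<forall>m\<in>M. \<forall>n\<in>carrier K. h (ext_elem R K M m n) = chain_class R K m n)"
proof -
  have idh: "(\<lambda>x. x) \<in> hom_lie_hom R K K"
    by (auto simp: hom_lie_hom_def hom_vec_hom_def)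
  obtain h where h: "h \<in> lin_map R Ext (chain_quot R K)"
    "\<forall>m\<in>M. \<forall>n\<in>carrier K. h (ext_elem R K M m n) = chain_class R K m n"
    using exterior_universal[OF K two M chain_quot_module[OF K two]
        exterior_form_pullback[OF K M chain_class_form[OF K two] idh hom_lie_ideal_subset[OF M]]]
    by blast
  have "h \<in> hom_vec_hom R Ext (chain_quot R K)"
    by (rule hom_vec_hom_on_span[OF exterior_vec[OF K two M] chain_quot_vec[OF K two] h(1)
          lin_span_ext_elem[OF K two M]])
      (use h(2) in \<open>auto simp: ext_elem_twist[OF K two M] chain_class_twist[OF K two]
        ideal_closed[OF K two M]\<close>)
  then show ?thesis
    using h(2) by blast
qed

lemma commutator_map_chain:
  assumes "h \<in> lin_map R Ext (chain_quot R K)"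
    and h: "\<forall>m\<in>M. \<forall>n\<in>carrier K. h (ext_elem R K M m n) = chain_class R K m n"
    and x: "x \<in> carrier Ext"
  shows "chain_commutator R K (h x) = commutator_map R K x"
  by (rule lin_span_eq_on[OF exterior_module[OF K two M] K.module_axioms
        lin_map_comp[OF assms(1) chain_commutator_lin[OF K two]]
        hom_vec_hom_lin_map[OF commutator_map_hom[OF K two M]] lin_span_ext_elem[OF K two M] _ x])
    (use h in \<open>auto simp: chain_commutator_class[OF K two] commutator_map_elem[OF K two M]
      ideal_closed[OF K two M]\<close>)

text \<open>An element of \<open>[M, K]\<close> is the commutator of an element of
  \<open>M \<curlywedge> K\<close>, hence of its image in \<open>chain_quot\<close>; so its class in
  first homology is zero and the inclusion of \<open>M\<close> descends.\<close>

lemma coinvariants_to_homology_class: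
  assumes m: "m \<in> M"
  shows "coinvariants_to_homology R K (MK +>\<^bsub>KM\<^esub> m) = homology_1_class R K m"
proof -
  have w: "(\<lambda>m. wedge R K [m]) \<in> lin_map R KM (chains R K 1)"
    using lin_map_restrict_domain[OF wedge_1_lin[OF K two]] hom_lie_ideal_subset[OF M] by blast
  obtain h where h: "h \<in> hom_vec_hom R Ext (chain_quot R K)"
    "\<forall>m\<in>M. \<forall>n\<in>carrier K. h (ext_elem R K M m n) = chain_class R K m n"
    using exterior_to_chain_quot by blast
  have "wedge R K [u] \<in> boundaries R K 1" if u: "u \<in> MK" for u
  proof -
    obtain x where x: "x \<in> carrier Ext" "u = commutator_map R K x"
      using u unfolding commutator_span_eq by auto
    then have "u = chain_commutator R K (h x)"
      using commutator_map_chain[OF hom_vec_hom_lin_map[OF h(1)] h(2)] by simp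
    then have "u \<in> chain_commutator R K ` carrier (chain_quot R K)"
      using lin_map_closed[OF hom_vec_hom_lin_map[OF h(1)] x(1)] by auto
    moreover have uc: "u \<in> carrier K"
      using x commutator_map_ideal hom_lie_ideal_subset[OF M] by auto
    ultimately have "homology_1_class R K u = \<zero>\<^bsub>homology R K 1\<^esub>"
      using homology_1_class_zero_iff[OF K two] by simp
    then show ?thesis
      using coset_zero_iff[OF chains_module[OF hom_lie_algebra_vec[OF K]] boundaries_1_submodule[OF K two]
          lin_map_closed[OF wedge_1_lin[OF K two] uc]]
      by (simp add: homology_1_class_def homology_1_eq[OF K two]
          quot_zero[OF chains_module[OF hom_lie_algebra_vec[OF K]] boundaries_1_submodule[OF K two]]
          del: One_nat_def)
  qed
  from quot_map_coset[OF hom_vector_space_module[OF restrict_vec] commutator_span_submodule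
      chains_module[OF hom_lie_algebra_vec[OF K]] boundaries_1_submodule[OF K two] w this] m
  show ?thesis
    by (simp add: coinvariants_to_homology_def quot_map_cycles homology_1_class_def del: One_nat_def)
qed

lemma coinvariants_to_homology_hom:
  "coinvariants_to_homology R K \<in> hom_vec_hom R (ideal_coinvariants R K M) (homology R K 1)"
proof (rule hom_vec_hom_factor[OF restrict_vec coinvariants_proj])
  show "(\<lambda>m. MK +>\<^bsub>KM\<^esub> m) ` carrier KM = carrier (ideal_coinvariants R K M)"
    using coinvariants_surj by simp
  show "homology_1_class R K \<in> hom_vec_hom R KM (homology R K 1)"
    using hom_vec_hom_restrict[OF homology_1_class_hom[OF K two], of M "carrier (homology R K 1)"]
      hom_lie_ideal_subset[OF M] lin_map_closed[OF hom_vec_hom_lin_map[OF homology_1_class_hom[OF K two]]]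
    by auto
  show "coinvariants_to_homology R K (MK +>\<^bsub>KM\<^esub> m) = homology_1_class R K m" if "m \<in> carrier KM" for m
    using coinvariants_to_homology_class that by simp
qed

end

section \<open>Right exactness\<close>

text \<open>
  Choosing lifts along \<open>q\<close> gives a form on \<open>L\<close> with values in \<open>E/I\<close>; the linear map it induces on
  \<open>E'\<close> inverts \<open>E/I \<rightarrow> E'\<close>.
\<close>

lemma exterior_kernel_subset:
  fixes E :: "('a, 'e) hom_alg"
  assumes K: "hom_lie_algebra R K" and M: "hom_lie_ideal R M K"
    and L: "hom_lie_algebra R L" and M': "hom_lie_ideal R M' L"
    and q: "q \<in> hom_lie_hom R K L" "q ` carrier K = carrier L" "M = {x \<in> carrier K. q x \<in> M'}"
    and E: "module R E" and e: "exterior_form R K M E e"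
    and span: "lin_span R E {e m k | m k. m \<in> M \<and> k \<in> carrier K} = carrier E"
    and P: "P \<in> lin_map R E E'" "\<And>m k. \<lbrakk>m \<in> M; k \<in> carrier K\<rbrakk> \<Longrightarrow> P (e m k) = e' (q m) (q k)"
    and I: "submodule I R E"
      "\<And>r k. \<lbrakk>r \<in> carrier K; q r = \<zero>\<^bsub>L\<^esub>; k \<in> carrier K\<rbrakk> \<Longrightarrow> e r k \<in> I"
      "\<And>m r. \<lbrakk>m \<in> M; r \<in> carrier K; q r = \<zero>\<^bsub>L\<^esub>\<rbrakk> \<Longrightarrow> e m r \<in> I"
    and E': "module R E'"
    and univ: "\<And>\<phi> :: 'l \<Rightarrow> 'l \<Rightarrow> 'e set. exterior_form R L M' (quot E I) \<phi> \<Longrightarrow>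
      \<exists>h. h \<in> lin_map R E' (quot E I) \<and> (\<forall>m\<in>M'. \<forall>n\<in>carrier L. h (e' m n) = \<phi> m n)"
    and x: "x \<in> carrier E" "P x = \<zero>\<^bsub>E'\<^esub>"
  shows "x \<in> I"
proof -
  interpret K: hom_lie_algebra R K by (rule K)
  interpret L: hom_lie_algebra R L by (rule L)
  interpret E: module R E by (rule E)
  have W: "module R (quot E I)"
    by (rule quot_module[OF E I(1)])
  let ?c = "\<lambda>x. I +>\<^bsub>E\<^esub> x"
  note c = proj_lin_map[OF E I(1)]
  let ?cf = "\<lambda>m k. ?c (e m k)"
  have cf: "exterior_form R K M (quot E I) ?cf"
    by (rule exterior_form_comp[OF E W e c K M])
  note Mc = ideal_closed(1-8)[OF K _ M]
  have MK: "m \<in> carrier K" if "m \<in> M" for m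
    by (rule hom_lie_ideal_subset[OF M that])
  note sM = hom_lie_ideal_submodule[OF M]
  note ql = hom_lie_hom_lin[OF q(1)]
  have diff: "u \<ominus>\<^bsub>K\<^esub> v \<in> carrier K" "q (u \<ominus>\<^bsub>K\<^esub> v) = \<zero>\<^bsub>L\<^esub>"
    if "u \<in> carrier K" "v \<in> carrier K" "q u = q v" for u v
    using that lin_map_minus[OF K.module_axioms L.module_axioms ql] hom_lie_hom_closed[OF q(1)]
    by (auto simp: a_minus_def L.r_neg)
  have minus_cancel: "v \<oplus>\<^bsub>K\<^esub> (u \<ominus>\<^bsub>K\<^esub> v) = u" if "u \<in> carrier K" "v \<in> carrier K" for u v
    using that by (simp add: a_minus_def K.a_lcomm K.r_neg)
  have zeroI: "?c y = \<zero>\<^bsub>quot E I\<^esub>" if "y \<in> I" for y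
    using coset_zero_iff[OF E I(1)] submodule_mem[OF I(1) that] that by (simp add: quot_zero[OF E I(1)])
  interpret W: module R "quot E I" by (rule W)
  \<comment> \<open>Changing an argument within its fibre over \<open>L\<close> changes the value of
    \<open>e\<close> by an element with an entry in the kernel of \<open>q\<close>, which lies in
    \<open>I\<close>. Left and right entries are covered by separate assumptions on
    \<open>I\<close>, since \<open>e\<close> is a form with left arguments in \<open>M\<close>
    only.\<close>
  have cong: "?cf m k = ?cf m' k'"
    if m: "m \<in> M" "m' \<in> M" "q m = q m'" and k: "k \<in> carrier K" "k' \<in> carrier K" "q k = q k'" for m m' k k'
  proof -
    have dM: "m \<ominus>\<^bsub>K\<^esub> m' \<in> M"
      by (rule submodule_minus[OF sM m(1,2)])
    have "?cf m k = ?cf (m' \<oplus>\<^bsub>K\<^esub> (m \<ominus>\<^bsub>K\<^esub> m')) k"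
      using minus_cancel MK m by simp
    also have "\<dots> = ?cf m' k \<oplus>\<^bsub>quot E I\<^esub> ?cf (m \<ominus>\<^bsub>K\<^esub> m') k"
      by (rule exterior_form_add_left[OF cf m(2) dM k(1)])
    also have "?cf (m \<ominus>\<^bsub>K\<^esub> m') k = \<zero>\<^bsub>quot E I\<^esub>"
      using diff[OF MK MK] m k by (intro zeroI I(2)) auto
    also have "?cf m' k = ?cf m' (k' \<oplus>\<^bsub>K\<^esub> (k \<ominus>\<^bsub>K\<^esub> k'))"
      using minus_cancel k by simp
    also have "\<dots> = ?cf m' k' \<oplus>\<^bsub>quot E I\<^esub> ?cf m' (k \<ominus>\<^bsub>K\<^esub> k')"
      by (rule exterior_form_add_right[OF cf m(2) k(2) diff(1)[OF k]])
    also have "?cf m' (k \<ominus>\<^bsub>K\<^esub> k') = \<zero>\<^bsub>quot E I\<^esub>"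
      using diff[OF k] m by (intro zeroI I(3)) auto
    finally show ?thesis
      using exterior_form_closed[OF cf m(2) k(2)] by simp
  qed
  \<comment> \<open>An arbitrary choice of lifts, not assumed additive or compatible with brackets;
    the properties of the form on \<open>L\<close> come from \<open>cong\<close>.\<close>
  define \<sigma> where "\<sigma> l = (SOME k. k \<in> carrier K \<and> q k = l)" for l
  have \<sigma>: "\<sigma> l \<in> carrier K \<and> q (\<sigma> l) = l" if "l \<in> carrier L" for l
  proof -
    have "l \<in> q ` carrier K"
      using that q(2) by simp
    then have "\<exists>k. k \<in> carrier K \<and> q k = l"
      by auto
    then show ?thesis
      unfolding \<sigma>_def by (rule someI_ex)
  qed
  have M'L: "m \<in> carrier L" if "m \<in> M'" for m
    by (rule hom_lie_ideal_subset[OF M' that])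
  have \<sigma>M: "\<sigma> m \<in> M" if "m \<in> M'" for m
    using \<sigma>[OF M'L[OF that]] that q(3) by auto
  let ?\<phi> = "\<lambda>m l. ?cf (\<sigma> m) (\<sigma> l)"
  have qM: "q m \<in> M'" if "m \<in> M" for m
    using that q(3) by blast
  have \<phi>: "?\<phi> (q m) (q k) = ?cf m k" if "m \<in> M" "k \<in> carrier K" for m k
    by (rule cong[OF \<sigma>M[OF qM[OF that(1)]] that(1) _ _ that(2)])
      (simp_all add: \<sigma> hom_lie_hom_closed[OF q(1)] MK that)
  have liftM: "\<exists>m\<in>M. q m = m'" if "m' \<in> M'" for m'
    using \<sigma>[OF M'L[OF that]] \<sigma>M[OF that] by blast
  have lift: "\<exists>k\<in>carrier K. q k = l" if "l \<in> carrier L" for l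
    using \<sigma>[OF that] by blast
  note qs = hom_lie_homD[OF q(1)]
  have Mcl: "\<alpha>\<^bsub>K\<^esub> m \<in> M" "m \<otimes>\<^bsub>K\<^esub> k \<in> M" "k \<otimes>\<^bsub>K\<^esub> m \<in> M" if "m \<in> M" "k \<in> carrier K" for m k
    using that hom_lie_ideal_twist[OF M] hom_lie_ideal_lie[OF M] hom_lie_ideal_lie'[OF K M] by auto
  \<comment> \<open>Each clause is transported by writing the arguments as \<open>q\<close> of
    elements of \<open>K\<close>, moving \<open>q\<close> outside sums, brackets and twists, and
    replacing the values at the chosen lifts by those at these elements.\<close>
  have "exterior_form R L M' (quot E I) ?\<phi>"
    unfolding exterior_form_def
  proof (intro conjI ballI lin_mapI)
    fix m' n' assume "m' \<in> M'" "n' \<in> carrier L"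
    then obtain m n where mn: "m \<in> M" "n \<in> carrier K" and eq: "m' = q m" "n' = q n"
      using liftM[of m'] lift[of n'] by auto
    show "?\<phi> m' n' \<in> carrier (quot E I)"
      unfolding eq \<phi>[OF mn] by (rule exterior_form_closed[OF cf mn])
    { fix k' assume "k' \<in> carrier L"
      then obtain k where k: "k \<in> carrier K" and eq': "k' = q k"
        using lift[of k'] by auto
      have nk: "n \<oplus>\<^bsub>K\<^esub> k \<in> carrier K" "n \<otimes>\<^bsub>K\<^esub> k \<in> carrier K" "\<alpha>\<^bsub>K\<^esub> n \<in> carrier K" "\<alpha>\<^bsub>K\<^esub> k \<in> carrier K"
        using mn k K.lie_closed K.twist_closed by auto
      show "?\<phi> m' (n' \<oplus>\<^bsub>L\<^esub> k') = ?\<phi> m' n' \<oplus>\<^bsub>quot E I\<^esub> ?\<phi> m' k'"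
        unfolding eq eq' qs(6)[OF mn(2) k, symmetric] \<phi>[OF mn] \<phi>[OF mn(1) k] \<phi>[OF mn(1) nk(1)]
        by (rule exterior_form_add_right[OF cf mn k])
      show "?\<phi> (\<alpha>\<^bsub>L\<^esub> m') (n' \<otimes>\<^bsub>L\<^esub> k')
          = ?\<phi> (k' \<otimes>\<^bsub>L\<^esub> m') (\<alpha>\<^bsub>L\<^esub> n') \<ominus>\<^bsub>quot E I\<^esub> ?\<phi> (n' \<otimes>\<^bsub>L\<^esub> m') (\<alpha>\<^bsub>L\<^esub> k')"
        unfolding eq eq' qs(5)[OF mn(2) k, symmetric] qs(5)[OF k MK[OF mn(1)], symmetric]
          qs(5)[OF mn(2) MK[OF mn(1)], symmetric] qs(4)[OF MK[OF mn(1)], symmetric]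
          qs(4)[OF mn(2), symmetric] qs(4)[OF k, symmetric]
          \<phi>[OF Mcl(1)[OF mn] nk(2)] \<phi>[OF Mcl(3)[OF mn(1) k] nk(3)] \<phi>[OF Mcl(3)[OF mn] nk(4)]
        by (rule exterior_form_lie_right[OF cf mn k]) }
    { fix r assume r: "r \<in> carrier R"
      have rn: "r \<odot>\<^bsub>K\<^esub> n \<in> carrier K"
        using r mn by simp
      show "?\<phi> m' (r \<odot>\<^bsub>L\<^esub> n') = r \<odot>\<^bsub>quot E I\<^esub> ?\<phi> m' n'"
        unfolding eq qs(7)[OF r mn(2), symmetric] \<phi>[OF mn] \<phi>[OF mn(1) rn]
        by (rule exterior_form_smult_right[OF cf r mn]) }
    { fix k' assume "k' \<in> M'"
      then obtain k where k: "k \<in> M" and eq': "k' = q k"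
        using liftM[of k'] by auto
      have nk: "k \<otimes>\<^bsub>K\<^esub> n \<in> carrier K" "m \<otimes>\<^bsub>K\<^esub> n \<in> carrier K" "\<alpha>\<^bsub>K\<^esub> n \<in> carrier K"
        using mn MK[OF k] MK[OF mn(1)] K.lie_closed K.twist_closed by auto
      show "?\<phi> (m' \<otimes>\<^bsub>L\<^esub> k') (\<alpha>\<^bsub>L\<^esub> n')
          = ?\<phi> (\<alpha>\<^bsub>L\<^esub> m') (k' \<otimes>\<^bsub>L\<^esub> n') \<ominus>\<^bsub>quot E I\<^esub> ?\<phi> (\<alpha>\<^bsub>L\<^esub> k') (m' \<otimes>\<^bsub>L\<^esub> n')"
        unfolding eq eq' qs(5)[OF MK[OF mn(1)] MK[OF k], symmetric] qs(5)[OF MK[OF k] mn(2), symmetric]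
          qs(5)[OF MK[OF mn(1)] mn(2), symmetric] qs(4)[OF MK[OF mn(1)], symmetric]
          qs(4)[OF mn(2), symmetric] qs(4)[OF MK[OF k], symmetric]
          \<phi>[OF Mcl(2)[OF mn(1) MK[OF k]] nk(3)] \<phi>[OF Mcl(1)[OF mn] nk(1)] \<phi>[OF Mcl(1)[OF k mn(2)] nk(2)]
        by (rule exterior_form_lie_left[OF cf mn(1) k mn(2)]) }
  next
    fix m' assume "m' \<in> M'"
    then obtain m where m: "m \<in> M" and eq: "m' = q m"
      using liftM[of m'] by auto
    show "?\<phi> m' m' = \<zero>\<^bsub>quot E I\<^esub>"
      unfolding eq \<phi>[OF m MK[OF m]] by (rule exterior_form_self[OF cf m])
  next
    fix n' m' assume n': "n' \<in> carrier L" and "m' \<in> carrier (L\<lparr>carrier := M'\<rparr>)"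
    then have "m' \<in> M'" by simp
    then obtain m n where mn: "m \<in> M" "n \<in> carrier K" and eq: "m' = q m" "n' = q n"
      using liftM[of m'] lift[OF n'] by auto
    show "?\<phi> m' n' \<in> carrier (quot E I)"
      unfolding eq \<phi>[OF mn] by (rule exterior_form_closed[OF cf mn])
    { fix k' assume "k' \<in> carrier (L\<lparr>carrier := M'\<rparr>)"
      then have "k' \<in> M'" by simp
      then obtain k where k: "k \<in> M" and eq': "k' = q k"
        using liftM[of k'] by auto
      have "?\<phi> (m' \<oplus>\<^bsub>L\<^esub> k') n' = ?\<phi> m' n' \<oplus>\<^bsub>quot E I\<^esub> ?\<phi> k' n'"
        unfolding eq eq' qs(6)[OF MK[OF mn(1)] MK[OF k], symmetric] \<phi>[OF mn] \<phi>[OF k mn(2)]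
          \<phi>[OF submodule_add[OF sM mn(1) k] mn(2)]
        by (rule exterior_form_add_left[OF cf mn(1) k mn(2)])
      then show "?\<phi> (m' \<oplus>\<^bsub>L\<lparr>carrier := M'\<rparr>\<^esub> k') n' = ?\<phi> m' n' \<oplus>\<^bsub>quot E I\<^esub> ?\<phi> k' n'"
        by simp }
    { fix r assume r: "r \<in> carrier R"
      have "?\<phi> (r \<odot>\<^bsub>L\<^esub> m') n' = r \<odot>\<^bsub>quot E I\<^esub> ?\<phi> m' n'"
        unfolding eq qs(7)[OF r MK[OF mn(1)], symmetric] \<phi>[OF mn]
          \<phi>[OF submodule_smult[OF sM r mn(1)] mn(2)]
        by (rule exterior_form_smult_left[OF cf r mn])
      then show "?\<phi> (r \<odot>\<^bsub>L\<lparr>carrier := M'\<rparr>\<^esub> m') n' = r \<odot>\<^bsub>quot E I\<^esub> ?\<phi> m' n'"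
        by simp }
  qed
  from univ[OF this] obtain h where h: "h \<in> lin_map R E' (quot E I)"
    "\<forall>m\<in>M'. \<forall>n\<in>carrier L. h (e' m n) = ?\<phi> m n"
    by (elim exE conjE)
  \<comment> \<open>On generators \<open>h\<close> undoes \<open>P\<close> up to \<open>I\<close>,
    so \<open>h\<close> after \<open>P\<close> is the projection onto \<open>quot E I\<close>; if
    \<open>P x\<close> vanishes, the coset of \<open>x\<close> is zero.\<close>
  have "h (P x) = ?c x"
  proof (rule lin_span_eq_on[OF E W lin_map_comp[OF P(1) h(1)] c span _ x(1)])
    fix u assume "u \<in> {e m k | m k. m \<in> M \<and> k \<in> carrier K}"
    then obtain m k where mk: "m \<in> M" "k \<in> carrier K" "u = e m k"
      by auto
    show "h (P u) = ?c u"
      unfolding mk(3) P(2)[OF mk(1,2)] h(2)[rule_format, OF qM[OF mk(1)] qs(3)[OF mk(2)]] by (rule \<phi>[OF mk(1,2)])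
  qed
  moreover have "h (P x) = \<zero>\<^bsub>quot E I\<^esub>"
    unfolding x(2) by (rule lin_map_zero[OF E' W h(1)])
  ultimately show ?thesis
    using coset_zero_iff[OF E I(1) x(1)] by (simp add: quot_zero[OF E I(1)])
qed

section \<open>Free Hom-Lie algebras\<close>

context
  fixes R :: "('a, 'r) ring_scheme" and X :: "'x set" and a :: "'x \<Rightarrow> 'x"
    and F :: "('a, 'f) hom_alg" and f :: "('x magma \<Rightarrow> 'a) set \<Rightarrow> 'f"
  assumes F: "hom_lie_algebra R F" and two: "\<one>\<^bsub>R\<^esub> \<oplus>\<^bsub>R\<^esub> \<one>\<^bsub>R\<^esub> \<noteq> \<zero>\<^bsub>R\<^esub>"
    and a: "a \<in> X \<rightarrow> X" and f: "f \<in> hom_lie_hom R (free_hom_lie R X a) F"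
    and bij: "bij_betw f (carrier (free_hom_lie R X a)) (carrier F)"
begin

interpretation F: hom_lie_algebra R F by (rule F)

private abbreviation (input) FA where "FA \<equiv> free_nonassoc R X a"
private abbreviation (input) FI where "FI \<equiv> presentation_ideal R X a {}"
private abbreviation (input) QF where "QF \<equiv> chain_quot R F"

definition free_eval :: "('x magma \<Rightarrow> 'a) \<Rightarrow> 'f" where
  "free_eval x = f (FI +>\<^bsub>FA\<^esub> x)"

private lemmas A_vec = hom_vector_space_free_nonassoc[OF F.field_axioms a]

interpretation FA: module R FA by (rule hom_vector_space_module[OF A_vec])

private lemmas A_mult_closed = free_nonassoc_mult_closed[OF F.field_axioms, where X = X and a = a]

lemma free_relators_closed: "hom_lie_relators FA \<subseteq> carrier FA"
proof
  fix x assume "x \<in> hom_lie_relators FA"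
  then show "x \<in> carrier FA"
    unfolding hom_lie_relators_def
    by (auto intro!: A_mult_closed hom_vector_space.twist_closed[OF A_vec])
qed

lemma free_ideal_eq: "FI = ideal_generated R FA (hom_lie_relators FA)"
  by (simp add: presentation_ideal_def)

lemma free_ideal_submodule: "submodule FI R FA"
  unfolding free_ideal_eq
  by (rule ideal_generated_ideal(1)[OF FA.module_axioms free_relators_closed A_mult_closed])

lemma free_ideal_mult:
  "\<lbrakk>y \<in> carrier FA; x \<in> FI\<rbrakk> \<Longrightarrow> y \<otimes>\<^bsub>FA\<^esub> x \<in> FI"
  "\<lbrakk>y \<in> carrier FA; x \<in> FI\<rbrakk> \<Longrightarrow> x \<otimes>\<^bsub>FA\<^esub> y \<in> FI"
  unfolding free_ideal_eq
  using ideal_generated_ideal(2,3)[OF FA.module_axioms free_relators_closed A_mult_closed] by blast+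

text \<open>The twist of words is multiplicative, so it maps relators to relators and the preimage
  of the ideal is again a two-sided ideal.\<close>

lemma free_ideal_twist:
  assumes "x \<in> FI"
  shows "\<alpha>\<^bsub>FA\<^esub> x \<in> FI"
proof -
  let ?P = "push R (map_magma a)"
  note tw = free_nonassoc_twist[OF F.field_axioms, of X a]
  have P: "?P \<in> lin_map R FA FA"
    by (rule push_magma_lin_map[OF F.field_axioms a])
  note P_mult = push_magma_mult[OF F.field_axioms a, where a = a and b = a]
  have rel: "?P x \<in> hom_lie_relators FA" if "x \<in> hom_lie_relators FA" for x
    by (rule hom_lie_relators_map[OF A_vec P P_mult _ A_mult_closed that]) (simp_all add: tw)
  have "ideal_generated R FA (hom_lie_relators FA) \<subseteq> {x \<in> carrier FA. ?P x \<in> FI}"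
  proof (rule ideal_generated_minimal)
    show "hom_lie_relators FA \<subseteq> {x \<in> carrier FA. ?P x \<in> FI}"
      using rel free_relators_closed ideal_generated_superset[of "hom_lie_relators FA" R FA]
      unfolding free_ideal_eq by blast
    show "submodule {x \<in> carrier FA. ?P x \<in> FI} R FA"
      by (rule submodule_vimage[OF FA.module_axioms FA.module_axioms P free_ideal_submodule])
    fix y x assume "y \<in> carrier FA" "x \<in> {x \<in> carrier FA. ?P x \<in> FI}"
    then show "y \<otimes>\<^bsub>FA\<^esub> x \<in> {x \<in> carrier FA. ?P x \<in> FI}" "x \<otimes>\<^bsub>FA\<^esub> y \<in> {x \<in> carrier FA. ?P x \<in> FI}"
      using free_ideal_mult lin_map_closed[OF P] A_mult_closed by (auto simp: P_mult)
  qed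
  then show ?thesis
    using assms unfolding tw free_ideal_eq by blast
qed

lemma free_hom_lie_eq: "free_hom_lie R X a = quot FA FI"
  by (simp add: free_hom_lie_def presented_hom_lie_def)

lemma free_proj: "(\<lambda>x. FI +>\<^bsub>FA\<^esub> x) \<in> hom_vec_hom R FA (free_hom_lie R X a)"
  unfolding free_hom_lie_eq
  by (rule hom_vector_space_quot(2)[OF A_vec free_ideal_submodule], erule free_ideal_twist)

lemma free_eval_hom: "free_eval \<in> hom_vec_hom R FA F"
  using hom_vec_hom_comp[OF free_proj hom_lie_hom_vec[OF f]] by (simp add: free_eval_def[abs_def])

lemmas free_eval_lin = hom_vec_hom_lin_map[OF free_eval_hom]

lemma free_carrier: "carrier (free_hom_lie R X a) = (\<lambda>x. FI +>\<^bsub>FA\<^esub> x) ` carrier FA"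
  unfolding free_hom_lie_eq by (rule quot_carrier[OF FA.module_axioms free_ideal_submodule])

lemma free_eval_surj: "free_eval ` carrier FA = carrier F"
  using bij_betw_imp_surj_on[OF bij] unfolding free_carrier image_image free_eval_def .

text \<open>Injectivity of \<open>f\<close> identifies the relations that hold in \<open>F\<close>
  with the presentation ideal; this is what freeness contributes.\<close>

lemma free_eval_zero_iff:
  assumes "x \<in> carrier FA"
  shows "free_eval x = \<zero>\<^bsub>F\<^esub> \<longleftrightarrow> x \<in> FI"
proof -
  have FL: "module R (free_hom_lie R X a)"
    unfolding free_hom_lie_eq by (rule quot_module[OF FA.module_axioms free_ideal_submodule])
  interpret FL: module R "free_hom_lie R X a" by (rule FL)
  have "f \<zero>\<^bsub>free_hom_lie R X a\<^esub> = \<zero>\<^bsub>F\<^esub>"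
    by (rule lin_map_zero[OF FL F.module_axioms hom_lie_hom_lin[OF f]])
  then have "free_eval x = \<zero>\<^bsub>F\<^esub> \<longleftrightarrow> f (FI +>\<^bsub>FA\<^esub> x) = f \<zero>\<^bsub>free_hom_lie R X a\<^esub>"
    by (simp add: free_eval_def)
  also have "\<dots> \<longleftrightarrow> FI +>\<^bsub>FA\<^esub> x = \<zero>\<^bsub>free_hom_lie R X a\<^esub>"
    using assms bij_betw_imp_inj_on[OF bij] FL.zero_closed
    by (intro inj_on_eq_iff) (auto simp: free_carrier)
  also have "\<dots> \<longleftrightarrow> x \<in> FI"
    unfolding free_hom_lie_eq quot_zero[OF FA.module_axioms free_ideal_submodule]
    by (rule coset_zero_iff[OF FA.module_axioms free_ideal_submodule assms])
  finally show ?thesis .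
qed

lemma free_eval_mult:
  assumes x: "x \<in> carrier FA" and y: "y \<in> carrier FA"
  shows "free_eval (x \<otimes>\<^bsub>FA\<^esub> y) = free_eval x \<otimes>\<^bsub>F\<^esub> free_eval y"
proof -
  note l = free_nonassoc_mult_lin_map[OF F.field_axioms]
  note sub = submoduleD[OF free_ideal_submodule]
  \<comment> \<open>\<open>rcoset_mult\<close> is a union over all pairs of representatives. The
    cosets coincide because \<open>u v - x y = i v + x j\<close> lies in the ideal.\<close>
  have cong: "FI +>\<^bsub>FA\<^esub> (u \<otimes>\<^bsub>FA\<^esub> v) = FI +>\<^bsub>FA\<^esub> (x \<otimes>\<^bsub>FA\<^esub> y)"
    if uv: "u \<in> FI +>\<^bsub>FA\<^esub> x" "v \<in> FI +>\<^bsub>FA\<^esub> y" for u v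
  proof -
    obtain i j where ij: "i \<in> FI" "u = i \<oplus>\<^bsub>FA\<^esub> x" "j \<in> FI" "v = j \<oplus>\<^bsub>FA\<^esub> y"
      using uv unfolding coset_iff by blast
    have c: "i \<in> carrier FA" "j \<in> carrier FA" "u \<in> carrier FA" "v \<in> carrier FA"
      using ij sub(2) x y by auto
    have "u \<otimes>\<^bsub>FA\<^esub> v = i \<otimes>\<^bsub>FA\<^esub> v \<oplus>\<^bsub>FA\<^esub> x \<otimes>\<^bsub>FA\<^esub> v"
      unfolding ij(2) by (rule lin_map_add[OF l(2)[OF c(4)] c(1) x])
    also have "x \<otimes>\<^bsub>FA\<^esub> v = x \<otimes>\<^bsub>FA\<^esub> j \<oplus>\<^bsub>FA\<^esub> x \<otimes>\<^bsub>FA\<^esub> y"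
      unfolding ij(4) by (rule lin_map_add[OF l(1)[OF x] c(2) y])
    finally have "u \<otimes>\<^bsub>FA\<^esub> v \<ominus>\<^bsub>FA\<^esub> x \<otimes>\<^bsub>FA\<^esub> y = i \<otimes>\<^bsub>FA\<^esub> v \<oplus>\<^bsub>FA\<^esub> x \<otimes>\<^bsub>FA\<^esub> j"
      using A_mult_closed c x y by (simp add: a_minus_def FA.a_assoc FA.r_neg)
    also have "\<dots> \<in> FI"
      using free_ideal_mult ij c x y by (intro sub(4)) auto
    finally show ?thesis
      using A_mult_closed c x y by (intro coset_eqI[OF FA.module_axioms free_ideal_submodule]) auto
  qed
  have "rcoset_mult FA FI (FI +>\<^bsub>FA\<^esub> x) (FI +>\<^bsub>FA\<^esub> y) = FI +>\<^bsub>FA\<^esub> (x \<otimes>\<^bsub>FA\<^esub> y)"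
    using cong coset_self[OF FA.module_axioms free_ideal_submodule x]
      coset_self[OF FA.module_axioms free_ideal_submodule y]
    unfolding rcoset_mult_def by blast
  then have "(FI +>\<^bsub>FA\<^esub> x) \<otimes>\<^bsub>free_hom_lie R X a\<^esub> (FI +>\<^bsub>FA\<^esub> y) = FI +>\<^bsub>FA\<^esub> (x \<otimes>\<^bsub>FA\<^esub> y)"
    by (simp add: free_hom_lie_eq quot_def)
  then show ?thesis
    using hom_lie_hom_lie[OF f, of "FI +>\<^bsub>FA\<^esub> x" "FI +>\<^bsub>FA\<^esub> y"] x y
    by (simp add: free_eval_def free_carrier)
qed

text \<open>The candidate inverse of the commutator, on words. Relators and lifts of classes are
  built from products, where the second equation is the one evaluated; zero is a default at
  generators.\<close>

primrec free_lift :: "'x magma \<Rightarrow> ('f list \<Rightarrow> 'a) set set" where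
  "free_lift (Gen x) = \<zero>\<^bsub>QF\<^esub>"
| "free_lift (Mul s t) = chain_class R F (free_eval (single R s)) (free_eval (single R t))"

text \<open>
  The commutator of a free algebra is injective because the decomposable part of a word determines
  an element of the exterior square that depends only on the value of the word.
\<close>

lemma free_chain_commutator_inj:
  assumes x: "x \<in> carrier QF" "chain_commutator R F x = \<zero>\<^bsub>F\<^esub>"
  shows "x = \<zero>\<^bsub>QF\<^esub>"
proof -
  interpret QF: module R QF by (rule chain_quot_module[OF F two])
  let ?T = "lin_ext R QF free_lift"
  note ev = lin_map_closed[OF free_eval_lin] and sc = single_word_closed[OF F.field_axioms]
  note form = chain_class_form[OF F two] and M = hom_lie_ideal_carrier[OF F]
  have l: "(\<lambda>u. chain_class R F u v) \<in> lin_map R F QF" if "v \<in> carrier F" for v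
    using exterior_form_lin_left[OF form that] by (simp add: lin_map_def)
  have fs: "free_lift \<in> {t. set_magma t \<subseteq> X} \<rightarrow> carrier QF"
  proof
    fix t assume "t \<in> {t. set_magma t \<subseteq> X}"
    then show "free_lift t \<in> carrier QF"
      by (cases t) (auto intro!: chain_class_closed[OF F two] ev sc)
  qed
  have T: "?T \<in> lin_map R FA QF"
    using lin_ext_lin_map[OF F.field_axioms QF.module_axioms fs]
    by (simp add: lin_map_free_nonassoc[OF F.field_axioms])
  have T_single: "?T (single R t) = free_lift t" if "set_magma t \<subseteq> X" for t
    by (rule lin_ext_single[OF F.field_axioms QF.module_axioms fs]) (use that in auto)
  have T_mult: "?T (y \<otimes>\<^bsub>FA\<^esub> z) = chain_class R F (free_eval y) (free_eval z)"
    if "y \<in> carrier FA" "z \<in> carrier FA" for y z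
    by (rule free_nonassoc_mult_transfer[OF F.field_axioms F.module_axioms F.module_axioms
          QF.module_axioms free_eval_lin free_eval_lin T exterior_form_lin_right[OF form] l _ that])
      (auto simp: T_single)
  \<comment> \<open>The kernel of \<open>?T\<close> need not be an ideal, but \<open>?T\<close> of a
    product is determined by the values of the factors; so the elements of the kernel that in
    addition evaluate to zero form one.\<close>
  let ?J = "{y \<in> carrier FA. ?T y = \<zero>\<^bsub>QF\<^esub>} \<inter> {y \<in> carrier FA. free_eval y = \<zero>\<^bsub>F\<^esub>}"
  note tw = hom_vector_space.twist_closed[OF A_vec]
  have rel: "?T y = \<zero>\<^bsub>QF\<^esub>" if "y \<in> hom_lie_relators FA" for y
    using that unfolding hom_lie_relators_def Un_iff mem_Collect_eq
  proof (elim disjE exE conjE)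
    fix c d assume y: "y = c \<otimes>\<^bsub>FA\<^esub> d \<oplus>\<^bsub>FA\<^esub> d \<otimes>\<^bsub>FA\<^esub> c" and cd: "c \<in> carrier FA" "d \<in> carrier FA"
    have "?T y = chain_class R F (free_eval c) (free_eval d)
        \<oplus>\<^bsub>QF\<^esub> chain_class R F (free_eval d) (free_eval c)"
      unfolding y using cd A_mult_closed by (simp add: lin_map_add[OF T] T_mult)
    also have "chain_class R F (free_eval d) (free_eval c)
        = \<ominus>\<^bsub>QF\<^esub> chain_class R F (free_eval c) (free_eval d)"
      by (rule exterior_form_antisym[OF F M QF.module_axioms form ev[OF cd(2)] ev[OF cd(1)]])
    finally show "?T y = \<zero>\<^bsub>QF\<^esub>"
      using chain_class_closed[OF F two] ev cd by (simp add: QF.r_neg)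
  next
    fix c d g assume y: "y = \<alpha>\<^bsub>FA\<^esub> c \<otimes>\<^bsub>FA\<^esub> (d \<otimes>\<^bsub>FA\<^esub> g) \<oplus>\<^bsub>FA\<^esub> \<alpha>\<^bsub>FA\<^esub> d \<otimes>\<^bsub>FA\<^esub> (g \<otimes>\<^bsub>FA\<^esub> c)
        \<oplus>\<^bsub>FA\<^esub> \<alpha>\<^bsub>FA\<^esub> g \<otimes>\<^bsub>FA\<^esub> (c \<otimes>\<^bsub>FA\<^esub> d)" and cdg: "c \<in> carrier FA" "d \<in> carrier FA" "g \<in> carrier FA"
    show "?T y = \<zero>\<^bsub>QF\<^esub>"
      unfolding y using cdg A_mult_closed tw
        exterior_form_jacobi[OF F M QF.module_axioms form ev[OF cdg(1)] ev[OF cdg(2)] ev[OF cdg(3)]]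
      by (simp add: lin_map_add[OF T] T_mult free_eval_mult hom_vec_hom_twist[OF free_eval_hom])
  qed
  have J1: "submodule {y \<in> carrier FA. ?T y = \<zero>\<^bsub>QF\<^esub>} R FA"
    by (rule submodule_kernel[OF FA.module_axioms QF.module_axioms T])
  have J2: "submodule {y \<in> carrier FA. free_eval y = \<zero>\<^bsub>F\<^esub>} R FA"
    by (rule submodule_kernel[OF FA.module_axioms F.module_axioms free_eval_lin])
  have FI: "FI \<subseteq> ?J"
    unfolding free_ideal_eq
  proof (rule ideal_generated_minimal)
    show "hom_lie_relators FA \<subseteq> ?J"
      using rel free_relators_closed free_eval_zero_iff
        ideal_generated_superset[of "hom_lie_relators FA" R FA]
      unfolding free_ideal_eq by blast
    show "submodule ?J R FA"
      by (rule submodule_Int[OF FA.module_axioms J1 J2])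
    fix y z assume "y \<in> carrier FA" "z \<in> ?J"
    then show "y \<otimes>\<^bsub>FA\<^esub> z \<in> ?J" "z \<otimes>\<^bsub>FA\<^esub> y \<in> ?J"
      using A_mult_closed exterior_form_zero[OF F M QF.module_axioms form] ev
      by (auto simp: T_mult free_eval_mult)
  qed
  \<comment> \<open>The classes that admit a lift \<open>y\<close> whose value is their commutator.
    They include the generators, hence everything; if the commutator of \<open>x\<close> is zero,
    then \<open>y\<close> lies in the presentation ideal and \<open>x = ?T y = 0\<close>.\<close>
  have sub: "submodule {x \<in> carrier QF. \<exists>y\<in>carrier FA. ?T y = x \<and> free_eval y = chain_commutator R F x} R QF"
  proof (rule submodule_intro[OF QF.module_axioms])
    note cc = chain_commutator_lin[OF F two]
    let ?S = "{x \<in> carrier QF. \<exists>y\<in>carrier FA. ?T y = x \<and> free_eval y = chain_commutator R F x}"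
    show "?S \<subseteq> carrier QF"
      by auto
    show "\<zero>\<^bsub>QF\<^esub> \<in> ?S"
      using lin_map_zero[OF FA.module_axioms QF.module_axioms T]
        lin_map_zero[OF FA.module_axioms F.module_axioms free_eval_lin]
        lin_map_zero[OF QF.module_axioms F.module_axioms cc] by auto
    show "u \<oplus>\<^bsub>QF\<^esub> v \<in> ?S" if uv: "u \<in> ?S" "v \<in> ?S" for u v
    proof -
      obtain y z where "y \<in> carrier FA" "z \<in> carrier FA" "?T y = u" "?T z = v"
        "free_eval y = chain_commutator R F u" "free_eval z = chain_commutator R F v"
        using uv by auto
      then show ?thesis
        using uv by (auto simp: lin_map_add[OF cc] lin_map_add[OF T] lin_map_add[OF free_eval_lin]
            intro!: bexI[of _ "y \<oplus>\<^bsub>FA\<^esub> z"])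
    qed
    show "r \<odot>\<^bsub>QF\<^esub> u \<in> ?S" if ru: "r \<in> carrier R" "u \<in> ?S" for r u
    proof -
      obtain y where "y \<in> carrier FA" "?T y = u" "free_eval y = chain_commutator R F u"
        using ru by auto
      then show ?thesis
        using ru by (auto simp: lin_map_smult[OF cc] lin_map_smult[OF T] lin_map_smult[OF free_eval_lin]
            intro!: bexI[of _ "r \<odot>\<^bsub>FA\<^esub> y"])
    qed
  qed
  have gens: "{chain_class R F u v | u v. u \<in> carrier F \<and> v \<in> carrier F}
      \<subseteq> {x \<in> carrier QF. \<exists>y\<in>carrier FA. ?T y = x \<and> free_eval y = chain_commutator R F x}"
  proof
    fix x assume "x \<in> {chain_class R F u v | u v. u \<in> carrier F \<and> v \<in> carrier F}"
    then obtain u v where uv: "u \<in> carrier F" "v \<in> carrier F" "x = chain_class R F u v"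
      by auto
    obtain c d where cd: "c \<in> carrier FA" "d \<in> carrier FA" "u = free_eval c" "v = free_eval d"
      using uv(1,2) unfolding free_eval_surj[symmetric] by auto
    then have "?T (c \<otimes>\<^bsub>FA\<^esub> d) = x" "free_eval (c \<otimes>\<^bsub>FA\<^esub> d) = chain_commutator R F x"
      using uv chain_commutator_class[OF F two uv(1,2)] by (simp_all add: T_mult free_eval_mult)
    then show "x \<in> {x \<in> carrier QF. \<exists>y\<in>carrier FA. ?T y = x \<and> free_eval y = chain_commutator R F x}"
      using A_mult_closed[OF cd(1,2)] chain_class_closed[OF F two uv(1,2)] uv(3)
      by (intro CollectI conjI bexI[of _ "c \<otimes>\<^bsub>FA\<^esub> d"]) simp_all
  qed
  have "carrier QF \<subseteq> {x \<in> carrier QF. \<exists>y\<in>carrier FA. ?T y = x \<and> free_eval y = chain_commutator R F x}"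
    using lin_span_minimal[OF gens sub] by (simp only: lin_span_chain_class[OF F two])
  then obtain y where y: "y \<in> carrier FA" "?T y = x" "free_eval y = chain_commutator R F x"
    using x(1) by blast
  then have "y \<in> FI"
    using x(2) free_eval_zero_iff by simp
  then show ?thesis
    using FI y(2) by auto
qed

end

section \<open>Split extensions\<close>

text \<open>Since \<open>x = \<pi> x + \<tau> x\<close>, one has \<open>x \<and> y - \<tau> x \<and>
  \<tau> y = \<pi> x \<and> y - \<pi> y \<and> \<tau> x\<close>, and the right-hand side can be
  written in \<open>M \<curlywedge> K\<close> because its left entries lie in \<open>M\<close>; this
  is the origin of \<open>?\<phi>\<close>. Being a left inverse, the induced map gives injectivity
  on the whole of \<open>M \<curlywedge> K\<close> and not only on the kernel of the
  commutator.\<close>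

lemma split_exterior_inj:
  assumes K: "hom_lie_algebra R K" and two: "\<one>\<^bsub>R\<^esub> \<oplus>\<^bsub>R\<^esub> \<one>\<^bsub>R\<^esub> \<noteq> \<zero>\<^bsub>R\<^esub>"
    and M: "hom_lie_ideal R M K" and \<tau>: "\<tau> \<in> hom_lie_hom R K K"
    and \<tau>M: "\<And>x. x \<in> carrier K \<Longrightarrow> x \<ominus>\<^bsub>K\<^esub> \<tau> x \<in> M" and M\<tau>: "\<And>m. m \<in> M \<Longrightarrow> \<tau> m = \<zero>\<^bsub>K\<^esub>"
    and h: "h \<in> lin_map R (exterior R K M (carrier K)) (chain_quot R K)"
      "\<And>m n. \<lbrakk>m \<in> M; n \<in> carrier K\<rbrakk> \<Longrightarrow> h (ext_elem R K M m n) = chain_class R K m n"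
    and x: "x \<in> carrier (exterior R K M (carrier K))" "h x = \<zero>\<^bsub>chain_quot R K\<^esub>"
  shows "x = \<zero>\<^bsub>exterior R K M (carrier K)\<^esub>"
proof -
  interpret K: hom_lie_algebra R K by (rule K)
  let ?E = "exterior R K M (carrier K)"
  note Em = exterior_module[OF K two M]
  interpret E: module R ?E by (rule Em)
  let ?e = "ext_elem R K M"
  note e = ext_elem_form[OF K two M]
  define \<pi> where "\<pi> x = x \<ominus>\<^bsub>K\<^esub> \<tau> x" for x
  let ?\<phi> = "\<lambda>x y. ?e (\<pi> x) y \<ominus>\<^bsub>?E\<^esub> ?e (\<pi> y) (\<tau> x)"
  note c = ideal_closed[OF K two M]
  note \<tau>s = hom_lie_homD[OF \<tau>]
  have \<tau>c: "\<tau> x \<in> carrier K" if "x \<in> carrier K" for x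
    by (rule \<tau>s(3)[OF that])
  have \<pi>M: "\<pi> x \<in> M" if "x \<in> carrier K" for x
    unfolding \<pi>_def by (rule \<tau>M[OF that])
  have \<pi>K: "\<pi> x \<in> carrier K" if "x \<in> carrier K" for x
    by (rule c(1)[OF \<pi>M[OF that]])
  have split: "\<pi> x \<oplus>\<^bsub>K\<^esub> \<tau> x = x" if "x \<in> carrier K" for x
    using that \<tau>c by (simp add: \<pi>_def a_minus_def K.a_assoc K.l_neg)
  have \<pi>_lin: "\<pi> \<in> lin_map R K (K\<lparr>carrier := M\<rparr>)"
  proof (rule lin_mapI)
    show "\<pi> x \<in> carrier (K\<lparr>carrier := M\<rparr>)" if "x \<in> carrier K" for x
      using \<pi>M[OF that] by simp
    show "\<pi> (x \<oplus>\<^bsub>K\<^esub> y) = \<pi> x \<oplus>\<^bsub>K\<lparr>carrier := M\<rparr>\<^esub> \<pi> y" if "x \<in> carrier K" "y \<in> carrier K" for x y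
      using that \<tau>c by (simp add: \<pi>_def \<tau>s(6) a_minus_def K.minus_add K.a_ac)
    show "\<pi> (r \<odot>\<^bsub>K\<^esub> x) = r \<odot>\<^bsub>K\<lparr>carrier := M\<rparr>\<^esub> \<pi> x" if "r \<in> carrier R" "x \<in> carrier K" for r x
      using that \<tau>c by (simp add: \<pi>_def \<tau>s(7) a_minus_def K.smult_r_distr K.smult_r_minus)
  qed
  note ec = exterior_form_closed[OF e]
  have sub_lin: "(\<lambda>x. u x \<ominus>\<^bsub>?E\<^esub> v x) \<in> lin_map R K ?E"
    if "u \<in> lin_map R K ?E" "v \<in> lin_map R K ?E" for u v
    using lin_mapD[OF that(1)] lin_mapD[OF that(2)]
    by (intro lin_mapI) (simp_all add: a_minus_def E.minus_add E.a_ac E.smult_r_distr E.smult_r_minus)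
  have form: "exterior_form R K (carrier K) ?E ?\<phi>"
  proof (rule exterior_form_carrierI[OF K Em])
    fix x assume x: "x \<in> carrier K"
    show "(\<lambda>y. ?\<phi> x y) \<in> lin_map R K ?E"
      by (rule sub_lin[OF exterior_form_lin_right[OF e \<pi>M[OF x]]
            lin_map_comp[OF \<pi>_lin exterior_form_lin_left[OF e \<tau>c[OF x]]]])
    show "(\<lambda>y. ?\<phi> y x) \<in> lin_map R K ?E"
      by (rule sub_lin[OF lin_map_comp[OF \<pi>_lin exterior_form_lin_left[OF e x]]
            lin_map_comp[OF \<tau>s(2) exterior_form_lin_right[OF e \<pi>M[OF x]]]])
    have "?e (\<pi> x) x = ?e (\<pi> x) (\<pi> x \<oplus>\<^bsub>K\<^esub> \<tau> x)"
      by (simp only: split[OF x])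
    also have "\<dots> = ?e (\<pi> x) (\<pi> x) \<oplus>\<^bsub>?E\<^esub> ?e (\<pi> x) (\<tau> x)"
      by (rule exterior_form_add_right[OF e \<pi>M[OF x] \<pi>K[OF x] \<tau>c[OF x]])
    also have "\<dots> = ?e (\<pi> x) (\<tau> x)"
      using exterior_form_self[OF e \<pi>M[OF x]] ec[OF \<pi>M[OF x] \<tau>c[OF x]] by simp
    finally have "?e (\<pi> x) x = ?e (\<pi> x) (\<tau> x)" .
    then show "?\<phi> x x = \<zero>\<^bsub>?E\<^esub>"
      using ec[OF \<pi>M[OF x] \<tau>c[OF x]] by (simp add: a_minus_def E.r_neg)
    fix y z assume y: "y \<in> carrier K" and z: "z \<in> carrier K"
    have cancel: "u \<oplus>\<^bsub>?E\<^esub> (v \<oplus>\<^bsub>?E\<^esub> (\<ominus>\<^bsub>?E\<^esub> u \<oplus>\<^bsub>?E\<^esub> \<ominus>\<^bsub>?E\<^esub> v)) = \<zero>\<^bsub>?E\<^esub>"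
      if "u \<in> carrier ?E" "v \<in> carrier ?E" for u v
      using that E.r_neg[of "u \<oplus>\<^bsub>?E\<^esub> v"] by (simp add: E.minus_add E.a_assoc)
    \<comment> \<open>The cyclic identity with at least two entries in \<open>M\<close>, where
      antisymmetry is available for the two terms that have to be flipped.\<close>
    have A: "?e (m \<otimes>\<^bsub>K\<^esub> m') (\<alpha>\<^bsub>K\<^esub> n) \<oplus>\<^bsub>?E\<^esub> ?e (m' \<otimes>\<^bsub>K\<^esub> n) (\<alpha>\<^bsub>K\<^esub> m)
        \<oplus>\<^bsub>?E\<^esub> ?e (n \<otimes>\<^bsub>K\<^esub> m) (\<alpha>\<^bsub>K\<^esub> m') = \<zero>\<^bsub>?E\<^esub>"
      if m: "m \<in> M" "m' \<in> M" "n \<in> carrier K" for m m' n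
    proof -
      note mc = c(1)[OF m(1)] c(1)[OF m(2)] m(3)
      have "?e (m' \<otimes>\<^bsub>K\<^esub> n) (\<alpha>\<^bsub>K\<^esub> m) = \<ominus>\<^bsub>?E\<^esub> ?e (\<alpha>\<^bsub>K\<^esub> m) (m' \<otimes>\<^bsub>K\<^esub> n)"
        using m c by (intro exterior_form_antisym[OF K M Em e]) auto
      moreover have "?e (n \<otimes>\<^bsub>K\<^esub> m) (\<alpha>\<^bsub>K\<^esub> m') = \<ominus>\<^bsub>?E\<^esub> ?e (\<alpha>\<^bsub>K\<^esub> m') (n \<otimes>\<^bsub>K\<^esub> m)"
        using m c by (intro exterior_form_antisym[OF K M Em e]) auto
      moreover have "?e (\<alpha>\<^bsub>K\<^esub> m') (n \<otimes>\<^bsub>K\<^esub> m) = \<ominus>\<^bsub>?E\<^esub> ?e (\<alpha>\<^bsub>K\<^esub> m') (m \<otimes>\<^bsub>K\<^esub> n)"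
        using K.lie_antisym[OF mc(3,1)] exterior_form_a_inv(1)[OF K M Em e c(6)[OF m(2)]
            K.lie_closed[OF mc(1,3)]] by simp
      moreover have "?e (\<alpha>\<^bsub>K\<^esub> m') (m \<otimes>\<^bsub>K\<^esub> n) \<in> carrier ?E" "?e (\<alpha>\<^bsub>K\<^esub> m) (m' \<otimes>\<^bsub>K\<^esub> n) \<in> carrier ?E"
        using m c by (auto intro!: ec)
      ultimately show ?thesis
        unfolding exterior_form_lie_left[OF e m]
        by (simp add: a_minus_def E.minus_add E.a_ac E.r_neg E.r_neg1 E.r_neg2 cancel)
    qed
    \<comment> \<open>With only one entry in \<open>M\<close>, the bracket \<open>[n, n']\<close>
      cannot stand on the left; that term appears with its arguments exchanged and a minus
      sign.\<close>
    have B: "?e (m \<otimes>\<^bsub>K\<^esub> n) (\<alpha>\<^bsub>K\<^esub> n') \<ominus>\<^bsub>?E\<^esub> ?e (\<alpha>\<^bsub>K\<^esub> m) (n \<otimes>\<^bsub>K\<^esub> n')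
        \<oplus>\<^bsub>?E\<^esub> ?e (n' \<otimes>\<^bsub>K\<^esub> m) (\<alpha>\<^bsub>K\<^esub> n) = \<zero>\<^bsub>?E\<^esub>"
      if m: "m \<in> M" "n \<in> carrier K" "n' \<in> carrier K" for m n n'
    proof -
      note mc = c(1)[OF m(1)]
      have "?e (n \<otimes>\<^bsub>K\<^esub> m) (\<alpha>\<^bsub>K\<^esub> n') = \<ominus>\<^bsub>?E\<^esub> ?e (m \<otimes>\<^bsub>K\<^esub> n) (\<alpha>\<^bsub>K\<^esub> n')"
        using K.lie_antisym[OF m(2) mc] exterior_form_a_inv(2)[OF K M Em e c(7)[OF m(1,2)]
            c(9)[OF m(3)]] by simp
      moreover have "?e (m \<otimes>\<^bsub>K\<^esub> n) (\<alpha>\<^bsub>K\<^esub> n') \<in> carrier ?E" "?e (n' \<otimes>\<^bsub>K\<^esub> m) (\<alpha>\<^bsub>K\<^esub> n) \<in> carrier ?E"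
        using m c by (auto intro!: ec)
      ultimately show ?thesis
        unfolding exterior_form_lie_right[OF e m]
        by (simp add: a_minus_def E.minus_add E.a_ac E.r_neg E.r_neg1 E.r_neg2)
    qed
    \<comment> \<open>As \<open>\<tau>\<close> is a homomorphism,
      \<open>\<pi> [x, y] = [x, y] - [\<tau> x, \<tau> y]\<close>, which leaves three of the four
      brackets in the expansion of \<open>[x, y]\<close>. Splitting the twisted argument as well
      gives seven terms.\<close>
    have ex: "?\<phi> (x \<otimes>\<^bsub>K\<^esub> y) (\<alpha>\<^bsub>K\<^esub> z) =
        ?e (\<pi> x \<otimes>\<^bsub>K\<^esub> \<pi> y) (\<alpha>\<^bsub>K\<^esub> (\<pi> z)) \<oplus>\<^bsub>?E\<^esub> ?e (\<pi> x \<otimes>\<^bsub>K\<^esub> \<pi> y) (\<alpha>\<^bsub>K\<^esub> (\<tau> z)) \<oplus>\<^bsub>?E\<^esub>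
        (?e (\<pi> x \<otimes>\<^bsub>K\<^esub> \<tau> y) (\<alpha>\<^bsub>K\<^esub> (\<pi> z)) \<oplus>\<^bsub>?E\<^esub> ?e (\<pi> x \<otimes>\<^bsub>K\<^esub> \<tau> y) (\<alpha>\<^bsub>K\<^esub> (\<tau> z))) \<oplus>\<^bsub>?E\<^esub>
        (?e (\<tau> x \<otimes>\<^bsub>K\<^esub> \<pi> y) (\<alpha>\<^bsub>K\<^esub> (\<pi> z)) \<oplus>\<^bsub>?E\<^esub> ?e (\<tau> x \<otimes>\<^bsub>K\<^esub> \<pi> y) (\<alpha>\<^bsub>K\<^esub> (\<tau> z))) \<oplus>\<^bsub>?E\<^esub>
        \<ominus>\<^bsub>?E\<^esub> ?e (\<alpha>\<^bsub>K\<^esub> (\<pi> z)) (\<tau> x \<otimes>\<^bsub>K\<^esub> \<tau> y)"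
      if x: "x \<in> carrier K" and y: "y \<in> carrier K" and z: "z \<in> carrier K" for x y z
    proof -
      note xc = \<pi>M[OF x] \<pi>M[OF y] \<pi>M[OF z] \<tau>c[OF x] \<tau>c[OF y] \<tau>c[OF z] \<pi>K[OF x] \<pi>K[OF y] \<pi>K[OF z]
      have "x \<otimes>\<^bsub>K\<^esub> y = (\<pi> x \<oplus>\<^bsub>K\<^esub> \<tau> x) \<otimes>\<^bsub>K\<^esub> (\<pi> y \<oplus>\<^bsub>K\<^esub> \<tau> y)"
        by (simp only: split[OF x] split[OF y])
      also have "\<dots> = \<pi> x \<otimes>\<^bsub>K\<^esub> \<pi> y \<oplus>\<^bsub>K\<^esub> \<pi> x \<otimes>\<^bsub>K\<^esub> \<tau> y \<oplus>\<^bsub>K\<^esub> \<tau> x \<otimes>\<^bsub>K\<^esub> \<pi> y \<oplus>\<^bsub>K\<^esub> \<tau> x \<otimes>\<^bsub>K\<^esub> \<tau> y"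
        using xc c by (simp add: K.lie_add_left K.lie_add_right K.a_ac)
      finally have xy: "x \<otimes>\<^bsub>K\<^esub> y
          = \<pi> x \<otimes>\<^bsub>K\<^esub> \<pi> y \<oplus>\<^bsub>K\<^esub> \<pi> x \<otimes>\<^bsub>K\<^esub> \<tau> y \<oplus>\<^bsub>K\<^esub> \<tau> x \<otimes>\<^bsub>K\<^esub> \<pi> y \<oplus>\<^bsub>K\<^esub> \<tau> x \<otimes>\<^bsub>K\<^esub> \<tau> y" .
      have "\<pi> (x \<otimes>\<^bsub>K\<^esub> y) = (x \<otimes>\<^bsub>K\<^esub> y) \<ominus>\<^bsub>K\<^esub> \<tau> x \<otimes>\<^bsub>K\<^esub> \<tau> y"
        by (simp add: \<pi>_def \<tau>s(5)[OF x y])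
      also have "\<dots> = \<pi> x \<otimes>\<^bsub>K\<^esub> \<pi> y \<oplus>\<^bsub>K\<^esub> \<pi> x \<otimes>\<^bsub>K\<^esub> \<tau> y \<oplus>\<^bsub>K\<^esub> \<tau> x \<otimes>\<^bsub>K\<^esub> \<pi> y"
        unfolding xy using xc c by (simp add: a_minus_def K.a_assoc K.r_neg)
      finally have 1: "\<pi> (x \<otimes>\<^bsub>K\<^esub> y) = \<pi> x \<otimes>\<^bsub>K\<^esub> \<pi> y \<oplus>\<^bsub>K\<^esub> \<pi> x \<otimes>\<^bsub>K\<^esub> \<tau> y \<oplus>\<^bsub>K\<^esub> \<tau> x \<otimes>\<^bsub>K\<^esub> \<pi> y" .
      have 2: "\<pi> (\<alpha>\<^bsub>K\<^esub> z) = \<alpha>\<^bsub>K\<^esub> (\<pi> z)"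
        unfolding \<pi>_def \<tau>s(4)[OF z]
        by (rule lin_map_minus[OF K.module_axioms K.module_axioms
              twist_lin_map[OF K.hom_vector_space_axioms] z \<tau>c[OF z], symmetric])
      have "\<alpha>\<^bsub>K\<^esub> z = \<alpha>\<^bsub>K\<^esub> (\<pi> z \<oplus>\<^bsub>K\<^esub> \<tau> z)"
        by (simp only: split[OF z])
      also have "\<dots> = \<alpha>\<^bsub>K\<^esub> (\<pi> z) \<oplus>\<^bsub>K\<^esub> \<alpha>\<^bsub>K\<^esub> (\<tau> z)"
        by (rule K.twist_add[OF xc(9,6)])
      finally have 3: "\<alpha>\<^bsub>K\<^esub> z = \<alpha>\<^bsub>K\<^esub> (\<pi> z) \<oplus>\<^bsub>K\<^esub> \<alpha>\<^bsub>K\<^esub> (\<tau> z)" .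
      note cl = xc c(2,6,7,8,9,10)
      have 4: "?e u (\<alpha>\<^bsub>K\<^esub> z) = ?e u (\<alpha>\<^bsub>K\<^esub> (\<pi> z)) \<oplus>\<^bsub>?E\<^esub> ?e u (\<alpha>\<^bsub>K\<^esub> (\<tau> z))" if "u \<in> M" for u
        unfolding 3 using that cl by (intro exterior_form_add_right[OF e]) auto
      have 5: "?e (\<pi> (x \<otimes>\<^bsub>K\<^esub> y)) (\<alpha>\<^bsub>K\<^esub> z) = ?e (\<pi> x \<otimes>\<^bsub>K\<^esub> \<pi> y) (\<alpha>\<^bsub>K\<^esub> z) \<oplus>\<^bsub>?E\<^esub>
          ?e (\<pi> x \<otimes>\<^bsub>K\<^esub> \<tau> y) (\<alpha>\<^bsub>K\<^esub> z) \<oplus>\<^bsub>?E\<^esub> ?e (\<tau> x \<otimes>\<^bsub>K\<^esub> \<pi> y) (\<alpha>\<^bsub>K\<^esub> z)"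
        unfolding 1 using cl c(9)[OF z] by (simp add: exterior_form_add_left[OF e])
      show ?thesis
        unfolding a_minus_def 2 \<tau>s(5)[OF x y] 5
        using cl by (simp add: 4)
    qed
    note xc = \<pi>M[OF x] \<pi>M[OF y] \<pi>M[OF z] \<tau>c[OF x] \<tau>c[OF y] \<tau>c[OF z] \<pi>K[OF x] \<pi>K[OF y] \<pi>K[OF z]
    have cl: "?e (u \<otimes>\<^bsub>K\<^esub> v) (\<alpha>\<^bsub>K\<^esub> t) \<in> carrier ?E" "?e (v \<otimes>\<^bsub>K\<^esub> u) (\<alpha>\<^bsub>K\<^esub> t) \<in> carrier ?E"
      "?e (\<alpha>\<^bsub>K\<^esub> u) (v \<otimes>\<^bsub>K\<^esub> t) \<in> carrier ?E" if "u \<in> M" "v \<in> carrier K" "t \<in> carrier K" for u v t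
      using that c by (auto intro!: ec)
    \<comment> \<open>The twenty-one terms of the cyclic sum are regrouped by the number of entries
      from \<open>M\<close>: one group with three and three groups with two vanish by
      \<open>A\<close>, and three groups with one vanish by \<open>B\<close>.\<close>
    have "?\<phi> (x \<otimes>\<^bsub>K\<^esub> y) (\<alpha>\<^bsub>K\<^esub> z) \<oplus>\<^bsub>?E\<^esub> ?\<phi> (y \<otimes>\<^bsub>K\<^esub> z) (\<alpha>\<^bsub>K\<^esub> x) \<oplus>\<^bsub>?E\<^esub> ?\<phi> (z \<otimes>\<^bsub>K\<^esub> x) (\<alpha>\<^bsub>K\<^esub> y) =
      (?e (\<pi> x \<otimes>\<^bsub>K\<^esub> \<pi> y) (\<alpha>\<^bsub>K\<^esub> (\<pi> z)) \<oplus>\<^bsub>?E\<^esub> ?e (\<pi> y \<otimes>\<^bsub>K\<^esub> \<pi> z) (\<alpha>\<^bsub>K\<^esub> (\<pi> x))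
        \<oplus>\<^bsub>?E\<^esub> ?e (\<pi> z \<otimes>\<^bsub>K\<^esub> \<pi> x) (\<alpha>\<^bsub>K\<^esub> (\<pi> y))) \<oplus>\<^bsub>?E\<^esub>
      (?e (\<pi> x \<otimes>\<^bsub>K\<^esub> \<pi> y) (\<alpha>\<^bsub>K\<^esub> (\<tau> z)) \<oplus>\<^bsub>?E\<^esub> ?e (\<pi> y \<otimes>\<^bsub>K\<^esub> \<tau> z) (\<alpha>\<^bsub>K\<^esub> (\<pi> x))
        \<oplus>\<^bsub>?E\<^esub> ?e (\<tau> z \<otimes>\<^bsub>K\<^esub> \<pi> x) (\<alpha>\<^bsub>K\<^esub> (\<pi> y))) \<oplus>\<^bsub>?E\<^esub>
      (?e (\<pi> y \<otimes>\<^bsub>K\<^esub> \<pi> z) (\<alpha>\<^bsub>K\<^esub> (\<tau> x)) \<oplus>\<^bsub>?E\<^esub> ?e (\<pi> z \<otimes>\<^bsub>K\<^esub> \<tau> x) (\<alpha>\<^bsub>K\<^esub> (\<pi> y))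
        \<oplus>\<^bsub>?E\<^esub> ?e (\<tau> x \<otimes>\<^bsub>K\<^esub> \<pi> y) (\<alpha>\<^bsub>K\<^esub> (\<pi> z))) \<oplus>\<^bsub>?E\<^esub>
      (?e (\<pi> z \<otimes>\<^bsub>K\<^esub> \<pi> x) (\<alpha>\<^bsub>K\<^esub> (\<tau> y)) \<oplus>\<^bsub>?E\<^esub> ?e (\<pi> x \<otimes>\<^bsub>K\<^esub> \<tau> y) (\<alpha>\<^bsub>K\<^esub> (\<pi> z))
        \<oplus>\<^bsub>?E\<^esub> ?e (\<tau> y \<otimes>\<^bsub>K\<^esub> \<pi> z) (\<alpha>\<^bsub>K\<^esub> (\<pi> x))) \<oplus>\<^bsub>?E\<^esub>
      (?e (\<pi> x \<otimes>\<^bsub>K\<^esub> \<tau> y) (\<alpha>\<^bsub>K\<^esub> (\<tau> z)) \<ominus>\<^bsub>?E\<^esub> ?e (\<alpha>\<^bsub>K\<^esub> (\<pi> x)) (\<tau> y \<otimes>\<^bsub>K\<^esub> \<tau> z)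
        \<oplus>\<^bsub>?E\<^esub> ?e (\<tau> z \<otimes>\<^bsub>K\<^esub> \<pi> x) (\<alpha>\<^bsub>K\<^esub> (\<tau> y))) \<oplus>\<^bsub>?E\<^esub>
      (?e (\<pi> y \<otimes>\<^bsub>K\<^esub> \<tau> z) (\<alpha>\<^bsub>K\<^esub> (\<tau> x)) \<ominus>\<^bsub>?E\<^esub> ?e (\<alpha>\<^bsub>K\<^esub> (\<pi> y)) (\<tau> z \<otimes>\<^bsub>K\<^esub> \<tau> x)
        \<oplus>\<^bsub>?E\<^esub> ?e (\<tau> x \<otimes>\<^bsub>K\<^esub> \<pi> y) (\<alpha>\<^bsub>K\<^esub> (\<tau> z))) \<oplus>\<^bsub>?E\<^esub>
      (?e (\<pi> z \<otimes>\<^bsub>K\<^esub> \<tau> x) (\<alpha>\<^bsub>K\<^esub> (\<tau> y)) \<ominus>\<^bsub>?E\<^esub> ?e (\<alpha>\<^bsub>K\<^esub> (\<pi> z)) (\<tau> x \<otimes>\<^bsub>K\<^esub> \<tau> y)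
        \<oplus>\<^bsub>?E\<^esub> ?e (\<tau> y \<otimes>\<^bsub>K\<^esub> \<pi> z) (\<alpha>\<^bsub>K\<^esub> (\<tau> x)))"
      unfolding ex[OF x y z] ex[OF y z x] ex[OF z x y]
      unfolding a_minus_def using xc by (simp add: cl E.a_ac)
    also have "\<dots> = \<zero>\<^bsub>?E\<^esub>"
      using A[OF xc(1,2,9)] A[OF xc(1,2,6)] A[OF xc(2,3,4)] A[OF xc(3,1,5)]
        B[OF xc(1,5,6)] B[OF xc(2,6,4)] B[OF xc(3,4,5)] by simp
    finally show "?\<phi> (x \<otimes>\<^bsub>K\<^esub> y) (\<alpha>\<^bsub>K\<^esub> z) \<oplus>\<^bsub>?E\<^esub> ?\<phi> (y \<otimes>\<^bsub>K\<^esub> z) (\<alpha>\<^bsub>K\<^esub> x)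
      \<oplus>\<^bsub>?E\<^esub> ?\<phi> (z \<otimes>\<^bsub>K\<^esub> x) (\<alpha>\<^bsub>K\<^esub> y) = \<zero>\<^bsub>?E\<^esub>" .
  qed
  obtain r where r: "r \<in> lin_map R (chain_quot R K) ?E"
    "\<forall>x\<in>carrier K. \<forall>y\<in>carrier K. r (chain_class R K x y) = ?\<phi> x y"
    using chain_quot_universal[OF K two Em form] by blast
  have idl: "(\<lambda>x. x) \<in> lin_map R ?E ?E"
    by (auto intro: lin_mapI)
  have "r (h x) = x"
  proof (rule lin_span_eq_on[OF Em Em lin_map_comp[OF h(1) r(1)] idl
        lin_span_ext_elem[OF K two M] _ x(1)])
    fix u assume "u \<in> {?e m n | m n. m \<in> M \<and> n \<in> carrier K}"
    then obtain m n where mn: "m \<in> M" "n \<in> carrier K" "u = ?e m n"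
      by auto
    \<comment> \<open>On \<open>M\<close> the homomorphism \<open>\<tau>\<close> vanishes, so the
      second term of the form disappears and \<open>r\<close> returns the generator.\<close>
    have "\<pi> m = m"
      using c(1)[OF mn(1)] M\<tau>[OF mn(1)] by (simp add: \<pi>_def a_minus_def)
    then have "?\<phi> m n = ?e m n \<ominus>\<^bsub>?E\<^esub> ?e (\<pi> n) \<zero>\<^bsub>K\<^esub>"
      using M\<tau>[OF mn(1)] by simp
    also have "\<dots> = ?e m n"
      using exterior_form_zero(1)[OF K M Em e \<pi>M[OF mn(2)]] ec[OF mn(1,2)]
      by (simp add: a_minus_def)
    finally show "r (h u) = u"
      using r(2) mn c(1)[OF mn(1)] by (simp add: h(2))
  qed
  then show ?thesis
    using x(2) lin_map_zero[OF chain_quot_module[OF K two] Em r(1)] by simp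
qed

section \<open>The exact sequence\<close>

lemma hom_lie_extensionD:
  assumes "hom_lie_extension R M K L p"
  shows "hom_lie_algebra R K" "hom_lie_algebra R L" "hom_lie_ideal R M K" "p \<in> hom_lie_hom R K L"
    "p ` carrier K = carrier L" "M = {x \<in> carrier K. p x = \<zero>\<^bsub>L\<^esub>}"
  using assms by (auto simp: hom_lie_extension_def a_kernel_eq)

text \<open>Passage from a row to the kernels of its vertical maps. The hypothesis \<open>ex\<close>
  asks for a preimage that lies in the kernel: this is automatic where the first two vertical maps
  share their target and commute with \<open>f\<close>, while in
  \<open>exact_at_commutator_ker_K\<close> the preimage has to be corrected.\<close>

lemma exact_at_kernels:
  assumes V: "hom_vector_space R V1" "hom_vector_space R V2" "hom_vector_space R V3"
    and U: "hom_vector_space R U1" "hom_vector_space R U2" "hom_vector_space R U3"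
    and c: "c1 \<in> hom_vec_hom R V1 U1" "c2 \<in> hom_vec_hom R V2 U2" "c3 \<in> hom_vec_hom R V3 U3"
    and fg: "f \<in> hom_vec_hom R V1 V2" "g \<in> hom_vec_hom R V2 V3"
    and f: "\<And>x. \<lbrakk>x \<in> carrier V1; c1 x = \<zero>\<^bsub>U1\<^esub>\<rbrakk> \<Longrightarrow> c2 (f x) = \<zero>\<^bsub>U2\<^esub>"
    and g: "\<And>x. \<lbrakk>x \<in> carrier V2; c2 x = \<zero>\<^bsub>U2\<^esub>\<rbrakk> \<Longrightarrow> c3 (g x) = \<zero>\<^bsub>U3\<^esub>"
    and gf: "\<And>x. \<lbrakk>x \<in> carrier V1; c1 x = \<zero>\<^bsub>U1\<^esub>\<rbrakk> \<Longrightarrow> g (f x) = \<zero>\<^bsub>V3\<^esub>"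
    and ex: "\<And>y. \<lbrakk>y \<in> carrier V2; c2 y = \<zero>\<^bsub>U2\<^esub>; g y = \<zero>\<^bsub>V3\<^esub>\<rbrakk>
      \<Longrightarrow> \<exists>x\<in>carrier V1. c1 x = \<zero>\<^bsub>U1\<^esub> \<and> y = f x"
  shows "exact_at R (V1\<lparr>carrier := a_kernel V1 U1 c1\<rparr>) f (V2\<lparr>carrier := a_kernel V2 U2 c2\<rparr>) g
    (V3\<lparr>carrier := a_kernel V3 U3 c3\<rparr>)"
  unfolding exact_at_def
proof (intro conjI)
  note fl = lin_map_closed[OF hom_vec_hom_lin_map[OF fg(1)]]
    and gl = lin_map_closed[OF hom_vec_hom_lin_map[OF fg(2)]]
  show "hom_vector_space R (V1\<lparr>carrier := a_kernel V1 U1 c1\<rparr>)"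
    "hom_vector_space R (V2\<lparr>carrier := a_kernel V2 U2 c2\<rparr>)"
    "hom_vector_space R (V3\<lparr>carrier := a_kernel V3 U3 c3\<rparr>)"
    by (rule hom_vector_space_kernel[OF V(1) U(1) c(1)])
      (rule hom_vector_space_kernel[OF V(2) U(2) c(2)] hom_vector_space_kernel[OF V(3) U(3) c(3)])+
  show "f \<in> hom_vec_hom R (V1\<lparr>carrier := a_kernel V1 U1 c1\<rparr>) (V2\<lparr>carrier := a_kernel V2 U2 c2\<rparr>)"
    by (rule hom_vec_hom_restrict[OF fg(1)]) (auto simp: a_kernel_eq fl f)
  show "g \<in> hom_vec_hom R (V2\<lparr>carrier := a_kernel V2 U2 c2\<rparr>) (V3\<lparr>carrier := a_kernel V3 U3 c3\<rparr>)"
    by (rule hom_vec_hom_restrict[OF fg(2)]) (auto simp: a_kernel_eq gl g)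
  show "f ` carrier (V1\<lparr>carrier := a_kernel V1 U1 c1\<rparr>) = a_kernel (V2\<lparr>carrier := a_kernel V2 U2 c2\<rparr>)
      (V3\<lparr>carrier := a_kernel V3 U3 c3\<rparr>) g"
  proof
    show "f ` carrier (V1\<lparr>carrier := a_kernel V1 U1 c1\<rparr>) \<subseteq> a_kernel (V2\<lparr>carrier := a_kernel V2 U2 c2\<rparr>)
      (V3\<lparr>carrier := a_kernel V3 U3 c3\<rparr>) g"
      using fl f gf by (auto simp: a_kernel_eq)
    show "a_kernel (V2\<lparr>carrier := a_kernel V2 U2 c2\<rparr>) (V3\<lparr>carrier := a_kernel V3 U3 c3\<rparr>) g
        \<subseteq> f ` carrier (V1\<lparr>carrier := a_kernel V1 U1 c1\<rparr>)"
    proof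
      fix y assume "y \<in> a_kernel (V2\<lparr>carrier := a_kernel V2 U2 c2\<rparr>) (V3\<lparr>carrier := a_kernel V3 U3 c3\<rparr>) g"
      then have "y \<in> carrier V2" "c2 y = \<zero>\<^bsub>U2\<^esub>" "g y = \<zero>\<^bsub>V3\<^esub>"
        by (auto simp: a_kernel_eq)
      from ex[OF this] show "y \<in> f ` carrier (V1\<lparr>carrier := a_kernel V1 U1 c1\<rparr>)"
        by (auto simp: a_kernel_eq)
    qed
  qed
qed

lemma exterior_map_hom:
  assumes K: "hom_lie_algebra R K" and K': "hom_lie_algebra R K'"
    and two: "\<one>\<^bsub>R\<^esub> \<oplus>\<^bsub>R\<^esub> \<one>\<^bsub>R\<^esub> \<noteq> \<zero>\<^bsub>R\<^esub>"
    and M: "hom_lie_ideal R M K" and M': "hom_lie_ideal R M' K'"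
    and f: "f \<in> hom_lie_hom R K K'" and fM: "\<And>m. m \<in> M \<Longrightarrow> f m \<in> M'"
  shows "exterior_map R K' M' (carrier K') f
    \<in> hom_vec_hom R (exterior R K M (carrier K)) (exterior R K' M' (carrier K'))"
    and "x \<in> carrier (exterior R K M (carrier K)) \<Longrightarrow>
      commutator_map R K' (exterior_map R K' M' (carrier K') f x) = f (commutator_map R K x)"
proof -
  note l = exterior_map_lin[OF K K' two M M' f fM] and e = exterior_map_elem[OF K K' two M M' f fM]
  note c = ideal_closed[OF K two M]
  show "exterior_map R K' M' (carrier K') f
      \<in> hom_vec_hom R (exterior R K M (carrier K)) (exterior R K' M' (carrier K'))"
  proof (rule hom_vec_hom_on_span[OF exterior_vec[OF K two M] exterior_vec[OF K' two M'] l
        lin_span_ext_elem[OF K two M]])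
    fix b assume "b \<in> {ext_elem R K M m n | m n. m \<in> M \<and> n \<in> carrier K}"
    then obtain m n where mn: "m \<in> M" "n \<in> carrier K" "b = ext_elem R K M m n"
      by auto
    then show "exterior_map R K' M' (carrier K') f (\<alpha>\<^bsub>exterior R K M (carrier K)\<^esub> b)
        = \<alpha>\<^bsub>exterior R K' M' (carrier K')\<^esub> (exterior_map R K' M' (carrier K') f b)"
      using c(1)[OF mn(1)] c(6)[OF mn(1)] c(9)[OF mn(2)] fM[OF mn(1)] hom_lie_hom_closed[OF f mn(2)]
      by (simp add: ext_elem_twist[OF K two M] ext_elem_twist[OF K' two M'] e hom_lie_hom_twist[OF f])
  qed
  show "commutator_map R K' (exterior_map R K' M' (carrier K') f x) = f (commutator_map R K x)"
    if x: "x \<in> carrier (exterior R K M (carrier K))"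
  proof (rule lin_span_eq_on[OF exterior_module[OF K two M] hom_lie_algebra_module[OF K']
        lin_map_comp[OF l hom_vec_hom_lin_map[OF commutator_map_hom[OF K' two M']]]
        lin_map_comp[OF hom_vec_hom_lin_map[OF commutator_map_hom[OF K two M]] hom_lie_hom_lin[OF f]]
        lin_span_ext_elem[OF K two M] _ x])
    fix b assume "b \<in> {ext_elem R K M m n | m n. m \<in> M \<and> n \<in> carrier K}"
    then obtain m n where mn: "m \<in> M" "n \<in> carrier K" "b = ext_elem R K M m n"
      by auto
    then show "commutator_map R K' (exterior_map R K' M' (carrier K') f b) = f (commutator_map R K b)"
      using c(1)[OF mn(1)] fM[OF mn(1)] hom_lie_hom_closed[OF f mn(2)]
      by (simp add: commutator_map_elem[OF K two M] commutator_map_elem[OF K' two M'] e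
          hom_lie_hom_lie[OF f])
  qed
qed

section \<open>The part of the sequence that comes from the extension by \<open>M\<close>\<close>

context
  fixes R :: "('a, 'r) ring_scheme" and K :: "('a, 'k) hom_alg" and L :: "('a, 'l) hom_alg"
    and M :: "'k set" and p :: "'k \<Rightarrow> 'l" and i
  assumes ext: "hom_lie_extension R M K L p" and two: "\<one>\<^bsub>R\<^esub> \<oplus>\<^bsub>R\<^esub> \<one>\<^bsub>R\<^esub> \<noteq> \<zero>\<^bsub>R\<^esub>"
    and i: "i \<in> hom_vec_hom R (exterior R K M (carrier K)) (chain_quot R K)"
    and i_elem: "\<forall>m\<in>M. \<forall>n\<in>carrier K. i (ext_elem R K M m n) = chain_class R K m n"
begin

private abbreviation (input) EK where "EK \<equiv> exterior R K M (carrier K)"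
private abbreviation (input) QK where "QK \<equiv> chain_quot R K"
private abbreviation (input) QL where "QL \<equiv> chain_quot R L"
private abbreviation (input) P where "P \<equiv> homology_map R L 2 p"
private abbreviation (input) cE where "cE \<equiv> commutator_map R K"
private abbreviation (input) cQ where "cQ \<equiv> chain_commutator R K"
private abbreviation (input) cQ' where "cQ' \<equiv> chain_commutator R L"
private abbreviation (input) D where "D \<equiv> ideal_coinvariants R K M"
private abbreviation (input) c where "c \<equiv> \<lambda>m. commutator_span R K M (carrier K) +>\<^bsub>K\<lparr>carrier := M\<rparr>\<^esub> m"

private lemmas extD = hom_lie_extensionD[OF ext]

interpretation K: hom_lie_algebra R K by (rule extD(1))
interpretation L: hom_lie_algebra R L by (rule extD(2))

private lemmas K = extD(1) and L = extD(2) and M = extD(3) and p = extD(4)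

private lemmas Em = exterior_module[OF K two M] and Qm = chain_quot_module[OF K two]
  and Qm' = chain_quot_module[OF L two]

interpretation EK: module R EK by (rule Em)
interpretation QK: module R QK by (rule Qm)
interpretation QL: module R QL by (rule Qm')

private lemmas i_lin = hom_vec_hom_lin_map[OF i]
private lemmas P_lin = homology_map_2_lin[OF K L two p]
private lemmas cQ_lin = chain_commutator_lin[OF K two]
private lemmas cQ_i = commutator_map_chain[OF K two M i_lin i_elem]
private lemmas cQ_P = homology_map_2_commutator[OF K L two p]

private lemma M_iff: "x \<in> M \<longleftrightarrow> x \<in> carrier K \<and> p x = \<zero>\<^bsub>L\<^esub>"
  using extD(6) by blast

private lemma P_i:
  assumes x: "x \<in> carrier EK"
  shows "P (i x) = \<zero>\<^bsub>QL\<^esub>"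
proof -
  have z: "(\<lambda>x. \<zero>\<^bsub>QL\<^esub>) \<in> lin_map R EK QL"
    by (auto intro!: lin_mapI)
  show ?thesis
  proof (rule lin_span_eq_on[OF Em Qm' lin_map_comp[OF i_lin P_lin] z lin_span_ext_elem[OF K two M] _ x])
    fix b assume "b \<in> {ext_elem R K M m n | m n. m \<in> M \<and> n \<in> carrier K}"
    then obtain m n where mn: "m \<in> M" "n \<in> carrier K" "b = ext_elem R K M m n"
      by auto
    have "P (i b) = chain_class R L (p m) (p n)"
      using mn i_elem M_iff homology_map_2_class[OF K L two p] by simp
    also have "\<dots> = chain_class R L \<zero>\<^bsub>L\<^esub> (p n)"
      using mn M_iff by simp
    also have "\<dots> = \<zero>\<^bsub>QL\<^esub>"
      by (rule exterior_form_zero(2)[OF L hom_lie_ideal_carrier[OF L] Qm' chain_class_form[OF L two]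
            hom_lie_hom_closed[OF p mn(2)]])
    finally show "P (i b) = \<zero>\<^bsub>QL\<^esub>" .
  qed
qed

text \<open>The instance of \<open>exterior_kernel_subset\<close> with the whole algebras as ideals:
  the image of \<open>i\<close> contains every class with an entry in \<open>M\<close>, on the left
  by the values of \<open>i\<close> and on the right by antisymmetry. It is applied later to the
  presentation of \<open>K\<close> by \<open>F\<close> as well.\<close>

lemma P_kernel:
  assumes x: "x \<in> carrier QK" "P x = \<zero>\<^bsub>QL\<^esub>"
  shows "\<exists>y\<in>carrier EK. x = i y"
proof -
  have I: "submodule (i ` carrier EK) R QK"
    by (rule submodule_image[OF Em Qm i_lin EK.carrier_is_submodule])
  have el: "chain_class R K m n \<in> i ` carrier EK" if "m \<in> carrier K" "p m = \<zero>\<^bsub>L\<^esub>" "n \<in> carrier K" for m n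
  proof -
    have "m \<in> M"
      using that M_iff by simp
    then show ?thesis
      using i_elem that ext_elem_closed[OF K two M] by (intro image_eqI[of _ _ "ext_elem R K M m n"]) auto
  qed
  have el': "chain_class R K m n \<in> i ` carrier EK" if "n \<in> carrier K" "p n = \<zero>\<^bsub>L\<^esub>" "m \<in> carrier K" for m n
  proof -
    have "chain_class R K m n = \<ominus>\<^bsub>QK\<^esub> chain_class R K n m"
      using that by (intro exterior_form_antisym[OF K hom_lie_ideal_carrier[OF K] Qm
            chain_class_form[OF K two]])
    then show ?thesis
      using submodule_a_inv[OF I el[OF that]] by simp
  qed
  have full: "carrier K = {x \<in> carrier K. p x \<in> carrier L}"
    using hom_lie_hom_closed[OF p] by auto
  have "x \<in> i ` carrier EK"
    by (rule exterior_kernel_subset[OF K hom_lie_ideal_carrier[OF K] L hom_lie_ideal_carrier[OF L] p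
          extD(5) full Qm chain_class_form[OF K two] lin_span_chain_class[OF K two] P_lin
          homology_map_2_class[OF K L two p] I el el' Qm' chain_quot_universal[OF L two] x])
      (use quot_module[OF Qm I] in auto)
  then show ?thesis
    by auto
qed

private lemma P_surj: "P ` carrier QK = carrier QL"
proof
  show "P ` carrier QK \<subseteq> carrier QL"
    using lin_map_closed[OF P_lin] by auto
  let ?B = "{chain_class R K x y | x y. x \<in> carrier K \<and> y \<in> carrier K}"
  have "{chain_class R L x y | x y. x \<in> carrier L \<and> y \<in> carrier L} \<subseteq> P ` carrier QK"
  proof
    fix b assume "b \<in> {chain_class R L x y | x y. x \<in> carrier L \<and> y \<in> carrier L}"
    then obtain x y where b: "x \<in> carrier L" "y \<in> carrier L" "b = chain_class R L x y"
      by auto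
    then obtain u v where uv: "u \<in> carrier K" "v \<in> carrier K" "x = p u" "y = p v"
      unfolding extD(5)[symmetric] by auto
    then have "b = P (chain_class R K u v)"
      using b homology_map_2_class[OF K L two p uv(1,2)] by simp
    then show "b \<in> P ` carrier QK"
      using chain_class_closed[OF K two uv(1,2)] by auto
  qed
  then have "lin_span R QL {chain_class R L x y | x y. x \<in> carrier L \<and> y \<in> carrier L} \<subseteq> P ` carrier QK"
    by (intro lin_span_minimal submodule_image[OF Qm Qm' P_lin QK.carrier_is_submodule])
  then show "carrier QL \<subseteq> P ` carrier QK"
    by (simp only: lin_span_chain_class[OF L two])
qed

text \<open>The commutators of \<open>M \<curlywedge> K\<close> and of \<open>chain_quot\<close>
  both take values in \<open>K\<close> and agree along \<open>i\<close>, so a preimage of a homology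
  class under \<open>i\<close> lies in the kernel of the commutator as it stands.\<close>

lemma exact_at_homology_2_K:
  "exact_at R (commutator_ker R K M (carrier K)) i (homology R K 2) P (homology R L 2)"
  unfolding commutator_ker_def homology_2_eq[OF K two] homology_2_eq[OF L two]
proof (rule exact_at_kernels[OF exterior_vec[OF K two M] chain_quot_vec[OF K two]
      chain_quot_vec[OF L two] hom_lie_algebra_vec[OF K] hom_lie_algebra_vec[OF K]
      hom_lie_algebra_vec[OF L] commutator_map_hom[OF K two M] chain_commutator_hom[OF K two]
      chain_commutator_hom[OF L two] i homology_map_2_hom[OF K L two p]])
  show "cQ (i x) = \<zero>\<^bsub>K\<^esub>" if "x \<in> carrier EK" "cE x = \<zero>\<^bsub>K\<^esub>" for x
    using that by (simp add: cQ_i)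
  show "cQ' (P x) = \<zero>\<^bsub>L\<^esub>" if "x \<in> carrier QK" "cQ x = \<zero>\<^bsub>K\<^esub>" for x
    using that lin_map_zero[OF K.module_axioms L.module_axioms hom_lie_hom_lin[OF p]] by (simp add: cQ_P)
  show "P (i x) = \<zero>\<^bsub>QL\<^esub>" if "x \<in> carrier EK" for x
    by (rule P_i[OF that])
  fix y assume y: "y \<in> carrier QK" "cQ y = \<zero>\<^bsub>K\<^esub>" "P y = \<zero>\<^bsub>QL\<^esub>"
  obtain x where "x \<in> carrier EK" "y = i x"
    using P_kernel[OF y(1,3)] by auto
  then show "\<exists>x\<in>carrier EK. cE x = \<zero>\<^bsub>K\<^esub> \<and> y = i x"
    using y(2) cQ_i by auto
qed

private lemma cQ_mem_M:
  assumes "x \<in> carrier QK" "cQ' (P x) = \<zero>\<^bsub>L\<^esub>"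
  shows "cQ x \<in> M"
  using assms cQ_P M_iff lin_map_closed[OF cQ_lin] by simp

private lemma c_closed: "m \<in> M \<Longrightarrow> c m \<in> carrier D"
  unfolding coinvariants_surj[OF K two M, symmetric] by (rule imageI)

text \<open>The snake map: a lift to \<open>chain_quot\<close> of a homology class of
  \<open>L\<close> need not be a cycle, and its commutator, which lies in \<open>M\<close>, measures
  the failure. Independence of the chosen lift is \<open>connecting_P\<close>.\<close>

definition connecting :: "('l list \<Rightarrow> 'a) set set \<Rightarrow> 'k set" where
  "connecting y = c (cQ (SOME x. x \<in> carrier QK \<and> P x = y))"

text \<open>Two lifts differ by an element in the image of \<open>i\<close>, and the commutator of
  such an element lies in \<open>[M, K]\<close>.\<close>

lemma connecting_P:
  assumes x: "x \<in> carrier QK" "cQ' (P x) = \<zero>\<^bsub>L\<^esub>"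
  shows "connecting (P x) = c (cQ x)"
proof -
  define u where "u = (SOME u. u \<in> carrier QK \<and> P u = P x)"
  have u: "u \<in> carrier QK \<and> P u = P x"
    unfolding u_def by (rule someI[of _ x]) (use x in simp)
  have d: "u \<ominus>\<^bsub>QK\<^esub> x \<in> carrier QK"
    using u x by simp
  have "P (u \<ominus>\<^bsub>QK\<^esub> x) = \<zero>\<^bsub>QL\<^esub>"
    using u x by (intro lin_map_diff_zero[OF Qm Qm' P_lin]) auto
  then obtain y where y: "y \<in> carrier EK" "u \<ominus>\<^bsub>QK\<^esub> x = i y"
    using P_kernel[OF d] by auto
  have incl: "(\<lambda>x. x) \<in> lin_map R (K\<lparr>carrier := M\<rparr>) K"
    by (rule lin_mapI) (use hom_lie_ideal_subset[OF M] in auto)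
  have "cQ u \<ominus>\<^bsub>K\<^esub> cQ x = cE y"
    using u x y cQ_i by (simp add: lin_map_minus[OF Qm K.module_axioms cQ_lin, symmetric])
  then have "cQ u \<ominus>\<^bsub>K\<^esub> cQ x \<in> commutator_span R K M (carrier K)"
    using y by (auto simp: commutator_span_eq[OF K two M])
  moreover have "cQ u \<in> M" "cQ x \<in> M"
    using u x by (auto intro: cQ_mem_M)
  \<comment> \<open>The additive inverse in the restricted record is defined through its own
    carrier, so the two differences are not equal by definition; linearity of the inclusion
    identifies them.\<close>
  moreover from this have "cQ u \<ominus>\<^bsub>K\<lparr>carrier := M\<rparr>\<^esub> cQ x = cQ u \<ominus>\<^bsub>K\<^esub> cQ x"
    using lin_map_minus[OF restrict_module[OF K.module_axioms hom_lie_ideal_submodule[OF M]]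
        K.module_axioms incl, of "cQ u" "cQ x"] by simp
  ultimately have "c (cQ u) = c (cQ x)"
    by (intro coset_eqI[OF restrict_module[OF K.module_axioms hom_lie_ideal_submodule[OF M]]
          commutator_span_submodule[OF K two M]]) auto
  then show ?thesis
    by (simp add: connecting_def u_def)
qed

text \<open>The choice of lifts hides linearity. It is recovered by factoring through the surjection
  \<open>P\<close> from the subspace of all admissible lifts, on which the composite is the
  commutator followed by a projection.\<close>

lemma connecting_hom: "connecting \<in> hom_vec_hom R (homology R L 2) D"
proof -
  note comp = hom_vec_hom_comp[OF homology_map_2_hom[OF K L two p] chain_commutator_hom[OF L two]]
  let ?N = "a_kernel QK L (\<lambda>x. cQ' (P x))"
  have N: "x \<in> ?N \<longleftrightarrow> x \<in> carrier QK \<and> cQ' (P x) = \<zero>\<^bsub>L\<^esub>" for x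
    by (auto simp: a_kernel_eq)
  have V: "hom_vector_space R (QK\<lparr>carrier := ?N\<rparr>)"
    by (rule hom_vector_space_kernel[OF chain_quot_vec[OF K two] hom_lie_algebra_vec[OF L] comp])
  have P: "P \<in> hom_vec_hom R (QK\<lparr>carrier := ?N\<rparr>) (homology R L 2)"
    unfolding homology_2_eq[OF L two]
    by (rule hom_vec_hom_restrict[OF homology_map_2_hom[OF K L two p]])
      (auto simp: N a_kernel_eq lin_map_closed[OF P_lin])
  have surj: "P ` carrier (QK\<lparr>carrier := ?N\<rparr>) = carrier (homology R L 2)"
    unfolding homology_2_eq[OF L two]
  proof
    show "P ` carrier (QK\<lparr>carrier := ?N\<rparr>) \<subseteq> carrier (QL\<lparr>carrier := a_kernel QL L cQ'\<rparr>)"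
      by (auto simp: a_kernel_eq lin_map_closed[OF P_lin])
    show "carrier (QL\<lparr>carrier := a_kernel QL L cQ'\<rparr>) \<subseteq> P ` carrier (QK\<lparr>carrier := ?N\<rparr>)"
      unfolding a_kernel_eq P_surj[symmetric] by auto
  qed
  have "cQ \<in> hom_vec_hom R (QK\<lparr>carrier := ?N\<rparr>) (K\<lparr>carrier := M\<rparr>)"
    by (rule hom_vec_hom_restrict[OF chain_commutator_hom[OF K two]]) (auto simp: N cQ_mem_M)
  from hom_vec_hom_comp[OF this coinvariants_proj[OF K two M]]
  show ?thesis
    by (rule hom_vec_hom_factor[OF V P surj]) (simp add: N connecting_P)
qed

lemma homology_2_L_lift:
  assumes "y \<in> carrier (homology R L 2)"
  shows "\<exists>x\<in>carrier QK. cQ' (P x) = \<zero>\<^bsub>L\<^esub> \<and> y = P x"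
  using assms unfolding homology_2_eq[OF L two] a_kernel_eq P_surj[symmetric] by auto

lemma exact_at_homology_2_L:
  "exact_at R (homology R K 2) P (homology R L 2) connecting D"
  unfolding exact_at_def
proof (intro conjI)
  note ex = exact_at_homology_2_K[unfolded exact_at_def]
  show "hom_vector_space R (homology R K 2)" "hom_vector_space R (homology R L 2)"
    "P \<in> hom_vec_hom R (homology R K 2) (homology R L 2)"
    using ex by auto
  show "hom_vector_space R D"
    by (rule coinvariants_vec[OF K two M])
  show "connecting \<in> hom_vec_hom R (homology R L 2) D"
    by (rule connecting_hom)
  have K2: "x \<in> carrier (homology R K 2) \<longleftrightarrow> x \<in> carrier QK \<and> cQ x = \<zero>\<^bsub>K\<^esub>" for x
    by (auto simp: homology_2_eq[OF K two] a_kernel_eq)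
  have L2: "x \<in> carrier (homology R L 2) \<longleftrightarrow> x \<in> carrier QL \<and> cQ' x = \<zero>\<^bsub>L\<^esub>" for x
    by (auto simp: homology_2_eq[OF L two] a_kernel_eq)
  have p0: "p \<zero>\<^bsub>K\<^esub> = \<zero>\<^bsub>L\<^esub>"
    by (rule lin_map_zero[OF K.module_axioms L.module_axioms hom_lie_hom_lin[OF p]])
  show "P ` carrier (homology R K 2) = a_kernel (homology R L 2) D connecting"
  proof
    show "P ` carrier (homology R K 2) \<subseteq> a_kernel (homology R L 2) D connecting"
    proof
      fix y assume "y \<in> P ` carrier (homology R K 2)"
      then obtain x where x: "x \<in> carrier QK" "cQ x = \<zero>\<^bsub>K\<^esub>" "y = P x"
        using K2 by auto
      then have z: "cQ' (P x) = \<zero>\<^bsub>L\<^esub>"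
        using cQ_P p0 by simp
      have "c \<zero>\<^bsub>K\<^esub> = \<zero>\<^bsub>D\<^esub>"
        using coinvariants_zero_iff[OF K two M, of "\<zero>\<^bsub>K\<^esub>"] M_iff p0
          lin_map_zero[OF Em K.module_axioms hom_vec_hom_lin_map[OF commutator_map_hom[OF K two M]]]
        by (auto intro!: image_eqI[of _ _ "\<zero>\<^bsub>EK\<^esub>"])
      then have "connecting y = \<zero>\<^bsub>D\<^esub>"
        using connecting_P[OF x(1) z] x by simp
      then show "y \<in> a_kernel (homology R L 2) D connecting"
        using x z lin_map_closed[OF P_lin] by (simp add: a_kernel_eq[of "homology R L 2"] L2)
    qed
    show "a_kernel (homology R L 2) D connecting \<subseteq> P ` carrier (homology R K 2)"
    proof
      fix y assume "y \<in> a_kernel (homology R L 2) D connecting"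
      then have y: "y \<in> carrier (homology R L 2)" "connecting y = \<zero>\<^bsub>D\<^esub>"
        by (auto simp: a_kernel_eq[of "homology R L 2"])
      obtain x where x: "x \<in> carrier QK" "cQ' (P x) = \<zero>\<^bsub>L\<^esub>" "y = P x"
        using homology_2_L_lift[OF y(1)] by auto
      have "c (cQ x) = \<zero>\<^bsub>D\<^esub>"
        using connecting_P[OF x(1,2)] y(2) x(3) by simp
      then obtain z where z: "z \<in> carrier EK" "cQ x = cE z"
        using coinvariants_zero_iff[OF K two M cQ_mem_M[OF x(1,2)]] by auto
      \<comment> \<open>The commutator of the lift lies in \<open>[M, K]\<close>, so it is also the
        commutator of some \<open>i z\<close>. Subtracting \<open>i z\<close> makes the lift a cycle
        and leaves its image under \<open>P\<close> unchanged.\<close>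
      let ?x = "x \<ominus>\<^bsub>QK\<^esub> i z"
      have iz: "i z \<in> carrier QK"
        by (rule lin_map_closed[OF i_lin z(1)])
      have "cQ ?x = \<zero>\<^bsub>K\<^esub>"
        using x iz z cQ_i[OF z(1)] by (intro lin_map_diff_zero[OF Qm K.module_axioms cQ_lin]) auto
      moreover have "P ?x = y"
        unfolding lin_map_minus[OF Qm Qm' P_lin x(1) iz] P_i[OF z(1)]
        using lin_map_closed[OF P_lin x(1)] x(3) by (simp add: a_minus_def)
      ultimately show "y \<in> P ` carrier (homology R K 2)"
        using x iz K2 by (intro image_eqI[of _ _ ?x]) auto
    qed
  qed
qed

lemma exact_at_coinvariants:
  "exact_at R (homology R L 2) connecting D (coinvariants_to_homology R K) (homology R K 1)"
  unfolding exact_at_def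
proof (intro conjI)
  note ex = exact_at_homology_2_L[unfolded exact_at_def]
  show "hom_vector_space R (homology R L 2)" "hom_vector_space R D"
    "connecting \<in> hom_vec_hom R (homology R L 2) D"
    using ex by auto
  show "hom_vector_space R (homology R K 1)"
    by (rule homology_1_vec[OF K two])
  show "coinvariants_to_homology R K \<in> hom_vec_hom R D (homology R K 1)"
    by (rule coinvariants_to_homology_hom[OF K two M])
  have L2: "x \<in> carrier (homology R L 2) \<longleftrightarrow> x \<in> carrier QL \<and> cQ' x = \<zero>\<^bsub>L\<^esub>" for x
    by (auto simp: homology_2_eq[OF L two] a_kernel_eq)
  note cc = coinvariants_to_homology_class[OF K two M]
  show "connecting ` carrier (homology R L 2) = a_kernel D (homology R K 1) (coinvariants_to_homology R K)"
  proof
    show "connecting ` carrier (homology R L 2) \<subseteq> a_kernel D (homology R K 1) (coinvariants_to_homology R K)"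
    proof
      fix d assume "d \<in> connecting ` carrier (homology R L 2)"
      then obtain y where y: "y \<in> carrier (homology R L 2)" "d = connecting y"
        by auto
      obtain x where x: "x \<in> carrier QK" "cQ' (P x) = \<zero>\<^bsub>L\<^esub>" "y = P x"
        using homology_2_L_lift[OF y(1)] by auto
      note m = cQ_mem_M[OF x(1,2)]
      have d: "d = c (cQ x)"
        using connecting_P[OF x(1,2)] y x by simp
      have "homology_1_class R K (cQ x) = \<zero>\<^bsub>homology R K 1\<^esub>"
        using homology_1_class_zero_iff[OF K two lin_map_closed[OF cQ_lin x(1)]] x(1) by auto
      then show "d \<in> a_kernel D (homology R K 1) (coinvariants_to_homology R K)"
        using c_closed[OF m] cc[OF m] by (simp add: a_kernel_eq[of D] d del: One_nat_def)
    qed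
    show "a_kernel D (homology R K 1) (coinvariants_to_homology R K) \<subseteq> connecting ` carrier (homology R L 2)"
    proof
      fix d assume "d \<in> a_kernel D (homology R K 1) (coinvariants_to_homology R K)"
      then have d: "d \<in> carrier D" "coinvariants_to_homology R K d = \<zero>\<^bsub>homology R K 1\<^esub>"
        by (auto simp: a_kernel_eq[of D])
      then obtain m where m: "m \<in> M" "d = c m"
        unfolding coinvariants_surj[OF K two M, symmetric] by auto
      have mK: "m \<in> carrier K"
        using m M_iff by simp
      have "homology_1_class R K m = \<zero>\<^bsub>homology R K 1\<^esub>"
        using d(2) cc[OF m(1)] m(2) by simp
      \<comment> \<open>An element of \<open>M\<close> with zero class is a commutator in
        \<open>K\<close>, and the element of \<open>chain_quot\<close> that exhibits this is itself
        the lift: its image under \<open>P\<close> is a cycle because \<open>p\<close> kills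
        \<open>M\<close>.\<close>
      then obtain x where x: "x \<in> carrier QK" "m = cQ x"
        using homology_1_class_zero_iff[OF K two mK] by auto
      have z: "cQ' (P x) = \<zero>\<^bsub>L\<^esub>"
        using cQ_P[OF x(1)] x(2) m(1) M_iff by simp
      have "d = connecting (P x)"
        using connecting_P[OF x(1) z] m x by simp
      then show "d \<in> connecting ` carrier (homology R L 2)"
        using lin_map_closed[OF P_lin x(1)] z L2 by (intro image_eqI[of _ _ "P x"]) auto
    qed
  qed
qed

lemma exact_at_homology_1:
  "exact_at R D (coinvariants_to_homology R K) (homology R K 1) (homology_map R L 1 p) (homology R L 1)"
  unfolding exact_at_def
proof (intro conjI)
  show "hom_vector_space R D" "coinvariants_to_homology R K \<in> hom_vec_hom R D (homology R K 1)"
    "hom_vector_space R (homology R K 1)"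
    using exact_at_coinvariants by (auto simp: exact_at_def)
  show "hom_vector_space R (homology R L 1)"
    by (rule homology_1_vec[OF L two])
  show "homology_map R L 1 p \<in> hom_vec_hom R (homology R K 1) (homology R L 1)"
    by (rule homology_map_1_hom[OF K L two p])
  note cc = coinvariants_to_homology_class[OF K two M]
  note hl = hom_vec_hom_lin_map[OF homology_1_class_hom[OF K two]]
    and hl' = hom_vec_hom_lin_map[OF homology_1_class_hom[OF L two]]
  note Hm = hom_vector_space_module[OF homology_1_vec[OF K two]]
    and Hm' = hom_vector_space_module[OF homology_1_vec[OF L two]]
  interpret H: module R "homology R K 1" by (rule Hm)
  show "coinvariants_to_homology R K ` carrier D
      = a_kernel (homology R K 1) (homology R L 1) (homology_map R L 1 p)"
  proof
    show "coinvariants_to_homology R K ` carrier D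
        \<subseteq> a_kernel (homology R K 1) (homology R L 1) (homology_map R L 1 p)"
    proof
      fix u assume "u \<in> coinvariants_to_homology R K ` carrier D"
      then obtain m where m: "m \<in> M" "u = homology_1_class R K m"
        unfolding coinvariants_surj[OF K two M, symmetric] using cc by auto
      have mK: "m \<in> carrier K" "p m = \<zero>\<^bsub>L\<^esub>"
        using m M_iff by auto
      have "homology_map R L 1 p u = homology_1_class R L \<zero>\<^bsub>L\<^esub>"
        unfolding m(2) homology_map_1_class[OF K L two p mK(1)] mK(2) ..
      also have "\<dots> = \<zero>\<^bsub>homology R L 1\<^esub>"
        by (rule lin_map_zero[OF L.module_axioms Hm' hl'])
      finally show "u \<in> a_kernel (homology R K 1) (homology R L 1) (homology_map R L 1 p)"
        using lin_map_closed[OF hl mK(1)] m(2) by (simp add: a_kernel_eq del: One_nat_def)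
    qed
    show "a_kernel (homology R K 1) (homology R L 1) (homology_map R L 1 p)
        \<subseteq> coinvariants_to_homology R K ` carrier D"
    proof
      fix u assume "u \<in> a_kernel (homology R K 1) (homology R L 1) (homology_map R L 1 p)"
      then have u: "u \<in> carrier (homology R K 1)" "homology_map R L 1 p u = \<zero>\<^bsub>homology R L 1\<^esub>"
        by (auto simp: a_kernel_eq)
      then obtain k where k: "k \<in> carrier K" "u = homology_1_class R K k"
        unfolding homology_1_class_surj[OF K two, symmetric] by auto
      have pk: "p k \<in> carrier L"
        by (rule hom_lie_hom_closed[OF p k(1)])
      have "homology_1_class R L (p k) = \<zero>\<^bsub>homology R L 1\<^esub>"
        using u(2) homology_map_1_class[OF K L two p k(1)] k(2) by simp
      then obtain y where y: "y \<in> carrier QL" "p k = cQ' y"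
        using homology_1_class_zero_iff[OF L two pk] by auto
      obtain x where x: "x \<in> carrier QK" "y = P x"
        using y(1) unfolding P_surj[symmetric] by auto
      have cx: "cQ x \<in> carrier K"
        by (rule lin_map_closed[OF cQ_lin x(1)])
      \<comment> \<open>The image \<open>p k\<close> is a commutator in \<open>L\<close>, which
        lifts to the commutator \<open>cQ x\<close> in \<open>K\<close>; subtracting it moves
        \<open>k\<close> into \<open>M\<close> without changing its class.\<close>
      let ?m = "k \<ominus>\<^bsub>K\<^esub> cQ x"
      have "p ?m = p k \<ominus>\<^bsub>L\<^esub> p (cQ x)"
        by (rule lin_map_minus[OF K.module_axioms L.module_axioms hom_lie_hom_lin[OF p] k(1) cx])
      also have "\<dots> = \<zero>\<^bsub>L\<^esub>"
        using y(2) x cQ_P[OF x(1)] pk by (simp add: a_minus_def L.r_neg)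
      finally have m: "?m \<in> M"
        using k(1) cx M_iff by simp
      have "homology_1_class R K (cQ x) = \<zero>\<^bsub>homology R K 1\<^esub>"
        using homology_1_class_zero_iff[OF K two cx] x(1) by auto
      then have "homology_1_class R K ?m = u"
        using lin_map_minus[OF K.module_axioms Hm hl k(1) cx] k(2) u(1)
        by (simp add: a_minus_def del: One_nat_def)
      then show "u \<in> coinvariants_to_homology R K ` carrier D"
        using cc[OF m] c_closed[OF m] by (intro image_eqI[of _ _ "c ?m"]) auto
    qed
  qed
qed

lemma homology_map_1_surj: "homology_map R L 1 p ` carrier (homology R K 1) = carrier (homology R L 1)"
proof -
  have "homology_map R L 1 p ` carrier (homology R K 1) = (\<lambda>x. homology_1_class R L (p x)) ` carrier K"
    unfolding homology_1_class_surj[OF K two, symmetric] image_image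
    by (rule image_cong[OF refl]) (rule homology_map_1_class[OF K L two p])
  also have "\<dots> = homology_1_class R L ` p ` carrier K"
    by (simp add: image_image)
  also have "\<dots> = carrier (homology R L 1)"
    unfolding extD(5) by (rule homology_1_class_surj[OF L two])
  finally show ?thesis .
qed

text \<open>Injectivity is that of \<open>i\<close> on all of \<open>M \<curlywedge> K\<close>, from
  \<open>split_exterior_inj\<close> with \<open>\<tau>\<close> the composite of \<open>p\<close> and
  the section. Surjectivity comes from the map induced by the section, which is a right inverse of
  \<open>P\<close> and preserves cycles.\<close>

lemma short_exact_split:
  assumes "split_extension R K L p"
  shows "short_exact R (commutator_ker R K M (carrier K)) i (homology R K 2) P (homology R L 2)"
proof -
  obtain s where s: "s \<in> hom_lie_hom R L K" "\<And>x. x \<in> carrier L \<Longrightarrow> p (s x) = x"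
    using assms by (auto simp: split_extension_def)
  note sl = hom_lie_homD[OF s(1)] and pl = hom_lie_homD[OF p]
  let ?\<tau> = "\<lambda>x. s (p x)"
  have \<tau>: "?\<tau> \<in> hom_lie_hom R K K"
    using hom_vec_hom_comp[OF pl(1) sl(1)] pl(3,5) sl(5) by (auto simp: hom_lie_hom_def)
  have \<tau>M: "x \<ominus>\<^bsub>K\<^esub> ?\<tau> x \<in> M" if x: "x \<in> carrier K" for x
  proof -
    have t: "?\<tau> x \<in> carrier K" "p x \<in> carrier L"
      using x pl(3) sl(3) by auto
    then have "p (x \<ominus>\<^bsub>K\<^esub> ?\<tau> x) = \<zero>\<^bsub>L\<^esub>"
      using lin_map_minus[OF K.module_axioms L.module_axioms pl(2) x t(1)] s(2)[OF t(2)]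
      by (simp add: a_minus_def L.r_neg)
    then show ?thesis
      using x t M_iff by simp
  qed
  have M\<tau>: "?\<tau> m = \<zero>\<^bsub>K\<^esub>" if "m \<in> M" for m
    using that M_iff lin_map_zero[OF L.module_axioms K.module_axioms sl(2)] by simp
  have inj: "inj_on i (carrier (commutator_ker R K M (carrier K)))"
  proof (rule inj_onI)
    fix x y assume "x \<in> carrier (commutator_ker R K M (carrier K))"
      "y \<in> carrier (commutator_ker R K M (carrier K))" and eq: "i x = i y"
    then have xy: "x \<in> carrier EK" "y \<in> carrier EK"
      by (auto simp: commutator_ker_def a_kernel_eq)
    then have "i (x \<ominus>\<^bsub>EK\<^esub> y) = \<zero>\<^bsub>QK\<^esub>"
      using eq by (intro lin_map_diff_zero[OF Em Qm i_lin]) auto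
    then have "x \<ominus>\<^bsub>EK\<^esub> y = \<zero>\<^bsub>EK\<^esub>"
      using xy i_elem by (intro split_exterior_inj[OF K two M \<tau> \<tau>M M\<tau> i_lin]) auto
    then show "x = y"
      using xy EK.minus_equality[of x "\<ominus>\<^bsub>EK\<^esub> y"] by (simp add: a_minus_def)
  qed
  have surj: "P ` carrier (homology R K 2) = carrier (homology R L 2)"
  proof
    show "P ` carrier (homology R K 2) \<subseteq> carrier (homology R L 2)"
      using exact_at_homology_2_K by (auto simp: exact_at_def hom_vec_hom_def)
    show "carrier (homology R L 2) \<subseteq> P ` carrier (homology R K 2)"
    proof
      fix y assume "y \<in> carrier (homology R L 2)"
      then have y: "y \<in> carrier QL" "cQ' y = \<zero>\<^bsub>L\<^esub>"
        by (auto simp: homology_2_eq[OF L two] a_kernel_eq)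
      let ?S = "homology_map R K 2 s"
      note S_lin = homology_map_2_lin[OF L K two s(1)]
      have idl: "(\<lambda>x. x) \<in> lin_map R QL QL"
        by (auto intro: lin_mapI)
      have "P (?S y) = y"
      proof (rule lin_span_eq_on[OF Qm' Qm' lin_map_comp[OF S_lin P_lin] idl
            lin_span_chain_class[OF L two] _ y(1)])
        fix b assume "b \<in> {chain_class R L x y | x y. x \<in> carrier L \<and> y \<in> carrier L}"
        then obtain u v where "u \<in> carrier L" "v \<in> carrier L" "b = chain_class R L u v"
          by auto
        then show "P (?S b) = b"
          using sl(3) s(2) by (simp add: homology_map_2_class[OF L K two s(1)] homology_map_2_class[OF K L two p])
      qed
      moreover have "?S y \<in> carrier (homology R K 2)"
        using lin_map_closed[OF S_lin y(1)] homology_map_2_commutator[OF L K two s(1) y(1)] y(2)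
          lin_map_zero[OF L.module_axioms K.module_axioms sl(2)]
        by (simp add: homology_2_eq[OF K two] a_kernel_eq)
      ultimately show "y \<in> P ` carrier (homology R K 2)"
        by (intro image_eqI[of _ _ "?S y"]) auto
    qed
  qed
  show ?thesis
    unfolding short_exact_def using exact_at_homology_2_K inj surj by blast
qed

end

lemma preimage_ideal:
  assumes K: "hom_lie_algebra R K" and F: "hom_lie_algebra R F" and q: "q \<in> hom_lie_hom R F K"
    and M: "hom_lie_ideal R M K"
  shows "hom_lie_ideal R {s \<in> carrier F. q s \<in> M} F"
  unfolding hom_lie_ideal_def
proof (intro conjI ballI)
  show "submodule {s \<in> carrier F. q s \<in> M} R F"
    by (rule submodule_vimage[OF hom_lie_algebra_module[OF F] hom_lie_algebra_module[OF K]
          hom_lie_hom_lin[OF q] hom_lie_ideal_submodule[OF M]])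
qed (auto simp: hom_lie_homD[OF q] hom_vector_space.twist_closed[OF hom_lie_algebra_vec[OF F]]
    hom_lie_algebra.lie_closed[OF F] intro!: hom_lie_ideal_twist[OF M] hom_lie_ideal_lie[OF M])

section \<open>The part of the sequence that comes from the free presentation\<close>

context
  fixes \<FF> :: "('a, 'r) ring_scheme" and K :: "('a, 'k) hom_alg" and F :: "('a, 'f) hom_alg"
    and M :: "'k set" and R S :: "'f set" and q :: "'f \<Rightarrow> 'k"
  assumes two: "\<one>\<^bsub>\<FF>\<^esub> \<oplus>\<^bsub>\<FF>\<^esub> \<one>\<^bsub>\<FF>\<^esub> \<noteq> \<zero>\<^bsub>\<FF>\<^esub>" and M: "hom_lie_ideal \<FF> M K"
    and pres: "hom_lie_extension \<FF> R F K q" and S: "S = {s \<in> carrier F. q s \<in> M}"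
begin

private abbreviation (input) ER where "ER \<equiv> exterior \<FF> F R (carrier F)"
private abbreviation (input) ES where "ES \<equiv> exterior \<FF> F S (carrier F)"
private abbreviation (input) EM where "EM \<equiv> exterior \<FF> K M (carrier K)"
private abbreviation (input) \<rho> where "\<rho> \<equiv> exterior_map \<FF> F S (carrier F) (\<lambda>x. x)"
private abbreviation (input) \<kappa> where "\<kappa> \<equiv> exterior_map \<FF> K M (carrier K) q"

private lemmas presD = hom_lie_extensionD[OF pres]
private lemmas alg_F = presD(1) and alg_K = presD(2) and ideal_R = presD(3) and q = presD(4)

interpretation F: hom_lie_algebra \<FF> F by (rule alg_F)
interpretation K: hom_lie_algebra \<FF> K by (rule alg_K)

private lemma ideal_S: "hom_lie_ideal \<FF> S F"
  unfolding S by (rule preimage_ideal[OF alg_K alg_F q M])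

private lemma R_iff: "x \<in> R \<longleftrightarrow> x \<in> carrier F \<and> q x = \<zero>\<^bsub>K\<^esub>"
  using presD(6) by blast

private lemma S_iff: "x \<in> S \<longleftrightarrow> x \<in> carrier F \<and> q x \<in> M"
  using S by blast

private lemma R_S: "x \<in> R \<Longrightarrow> x \<in> S"
  using R_iff S_iff submodule_zero[OF hom_lie_ideal_submodule[OF M]] by auto

private lemma q_S: "x \<in> S \<Longrightarrow> q x \<in> M"
  using S_iff by blast

private lemma id_hom: "(\<lambda>x. x) \<in> hom_lie_hom \<FF> F F"
  by (auto simp: hom_lie_hom_def hom_vec_hom_def)

private lemma \<rho>_elem:
  "\<lbrakk>m \<in> R; n \<in> carrier F\<rbrakk> \<Longrightarrow> \<rho> (ext_elem \<FF> F R m n) = ext_elem \<FF> F S m n"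
  by (rule exterior_map_elem[OF alg_F alg_F two ideal_R ideal_S id_hom]) (auto intro: R_S)

private lemma \<kappa>_elem:
  "\<lbrakk>m \<in> S; n \<in> carrier F\<rbrakk> \<Longrightarrow> \<kappa> (ext_elem \<FF> F S m n) = ext_elem \<FF> K M (q m) (q n)"
  by (rule exterior_map_elem[OF alg_F alg_K two ideal_S M q]) (auto intro: q_S)

private lemma \<rho>_hom:
  shows "\<rho> \<in> hom_vec_hom \<FF> ER ES"
    and "x \<in> carrier ER \<Longrightarrow> commutator_map \<FF> F (\<rho> x) = commutator_map \<FF> F x"
  by (rule exterior_map_hom(1)[OF alg_F alg_F two ideal_R ideal_S id_hom], erule R_S)
    (rule exterior_map_hom(2)[OF alg_F alg_F two ideal_R ideal_S id_hom], erule R_S)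

private lemma \<kappa>_hom:
  shows "\<kappa> \<in> hom_vec_hom \<FF> ES EM"
    and "x \<in> carrier ES \<Longrightarrow> commutator_map \<FF> K (\<kappa> x) = q (commutator_map \<FF> F x)"
  by (rule exterior_map_hom(1)[OF alg_F alg_K two ideal_S M q], erule q_S)
    (rule exterior_map_hom(2)[OF alg_F alg_K two ideal_S M q], erule q_S)

private lemmas \<rho>_lin = hom_vec_hom_lin_map[OF \<rho>_hom(1)] and \<kappa>_lin = hom_vec_hom_lin_map[OF \<kappa>_hom(1)]

private lemmas ER = exterior_module[OF alg_F two ideal_R] and ES = exterior_module[OF alg_F two ideal_S]
  and EM = exterior_module[OF alg_K two M]

interpretation ER: module \<FF> ER by (rule ER)
interpretation ES: module \<FF> ES by (rule ES)
interpretation EM: module \<FF> EM by (rule EM)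

private lemma \<kappa>_\<rho>:
  assumes x: "x \<in> carrier ER"
  shows "\<kappa> (\<rho> x) = \<zero>\<^bsub>EM\<^esub>"
proof -
  have z: "(\<lambda>x. \<zero>\<^bsub>EM\<^esub>) \<in> lin_map \<FF> ER EM"
    by (auto intro!: lin_mapI)
  show ?thesis
  proof (rule lin_span_eq_on[OF ER EM lin_map_comp[OF \<rho>_lin \<kappa>_lin] z
        lin_span_ext_elem[OF alg_F two ideal_R] _ x])
    fix b assume "b \<in> {ext_elem \<FF> F R m n | m n. m \<in> R \<and> n \<in> carrier F}"
    then obtain m n where mn: "m \<in> R" "n \<in> carrier F" "b = ext_elem \<FF> F R m n"
      by auto
    have "\<kappa> (\<rho> b) = ext_elem \<FF> K M (q m) (q n)"
      using mn R_S by (simp add: \<rho>_elem \<kappa>_elem)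
    also have "\<dots> = ext_elem \<FF> K M \<zero>\<^bsub>K\<^esub> (q n)"
      using mn R_iff by simp
    also have "\<dots> = \<zero>\<^bsub>EM\<^esub>"
      by (rule exterior_form_zero(2)[OF alg_K M EM ext_elem_form[OF alg_K two M]
            hom_lie_hom_closed[OF q mn(2)]])
    finally show "\<kappa> (\<rho> b) = \<zero>\<^bsub>EM\<^esub>" .
  qed
qed

private lemma \<kappa>_kernel:
  assumes x: "x \<in> carrier ES" "\<kappa> x = \<zero>\<^bsub>EM\<^esub>"
  shows "\<exists>y\<in>carrier ER. x = \<rho> y"
proof -
  have I: "submodule (\<rho> ` carrier ER) \<FF> ES"
    by (rule submodule_image[OF ER ES \<rho>_lin ER.carrier_is_submodule])
  have el: "ext_elem \<FF> F S m n \<in> \<rho> ` carrier ER" if "m \<in> carrier F" "q m = \<zero>\<^bsub>K\<^esub>" "n \<in> carrier F" for m n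
  proof -
    have m: "m \<in> R"
      using that R_iff by simp
    then show ?thesis
      using \<rho>_elem[OF m that(3)] ext_elem_closed[OF alg_F two ideal_R m that(3)]
      by (intro image_eqI[of _ _ "ext_elem \<FF> F R m n"]) auto
  qed
  have el': "ext_elem \<FF> F S m n \<in> \<rho> ` carrier ER" if "m \<in> S" "n \<in> carrier F" "q n = \<zero>\<^bsub>K\<^esub>" for m n
  proof -
    \<comment> \<open>An element of the kernel of \<open>q\<close> lies in \<open>R\<close> and
      hence in \<open>S\<close>, so antisymmetry on \<open>S\<close> moves it to the left.\<close>
    have n: "n \<in> S" and m: "m \<in> carrier F"
      using that R_iff R_S S_iff by auto
    have "ext_elem \<FF> F S m n = \<ominus>\<^bsub>ES\<^esub> ext_elem \<FF> F S n m"
      by (rule exterior_form_antisym[OF alg_F ideal_S ES ext_elem_form[OF alg_F two ideal_S] that(1) n])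
    then show ?thesis
      using submodule_a_inv[OF I el[OF that(2,3) m]] by simp
  qed
  have "x \<in> \<rho> ` carrier ER"
    by (rule exterior_kernel_subset[OF alg_F ideal_S alg_K M q presD(5) S ES
          ext_elem_form[OF alg_F two ideal_S] lin_span_ext_elem[OF alg_F two ideal_S] \<kappa>_lin
          \<kappa>_elem I el el' EM exterior_universal[OF alg_K two M] x])
      (use quot_module[OF ES I] in auto)
  then show ?thesis
    by auto
qed

text \<open>Every lift of an element of \<open>M\<close> lies in \<open>S\<close>, since
  \<open>S\<close> is the full preimage of \<open>M\<close>; so generators lift to
  generators.\<close>

private lemma \<kappa>_surj: "\<kappa> ` carrier ES = carrier EM"
proof
  show "\<kappa> ` carrier ES \<subseteq> carrier EM"
    using lin_map_closed[OF \<kappa>_lin] by auto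
  have "{ext_elem \<FF> K M m n | m n. m \<in> M \<and> n \<in> carrier K} \<subseteq> \<kappa> ` carrier ES"
  proof
    fix b assume "b \<in> {ext_elem \<FF> K M m n | m n. m \<in> M \<and> n \<in> carrier K}"
    then obtain m n where b: "m \<in> M" "n \<in> carrier K" "b = ext_elem \<FF> K M m n"
      by auto
    have "m \<in> carrier K"
      by (rule hom_lie_ideal_subset[OF M b(1)])
    then obtain u v where uv: "u \<in> carrier F" "v \<in> carrier F" "m = q u" "n = q v"
      using b(2) unfolding presD(5)[symmetric] by auto
    have u: "u \<in> S"
      using uv b(1) S_iff by simp
    have "b = \<kappa> (ext_elem \<FF> F S u v)"
      unfolding b(3) uv(3,4) by (rule \<kappa>_elem[OF u uv(2), symmetric])
    then show "b \<in> \<kappa> ` carrier ES"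
      using ext_elem_closed[OF alg_F two ideal_S u uv(2)] by (rule image_eqI)
  qed
  then have "lin_span \<FF> EM {ext_elem \<FF> K M m n | m n. m \<in> M \<and> n \<in> carrier K} \<subseteq> \<kappa> ` carrier ES"
    by (intro lin_span_minimal submodule_image[OF ES EM \<kappa>_lin ES.carrier_is_submodule])
  then show "carrier EM \<subseteq> \<kappa> ` carrier ES"
    by (simp only: lin_span_ext_elem[OF alg_K two M])
qed

text \<open>The map induced by the inclusion of \<open>R\<close> in \<open>S\<close> preserves
  commutators in \<open>F\<close>, so any preimage of a kernel element is again in the
  kernel.\<close>

lemma exact_at_commutator_ker_F:
  "exact_at \<FF> (commutator_ker \<FF> F R (carrier F)) \<rho> (commutator_ker \<FF> F S (carrier F)) \<kappa>
     (commutator_ker \<FF> K M (carrier K))"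
  unfolding commutator_ker_def
proof (rule exact_at_kernels[OF exterior_vec[OF alg_F two ideal_R] exterior_vec[OF alg_F two ideal_S]
      exterior_vec[OF alg_K two M] hom_lie_algebra_vec[OF alg_F] hom_lie_algebra_vec[OF alg_F]
      hom_lie_algebra_vec[OF alg_K] commutator_map_hom[OF alg_F two ideal_R]
      commutator_map_hom[OF alg_F two ideal_S] commutator_map_hom[OF alg_K two M] \<rho>_hom(1) \<kappa>_hom(1)])
  show "commutator_map \<FF> F (\<rho> x) = \<zero>\<^bsub>F\<^esub>" if "x \<in> carrier ER" "commutator_map \<FF> F x = \<zero>\<^bsub>F\<^esub>" for x
    using that \<rho>_hom(2) by simp
  show "commutator_map \<FF> K (\<kappa> x) = \<zero>\<^bsub>K\<^esub>" if "x \<in> carrier ES" "commutator_map \<FF> F x = \<zero>\<^bsub>F\<^esub>" for x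
    using that \<kappa>_hom(2) lin_map_zero[OF F.module_axioms K.module_axioms hom_lie_hom_lin[OF q]] by simp
  show "\<kappa> (\<rho> x) = \<zero>\<^bsub>EM\<^esub>" if "x \<in> carrier ER" for x
    by (rule \<kappa>_\<rho>[OF that])
  fix y assume y: "y \<in> carrier ES" "commutator_map \<FF> F y = \<zero>\<^bsub>F\<^esub>" "\<kappa> y = \<zero>\<^bsub>EM\<^esub>"
  obtain x where "x \<in> carrier ER" "y = \<rho> x"
    using \<kappa>_kernel[OF y(1,3)] by auto
  then show "\<exists>x\<in>carrier ER. commutator_map \<FF> F x = \<zero>\<^bsub>F\<^esub> \<and> y = \<rho> x"
    using y(2) \<rho>_hom(2) by auto
qed

text \<open>The maps \<open>j\<close> and \<open>k\<close> compare \<open>S \<curlywedge> F\<close>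
  and \<open>R \<curlywedge> F\<close> with \<open>chain_quot\<close> of \<open>F\<close>, and
  \<open>?P\<close> leads on to \<open>chain_quot\<close> of \<open>K\<close>. An element killed by
  \<open>i\<close> is lifted to \<open>S \<curlywedge> F\<close>; there \<open>j\<close> sends the
  lift into the kernel of \<open>?P\<close>, that is, into the image of
  \<open>R \<curlywedge> F\<close>, and subtracting that part gives a lift with zero
  commutator.\<close>

lemma exact_at_commutator_ker_K:
  assumes free: "is_free_hom_lie \<FF> X a F"
    and i: "i \<in> hom_vec_hom \<FF> EM (chain_quot \<FF> K)"
    and i_elem: "\<forall>m\<in>M. \<forall>n\<in>carrier K. i (ext_elem \<FF> K M m n) = chain_class \<FF> K m n"
  shows "exact_at \<FF> (commutator_ker \<FF> F S (carrier F)) \<kappa> (commutator_ker \<FF> K M (carrier K)) i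
    (homology \<FF> K 2)"
proof -
  let ?Q = "chain_quot \<FF> F" and ?Q' = "chain_quot \<FF> K"
  let ?P = "homology_map \<FF> K 2 q"
  note Q = chain_quot_module[OF alg_F two] and Q' = chain_quot_module[OF alg_K two]
  interpret Q: module \<FF> ?Q by (rule Q)
  obtain f where f: "a \<in> X \<rightarrow> X" "f \<in> hom_lie_hom \<FF> (free_hom_lie \<FF> X a) F"
    "bij_betw f (carrier (free_hom_lie \<FF> X a)) (carrier F)"
    using free by (auto simp: is_free_hom_lie_def)
  note inj = free_chain_commutator_inj[OF alg_F two f]
  obtain j where j: "j \<in> hom_vec_hom \<FF> ES ?Q"
    "\<forall>m\<in>S. \<forall>n\<in>carrier F. j (ext_elem \<FF> F S m n) = chain_class \<FF> F m n"
    using exterior_to_chain_quot[OF alg_F two ideal_S] by blast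
  obtain k where k: "k \<in> hom_vec_hom \<FF> ER ?Q"
    "\<forall>m\<in>R. \<forall>n\<in>carrier F. k (ext_elem \<FF> F R m n) = chain_class \<FF> F m n"
    using exterior_to_chain_quot[OF alg_F two ideal_R] by blast
  note jl = hom_vec_hom_lin_map[OF j(1)] and kl = hom_vec_hom_lin_map[OF k(1)]
    and il = hom_vec_hom_lin_map[OF i]
  note Pl = homology_map_2_lin[OF alg_F alg_K two q]
  note q0 = lin_map_zero[OF F.module_axioms K.module_axioms hom_lie_hom_lin[OF q]]
  have jc: "chain_commutator \<FF> F (j x) = commutator_map \<FF> F x" if "x \<in> carrier ES" for x
    by (rule commutator_map_chain[OF alg_F two ideal_S jl j(2) that])
  have ic: "chain_commutator \<FF> K (i x) = commutator_map \<FF> K x" if "x \<in> carrier EM" for x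
    by (rule commutator_map_chain[OF alg_K two M il i_elem that])
  have Pj: "?P (j x) = i (\<kappa> x)" if x: "x \<in> carrier ES" for x
  proof (rule lin_span_eq_on[OF ES Q' lin_map_comp[OF jl Pl] lin_map_comp[OF \<kappa>_lin il]
        lin_span_ext_elem[OF alg_F two ideal_S] _ x])
    fix b assume "b \<in> {ext_elem \<FF> F S m n | m n. m \<in> S \<and> n \<in> carrier F}"
    then obtain m n where mn: "m \<in> S" "n \<in> carrier F" "b = ext_elem \<FF> F S m n"
      by auto
    then show "?P (j b) = i (\<kappa> b)"
      using j(2) i_elem q_S[OF mn(1)] hom_lie_hom_closed[OF q]
        hom_lie_ideal_subset[OF ideal_S mn(1)]
      by (simp add: \<kappa>_elem homology_map_2_class[OF alg_F alg_K two q])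
  qed
  have j\<rho>: "j (\<rho> x) = k x" if x: "x \<in> carrier ER" for x
    by (rule lin_span_eq_on[OF ER Q lin_map_comp[OF \<rho>_lin jl] kl
          lin_span_ext_elem[OF alg_F two ideal_R] _ x])
      (use j(2) k(2) R_S in \<open>auto simp: \<rho>_elem\<close>)
  \<comment> \<open>Freeness enters here: \<open>j y\<close> has zero commutator, and on
    \<open>chain_quot\<close> of a free algebra the commutator is injective.\<close>
  have j_zero: "j y = \<zero>\<^bsub>?Q\<^esub>" if "y \<in> carrier ES" "commutator_map \<FF> F y = \<zero>\<^bsub>F\<^esub>" for y
    using inj[OF lin_map_closed[OF jl that(1)]] jc[OF that(1)] that(2) by simp
  show ?thesis
    unfolding commutator_ker_def homology_2_eq[OF alg_K two]
  proof (rule exact_at_kernels[OF exterior_vec[OF alg_F two ideal_S] exterior_vec[OF alg_K two M]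
        chain_quot_vec[OF alg_K two] hom_lie_algebra_vec[OF alg_F] hom_lie_algebra_vec[OF alg_K]
        hom_lie_algebra_vec[OF alg_K] commutator_map_hom[OF alg_F two ideal_S]
        commutator_map_hom[OF alg_K two M] chain_commutator_hom[OF alg_K two] \<kappa>_hom(1) i])
    show "commutator_map \<FF> K (\<kappa> x) = \<zero>\<^bsub>K\<^esub>" if "x \<in> carrier ES" "commutator_map \<FF> F x = \<zero>\<^bsub>F\<^esub>" for x
      using that \<kappa>_hom(2) q0 by simp
    show "chain_commutator \<FF> K (i x) = \<zero>\<^bsub>K\<^esub>" if "x \<in> carrier EM" "commutator_map \<FF> K x = \<zero>\<^bsub>K\<^esub>" for x
      using that ic by simp
    show "i (\<kappa> x) = \<zero>\<^bsub>?Q'\<^esub>" if x: "x \<in> carrier ES" "commutator_map \<FF> F x = \<zero>\<^bsub>F\<^esub>" for x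
      unfolding Pj[OF x(1), symmetric] j_zero[OF x] by (rule lin_map_zero[OF Q Q' Pl])
    fix x assume x: "x \<in> carrier EM" "commutator_map \<FF> K x = \<zero>\<^bsub>K\<^esub>" "i x = \<zero>\<^bsub>?Q'\<^esub>"
    obtain y where y: "y \<in> carrier ES" "x = \<kappa> y"
      using x(1) unfolding \<kappa>_surj[symmetric] by auto
    have "?P (j y) = \<zero>\<^bsub>?Q'\<^esub>"
      using Pj[OF y(1)] y(2) x(3) by simp
    then obtain z where z: "z \<in> carrier ER" "j y = k z"
      using P_kernel[OF pres two k lin_map_closed[OF jl y(1)]] by auto
    have \<rho>z: "\<rho> z \<in> carrier ES"
      by (rule lin_map_closed[OF \<rho>_lin z(1)])
    \<comment> \<open>As \<open>j\<close> after \<open>\<rho>\<close> is \<open>k\<close>, this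
      difference is killed by \<open>j\<close> and therefore has zero commutator;
      \<open>\<kappa>\<close> does not see the subtracted term.\<close>
    let ?y = "y \<ominus>\<^bsub>ES\<^esub> \<rho> z"
    have "j ?y = \<zero>\<^bsub>?Q\<^esub>"
      using z j\<rho>[OF z(1)] by (intro lin_map_diff_zero[OF ES Q jl y(1) \<rho>z]) simp
    then have "commutator_map \<FF> F ?y = \<zero>\<^bsub>F\<^esub>"
      using jc[of ?y] y(1) \<rho>z lin_map_zero[OF Q F.module_axioms chain_commutator_lin[OF alg_F two]]
      by simp
    moreover have "\<kappa> ?y = x"
      unfolding lin_map_minus[OF ES EM \<kappa>_lin y(1) \<rho>z] \<kappa>_\<rho>[OF z(1)] y(2)[symmetric]
      using x(1) by (simp add: a_minus_def)
    ultimately show "\<exists>y\<in>carrier ES. commutator_map \<FF> F y = \<zero>\<^bsub>F\<^esub> \<and> x = \<kappa> y"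
      using y(1) \<rho>z by (intro bexI[of _ ?y]) auto
  qed
qed

end

theorem theorem4p6:
  fixes \<FF> :: "('a, 'r) ring_scheme"
    and K :: "('a, 'k) hom_alg" and L :: "('a, 'l) hom_alg" and F :: "('a, 'f) hom_alg"
    and M :: "'k set" and R S :: "'f set"
    and p :: "'k \<Rightarrow> 'l" and q :: "'f \<Rightarrow> 'k"
    and X :: "'x set" and \<alpha>X :: "'x \<Rightarrow> 'x"
  assumes "field \<FF>" and "\<one>\<^bsub>\<FF>\<^esub> \<oplus>\<^bsub>\<FF>\<^esub> \<one>\<^bsub>\<FF>\<^esub> \<noteq> \<zero>\<^bsub>\<FF>\<^esub>"
    and "hom_lie_extension \<FF> M K L p"
    and "is_free_hom_lie \<FF> X \<alpha>X F"
    and "hom_lie_extension \<FF> R F K q"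
    and "S = {s \<in> carrier F. q s \<in> M}"
  shows "\<exists>\<eta> \<delta>.
     exact_at \<FF> (commutator_ker \<FF> F R (carrier F)) (exterior_map \<FF> F S (carrier F) (\<lambda>x. x))
       (commutator_ker \<FF> F S (carrier F)) (exterior_map \<FF> K M (carrier K) q)
       (commutator_ker \<FF> K M (carrier K)) \<and>
     exact_at \<FF> (commutator_ker \<FF> F S (carrier F)) (exterior_map \<FF> K M (carrier K) q)
       (commutator_ker \<FF> K M (carrier K)) \<eta> (homology \<FF> K 2) \<and>
     exact_at \<FF> (commutator_ker \<FF> K M (carrier K)) \<eta>
       (homology \<FF> K 2) (homology_map \<FF> L 2 p) (homology \<FF> L 2) \<and>
     exact_at \<FF> (homology \<FF> K 2) (homology_map \<FF> L 2 p)
       (homology \<FF> L 2) \<delta> (ideal_coinvariants \<FF> K M) \<and>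
     exact_at \<FF> (homology \<FF> L 2) \<delta>
       (ideal_coinvariants \<FF> K M) (coinvariants_to_homology \<FF> K) (homology \<FF> K 1) \<and>
     exact_at \<FF> (ideal_coinvariants \<FF> K M) (coinvariants_to_homology \<FF> K)
       (homology \<FF> K 1) (homology_map \<FF> L 1 p) (homology \<FF> L 1) \<and>
     homology_map \<FF> L 1 p ` carrier (homology \<FF> K 1) = carrier (homology \<FF> L 1) \<and>
     (split_extension \<FF> K L p \<longrightarrow>
        short_exact \<FF> (commutator_ker \<FF> K M (carrier K)) \<eta>
          (homology \<FF> K 2) (homology_map \<FF> L 2 p) (homology \<FF> L 2))"
proof -
  note two = assms(2) and ext = assms(3) and free = assms(4) and pres = assms(5) and S = assms(6)
  note extD = hom_lie_extensionD[OF ext]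
  \<comment> \<open>One map is fixed here because the same \<open>\<eta>\<close> occurs in several
    of the claims; the connecting map of the snake serves as \<open>\<delta>\<close>.\<close>
  obtain i where i: "i \<in> hom_vec_hom \<FF> (exterior \<FF> K M (carrier K)) (chain_quot \<FF> K)"
    "\<forall>m\<in>M. \<forall>n\<in>carrier K. i (ext_elem \<FF> K M m n) = chain_class \<FF> K m n"
    using exterior_to_chain_quot[OF extD(1) two extD(3)] by blast
  show ?thesis
    using exact_at_commutator_ker_F[OF two extD(3) pres S]
      exact_at_commutator_ker_K[OF two extD(3) pres S free i]
      exact_at_homology_2_K[OF ext two i] exact_at_homology_2_L[OF ext two i]
      exact_at_coinvariants[OF ext two i] exact_at_homology_1[OF ext two i]
      homology_map_1_surj[OF ext two i] short_exact_split[OF ext two i]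
    by (intro exI conjI impI)
qed

end
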